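(* Let $(d_n)$ be a sequence of positive integers, $(T,m)$ a probability space, and let $(\varphi_n),(\psi_n)$ be systems of random $d_n\times d_n$ complex matrices on $(T,m)$ such that, for some constant $C'$, $\|\varphi_n\|_{L_\infty(m;M_{d_n})}\le C'$ and $\|\psi_n\|_{L_\infty(m;M_{d_n})}\le C'$ for all $n$, and such that $$\int\varphi_n(i,j)\overline{\psi_{n'}(k,\ell)}\,dm=d_n^{-1}\delta_{n,n'}\delta_{i,k}\delta_{j,\ell}\quad\text{for all } n,n',\ 1\le i,j\le d_n,\ 1\le k,\ell\le d_{n'}.$$ If $(\psi_n)$ is randomly Sidon, then it is $\dot\otimes^k$-Sidon for all $k\ge4$.
   Context: $M_d$ is the space of complex $d\times d$ matrices with the operator norm, $|a|=(a^*a)^{1/2}$; $\|\psi\|_{L_\infty(m;M_d)}$ is the essential supremum of the operator norm of $\psi(t)$. $(g_n)$ is an independent sequence of random $d_n\times d_n$ matrices on a probability space $(\Omega,\mathbb{P})$ (expectation $\mathbb{E}$) such that $\{d_n^{1/2}g_n(i,j)\mid n\ge1,1\le i,j\le d_n\}$ are i.i.d. standard complex Gaussian random variables (mean $0$, $\mathbb{E}|\cdot|^2=1$). A system $(\psi_n)$ with $\psi_n\in L_\infty(T,m;M_{d_n})$ is randomly Sidon if there is a constant $C$ such that for every finitely supported family $(x_n)$ with $x_n\in M_{d_n}$, $\sum d_n\,\mathrm{tr}|x_n|\le C\,\mathbb{E}\|\sum d_n\,\mathrm{tr}(x_ng_n\psi_n)\|_{L_\infty(m)}$. For $k\ge1$,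 $(\psi_n)$ is $\dot\otimes^k$-Sidon if there is a constant $C$ such that for every finitely supported family $(x_n)$ with $x_n\in M_{d_n}$, $\sum d_n\,\mathrm{tr}|x_n|\le C\,\|\sum d_n\,\mathrm{tr}(x_n\psi_n(t_1)\cdots\psi_n(t_k))\|_{L_\infty(T^k,m^k)}$ (matrix product of the $\psi_n(t_j)$). *)

theory Defs
  imports "HOL-Probability.Probability" "Jordan_Normal_Form.Schur_Decomposition"
begin

text \<open>Since the sizes \<open>d n\<close> vary with \<open>n\<close>, complex \<open>d \<times> d\<close> matrices are the elements of
  \<open>carrier_mat d d\<close>; entries are indexed from \<open>0\<close>.\<close>

definition mat_tr :: "complex mat \<Rightarrow> complex" where
  "mat_tr A = (\<Sum>i<dim_row A. A $$ (i, i))"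

definition l2_norm_vec :: "complex Matrix.vec \<Rightarrow> real" where
  "l2_norm_vec v = sqrt (\<Sum>i<dim_vec v. (cmod (vec_index v i))\<^sup>2)"

definition mat_op_norm :: "complex mat \<Rightarrow> real" where
  "mat_op_norm A =
     (SUP v \<in> {v \<in> carrier_vec (dim_col A). l2_norm_vec v \<le> 1}. l2_norm_vec (A *\<^sub>v v))"

text \<open>In the order on \<^typ>\<open>complex\<close>, \<open>0 \<le> z\<close> says that \<open>z\<close> is real and nonnegative.\<close>

definition pos_semidef :: "nat \<Rightarrow> complex mat \<Rightarrow> bool" where
  "pos_semidef d A \<longleftrightarrow>
     A \<in> carrier_mat d d \<and> (\<forall>v \<in> carrier_vec d. 0 \<le> (A *\<^sub>v v) \<bullet>c v)"

definition mat_sqrt :: "complex mat \<Rightarrow> complex mat" where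
  "mat_sqrt A = (THE B. pos_semidef (dim_row A) B \<and> B * B = A)"

definition mat_abs :: "complex mat \<Rightarrow> complex mat" where
  "mat_abs A = mat_sqrt (mat_adjoint A * A)"

text \<open>The trace of \<open>mat_abs A\<close> is real, so taking the real part only changes its type.\<close>

definition trace_norm :: "complex mat \<Rightarrow> real" where
  "trace_norm A = Re (mat_tr (mat_abs A))"

definition random_matrix :: "'t measure \<Rightarrow> nat \<Rightarrow> ('t \<Rightarrow> complex mat) \<Rightarrow> bool" where
  "random_matrix M d A \<longleftrightarrow>
     (\<forall>t \<in> space M. A t \<in> carrier_mat d d) \<and>
     (\<forall>i<d. \<forall>j<d. (\<lambda>t. A t $$ (i, j)) \<in> borel_measurable M)"

text \<open>The \<open>L\<^sub>\<infinity>\<close>-norms take values in \<^typ>\<open>ennreal\<close>, being infinite for unbounded functions.\<close>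

definition Linf_norm :: "'t measure \<Rightarrow> ('t \<Rightarrow> complex) \<Rightarrow> ennreal" where
  "Linf_norm M f = esssup M (\<lambda>t. ennreal (cmod (f t)))"

definition Linf_norm_mat :: "'t measure \<Rightarrow> ('t \<Rightarrow> complex mat) \<Rightarrow> ennreal" where
  "Linf_norm_mat M A = esssup M (\<lambda>t. ennreal (mat_op_norm (A t)))"

text \<open>A standard complex Gaussian has independent centred normal real and imaginary parts of
  variance \<open>1/2\<close> each (the second parameter of \<^const>\<open>normal_density\<close> is the standard deviation).\<close>

definition std_complex_gaussian :: "'w measure \<Rightarrow> ('w \<Rightarrow> complex) \<Rightarrow> bool" where
  "std_complex_gaussian P Z \<longleftrightarrow>
     distributed P lborel (\<lambda>w. Re (Z w)) (normal_density 0 (1 / sqrt 2)) \<and>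
     distributed P lborel (\<lambda>w. Im (Z w)) (normal_density 0 (1 / sqrt 2)) \<and>
     prob_space.indep_var P borel (\<lambda>w. Re (Z w)) borel (\<lambda>w. Im (Z w))"

text \<open>Joint independence of all the entries, over all \<open>n\<close> as well, contains the independence of the
  sequence \<open>g\<close>.\<close>

definition gaussian_matrices ::
  "'w measure \<Rightarrow> (nat \<Rightarrow> nat) \<Rightarrow> (nat \<Rightarrow> 'w \<Rightarrow> complex mat) \<Rightarrow> bool" where
  "gaussian_matrices P d g \<longleftrightarrow>
     (\<forall>n. random_matrix P (d n) (g n)) \<and>
     (\<forall>n. \<forall>i<d n. \<forall>j<d n.
        std_complex_gaussian P (\<lambda>w. complex_of_real (sqrt (real (d n))) * g n w $$ (i, j))) \<and>
     prob_space.indep_vars P (\<lambda>_. borel)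
       (\<lambda>(n, i, j) w. complex_of_real (sqrt (real (d n))) * g n w $$ (i, j))
       {(n, i, j). i < d n \<and> j < d n}"

definition mat_support :: "(nat \<Rightarrow> nat) \<Rightarrow> (nat \<Rightarrow> complex mat) \<Rightarrow> nat set" where
  "mat_support d x = {n. x n \<noteq> 0\<^sub>m (d n) (d n)}"

definition fin_supp_family :: "(nat \<Rightarrow> nat) \<Rightarrow> (nat \<Rightarrow> complex mat) \<Rightarrow> bool" where
  "fin_supp_family d x \<longleftrightarrow>
     (\<forall>n. x n \<in> carrier_mat (d n) (d n)) \<and> finite (mat_support d x)"

text \<open>\<open>g\<close> is meant to satisfy \<open>gaussian_matrices P d g\<close>; the expectation is that of an
  \<^typ>\<open>ennreal\<close>-valued function.\<close>

definition randomly_sidon ::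
  "'w measure \<Rightarrow> (nat \<Rightarrow> 'w \<Rightarrow> complex mat) \<Rightarrow> 't measure \<Rightarrow> (nat \<Rightarrow> nat) \<Rightarrow>
   (nat \<Rightarrow> 't \<Rightarrow> complex mat) \<Rightarrow> bool" where
  "randomly_sidon P g m d \<psi> \<longleftrightarrow>
     (\<exists>C::real. \<forall>x. fin_supp_family d x \<longrightarrow>
        ennreal (\<Sum>n \<in> mat_support d x. real (d n) * trace_norm (x n))
        \<le> ennreal C * (\<integral>\<^sup>+ w. Linf_norm m
             (\<lambda>t. \<Sum>n \<in> mat_support d x. of_nat (d n) * mat_tr (x n * g n w * \<psi> n t)) \<partial>P))"

text \<open>\<open>mat_prod_upto d A k\<close> is \<open>A 1 * \<dots> * A k\<close>, in this order, for \<open>d \<times> d\<close> matrices.\<close>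

definition mat_prod_upto :: "nat \<Rightarrow> (nat \<Rightarrow> complex mat) \<Rightarrow> nat \<Rightarrow> complex mat" where
  "mat_prod_upto d A k = foldr (\<lambda>j B. A j * B) [1..<Suc k] (1\<^sub>m d)"

definition dot_tensor_sidon ::
  "nat \<Rightarrow> 't measure \<Rightarrow> (nat \<Rightarrow> nat) \<Rightarrow> (nat \<Rightarrow> 't \<Rightarrow> complex mat) \<Rightarrow> bool" where
  "dot_tensor_sidon k m d \<psi> \<longleftrightarrow>
     (\<exists>C::real. \<forall>x. fin_supp_family d x \<longrightarrow>
        ennreal (\<Sum>n \<in> mat_support d x. real (d n) * trace_norm (x n))
        \<le> ennreal C * Linf_norm (\<Pi>\<^sub>M j \<in> {1..k}. m)
             (\<lambda>t. \<Sum>n \<in> mat_support d x.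
                of_nat (d n) * mat_tr (x n * mat_prod_upto (d n) (\<lambda>j. \<psi> n (t j)) k)))"

end

theory Submission
  imports Defs "Jordan_Normal_Form.Spectral_Radius"
begin

text \<open>
  Let \<open>N\<close> be the norm of \<open>\<Sum> d\<^sub>n tr(x\<^sub>n \<psi>\<^sub>n(t\<^sub>1) \<dots> \<psi>\<^sub>n(t\<^sub>k))\<close> in \<open>L\<^sub>\<infinity>\<close> and \<open>T = \<Sum> d\<^sub>n tr|x\<^sub>n|\<close>. By duality, the randomly
  Sidon property yields kernels \<open>\<beta>(w, t)\<close> on the product of Gauss space and the given space, with
  \<open>\<integral>|\<beta>(w, t)| dm(t) \<le> 1\<close>, such that \<open>\<psi>\<^sub>n\<close> averaged against \<open>\<beta>(w, \<cdot>)\<close> has a first Gaussian chaos that tests the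
  trace norms of a given family. Integrating the factors in \<open>t\<^bsub>k-2\<^esub>\<close> and \<open>t\<^sub>k\<close> against two such kernels, with
  the other variables fixed, gives a function of \<open>(w, w')\<close> bounded by \<open>N\<close>.

  That function is integrated against a Mehler kernel of parameter \<open>r\<close>, composed with a unitary of the
  Gauss space and averaged over the cube roots of unity. Since the Mehler kernel is positive of mass
  one, the result is at most \<open>N\<close>; it equals \<open>r\<close> times a contraction of the two first chaoses plus a
  remainder that only involves chaoses of degree at least two and is \<open>O(r\<^sup>2 T)\<close>. By linearity the
  unitary may be replaced by a multiple of a tensor product of contractions, and these are chosen as
  the products of the entrywise conjugates of \<open>\<phi>\<^sub>n\<close> at the fixed variables. Integrating over the
  latter, biorthogonality reduces the first chaos term to the product of the two Sidon functionals,
  which dominates \<open>T\<close> up to a constant. Hence \<open>r T \<le> c (N + r\<^sup>2 q T)\<close> with \<open>c\<close> and \<open>q\<close> independent of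
  \<open>x\<close>, and the last term is absorbed when \<open>r\<close> is small.
\<close>

section \<open>The complex Gaussian measure and its Mehler kernel\<close>

text \<open>The bound \<open>k >= 4\<close> is a count of variables. Two are spent on the Sidon
  kernels. The unitary of Gauss space acts on matrices through a left and a right factor, and each
  factor is recovered by biorthogonality from a nonempty block of the other variables:
  \<open>k - 3 >= 1\<close> of them for the left factor, one for the right. An empty block would be
  the identity matrix, which does not separate different \<open>n\<close>. The obstacle is
  uniformity: the constant in the remainder may depend neither on the sizes \<open>d n\<close> nor
  on the support of \<open>x\<close>. This needs the contraction \<open>r^2\<close> on chaoses of
  degree at least two, obtained in every dimension from the semigroup law rather than from Hermite
  expansions, and a Cauchy-Schwarz argument over the inner matrix index, followed by duality of
  trace norm and operator norm. The Sidon hypothesis enters twice because biorthogonality leaves the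
  sum of \<open>tr(z_n) tr(x_n z'_n)\<close>: the kernel behind \<open>z'\<close> norms
  \<open>x\<close>, and the one behind \<open>z\<close> norms the scalar matrices with traces
  \<open>tr(x_n z'_n)\<close>.\<close>

lemma measurable_case_Complex [measurable]:
  "(\<lambda>(x, y). Complex x y) \<in> borel_measurable (lborel \<Otimes>\<^sub>M lborel)"
proof -
  have "(\<lambda>z. complex_of_real (fst z) + \<i> * complex_of_real (snd z)) \<in> borel_measurable (lborel \<Otimes>\<^sub>M lborel)"
    by measurable
  then show ?thesis
    by (simp add: Complex_eq case_prod_unfold)
qed

text \<open>Lebesgue measure is determined by its values on boxes, and a box for the basis
  \<open>1\<close>, \<open>\<i>\<close> is a rectangle in the two real coordinates. This lets the
  complex Gaussian be built from two real ones.\<close>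

lemma lborel_complex: "(lborel :: complex measure) = distr (lborel \<Otimes>\<^sub>M lborel) borel (\<lambda>(x, y). Complex x y)"
proof (rule lborel_eqI)
  fix l u :: complex
  assume le: "\<And>b. b \<in> Basis \<Longrightarrow> l \<bullet> b \<le> u \<bullet> b"
  have le': "Re l \<le> Re u" "Im l \<le> Im u"
    using le[of 1] le[of \<i>] by (simp_all add: Basis_complex_def inner_complex_def)
  have eq: "(\<lambda>(x, y). Complex x y) -` box l u \<inter> space (lborel \<Otimes>\<^sub>M lborel) =
     {Re l <..< Re u} \<times> {Im l <..< Im u}"
    by (auto simp: box_def Basis_complex_def inner_complex_def space_pair_measure)
  have "emeasure (distr (lborel \<Otimes>\<^sub>M lborel) borel (\<lambda>(x, y). Complex x y)) (box l u) =
      emeasure (lborel \<Otimes>\<^sub>M lborel) ({Re l <..< Re u} \<times> {Im l <..< Im u})"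
    by (subst emeasure_distr) (auto simp: eq)
  also have "\<dots> = ennreal (Re u - Re l) * ennreal (Im u - Im l)"
    using le' by (subst lborel.emeasure_pair_measure_Times) auto
  finally show "emeasure (distr (lborel \<Otimes>\<^sub>M lborel) borel (\<lambda>(x, y). Complex x y)) (box l u) =
      ennreal (prod ((\<bullet>) (u - l)) Basis)"
    using le' by (simp add: Basis_complex_def inner_complex_def ennreal_mult)
qed simp

text \<open>Normalised by \<open>E|z|^2 = 1\<close>, so that the real and imaginary parts have
  variance 1/2, as in \<open>std_complex_gaussian\<close>.\<close>

definition cgauss :: "complex measure" where
  "cgauss = density lborel (\<lambda>z. ennreal (exp (- (cmod z)\<^sup>2) / pi))"

lemma sets_cgauss [measurable_cong, simp]: "sets cgauss = sets borel"
  by (simp add: cgauss_def)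

lemma space_cgauss [simp]: "space cgauss = UNIV"
  by (simp add: cgauss_def)

lemma cgauss_distr:
  "cgauss = distr (density lborel (normal_density 0 (1 / sqrt 2)) \<Otimes>\<^sub>M density lborel (normal_density 0 (1 / sqrt 2)))
     borel (\<lambda>(x, y). Complex x y)"
proof -
  let ?n = "normal_density 0 (1 / sqrt 2)"
  interpret N: prob_space "density lborel ?n" by (rule prob_space_normal_density) simp
  have nn: "?n x = exp (- x\<^sup>2) / sqrt pi" for x
    by (simp add: normal_density_def power2_eq_square)
  have "density lborel ?n \<Otimes>\<^sub>M density lborel ?n = 
      density (lborel \<Otimes>\<^sub>M lborel) (\<lambda>(x,y). ennreal (?n x) * ennreal (?n y))"
    by (rule pair_measure_density) (auto intro!: N.sigma_finite_measure lborel.sigma_finite_measure_axioms)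
  also have "\<dots> = density (lborel \<Otimes>\<^sub>M lborel) (\<lambda>z. ennreal (exp (- (cmod (case z of (x, y) \<Rightarrow> Complex x y))\<^sup>2) / pi))"
    by (intro density_cong AE_I2; (measurable; fail)?) 
      (auto simp: nn ennreal_mult[symmetric] cmod_power2 exp_diff exp_minus field_simps)
  finally have *: "density lborel ?n \<Otimes>\<^sub>M density lborel ?n = density (lborel \<Otimes>\<^sub>M lborel) (\<lambda>z. ennreal (exp (- (cmod (case z of (x, y) \<Rightarrow> Complex x y))\<^sup>2) / pi))" .
  show ?thesis
    unfolding cgauss_def * by (subst lborel_complex, subst density_distr) auto
qed

lemma prob_space_cgauss: "prob_space cgauss"
proof -
  let ?n = "normal_density 0 (1 / sqrt 2)"
  interpret N: prob_space "density lborel ?n" by (rule prob_space_normal_density) simp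
  interpret NN: pair_prob_space "density lborel ?n" "density lborel ?n" ..
  show ?thesis unfolding cgauss_distr
    by (rule NN.prob_space_distr) (simp cong: measurable_cong_sets)
qed

interpretation cgauss: prob_space cgauss by (rule prob_space_cgauss)

lemma nn_integral_complex_affine:
  fixes f :: "complex \<Rightarrow> ennreal"
  assumes [measurable]: "f \<in> borel_measurable borel" and c: "0 < c"
  shows "(\<integral>\<^sup>+z. f z \<partial>lborel) = ennreal (c\<^sup>2) * (\<integral>\<^sup>+z. f (t + c *\<^sub>R z) \<partial>lborel)"
  using c by (subst lborel_affine[of c t])
    (simp_all add: nn_integral_density nn_integral_distr nn_integral_cmult power2_eq_square)

lemma nn_integral_cgauss_const: "(\<integral>\<^sup>+z. ennreal (exp (- (cmod z)\<^sup>2) / pi) \<partial>lborel) = 1"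
  using cgauss.emeasure_space_1 by (simp add: cgauss_def emeasure_density)

text \<open>Completing the square.\<close>

lemma nn_integral_cgauss_exp:
  assumes "B > -1"
  shows "(\<integral>\<^sup>+z. ennreal (exp (- (B * (cmod z)\<^sup>2) + 2 * Re (cnj b * z))) \<partial>cgauss) =
    ennreal (exp ((cmod b)\<^sup>2 / (1 + B)) / (1 + B))"
proof -
  define A where "A = 1 + B"
  have A: "A > 0" using assms by (simp add: A_def)
  \<comment> \<open>Centre of the completed square: the full exponent is
    \<open>- A * |z - ?t|^2 + |b|^2 / A\<close>, so the scale is \<open>1 / sqrt A\<close>.\<close>
  let ?t = "b / of_real A"
  define f where "f z = ennreal (exp (- (B * (cmod z)\<^sup>2) + 2 * Re (cnj b * z))) * ennreal (exp (- (cmod z)\<^sup>2) / pi)" for z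
  have [measurable]: "f \<in> borel_measurable borel" unfolding f_def by measurable
  have f: "f (?t + (1 / sqrt A) *\<^sub>R z) = ennreal (exp ((cmod b)\<^sup>2 / A)) * ennreal (exp (- (cmod z)\<^sup>2) / pi)" for z
  proof -
    define w where "w = ?t + (1 / sqrt A) *\<^sub>R z"
    define s where "s = sqrt A"
    have s: "s > 0" "A = s * s" using A by (simp_all add: s_def)
    have w: "Re w = Re b / (s * s) + Re z / s" "Im w = Im b / (s * s) + Im z / s"
      by (simp_all add: w_def s(2)) (use s(1) in simp_all)
    have cb: "Re (cnj b * w) = Re b * Re w + Im b * Im w" by simp
    have "- (A * (cmod w)\<^sup>2) + 2 * Re (cnj b * w) = (cmod b)\<^sup>2 / A - (cmod z)\<^sup>2"
    proof -
      have "- ((s * s) * ((x / (s * s) + u / s)\<^sup>2 + (y / (s * s) + v / s)\<^sup>2)) + 2 * (x * (x / (s * s) + u / s) + y * (y / (s * s) + v / s))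
         = (x\<^sup>2 + y\<^sup>2) / (s * s) - (u\<^sup>2 + v\<^sup>2)" for x y u v
      proof -
        define a where "a = x / s"
        define c where "c = y / s"
        have xy: "x = a * s" "y = c * s" using s(1) by (simp_all add: a_def c_def)
        show ?thesis using s(1) unfolding xy by (simp add: field_simps) (simp add: power2_eq_square power4_eq_xxxx algebra_simps)
      qed
      then show ?thesis unfolding cmod_power2 s(2) cb w .
    qed
    then have "- (B * (cmod w)\<^sup>2) + 2 * Re (cnj b * w) + (- (cmod w)\<^sup>2) = (cmod b)\<^sup>2 / A + (- (cmod z)\<^sup>2)"
    proof -
      have "- (A * W) + R = X - Z \<Longrightarrow> - (B * W) + R + (- W) = X + (- Z)" for W R X Z
        by (simp add: A_def algebra_simps)
      moreover assume "- (A * (cmod w)\<^sup>2) + 2 * Re (cnj b * w) = (cmod b)\<^sup>2 / A - (cmod z)\<^sup>2"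
      ultimately show ?thesis by blast
    qed
    then have "exp (- (B * (cmod w)\<^sup>2) + 2 * Re (cnj b * w)) * (exp (- (cmod w)\<^sup>2) / pi) =
       exp ((cmod b)\<^sup>2 / A) * (exp (- (cmod z)\<^sup>2) / pi)"
      by (simp only: times_divide_eq_right exp_add[symmetric])
    then show ?thesis unfolding f_def w_def
      by (simp add: ennreal_mult[symmetric])
  qed
  have "(\<integral>\<^sup>+z. ennreal (exp (- (B * (cmod z)\<^sup>2) + 2 * Re (cnj b * z))) \<partial>cgauss) = (\<integral>\<^sup>+z. f z \<partial>lborel)"
    unfolding cgauss_def f_def by (subst nn_integral_density) (measurable, simp only: mult.commute)
  also have "\<dots> = ennreal ((1 / sqrt A)\<^sup>2) * (\<integral>\<^sup>+z. f (?t + (1 / sqrt A) *\<^sub>R z) \<partial>lborel)"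
    using A by (intro nn_integral_complex_affine) auto
  also have "\<dots> = ennreal (1 / A) * ennreal (exp ((cmod b)\<^sup>2 / A))"
    using A by (simp add: f nn_integral_cmult nn_integral_cgauss_const power_divide)
  also have "\<dots> = ennreal (exp ((cmod b)\<^sup>2 / A) / A)"
    using A by (subst ennreal_mult[symmetric]) auto
  finally show ?thesis by (simp add: A_def)
qed

lemma has_bochner_integral_cgauss:
  fixes f :: "complex \<Rightarrow> real"
  assumes [measurable]: "f \<in> borel_measurable borel"
  shows "has_bochner_integral cgauss f a \<longleftrightarrow> has_bochner_integral lborel (\<lambda>z. exp (- (cmod z)\<^sup>2) / pi * f z) a"
  unfolding cgauss_def has_bochner_integral_iff by (simp add: integrable_density integral_density)

lemma has_bochner_integral_cgauss_exp:
  assumes "B > -1"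
  shows "has_bochner_integral cgauss (\<lambda>z. exp (- (B * (cmod z)\<^sup>2) + 2 * Re (cnj b * z))) (exp ((cmod b)\<^sup>2 / (1 + B)) / (1 + B))"
  using assms by (intro has_bochner_integral_nn_integral nn_integral_cgauss_exp) auto

lemma cgauss_product:
  fixes f g :: "real \<Rightarrow> real"
  assumes f: "has_bochner_integral lborel (\<lambda>x. normal_density 0 (1 / sqrt 2) x * f x) a"
    and g: "has_bochner_integral lborel (\<lambda>x. normal_density 0 (1 / sqrt 2) x * g x) b"
    and [measurable]: "f \<in> borel_measurable borel" "g \<in> borel_measurable borel"
  shows "has_bochner_integral cgauss (\<lambda>z. f (Re z) * g (Im z)) (a * b)"
proof -
  let ?n = "normal_density 0 (1 / sqrt 2)"
  let ?N = "density lborel ?n"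
  interpret N: prob_space ?N by (rule prob_space_normal_density) simp
  interpret NN: pair_prob_space ?N ?N ..
  have f': "has_bochner_integral ?N f a" using f by (simp add: has_bochner_integral_iff integrable_density integral_density)
  have g': "has_bochner_integral ?N g b" using g by (simp add: has_bochner_integral_iff integrable_density integral_density)
  have fi: "integrable ?N f" "integrable ?N g" using f' g' by (auto simp: has_bochner_integral_iff)
  have int: "integrable (?N \<Otimes>\<^sub>M ?N) (\<lambda>(x, y). f x * g y)"
  proof (rule NN.Fubini_integrable)
    have [measurable]: "f \<in> borel_measurable ?N" "g \<in> borel_measurable ?N" by simp_all
    show "(\<lambda>(x, y). f x * g y) \<in> borel_measurable (?N \<Otimes>\<^sub>M ?N)" by measurable
    show "integrable ?N (\<lambda>x. \<integral>y. norm (case (x, y) of (x, y) \<Rightarrow> f x * g y) \<partial>?N)"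
      using fi(1) by (simp only: prod.case real_norm_def abs_mult integral_mult_right_zero)
        (intro integrable_mult_left integrable_abs)
    show "AE x in ?N. integrable ?N (\<lambda>y. case (x, y) of (x, y) \<Rightarrow> f x * g y)"
      using fi(2) by simp
  qed
  have "integral\<^sup>L (?N \<Otimes>\<^sub>M ?N) (\<lambda>(x, y). f x * g y) = a * b"
    using f' g' by (subst NN.integral_fst[OF int, symmetric]) (simp add: has_bochner_integral_iff)
  moreover have "(\<lambda>(x, y). Complex x y) \<in> borel_measurable (?N \<Otimes>\<^sub>M ?N)"
    using measurable_case_Complex by (simp cong: measurable_cong_sets)
  moreover have "(\<lambda>p. f (Re (case p of (x, y) \<Rightarrow> Complex x y)) * g (Im (case p of (x, y) \<Rightarrow> Complex x y))) = (\<lambda>(x, y). f x * g y)"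
    by (simp add: fun_eq_iff)
  ultimately show ?thesis unfolding cgauss_distr
    using int by (intro has_bochner_integral_distr) (auto simp only: has_bochner_integral_iff, measurable)
qed

lemma cgauss_moments:
  "has_bochner_integral cgauss Re 0" "has_bochner_integral cgauss Im 0"
  "has_bochner_integral cgauss (\<lambda>z. Re z * Re z) (1/2)" "has_bochner_integral cgauss (\<lambda>z. Im z * Im z) (1/2)"
  "has_bochner_integral cgauss (\<lambda>z. Re z * Im z) 0"
proof -
  let ?n = "normal_density 0 (1 / sqrt 2)"
  have s: "0 < 1 / sqrt 2" by simp
  have 0: "has_bochner_integral lborel (\<lambda>x. ?n x * 1) 1"
    using normal_moment_even[OF s, of 0 0] by simp
  have 1: "has_bochner_integral lborel (\<lambda>x. ?n x * x) 0"
    using normal_moment_nz_1[OF s, of 0] by simp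
  have 2: "has_bochner_integral lborel (\<lambda>x. ?n x * (x * x)) (1/2)"
    using normal_moment_even[OF s, of 0 1] by (simp add: power2_eq_square)
  have "has_bochner_integral cgauss (\<lambda>z. Re z * 1) (0 * 1)" by (rule cgauss_product[OF 1 0]) simp_all
  then show "has_bochner_integral cgauss Re 0" by (simp only: mult_1_right mult_zero_left)
  have "has_bochner_integral cgauss (\<lambda>z. 1 * Im z) (1 * 0)" by (rule cgauss_product[OF 0 1]) simp_all
  then show "has_bochner_integral cgauss Im 0" by (simp only: mult_1_left mult_zero_right)
  have "has_bochner_integral cgauss (\<lambda>z. (Re z * Re z) * 1) (1 / 2 * 1)" by (rule cgauss_product[OF 2 0]) simp_all
  then show "has_bochner_integral cgauss (\<lambda>z. Re z * Re z) (1/2)" by (simp only: mult_1_right)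
  have "has_bochner_integral cgauss (\<lambda>z. 1 * (Im z * Im z)) (1 * (1 / 2))" by (rule cgauss_product[OF 0 2]) simp_all
  then show "has_bochner_integral cgauss (\<lambda>z. Im z * Im z) (1/2)" by (simp only: mult_1_left)
  have "has_bochner_integral cgauss (\<lambda>z. Re z * Im z) (0 * 0)" by (rule cgauss_product[OF 1 1]) simp_all
  then show "has_bochner_integral cgauss (\<lambda>z. Re z * Im z) 0" by (simp only: mult_zero_left)
qed

text \<open>Density relative to \<open>cgauss\<close> of the law of
  \<open>r * x + sqrt (1 - r^2) * z\<close> with \<open>z\<close> standard Gaussian. It is the
  kernel of the Ornstein-Uhlenbeck operator, which multiplies the chaos of degree \<open>n\<close>
  by \<open>r^n\<close>.\<close>

definition mehler1 :: "real \<Rightarrow> complex \<Rightarrow> complex \<Rightarrow> real" where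
  "mehler1 r x y = exp ((2 * r * Re (cnj x * y) - r\<^sup>2 * (cmod x)\<^sup>2 - r\<^sup>2 * (cmod y)\<^sup>2) / (1 - r\<^sup>2)) / (1 - r\<^sup>2)"

lemma mehler1_commute: "mehler1 r x y = mehler1 r y x"
  by (simp add: mehler1_def algebra_simps)

lemma mehler1_nonneg: "0 \<le> r \<Longrightarrow> r < 1 \<Longrightarrow> 0 \<le> mehler1 r x y"
  by (simp add: mehler1_def power_le_one)

lemma measurable_mehler1 [measurable (raw)]:
  assumes [measurable]: "f \<in> borel_measurable M" "g \<in> borel_measurable M"
  shows "(\<lambda>w. mehler1 r (f w) (g w)) \<in> borel_measurable M"
  unfolding mehler1_def by simp

text \<open>Semigroup law in one variable. In the middle point the product of two kernels is the
  exponential of a quadratic polynomial, so \<open>has_bochner_integral_cgauss_exp\<close> evaluates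
  it; what remains is to match the coefficients of \<open>|x|^2\<close>, \<open>|z|^2\<close> and
  \<open>Re (cnj x * z)\<close>.\<close>

lemma mehler1_compose:
  assumes r: "0 \<le> r" "r < 1" and s: "0 \<le> s" "s < 1"
  shows "has_bochner_integral cgauss (\<lambda>y. mehler1 r x y * mehler1 s y z) (mehler1 (r * s) x z)"
proof -
  define q p where "q = 1 - r\<^sup>2" and "p = 1 - s\<^sup>2"
  have q: "q > 0" and p: "p > 0" using r s by (simp_all add: q_def p_def abs_square_less_1)
  have "r * s < 1" using r s by (metis le_less_trans less_eq_real_def mult_left_le)
  then have k0: "(r * s)\<^sup>2 < 1" using r s by (simp add: abs_square_less_1)
  define k where "k = 1 - (r * s)\<^sup>2"
  have r2: "r\<^sup>2 = 1 - q" and s2: "s\<^sup>2 = 1 - p" by (simp_all add: q_def p_def)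
  have k: "k > 0" "k = q + p - q * p" using k0 by (simp_all add: k_def q_def p_def power_mult_distrib algebra_simps)
  define B where "B = r\<^sup>2 / q + s\<^sup>2 / p"
  have B: "1 + B = k / (q * p)" using q p by (simp add: B_def k r2 s2 field_simps)
  have B1: "B > -1" using q p by (simp add: B_def) (smt (verit) divide_nonneg_pos zero_le_power2)
  define b where "b = (r / q) *\<^sub>R x + (s / p) *\<^sub>R z"
  let ?C = "exp (- (r\<^sup>2 * (cmod x)\<^sup>2 / q + s\<^sup>2 * (cmod z)\<^sup>2 / p)) / (q * p)"
  have *: "mehler1 r x y * mehler1 s y z = ?C * exp (- (B * (cmod y)\<^sup>2) + 2 * Re (cnj b * y))" for y
  proof -
    have lin: "Re (cnj b * y) = r / q * Re (cnj x * y) + s / p * Re (cnj y * z)"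
      by (simp add: b_def algebra_simps)
    have "(2 * r * X - r\<^sup>2 * u - r\<^sup>2 * v) / q + (2 * s * Z - s\<^sup>2 * v - s\<^sup>2 * w) / p =
       - (r\<^sup>2 * u / q + s\<^sup>2 * w / p) + (- ((r\<^sup>2 / q + s\<^sup>2 / p) * v) + 2 * (r / q * X + s / p * Z))" for X Z u v w
      using q p by (simp add: field_simps)
    from arg_cong[where f=exp, OF this[of "Re (cnj x * y)" "(cmod x)\<^sup>2" "(cmod y)\<^sup>2" "Re (cnj y * z)" "(cmod z)\<^sup>2"]]
    show ?thesis unfolding mehler1_def q_def[symmetric] p_def[symmetric] lin B_def exp_add by simp
  qed
  have "(cmod b)\<^sup>2 / (1 + B) = (cmod b)\<^sup>2 * (q * p) / k" unfolding B by simp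
  moreover have "(cmod b)\<^sup>2 * (q * p) - (r\<^sup>2 * (cmod x)\<^sup>2 / q + s\<^sup>2 * (cmod z)\<^sup>2 / p) * k =
      2 * (r * s) * Re (cnj x * z) - (r * s)\<^sup>2 * (cmod x)\<^sup>2 - (r * s)\<^sup>2 * (cmod z)\<^sup>2"
  proof -
    have b2: "(cmod b)\<^sup>2 = (r/q)\<^sup>2 * (cmod x)\<^sup>2 + (s/p)\<^sup>2 * (cmod z)\<^sup>2 + 2 * (r/q) * (s/p) * Re (cnj x * z)"
    proof -
      have "(cmod (a *\<^sub>R x + c *\<^sub>R z))\<^sup>2 = a\<^sup>2 * (cmod x)\<^sup>2 + c\<^sup>2 * (cmod z)\<^sup>2 + 2 * a * c * Re (cnj x * z)" for a c
        unfolding cmod_power2 by (simp add: power2_eq_square algebra_simps)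
      then show ?thesis unfolding b_def .
    qed
    have 1: "(r/q)\<^sup>2 * (q * p) - r\<^sup>2 / q * k = - (r * s)\<^sup>2"
    proof -
      have "(r/q)\<^sup>2 * (q * p) - r\<^sup>2 / q * k = r\<^sup>2 * (p - k) / q" using q by (simp add: field_simps power2_eq_square)
      also have "p - k = - q * s\<^sup>2" by (simp add: k p_def algebra_simps)
      finally show ?thesis using q by (simp add: power_mult_distrib)
    qed
    have 2: "(s/p)\<^sup>2 * (q * p) - s\<^sup>2 / p * k = - (r * s)\<^sup>2"
    proof -
      have "(s/p)\<^sup>2 * (q * p) - s\<^sup>2 / p * k = s\<^sup>2 * (q - k) / p" using p by (simp add: field_simps power2_eq_square)
      also have "q - k = - p * r\<^sup>2" by (simp add: k q_def algebra_simps)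
      finally show ?thesis using p by (simp add: power_mult_distrib)
    qed
    have 3: "2 * (r/q) * (s/p) * (q * p) = 2 * (r * s)" using q p by simp
    have "(a * X + c * Z + e * R) * t - (u * X / q + v * Z / p) * k = (a * t - u / q * k) * X + (c * t - v / p * k) * Z + (e * t) * R"
      for a c e X Z R u v t by (simp add: algebra_simps)
    then have "(cmod b)\<^sup>2 * (q * p) - (r\<^sup>2 * (cmod x)\<^sup>2 / q + s\<^sup>2 * (cmod z)\<^sup>2 / p) * k =
      ((r/q)\<^sup>2 * (q * p) - r\<^sup>2 / q * k) * (cmod x)\<^sup>2 + ((s/p)\<^sup>2 * (q * p) - s\<^sup>2 / p * k) * (cmod z)\<^sup>2
       + 2 * (r/q) * (s/p) * (q * p) * Re (cnj x * z)"
      unfolding b2 by this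
    then show ?thesis unfolding 1 2 3 by simp
  qed
  ultimately have "(cmod b)\<^sup>2 / (1 + B) - (r\<^sup>2 * (cmod x)\<^sup>2 / q + s\<^sup>2 * (cmod z)\<^sup>2 / p) =
      (2 * (r * s) * Re (cnj x * z) - (r * s)\<^sup>2 * (cmod x)\<^sup>2 - (r * s)\<^sup>2 * (cmod z)\<^sup>2) / k"
  proof -
    have gen: "L = X / k \<Longrightarrow> X - W * k = N \<Longrightarrow> L - W = N / k" for L X W N
      using k(1) by (simp add: field_simps)
    assume "(cmod b)\<^sup>2 / (1 + B) = (cmod b)\<^sup>2 * (q * p) / k" and "(cmod b)\<^sup>2 * (q * p) - (r\<^sup>2 * (cmod x)\<^sup>2 / q + s\<^sup>2 * (cmod z)\<^sup>2 / p) * k =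
      2 * (r * s) * Re (cnj x * z) - (r * s)\<^sup>2 * (cmod x)\<^sup>2 - (r * s)\<^sup>2 * (cmod z)\<^sup>2"
    from gen[OF this] show ?thesis .
  qed
  then have "exp (- (r\<^sup>2 * (cmod x)\<^sup>2 / q + s\<^sup>2 * (cmod z)\<^sup>2 / p)) * exp ((cmod b)\<^sup>2 / (1 + B)) =
    exp ((2 * (r * s) * Re (cnj x * z) - (r * s)\<^sup>2 * (cmod x)\<^sup>2 - (r * s)\<^sup>2 * (cmod z)\<^sup>2) / k)"
    by (simp only: exp_add[symmetric]) (simp only: uminus_add_conv_diff)
  then have "?C * (exp ((cmod b)\<^sup>2 / (1 + B)) / (1 + B)) = mehler1 (r * s) x z"
    unfolding mehler1_def k_def[symmetric] B using q p k(1) by simp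
  then show ?thesis unfolding *
    using has_bochner_integral_mult_right[OF has_bochner_integral_cgauss_exp[OF B1, of b], of ?C] by simp
qed

lemma mehler1_0 [simp]: "mehler1 0 x y = 1"
  by (simp add: mehler1_def)

lemma mehler1_integral:
  assumes "0 \<le> r" "r < 1"
  shows "has_bochner_integral cgauss (\<lambda>y. mehler1 r x y) 1"
  using mehler1_compose[OF assms, of 0 x 0] by simp

text \<open>The trace of the operator: the eigenvalue \<open>r^n\<close> has multiplicity
  \<open>n + 1\<close>, and the sum of \<open>(n + 1) * r^n\<close> is \<open>1 / (1 - r)^2\<close>.
  On the diagonal the exponent is \<open>2 * r / (1 + r) * |x|^2\<close>, which the Gaussian density
  dominates because \<open>r < 1\<close>.\<close>

lemma mehler1_diag:
  assumes r: "0 \<le> r" "r < 1"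
  shows "has_bochner_integral cgauss (\<lambda>x. mehler1 r x x) (1 / (1 - r)\<^sup>2)"
proof -
  let ?B = "- 2 * r / (1 + r)"
  have B: "?B > -1" using r by (simp add: field_simps)
  have B1: "1 + ?B = (1 - r) / (1 + r)" using r by (simp add: field_simps)
  have q: "1 - r\<^sup>2 = (1 - r) * (1 + r)" by (simp add: power2_eq_square algebra_simps)
  have "mehler1 r x x = 1 / ((1 - r) * (1 + r)) * exp (- (?B * (cmod x)\<^sup>2) + 2 * Re (cnj 0 * x))" for x
  proof -
    have "(2 * r * Re (cnj x * x) - r\<^sup>2 * (cmod x)\<^sup>2 - r\<^sup>2 * (cmod x)\<^sup>2) / ((1 - r) * (1 + r)) = 2 * r * (1 - r) * (cmod x)\<^sup>2 / ((1 - r) * (1 + r))"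
      unfolding cmod_power2 by (simp add: power2_eq_square algebra_simps)
    also have "\<dots> = - (?B * (cmod x)\<^sup>2)" using r by simp
    finally show ?thesis unfolding mehler1_def q by simp
  qed
  moreover have "1 / ((1 - r) * (1 + r)) * (exp ((cmod 0)\<^sup>2 / (1 + ?B)) / (1 + ?B)) = 1 / (1 - r)\<^sup>2"
  proof -
    have "1 / (a * c) * (1 / (a / c)) = 1 / a\<^sup>2" if "a \<noteq> 0" "c \<noteq> 0" for a c :: real
      using that by (simp add: power2_eq_square)
    from this[of "1 - r" "1 + r"] show ?thesis unfolding B1 using r by simp
  qed
  ultimately show ?thesis
    using has_bochner_integral_mult_right[OF has_bochner_integral_cgauss_exp[OF B, of 0], of "1 / ((1 - r) * (1 + r))"] by simp
qed

lemma integral_complex_affine: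
  fixes f :: "complex \<Rightarrow> real"
  assumes [measurable]: "f \<in> borel_measurable borel" and c: "0 < c"
    and "has_bochner_integral lborel (\<lambda>z. c\<^sup>2 * f (t + c *\<^sub>R z)) a"
  shows "has_bochner_integral lborel f a"
  using assms by (subst lborel_affine[of c t])
    (simp_all add: has_bochner_integral_density has_bochner_integral_distr power2_eq_square)

text \<open>The first chaos is an eigenspace for \<open>r\<close>. After the substitution
  \<open>y = r * x + q * z\<close>, kernel and density combine to the Gaussian density in
  \<open>z\<close>, and a linear \<open>h\<close> of mean zero leaves only
  \<open>r * h x\<close>.\<close>

lemma mehler1_linear:
  fixes h :: "complex \<Rightarrow> real"
  assumes r: "0 \<le> r" "r < 1" and h: "bounded_linear h" and h0: "has_bochner_integral cgauss h 0"
  shows "has_bochner_integral cgauss (\<lambda>y. mehler1 r x y * h y) (r * h x)"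
proof -
  interpret h: bounded_linear h by fact
  have [measurable]: "h \<in> borel_measurable borel"
    by (intro borel_measurable_continuous_onI h.continuous_on continuous_on_id)
  define q where "q = sqrt (1 - r\<^sup>2)"
  have q: "q > 0" "q\<^sup>2 = 1 - r\<^sup>2" using r by (simp_all add: q_def abs_square_less_1 power_le_one)
  have *: "q\<^sup>2 * (exp (- (cmod (r *\<^sub>R x + q *\<^sub>R z))\<^sup>2) / pi * (mehler1 r x (r *\<^sub>R x + q *\<^sub>R z) * h (r *\<^sub>R x + q *\<^sub>R z))) =
     exp (- (cmod z)\<^sup>2) / pi * (r * h x + q * h z)" for z
  proof -
    define y where "y = r *\<^sub>R x + q *\<^sub>R z"
    have "- (cmod y)\<^sup>2 + (2 * r * Re (cnj x * y) - r\<^sup>2 * (cmod x)\<^sup>2 - r\<^sup>2 * (cmod y)\<^sup>2) / q\<^sup>2 = - (cmod z)\<^sup>2"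
    proof -
      have "(cmod y)\<^sup>2 + r\<^sup>2 * (cmod x)\<^sup>2 - 2 * r * Re (cnj x * y) = (cmod z)\<^sup>2 * q\<^sup>2"
        unfolding y_def cmod_power2 by (simp add: power2_eq_square algebra_simps)
      moreover have "- Y + (2 * r * w - r\<^sup>2 * X - r\<^sup>2 * Y) / q\<^sup>2 = - Z" if "Y + r\<^sup>2 * X - 2 * r * w = Z * q\<^sup>2" for X Y Z w
      proof -
        have "2 * r * w - r\<^sup>2 * X - r\<^sup>2 * Y = (Y - Z) * q\<^sup>2" using that unfolding q(2) by (simp add: algebra_simps)
        then show ?thesis using q(1) by simp
      qed
      ultimately show ?thesis by blast
    qed
      moreover have "mehler1 r x y * q\<^sup>2 = exp ((2 * r * Re (cnj x * y) - r\<^sup>2 * (cmod x)\<^sup>2 - r\<^sup>2 * (cmod y)\<^sup>2) / q\<^sup>2)"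
      using q(1) by (simp only: mehler1_def q(2)[symmetric]) simp
    ultimately have "exp (- (cmod y)\<^sup>2) * mehler1 r x y * q\<^sup>2 = exp (- (cmod z)\<^sup>2)"
      by (simp only: mult.assoc exp_add[symmetric])
    moreover have "h y = r * h x + q * h z" by (simp add: y_def h.add h.scaleR)
    moreover have "Q * (E / pi * (M * H)) = E * M * Q / pi * H" for Q E M H :: real by simp
    ultimately show ?thesis unfolding y_def[symmetric] by (simp only:)
  qed
  have "has_bochner_integral cgauss (\<lambda>z. r * h x) (r * h x)"
    using cgauss.prob_space by (simp add: has_bochner_integral_iff)
  then have "has_bochner_integral cgauss (\<lambda>z. r * h x + q * h z) (r * h x + q * 0)"
    by (rule has_bochner_integral_add[OF _ has_bochner_integral_mult_right[OF h0]])
  then have "has_bochner_integral cgauss (\<lambda>z. r * h x + q * h z) (r * h x)"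
    by (simp only: mult_zero_right add_0_right)
  then have "has_bochner_integral lborel (\<lambda>z. exp (- (cmod z)\<^sup>2) / pi * (r * h x + q * h z)) (r * h x)"
    by (rule has_bochner_integral_cgauss[THEN iffD1, rotated]) measurable
  then have "has_bochner_integral lborel (\<lambda>y. exp (- (cmod y)\<^sup>2) / pi * (mehler1 r x y * h y)) (r * h x)"
    unfolding *[symmetric] by (rule integral_complex_affine[OF _ q(1), rotated]) simp
  then show ?thesis by (rule has_bochner_integral_cgauss[THEN iffD2, rotated]) measurable
qed

section \<open>Mehler kernels in several variables\<close>

lemma integral_Cauchy_Schwarz:
  fixes f g :: "'a \<Rightarrow> complex"
  assumes [measurable]: "f \<in> borel_measurable M" "g \<in> borel_measurable M"
    and f: "integrable M (\<lambda>x. (cmod (f x))\<^sup>2)" and g: "integrable M (\<lambda>x. (cmod (g x))\<^sup>2)"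
  shows "integrable M (\<lambda>x. f x * g x)"
    and "cmod (\<integral>x. f x * g x \<partial>M) \<le> sqrt (\<integral>x. (cmod (f x))\<^sup>2 \<partial>M) * sqrt (\<integral>x. (cmod (g x))\<^sup>2 \<partial>M)"
proof -
  have le: "cmod (f x * g x) \<le> (cmod (f x))\<^sup>2 + (cmod (g x))\<^sup>2" for x
    unfolding norm_mult
    using sum_squares_bound[of "cmod (f x)" "cmod (g x)"] mult_nonneg_nonneg[OF norm_ge_zero norm_ge_zero, of "f x" "g x"]
    by linarith
  show int: "integrable M (\<lambda>x. f x * g x)"
    by (rule Bochner_Integration.integrable_bound[OF Bochner_Integration.integrable_add[OF f g]])
      (use le in \<open>auto intro!: AE_I2 order_trans[OF _ abs_ge_self]\<close>)
  define a where "a = (\<integral>x. (cmod (f x))\<^sup>2 \<partial>M)"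
  define b where "b = (\<integral>x. (cmod (g x))\<^sup>2 \<partial>M)"
  have ab: "a \<ge> 0" "b \<ge> 0" by (auto simp: a_def b_def)
  define c where "c = (\<integral>x. cmod (f x * g x) \<partial>M)"
  have c0: "c \<ge> 0" by (auto simp: c_def)
  \<comment> \<open>Discriminant argument. For \<open>a = 0\<close> and \<open>c\<close> nonzero the
    choice \<open>t = (b + 1) / c\<close> is contradictory; for \<open>a > 0\<close> the optimal
    choice is \<open>t = c / a\<close>.\<close>
  have key: "2 * t * c \<le> t\<^sup>2 * a + b" for t :: real
  proof -
    have "(\<integral>x. 2 * t * cmod (f x * g x) \<partial>M) \<le> (\<integral>x. t\<^sup>2 * (cmod (f x))\<^sup>2 + (cmod (g x))\<^sup>2 \<partial>M)"
    proof (rule integral_mono)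
      show "integrable M (\<lambda>x. 2 * t * cmod (f x * g x))" using int by (intro integrable_mult_right integrable_norm)
      show "integrable M (\<lambda>x. t\<^sup>2 * (cmod (f x))\<^sup>2 + (cmod (g x))\<^sup>2)" using f g by (intro Bochner_Integration.integrable_add integrable_mult_right)
      show "2 * t * cmod (f x * g x) \<le> t\<^sup>2 * (cmod (f x))\<^sup>2 + (cmod (g x))\<^sup>2" for x
        using sum_squares_bound[of "t * cmod (f x)" "cmod (g x)"] by (simp add: norm_mult power_mult_distrib mult_ac)
    qed
    then show ?thesis using f g by (simp add: a_def b_def c_def)
  qed
  have "c\<^sup>2 \<le> a * b"
  proof (cases "a = 0")
    case True
    have "c = 0"
    proof (rule ccontr)
      assume "c \<noteq> 0"
      then show False using key[of "(b + 1) / c"] ab True by simp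
    qed
    then show ?thesis using ab by simp
  next
    case False
    then have a: "a > 0" using ab by simp
    have "2 * (c / a) * c \<le> (c / a)\<^sup>2 * a + b" by (rule key)
    then show ?thesis using a by (simp add: field_simps power2_eq_square)
  qed
  then have "c \<le> sqrt (a * b)" by (rule real_le_rsqrt)
  then have "c \<le> sqrt a * sqrt b" by (simp add: real_sqrt_mult)
  moreover have "cmod (\<integral>x. f x * g x \<partial>M) \<le> c" unfolding c_def by (rule integral_norm_bound)
  ultimately show "cmod (\<integral>x. f x * g x \<partial>M) \<le> sqrt (\<integral>x. (cmod (f x))\<^sup>2 \<partial>M) * sqrt (\<integral>x. (cmod (g x))\<^sup>2 \<partial>M)"
    by (simp add: a_def b_def)
qed

text \<open>Iteration bounds \<open>f r ^ (2 ^ n)\<close> by \<open>f (r ^ (2 ^ n))\<close>, to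
  which the crude estimate applies once \<open>r ^ (2 ^ n)\<close> is small. Roots of order
  \<open>2 ^ n\<close> then send the constant \<open>K\<close> to 1. This turns a bound that depends
  on the dimension into one that does not.\<close>

lemma self_improve:
  fixes f :: "real \<Rightarrow> real"
  assumes pos: "\<And>r. f r \<ge> 0"
    and sq: "\<And>r. 0 \<le> r \<Longrightarrow> r < 1 \<Longrightarrow> (f r)\<^sup>2 \<le> f (r\<^sup>2)"
    and K: "\<And>r. 0 \<le> r \<Longrightarrow> r \<le> 1 / 2 \<Longrightarrow> f r \<le> K * r ^ 4"
    and r: "0 \<le> r" "r < 1"
  shows "f r \<le> r ^ 4"
proof (cases "r = 0")
  case True then show ?thesis using K[of 0] by simp
next
  case False
  then have r0: "r > 0" using r by simp
  have pow: "f r ^ (2 ^ n) \<le> f (r ^ (2 ^ n))" for n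
  proof (induction n)
    case (Suc n)
    have "f r ^ (2 ^ Suc n) = (f r ^ (2 ^ n))\<^sup>2" by (simp add: power_mult[symmetric] mult.commute)
    also have "\<dots> \<le> (f (r ^ (2 ^ n)))\<^sup>2" using Suc pos by (intro power_mono) auto
    also have "\<dots> \<le> f ((r ^ (2 ^ n))\<^sup>2)"
      using r r0 by (intro sq) (auto simp: power_less_one_iff)
    also have "(r ^ (2 ^ n))\<^sup>2 = r ^ (2 ^ Suc n)" by (simp add: power_mult[symmetric] mult.commute)
    finally show ?case .
  qed simp
  show ?thesis
  proof (rule ccontr)
    assume "\<not> f r \<le> r ^ 4"
    then have q: "f r / r ^ 4 > 1" using r0 by simp
    obtain N where N: "r ^ N < 1 / 2" using real_arch_pow_inv[of "1/2" r] r by auto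
    obtain m where m: "(f r / r ^ 4) ^ m > K" using real_arch_pow[OF q] by blast
    define n where "n = max N m"
    have n2: "n \<le> 2 ^ n" by (simp add: less_imp_le_nat)
    have "r ^ (2 ^ n) \<le> r ^ N" using r n2 by (intro power_decreasing) (auto simp: n_def)
    then have "f (r ^ (2 ^ n)) \<le> K * (r ^ (2 ^ n)) ^ 4" using N r by (intro K) auto
    with pow[of n] have "f r ^ (2 ^ n) \<le> K * (r ^ 4) ^ (2 ^ n)" by (simp add: power_mult[symmetric] mult.commute)
    then have "(f r / r ^ 4) ^ (2 ^ n) \<le> K" using r0 by (simp add: power_divide field_simps)
    moreover have "(f r / r ^ 4) ^ m \<le> (f r / r ^ 4) ^ (2 ^ n)"
      using q n2 by (intro power_increasing) (auto simp: n_def)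
    ultimately show False using m by simp
  qed
qed

text \<open>If \<open>G\<close> is the kernel of \<open>A\<^sup>T A\<close>, then \<open>\<parallel>A b\<parallel>\<^sup>2 = \<langle>b, G b\<rangle>\<close>.\<close>

lemma kernel_square:
  fixes A G :: "'a \<Rightarrow> 'a \<Rightarrow> real" and b :: "'a \<Rightarrow> real"
  assumes "prob_space M"
    and A [measurable]: "case_prod A \<in> borel_measurable (M \<Otimes>\<^sub>M M)"
    and G [measurable]: "case_prod G \<in> borel_measurable (M \<Otimes>\<^sub>M M)"
    and comp: "\<And>x y. has_bochner_integral M (\<lambda>w. A w x * A w y) (G x y)"
    and diag: "integrable M (\<lambda>x. G x x)"
    and b [measurable]: "b \<in> borel_measurable M" and bB: "\<And>x. \<bar>b x\<bar> \<le> B"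
  shows "has_bochner_integral M (\<lambda>w. (\<integral>x. b x * A w x \<partial>M)\<^sup>2) (\<integral>y. b y * (\<integral>x. b x * G x y \<partial>M) \<partial>M)" (is ?thesis1)
    and "(\<integral>w. (\<integral>x. b x * A w x \<partial>M)\<^sup>2 \<partial>M) \<le> B\<^sup>2 * (\<integral>x. G x x \<partial>M)" (is ?thesis2)
proof -
  interpret prob_space M by fact
  interpret P: pair_prob_space M M ..
  interpret T: pair_prob_space M "M \<Otimes>\<^sub>M M" ..
  have B0: "B \<ge> 0" using order_trans[OF abs_ge_zero bB] .
  \<comment> \<open>The trace of \<open>G\<close> is the squared Hilbert-Schmidt norm of
    \<open>A\<close>. Its finiteness is what justifies the exchanges of integrals below.\<close>
  have hs: "integrable (M \<Otimes>\<^sub>M M) (\<lambda>(w, x). (A w x)\<^sup>2)"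
  proof -
    have "integrable (M \<Otimes>\<^sub>M M) (\<lambda>(x, w). (A w x)\<^sup>2)"
    proof (rule P.Fubini_integrable)
      show "(\<lambda>(x, w). (A w x)\<^sup>2) \<in> borel_measurable (M \<Otimes>\<^sub>M M)" by measurable
      have "(\<integral>w. (A w x)\<^sup>2 \<partial>M) = G x x" for x
        using comp[of x x] by (simp add: has_bochner_integral_iff power2_eq_square)
      then show "integrable M (\<lambda>x. \<integral>w. norm (case (x, w) of (x, w) \<Rightarrow> (A w x)\<^sup>2) \<partial>M)"
        using diag by simp
      show "AE x in M. integrable M (\<lambda>w. case (x, w) of (x, w) \<Rightarrow> (A w x)\<^sup>2)"
        using comp by (simp add: has_bochner_integral_iff power2_eq_square)
    qed
    from P.integrable_product_swap[OF this] show ?thesis by simp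
  qed
  have hsI: "(\<integral>(w, x). (A w x)\<^sup>2 \<partial>(M \<Otimes>\<^sub>M M)) = (\<integral>x. G x x \<partial>M)"
  proof -
    have "(\<integral>(w, x). (A w x)\<^sup>2 \<partial>(M \<Otimes>\<^sub>M M)) = (\<integral>x. (\<integral>w. (A w x)\<^sup>2 \<partial>M) \<partial>M)"
      using hs by (subst P.integral_snd) auto
    also have "\<dots> = (\<integral>x. G x x \<partial>M)"
      using comp by (simp add: has_bochner_integral_iff power2_eq_square)
    finally show ?thesis .
  qed
  have AEA: "AE w in M. integrable M (\<lambda>x. (A w x)\<^sup>2)"
    using P.AE_integrable_fst[OF hs] by simp
  have bA: "integrable M (\<lambda>x. b x * A w x)" and A1: "integrable M (A w)" if i: "integrable M (\<lambda>x. (A w x)\<^sup>2)" and [simp]: "w \<in> space M" for w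
  proof -
    have [measurable]: "A w \<in> borel_measurable M" using measurable_Pair2[OF A, of w] by simp
    show i1: "integrable M (A w)"
      by (rule square_integrable_imp_integrable[OF _ i]) simp
    show "integrable M (\<lambda>x. b x * A w x)"
      by (rule Bochner_Integration.integrable_bound[OF integrable_mult_right[OF integrable_norm[OF i1], of B]])
        (use bB B0 in \<open>auto simp: abs_mult intro!: AE_I2 mult_right_mono\<close>)
  qed
  \<comment> \<open>Integrated over \<open>(x, y)\<close> this gives the square for fixed
    \<open>w\<close>; integrated over \<open>w\<close> it gives
    \<open>b x * b y * G x y\<close>.\<close>
  let ?T = "\<lambda>(w, (x, y)). (b x * A w x) * (b y * A w y)"
  have Tm [measurable]: "?T \<in> borel_measurable (M \<Otimes>\<^sub>M (M \<Otimes>\<^sub>M M))" by measurable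
  have Tint: "integrable (M \<Otimes>\<^sub>M (M \<Otimes>\<^sub>M M)) ?T"
  proof (rule T.Fubini_integrable[OF Tm])
    have sqi: "integrable M (\<lambda>w. (\<integral>x. (A w x)\<^sup>2 \<partial>M))"
      using P.integrable_fst[OF hs] .
    have ae: "AE w in M. integrable (M \<Otimes>\<^sub>M M) (\<lambda>p. ?T (w, p))"
      using AEA AE_space
    proof eventually_elim
      case (elim w)
      have [measurable]: "A w \<in> borel_measurable M" using measurable_Pair2[OF A, of w] elim by simp
      note i = bA[OF elim]
      have "integrable (M \<Otimes>\<^sub>M M) (\<lambda>(x, y). (b x * A w x) * (b y * A w y))"
      proof (rule P.Fubini_integrable)
        show "(\<lambda>(x, y). (b x * A w x) * (b y * A w y)) \<in> borel_measurable (M \<Otimes>\<^sub>M M)" by measurable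
        show "integrable M (\<lambda>x. \<integral>y. norm (case (x, y) of (x, y) \<Rightarrow> (b x * A w x) * (b y * A w y)) \<partial>M)"
          using i by (simp only: prod.case real_norm_def abs_mult[of "_ * _" "_ * _"] integral_mult_right_zero)
            (intro integrable_mult_left integrable_abs)
        show "AE x in M. integrable M (\<lambda>y. case (x, y) of (x, y) \<Rightarrow> (b x * A w x) * (b y * A w y))"
          using i by simp
      qed
      then show ?case by simp
    qed
    then show "AE w in M. integrable (M \<Otimes>\<^sub>M M) (\<lambda>p. ?T (w, p))" .
    have le: "AE w in M. (\<integral>p. norm (?T (w, p)) \<partial>(M \<Otimes>\<^sub>M M)) \<le> B\<^sup>2 * (\<integral>x. (A w x)\<^sup>2 \<partial>M)"
      using AEA AE_space ae
    proof eventually_elim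
      case (elim w)
      have [measurable]: "A w \<in> borel_measurable M" using measurable_Pair2[OF A, of w] elim by simp
      note i = bA[OF elim(1,2)] A1[OF elim(1,2)] integrable_abs[OF bA[OF elim(1,2)], unfolded abs_mult]
      have "(\<integral>p. norm (?T (w, p)) \<partial>(M \<Otimes>\<^sub>M M)) = (\<integral>x. (\<integral>y. \<bar>b x * A w x\<bar> * \<bar>b y * A w y\<bar> \<partial>M) \<partial>M)"
        using integrable_norm[OF elim(3)] by (subst P.integral_fst'[symmetric]) (simp_all add: abs_mult)
      also have "\<dots> = (\<integral>x. \<bar>b x * A w x\<bar> \<partial>M)\<^sup>2"
        by (simp add: power2_eq_square)
      also have "(\<integral>x. \<bar>b x * A w x\<bar> \<partial>M)\<^sup>2 \<le> (\<integral>x. B * \<bar>A w x\<bar> \<partial>M)\<^sup>2"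
        using i bB by (intro power_mono integral_mono integral_nonneg_AE) (auto simp: abs_mult intro!: mult_right_mono)
      also have "\<dots> = B\<^sup>2 * (\<integral>x. \<bar>A w x\<bar> \<partial>M)\<^sup>2" by (simp add: power_mult_distrib)
      also have "(\<integral>x. \<bar>A w x\<bar> \<partial>M)\<^sup>2 \<le> (\<integral>x. \<bar>A w x\<bar>\<^sup>2 \<partial>M)"
      proof -
        have "0 \<le> (\<integral>x. (\<bar>A w x\<bar> - (\<integral>y. \<bar>A w y\<bar> \<partial>M))\<^sup>2 \<partial>M)" by simp
        also have "\<dots> = (\<integral>x. \<bar>A w x\<bar>\<^sup>2 \<partial>M) - (\<integral>x. \<bar>A w x\<bar> \<partial>M)\<^sup>2"
          using i elim(1) by (subst variance_eq) auto
        finally show ?thesis by simp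
      qed
      finally show ?case by (simp add: mult_left_mono)
    qed
    show "integrable M (\<lambda>w. \<integral>p. norm (?T (w, p)) \<partial>(M \<Otimes>\<^sub>M M))"
    proof (rule Bochner_Integration.integrable_bound[OF integrable_mult_right[OF sqi, of "B\<^sup>2"]])
      show "(\<lambda>w. \<integral>p. norm (?T (w, p)) \<partial>(M \<Otimes>\<^sub>M M)) \<in> borel_measurable M" by measurable
      show "AE w in M. norm (\<integral>p. norm (?T (w, p)) \<partial>(M \<Otimes>\<^sub>M M)) \<le> norm (B\<^sup>2 * (\<integral>x. (A w x)\<^sup>2 \<partial>M))"
        using le by eventually_elim simp
    qed
  qed
  have sq: "AE w in M. (\<integral>p. ?T (w, p) \<partial>(M \<Otimes>\<^sub>M M)) = (\<integral>x. b x * A w x \<partial>M)\<^sup>2"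
    using T.AE_integrable_fst'[OF Tint]
  proof eventually_elim
    case (elim w)
    then show ?case
      by (subst P.integral_fst'[symmetric]) (simp_all add: power2_eq_square)
  qed
  have m1 [measurable]: "(\<lambda>w. (\<integral>x. b x * A w x \<partial>M)\<^sup>2) \<in> borel_measurable M" by measurable
  have int1: "integrable M (\<lambda>w. (\<integral>x. b x * A w x \<partial>M)\<^sup>2)"
    using T.integrable_fst'[OF Tint] by (rule integrable_cong_AE_imp) (use sq in auto)
  have "(\<integral>w. (\<integral>x. b x * A w x \<partial>M)\<^sup>2 \<partial>M) = (\<integral>w. (\<integral>p. ?T (w, p) \<partial>(M \<Otimes>\<^sub>M M)) \<partial>M)"
    using sq by (intro integral_cong_AE) auto
  also have "\<dots> = (\<integral>p. (\<integral>w. ?T (w, p) \<partial>M) \<partial>(M \<Otimes>\<^sub>M M))"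
    using T.Fubini_integral[of "\<lambda>w p. ?T (w, p)"] Tint by simp
  also have "\<dots> = (\<integral>p. (case p of (x, y) \<Rightarrow> b x * b y * G x y) \<partial>(M \<Otimes>\<^sub>M M))"
  proof (rule Bochner_Integration.integral_cong[OF refl], clarsimp)
    fix x y
    have "(\<integral>w. b x * A w x * (b y * A w y) \<partial>M) = (\<integral>w. (b x * b y) * (A w x * A w y) \<partial>M)"
      by (simp add: ac_simps)
    also have "\<dots> = b x * b y * G x y" using comp[of x y] by (simp add: has_bochner_integral_iff)
    finally show "(\<integral>w. b x * A w x * (b y * A w y) \<partial>M) = b x * b y * G x y" .
  qed
  also have "\<dots> = (\<integral>y. (\<integral>x. b x * b y * G x y \<partial>M) \<partial>M)"
  proof -
    have "integrable (M \<Otimes>\<^sub>M M) (\<lambda>p. \<integral>w. ?T (w, p) \<partial>M)"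
      using T.integrable_snd[of "\<lambda>w p. ?T (w, p)"] Tint by simp
    moreover have "(\<integral>w. ?T (w, (x, y)) \<partial>M) = b x * b y * G x y" for x y
    proof -
      have "(\<integral>w. b x * A w x * (b y * A w y) \<partial>M) = (\<integral>w. (b x * b y) * (A w x * A w y) \<partial>M)"
        by (simp add: ac_simps)
      also have "\<dots> = b x * b y * G x y" using comp[of x y] by (simp add: has_bochner_integral_iff)
      finally show ?thesis by simp
    qed
    ultimately have "integrable (M \<Otimes>\<^sub>M M) (\<lambda>(x, y). b x * b y * G x y)"
      by (simp add: case_prod_beta')
    from P.integral_snd[OF this] show ?thesis by simp
  qed
  also have "\<dots> = (\<integral>y. b y * (\<integral>x. b x * G x y \<partial>M) \<partial>M)"
  proof (rule Bochner_Integration.integral_cong[OF refl])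
    fix y
    have "(\<integral>x. b x * b y * G x y \<partial>M) = (\<integral>x. b y * (b x * G x y) \<partial>M)" by (simp add: ac_simps)
    then show "(\<integral>x. b x * b y * G x y \<partial>M) = b y * (\<integral>x. b x * G x y \<partial>M)" by simp
  qed
  finally show ?thesis1 using int1 by (simp add: has_bochner_integral_iff)
  have "(\<integral>w. (\<integral>x. b x * A w x \<partial>M)\<^sup>2 \<partial>M) \<le> (\<integral>w. B\<^sup>2 * (\<integral>x. (A w x)\<^sup>2 \<partial>M) \<partial>M)"
  proof (rule integral_mono_AE[OF int1])
    show "integrable M (\<lambda>w. B\<^sup>2 * (\<integral>x. (A w x)\<^sup>2 \<partial>M))" using P.integrable_fst[OF hs] by simp
    show "AE w in M. (\<integral>x. b x * A w x \<partial>M)\<^sup>2 \<le> B\<^sup>2 * (\<integral>x. (A w x)\<^sup>2 \<partial>M)"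
      using AEA AE_space
    proof eventually_elim
      case (elim w)
      note i = bA[OF elim] A1[OF elim] integrable_abs[OF bA[OF elim], unfolded abs_mult]
      have "\<bar>\<integral>x. b x * A w x \<partial>M\<bar> \<le> (\<integral>x. \<bar>b x * A w x\<bar> \<partial>M)" by (rule integral_abs_bound)
      also have "\<dots> \<le> (\<integral>x. B * \<bar>A w x\<bar> \<partial>M)"
        using i bB by (intro integral_mono) (auto simp: abs_mult intro!: mult_right_mono)
      finally have "\<bar>\<integral>x. b x * A w x \<partial>M\<bar>\<^sup>2 \<le> (\<integral>x. B * \<bar>A w x\<bar> \<partial>M)\<^sup>2" by (intro power_mono) auto
      also have "\<dots> = B\<^sup>2 * (\<integral>x. \<bar>A w x\<bar> \<partial>M)\<^sup>2" by (simp add: power_mult_distrib)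
      also have "(\<integral>x. \<bar>A w x\<bar> \<partial>M)\<^sup>2 \<le> (\<integral>x. \<bar>A w x\<bar>\<^sup>2 \<partial>M)"
      proof -
        have "0 \<le> (\<integral>x. (\<bar>A w x\<bar> - (\<integral>y. \<bar>A w y\<bar> \<partial>M))\<^sup>2 \<partial>M)" by simp
        also have "\<dots> = (\<integral>x. \<bar>A w x\<bar>\<^sup>2 \<partial>M) - (\<integral>x. \<bar>A w x\<bar> \<partial>M)\<^sup>2"
          using i elim(1) by (subst variance_eq) auto
        finally show ?thesis by simp
      qed
      finally show ?case by (simp add: mult_left_mono)
    qed
  qed
  also have "\<dots> = B\<^sup>2 * (\<integral>x. G x x \<partial>M)"
    using hsI P.integral_fst[OF hs] by simp
  finally show ?thesis2 .
qed

section \<open>Gauss space over a finite index set, and the part of the Mehler kernel in degrees at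
  least two\<close>

interpretation cgauss_prod: product_sigma_finite "\<lambda>_. cgauss"
  by (simp add: product_sigma_finite_def prob_space_imp_sigma_finite prob_space_cgauss)

abbreviation gspace :: "'i set \<Rightarrow> ('i \<Rightarrow> complex) measure" where
  "gspace I \<equiv> PiM I (\<lambda>_. cgauss)"

lemma measurable_gspace_component [measurable (raw)]:
  assumes "f \<in> measurable M (gspace I)" "i \<in> I"
  shows "(\<lambda>w. f w i) \<in> borel_measurable M"
  using measurable_compose[OF assms(1) measurable_component_singleton[OF assms(2)]]
  by (simp cong: measurable_cong_sets)

lemma prob_space_gspace: "prob_space (gspace I)"
  by (rule prob_space_PiM) (rule prob_space_cgauss)

lemma hbi_gspace_prod:
  fixes f :: "'i \<Rightarrow> complex \<Rightarrow> real"
  assumes "finite I" "\<And>i. i \<in> I \<Longrightarrow> has_bochner_integral cgauss (f i) (a i)"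
  shows "has_bochner_integral (gspace I) (\<lambda>w. \<Prod>i\<in>I. f i (w i)) (\<Prod>i\<in>I. a i)"
  using assms unfolding has_bochner_integral_iff
  by (simp add: cgauss_prod.product_integrable_prod cgauss_prod.product_integral_prod)

lemma hbi_cgauss_const: "has_bochner_integral cgauss (\<lambda>_. c :: real) c"
  using cgauss.prob_space by (simp add: has_bochner_integral_iff)

lemma hbi_gspace_const: "has_bochner_integral (gspace I) (\<lambda>_. c :: real) c"
proof -
  interpret prob_space "gspace I" by (rule prob_space_gspace)
  show ?thesis by (simp add: has_bochner_integral_iff prob_space)
qed

lemma hbi_gspace_single:
  fixes f :: "complex \<Rightarrow> real"
  assumes I: "finite I" "i \<in> I" and f: "has_bochner_integral cgauss f a"
  shows "has_bochner_integral (gspace I) (\<lambda>w. f (w i)) a"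
proof -
  have "has_bochner_integral (gspace I) (\<lambda>w. \<Prod>j\<in>I. (if j = i then f else (\<lambda>_. 1)) (w j)) (\<Prod>j\<in>I. if j = i then a else 1)"
    using f by (intro hbi_gspace_prod I) (auto simp: hbi_cgauss_const)
  moreover have "(\<Prod>j\<in>I. (if j = i then f else (\<lambda>_. 1)) (w j)) = f (w i)" for w
    using I by (subst prod.remove[of _ i]) (auto intro!: prod.neutral)
  ultimately show ?thesis using I by (simp add: prod.delta)
qed

lemma hbi_gspace_pair:
  fixes f g :: "complex \<Rightarrow> real"
  assumes I: "finite I" "i \<in> I" "j \<in> I" "i \<noteq> j"
    and f: "has_bochner_integral cgauss f a" and g: "has_bochner_integral cgauss g b"
  shows "has_bochner_integral (gspace I) (\<lambda>w. f (w i) * g (w j)) (a * b)"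
proof -
  let ?f = "\<lambda>k. if k = i then f else if k = j then g else (\<lambda>_. 1)"
  let ?a = "\<lambda>k. if k = i then a else if k = j then b else 1"
  have "has_bochner_integral (gspace I) (\<lambda>w. \<Prod>k\<in>I. ?f k (w k)) (\<Prod>k\<in>I. ?a k)"
    using f g by (intro hbi_gspace_prod I) (auto simp: hbi_cgauss_const)
  moreover have "(\<Prod>k\<in>I. ?f k (w k)) = f (w i) * g (w j)" for w
  proof -
    have "(\<Prod>k\<in>I. ?f k (w k)) = f (w i) * (\<Prod>k\<in>I - {i}. ?f k (w k))"
      using I by (subst prod.remove[of _ i]) auto
    also have "(\<Prod>k\<in>I - {i}. ?f k (w k)) = g (w j)"
      using I by (subst prod.remove[of _ j]) (auto intro!: prod.neutral)
    finally show ?thesis .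
  qed
  moreover have "(\<Prod>k\<in>I. ?a k) = a * b"
  proof -
    have "(\<Prod>k\<in>I. ?a k) = a * (\<Prod>k\<in>I - {i}. ?a k)"
      using I by (subst prod.remove[of _ i]) auto
    also have "(\<Prod>k\<in>I - {i}. ?a k) = b"
      using I by (subst prod.remove[of _ j]) (auto intro!: prod.neutral)
    finally show ?thesis .
  qed
  ultimately show ?thesis by simp
qed

text \<open>The factor \<open>sqrt 2\<close> makes these real coordinates orthonormal in
  \<open>L_2\<close> of Gauss space; the flag \<open>True\<close> selects the real part.\<close>

definition ucoord :: "'i \<times> bool \<Rightarrow> ('i \<Rightarrow> complex) \<Rightarrow> real" where
  "ucoord p w = sqrt 2 * (if snd p then Re (w (fst p)) else Im (w (fst p)))"

definition mehler :: "'i set \<Rightarrow> real \<Rightarrow> ('i \<Rightarrow> complex) \<Rightarrow> ('i \<Rightarrow> complex) \<Rightarrow> real" where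
  "mehler I r w z = (\<Prod>i\<in>I. mehler1 r (w i) (z i))"

text \<open>Reproducing kernel of the real first chaos, the span of the functions
  \<open>ucoord p\<close>; see \<open>pairing_ucoord\<close>.\<close>

definition pairing :: "'i set \<Rightarrow> ('i \<Rightarrow> complex) \<Rightarrow> ('i \<Rightarrow> complex) \<Rightarrow> real" where
  "pairing I w z = 2 * (\<Sum>i\<in>I. Re (cnj (w i) * z i))"

text \<open>Kernel of the Mehler operator restricted to degrees at least two: the constants
  contribute 1 and the first chaos contributes \<open>r * pairing I w z\<close>.\<close>

definition mehler_rem :: "'i set \<Rightarrow> real \<Rightarrow> ('i \<Rightarrow> complex) \<Rightarrow> ('i \<Rightarrow> complex) \<Rightarrow> real" where
  "mehler_rem I r w z = mehler I r w z - 1 - r * pairing I w z"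

lemma pairing_ucoord: "pairing I w z = (\<Sum>p\<in>I \<times> UNIV. ucoord p w * ucoord p z)"
proof -
  have "(\<Sum>p\<in>I \<times> UNIV. ucoord p w * ucoord p z) = (\<Sum>i\<in>I. \<Sum>b\<in>UNIV. ucoord (i, b) w * ucoord (i, b) z)"
    by (simp add: sum.cartesian_product)
  also have "\<dots> = pairing I w z"
    unfolding pairing_def sum_distrib_left
    by (intro sum.cong refl) (simp add: UNIV_bool ucoord_def algebra_simps)
  finally show ?thesis by simp
qed

lemma pairing_commute: "pairing I w z = pairing I z w"
  by (simp add: pairing_ucoord mult.commute)

lemma measurable_pairing [measurable]: "case_prod (pairing I) \<in> borel_measurable (gspace I \<Otimes>\<^sub>M gspace I)"
  unfolding pairing_def by simp

lemma measurable_mehler [measurable]: "case_prod (mehler I r) \<in> borel_measurable (gspace I \<Otimes>\<^sub>M gspace I)"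
  unfolding mehler_def by measurable

lemma measurable_mehler_rem [measurable]: "case_prod (mehler_rem I r) \<in> borel_measurable (gspace I \<Otimes>\<^sub>M gspace I)"
  unfolding mehler_rem_def by measurable

lemma mehler_commute: "mehler I r w z = mehler I r z w"
  unfolding mehler_def by (intro prod.cong refl mehler1_commute)

lemma mehler_nonneg: "0 \<le> r \<Longrightarrow> r < 1 \<Longrightarrow> 0 \<le> mehler I r w z"
  unfolding mehler_def by (intro prod_nonneg ballI mehler1_nonneg)

lemma hbi_cgauss_ucoord:
  "has_bochner_integral cgauss (\<lambda>z. sqrt 2 * (if b then Re z else Im z)) 0"
  using has_bochner_integral_mult_right[OF cgauss_moments(1), of "sqrt 2"]
    has_bochner_integral_mult_right[OF cgauss_moments(2), of "sqrt 2"] by (cases b) simp_all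

lemma hbi_ucoord:
  assumes "finite I" "p \<in> I \<times> UNIV"
  shows "has_bochner_integral (gspace I) (ucoord p) 0"
  unfolding ucoord_def using assms by (intro hbi_gspace_single hbi_cgauss_ucoord) auto

lemma hbi_ucoord_ucoord:
  assumes "finite I" "p \<in> I \<times> UNIV" "q \<in> I \<times> UNIV"
  shows "has_bochner_integral (gspace I) (\<lambda>w. ucoord p w * ucoord q w) (if p = q then 1 else 0)"
proof (cases "fst p = fst q")
  case False
  have "has_bochner_integral (gspace I) (\<lambda>w. ucoord p w * ucoord q w) (0 * 0)"
    unfolding ucoord_def using assms False by (intro hbi_gspace_pair hbi_cgauss_ucoord) auto
  then show ?thesis using False by auto
next
  case True
  let ?f = "\<lambda>z. (sqrt 2 * (if snd p then Re z else Im z)) * (sqrt 2 * (if snd q then Re z else Im z))"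
  have eq: "?f = (\<lambda>z. 2 * (if snd p then if snd q then Re z * Re z else Re z * Im z else if snd q then Re z * Im z else Im z * Im z))"
    by (auto simp: fun_eq_iff)
  have "has_bochner_integral cgauss ?f (2 * (if snd p then if snd q then 1/2 else 0 else if snd q then 0 else 1/2))"
    unfolding eq by (intro has_bochner_integral_mult_right) (auto intro: cgauss_moments)
  then have "has_bochner_integral cgauss ?f (if p = q then 1 else 0)"
    using True by (cases p; cases q) (auto split: if_splits)
  then have "has_bochner_integral (gspace I) (\<lambda>w. ?f (w (fst p))) (if p = q then 1 else 0)"
    using assms by (intro hbi_gspace_single) auto
  then show ?thesis by (simp only: ucoord_def True)
qed

lemma hbi_mehler:
  assumes "finite I" "0 \<le> r" "r < 1"
  shows "has_bochner_integral (gspace I) (\<lambda>w. mehler I r w z) 1"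
proof -
  have "has_bochner_integral (gspace I) (\<lambda>w. \<Prod>i\<in>I. mehler1 r (w i) (z i)) (\<Prod>i\<in>I. 1)"
    using mehler1_integral[OF assms(2,3)] by (intro hbi_gspace_prod assms) (simp add: mehler1_commute[of r _ "z _"])
  then show ?thesis by (simp add: mehler_def)
qed

lemma hbi_mehler_mehler:
  assumes "finite I" "0 \<le> r" "r < 1"
  shows "has_bochner_integral (gspace I) (\<lambda>w. mehler I r w x * mehler I r w z) (mehler I (r\<^sup>2) x z)"
proof -
  have "has_bochner_integral (gspace I) (\<lambda>w. \<Prod>i\<in>I. mehler1 r (x i) (w i) * mehler1 r (w i) (z i)) (\<Prod>i\<in>I. mehler1 (r * r) (x i) (z i))"
    using mehler1_compose[OF assms(2,3,2,3)] by (intro hbi_gspace_prod assms)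
  then show ?thesis by (simp add: mehler_def prod.distrib power2_eq_square mehler1_commute[of r "x _"])
qed

lemma hbi_mehler_ucoord:
  assumes I: "finite I" "p \<in> I \<times> UNIV" and r: "0 \<le> r" "r < 1"
  shows "has_bochner_integral (gspace I) (\<lambda>w. mehler I r w z * ucoord p w) (r * ucoord p z)"
proof -
  define i where "i = fst p"
  define h where "h = (\<lambda>y. sqrt 2 * (if snd p then Re y else Im y))"
  have i: "i \<in> I" using I by (auto simp: i_def)
  have h: "bounded_linear h" unfolding h_def
    by (cases "snd p") (auto intro: bounded_linear_const_mult bounded_linear_Re bounded_linear_Im)
  let ?f = "\<lambda>j y. mehler1 r (z j) y * (if j = i then h y else 1)"
  let ?a = "\<lambda>j. if j = i then r * h (z j) else 1"
  have "has_bochner_integral cgauss (?f j) (?a j)" for j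
    using mehler1_linear[OF r h, of "z j"] hbi_cgauss_ucoord[of "snd p"] mehler1_integral[OF r, of "z j"]
    by (auto simp: h_def)
  then have "has_bochner_integral (gspace I) (\<lambda>w. \<Prod>j\<in>I. ?f j (w j)) (\<Prod>j\<in>I. ?a j)"
    by (intro hbi_gspace_prod I)
  moreover have "(\<Prod>j\<in>I. ?f j (w j)) = mehler I r w z * ucoord p w" for w
    using I(1) i by (simp add: prod.distrib mehler_def mehler1_commute[of r "z _"] prod.delta ucoord_def h_def i_def)
  moreover have "(\<Prod>j\<in>I. ?a j) = r * ucoord p z"
    using I(1) i by (simp add: prod.delta ucoord_def h_def i_def)
  ultimately show ?thesis by simp
qed

lemma hbi_mehler_pairing:
  assumes "finite I" "0 \<le> r" "r < 1"
  shows "has_bochner_integral (gspace I) (\<lambda>w. mehler I r w x * pairing I w z) (r * pairing I x z)"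
proof -
  have "has_bochner_integral (gspace I) (\<lambda>w. \<Sum>p\<in>I \<times> UNIV. (mehler I r w x * ucoord p w) * ucoord p z)
     (\<Sum>p\<in>I \<times> UNIV. (r * ucoord p x) * ucoord p z)"
    using assms by (intro has_bochner_integral_sum has_bochner_integral_mult_left hbi_mehler_ucoord)
  then show ?thesis by (simp add: pairing_ucoord sum_distrib_left mult.assoc)
qed

lemma hbi_pairing:
  assumes "finite I"
  shows "has_bochner_integral (gspace I) (\<lambda>w. pairing I w z) 0"
proof -
  have "has_bochner_integral (gspace I) (\<lambda>w. \<Sum>p\<in>I \<times> UNIV. ucoord p w * ucoord p z) (\<Sum>p\<in>I \<times> UNIV. 0 * ucoord p z)"
    using assms by (intro has_bochner_integral_sum has_bochner_integral_mult_left hbi_ucoord)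
  then show ?thesis by (simp add: pairing_ucoord)
qed

lemma hbi_pairing_pairing:
  assumes I: "finite I"
  shows "has_bochner_integral (gspace I) (\<lambda>w. pairing I w x * pairing I w z) (pairing I x z)"
proof -
  have "has_bochner_integral (gspace I) (\<lambda>w. \<Sum>p\<in>I \<times> UNIV. \<Sum>q\<in>I \<times> UNIV. (ucoord p w * ucoord q w) * (ucoord p x * ucoord q z))
      (\<Sum>p\<in>I \<times> UNIV. \<Sum>q\<in>I \<times> UNIV. (if p = q then 1 else 0) * (ucoord p x * ucoord q z))"
    using assms by (intro has_bochner_integral_sum has_bochner_integral_mult_left hbi_ucoord_ucoord)
  moreover have "(\<Sum>p\<in>I \<times> UNIV. \<Sum>q\<in>I \<times> UNIV. (ucoord p w * ucoord q w) * (ucoord p x * ucoord q z)) = pairing I w x * pairing I w z" for w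
    unfolding pairing_ucoord sum_product by (simp add: ac_simps)
  moreover have "(\<Sum>p\<in>I \<times> UNIV. \<Sum>q\<in>I \<times> UNIV. (if p = q then 1 else 0) * (ucoord p x * ucoord q z)) = pairing I x z"
  proof -
    have "(\<Sum>p\<in>I \<times> UNIV. \<Sum>q\<in>I \<times> UNIV. (if p = q then 1 else 0) * (ucoord p x * ucoord q z)) =
       (\<Sum>p\<in>I \<times> UNIV. \<Sum>q\<in>I \<times> UNIV. if p = q then ucoord p x * ucoord q z else 0)"
      by (intro sum.cong refl) simp
    also have "\<dots> = pairing I x z" using I by (simp add: sum.delta pairing_ucoord)
    finally show ?thesis .
  qed
  ultimately show ?thesis by simp
qed

text \<open>Constants and first chaos are eigenspaces, so the remainder inherits the semigroup law.
  In the expanded product every cross term is given by one of the preceding integrals, and what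
  survives is the remainder for \<open>r^2\<close>.\<close>

lemma hbi_mehler_rem:
  assumes I: "finite I" and r: "0 \<le> r" "r < 1"
  shows "has_bochner_integral (gspace I) (\<lambda>w. mehler_rem I r w x * mehler_rem I r w z) (mehler_rem I (r\<^sup>2) x z)"
proof -
  let ?M = "\<lambda>x w. mehler I r w x" and ?l = "\<lambda>x w. pairing I w x"
  have 1: "has_bochner_integral (gspace I) (\<lambda>w. (?M x w * ?M z w - ?M x w - r * (?M x w * ?l z w)) - (?M z w - 1 - r * ?l z w)
     - (r * (?M z w * ?l x w) - r * ?l x w - r * r * (?l x w * ?l z w)))
     ((mehler I (r\<^sup>2) x z - 1 - r * (r * pairing I x z)) - (1 - 1 - r * 0)
     - (r * (r * pairing I z x) - r * 0 - r * r * pairing I x z))"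
    by (intro has_bochner_integral_diff has_bochner_integral_mult_right hbi_mehler_mehler hbi_mehler
      hbi_mehler_pairing hbi_pairing hbi_pairing_pairing hbi_gspace_const assms)
  have 2: "(mehler I (r\<^sup>2) x z - 1 - r * (r * pairing I x z)) - (1 - 1 - r * 0)
     - (r * (r * pairing I z x) - r * 0 - r * r * pairing I x z) = mehler_rem I (r\<^sup>2) x z"
    by (simp add: mehler_rem_def pairing_commute[of I z x] power2_eq_square)
  have 3: "(?M x w * ?M z w - ?M x w - r * (?M x w * ?l z w)) - (?M z w - 1 - r * ?l z w)
     - (r * (?M z w * ?l x w) - r * ?l x w - r * r * (?l x w * ?l z w)) = mehler_rem I r w x * mehler_rem I r w z" for w
    unfolding mehler_rem_def by (simp add: algebra_simps)
  show ?thesis using 1 unfolding 2 3 .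
qed

text \<open>Trace of the remainder. The \<open>2 * card I\<close> real coordinates account exactly
  for the linear term of the expansion in \<open>r\<close>, so the trace is \<open>O(r^2)\<close> by
  the next lemma.\<close>

lemma hbi_mehler_rem_diag:
  assumes I: "finite I" and r: "0 \<le> r" "r < 1"
  shows "has_bochner_integral (gspace I) (\<lambda>w. mehler_rem I r w w) (1 / (1 - r) ^ (2 * card I) - 1 - 2 * real (card I) * r)"
proof -
  have "has_bochner_integral (gspace I) (\<lambda>w. \<Prod>i\<in>I. mehler1 r (w i) (w i)) (\<Prod>i\<in>I. 1 / (1 - r)\<^sup>2)"
    by (intro hbi_gspace_prod I mehler1_diag r)
  moreover have "has_bochner_integral (gspace I) (\<lambda>w. pairing I w w) (\<Sum>p\<in>I \<times> (UNIV :: bool set). if p = p then 1 else 0)"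
    unfolding pairing_ucoord using I by (intro has_bochner_integral_sum hbi_ucoord_ucoord) auto
  ultimately have "has_bochner_integral (gspace I) (\<lambda>w. (\<Prod>i\<in>I. mehler1 r (w i) (w i)) - 1 - r * pairing I w w)
    ((\<Prod>i\<in>I. 1 / (1 - r)\<^sup>2) - 1 - r * (\<Sum>p\<in>I \<times> (UNIV :: bool set). if p = p then 1 else 0))"
    by (intro has_bochner_integral_diff has_bochner_integral_mult_right hbi_gspace_const)
  then show ?thesis
    by (simp add: mehler_rem_def mehler_def power_divide card_cartesian_product mult_ac flip: power_mult)
qed

text \<open>The constant grows with \<open>n\<close>, that is with the number of Gaussian variables.
  This is harmless, since \<open>self_improve\<close> removes it.\<close>

lemma inverse_power_quadratic:
  "\<exists>K. \<forall>s. 0 \<le> s \<and> s \<le> 1 / 2 \<longrightarrow> 1 / (1 - s) ^ n - 1 - real n * s \<le> K * s\<^sup>2"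
proof (induction n)
  case 0
  show ?case by (rule exI[of _ 0]) simp
next
  case (Suc n)
  then obtain K where K: "\<And>s. 0 \<le> s \<Longrightarrow> s \<le> 1 / 2 \<Longrightarrow> 1 / (1 - s) ^ n - 1 - real n * s \<le> K * s\<^sup>2" by blast
  define L where "L = \<bar>K\<bar>"
  have K': "1 / (1 - s) ^ n \<le> 1 + real n * s + L * s\<^sup>2" if "0 \<le> s" "s \<le> 1 / 2" for s
    using K[OF that] mult_right_mono[OF abs_ge_self[of K] zero_le_power2[of s]] unfolding L_def by linarith
  show ?case
  proof (intro exI[of _ "real n + L + 2 + 2 * real n + 2 * L"] allI impI)
    fix s :: real assume s: "0 \<le> s \<and> s \<le> 1 / 2"
    have L0: "L \<ge> 0" by (simp add: L_def)
    \<comment> \<open>The constant 2 works because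
      \<open>(1 + s + 2 * s^2) * (1 - s) = 1 + s^2 * (1 - 2 * s)\<close> is at least 1 for
      \<open>s\<close> up to 1/2.\<close>
    have "1 / (1 - s) \<le> 1 + s + 2 * s\<^sup>2"
    proof -
      have "(1 + s + 2 * s\<^sup>2) * (1 - s) = 1 + s\<^sup>2 * (1 - 2 * s)" by (simp add: power2_eq_square algebra_simps)
      also have "\<dots> \<ge> 1" using s by simp
      finally show ?thesis using s by (simp add: field_simps)
    qed
    then have "1 / (1 - s) ^ Suc n \<le> (1 + real n * s + L * s\<^sup>2) * (1 + s + 2 * s\<^sup>2)"
      using K'[of s] s L0 mult_mono[of "1 / (1 - s) ^ n" "1 + real n * s + L * s\<^sup>2" "1 / (1 - s)" "1 + s + 2 * s\<^sup>2"]
      by (simp add: mult_ac)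
    also have "\<dots> = 1 + (real n + 1) * s + (real n + 2 + L) * s\<^sup>2 + (2 * real n + L) * (s * s\<^sup>2) + 2 * L * (s\<^sup>2 * s\<^sup>2)"
      by (simp add: power2_eq_square algebra_simps)
    also have "\<dots> \<le> 1 + (real n + 1) * s + (real n + 2 + L) * s\<^sup>2 + (2 * real n + L) * s\<^sup>2 + L * s\<^sup>2"
    proof -
      have "s * s\<^sup>2 \<le> 1 * s\<^sup>2" using s by (intro mult_right_mono) auto
      moreover have "s\<^sup>2 * s\<^sup>2 \<le> 1 / 2 * s\<^sup>2"
        using s power_mono[of s "1/2" 2] by (intro mult_right_mono) (auto simp: power2_eq_square)
      then have "2 * L * (s\<^sup>2 * s\<^sup>2) \<le> 2 * L * (1 / 2 * s\<^sup>2)" using L0 by (intro mult_left_mono) auto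
      ultimately show ?thesis using L0 mult_left_mono[of "s * s\<^sup>2" "1 * s\<^sup>2" "2 * real n + L"] by simp
    qed
    finally show "1 / (1 - s) ^ Suc n - 1 - real (Suc n) * s \<le> (real n + L + 2 + 2 * real n + 2 * L) * s\<^sup>2"
      by (simp add: algebra_simps)
  qed
qed

section \<open>Unitary changes of variables and the dimension-free contraction\<close>

lemma borel_measurable_cnj [measurable (raw)]:
  assumes "f \<in> borel_measurable M"
  shows "(\<lambda>x. cnj (f x)) \<in> borel_measurable M"
  by (rule measurable_compose[OF assms borel_measurable_continuous_onI]) (intro continuous_intros)

definition unitary_on :: "'i set \<Rightarrow> ('i \<Rightarrow> 'i \<Rightarrow> complex) \<Rightarrow> bool" where
  "unitary_on I U \<longleftrightarrow>
     (\<forall>i\<in>I. \<forall>j\<in>I. (\<Sum>k\<in>I. U i k * cnj (U j k)) = (if i = j then 1 else 0)) \<and>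
     (\<forall>i\<in>I. \<forall>j\<in>I. (\<Sum>k\<in>I. U k i * cnj (U k j)) = (if i = j then 1 else 0))"

text \<open>The conjugate makes \<open>cnj (rot I U c w i) * x i\<close> bilinear in
  \<open>w\<close> and \<open>x\<close>. The part of the first chaos that is linear in
  \<open>c\<close> then pairs the coefficients \<open>gcoef\<close> of both functions without
  conjugates.\<close>

definition rot :: "'i set \<Rightarrow> ('i \<Rightarrow> 'i \<Rightarrow> complex) \<Rightarrow> complex \<Rightarrow> ('i \<Rightarrow> complex) \<Rightarrow> 'i \<Rightarrow> complex" where
  "rot I U c w = (\<lambda>i\<in>I. cnj (c * (\<Sum>j\<in>I. U i j * w j)))"

lemma rot_in_space [simp]: "rot I U c w \<in> space (gspace I)"
  by (simp add: rot_def space_PiM)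

lemma measurable_rot [measurable]: "rot I U c \<in> measurable (gspace I) (gspace I)"
proof -
  have "(\<lambda>w. cnj (c * (\<Sum>j\<in>I. U i j * w j))) \<in> borel_measurable (gspace I)" for i
    by measurable
  then have "(\<lambda>w. \<lambda>i\<in>I. cnj (c * (\<Sum>j\<in>I. U i j * w j))) \<in> measurable (gspace I) (gspace I)"
    by (intro measurable_restrict) (simp cong: measurable_cong_sets)
  then show ?thesis unfolding rot_def[abs_def] .
qed

text \<open>Because of the conjugation, the adjoint for the real inner product carries the transpose
  of \<open>U\<close> and the same phase \<open>c\<close>.\<close>

lemma rot_adjoint: "finite I \<Longrightarrow> pairing I (rot I U c w) z = pairing I w (rot I (\<lambda>i j. U j i) c z)"
proof -
  assume "finite I"
  have "(\<Sum>i\<in>I. Re (cnj (rot I U c w i) * z i)) = Re (\<Sum>i\<in>I. \<Sum>j\<in>I. c * U i j * w j * z i)"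
    by (simp add: rot_def sum_distrib_left sum_distrib_right mult.assoc)
  also have "\<dots> = Re (\<Sum>j\<in>I. \<Sum>i\<in>I. c * U i j * w j * z i)"
    by (subst sum.swap) simp
  also have "\<dots> = (\<Sum>j\<in>I. Re (w j * cnj (rot I (\<lambda>i j. U j i) c z j)))"
    by (simp add: rot_def sum_distrib_left sum_distrib_right mult_ac)
  also have "\<dots> = (\<Sum>j\<in>I. Re (cnj (w j) * rot I (\<lambda>i j. U j i) c z j))"
    by (intro sum.cong refl) simp
  finally show ?thesis by (simp add: pairing_def)
qed

lemma unitary_on_transpose: "unitary_on I U \<Longrightarrow> unitary_on I (\<lambda>i j. U j i)"
  by (auto simp: unitary_on_def)

lemma rot_isometry:
  assumes I: "finite I" and U: "unitary_on I U" and c: "cmod c = 1"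
  shows "pairing I (rot I U c w) (rot I U c z) = pairing I w z"
proof -
  have cc: "c * cnj c = 1" using c by (simp add: complex_norm_square[symmetric])
  have "(\<Sum>i\<in>I. Re (cnj (rot I U c w i) * rot I U c z i)) = Re (\<Sum>i\<in>I. \<Sum>j\<in>I. \<Sum>k\<in>I. (c * cnj c) * (U i j * cnj (U i k)) * (w j * cnj (z k)))"
  proof -
    have "cnj (rot I U c w i) * rot I U c z i = (\<Sum>j\<in>I. \<Sum>k\<in>I. (c * cnj c) * (U i j * cnj (U i k)) * (w j * cnj (z k)))" if "i \<in> I" for i
    proof -
      have "cnj (rot I U c w i) * rot I U c z i = (c * cnj c) * ((\<Sum>j\<in>I. U i j * w j) * (\<Sum>k\<in>I. cnj (U i k) * cnj (z k)))"
        using that by (simp add: rot_def)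
      also have "\<dots> = (\<Sum>j\<in>I. \<Sum>k\<in>I. (c * cnj c) * (U i j * cnj (U i k)) * (w j * cnj (z k)))"
        unfolding sum_product unfolding sum_distrib_left by (intro sum.cong refl) simp
      finally show ?thesis .
    qed
    then show ?thesis unfolding Re_sum[symmetric] by (intro arg_cong[where f=Re] sum.cong refl)
  qed
  also have "(\<Sum>i\<in>I. \<Sum>j\<in>I. \<Sum>k\<in>I. (c * cnj c) * (U i j * cnj (U i k)) * (w j * cnj (z k))) =
     (\<Sum>j\<in>I. \<Sum>k\<in>I. (\<Sum>i\<in>I. U i j * cnj (U i k)) * (w j * cnj (z k)))"
    unfolding cc sum_distrib_right mult_1
    by (rule trans[OF sum.swap]) (intro sum.cong refl sum.swap)
  also have "\<dots> = (\<Sum>j\<in>I. \<Sum>k\<in>I. if j = k then w j * cnj (z k) else 0)"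
    using U by (intro sum.cong refl) (auto simp: unitary_on_def)
  also have "\<dots> = (\<Sum>j\<in>I. w j * cnj (z j))" using I by (simp add: sum.delta)
  also have "Re \<dots> = (\<Sum>j\<in>I. Re (cnj (w j) * z j))" by simp
  finally show ?thesis by (simp add: pairing_def)
qed

text \<open>The kernel sees its two points only through the real inner product. This yields the
  compatibility with \<open>rot\<close>, which is a real-linear isometry.\<close>

lemma mehler_pairing:
  "mehler I r w z = exp ((2 * r * pairing I w z - r\<^sup>2 * pairing I w w - r\<^sup>2 * pairing I z z) / (2 * (1 - r\<^sup>2))) / (1 - r\<^sup>2) ^ card I"
proof (cases "finite I")
  case True
  have "mehler I r w z = exp (\<Sum>i\<in>I. (2 * r * Re (cnj (w i) * z i) - r\<^sup>2 * (cmod (w i))\<^sup>2 - r\<^sup>2 * (cmod (z i))\<^sup>2) / (1 - r\<^sup>2)) / (1 - r\<^sup>2) ^ card I"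
    unfolding mehler_def mehler1_def by (simp add: prod_dividef exp_sum True)
  moreover have "(\<Sum>i\<in>I. (2 * r * Re (cnj (w i) * z i) - r\<^sup>2 * (cmod (w i))\<^sup>2 - r\<^sup>2 * (cmod (z i))\<^sup>2) / (1 - r\<^sup>2)) =
     (2 * r * pairing I w z - r\<^sup>2 * pairing I w w - r\<^sup>2 * pairing I z z) / (2 * (1 - r\<^sup>2))"
  proof -
    have p: "pairing I w w = 2 * (\<Sum>i\<in>I. (cmod (w i))\<^sup>2)" for w
    proof -
      have "Re (cnj x * x) = (cmod x)\<^sup>2" for x unfolding cmod_power2 by (simp add: power2_eq_square)
      then show ?thesis by (simp only: pairing_def)
    qed
    have "(\<Sum>i\<in>I. (2 * r * Re (cnj (w i) * z i) - r\<^sup>2 * (cmod (w i))\<^sup>2 - r\<^sup>2 * (cmod (z i))\<^sup>2) / (1 - r\<^sup>2)) =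
      (2 * r * (\<Sum>i\<in>I. Re (cnj (w i) * z i)) - r\<^sup>2 * (\<Sum>i\<in>I. (cmod (w i))\<^sup>2) - r\<^sup>2 * (\<Sum>i\<in>I. (cmod (z i))\<^sup>2)) / (1 - r\<^sup>2)"
      by (simp only: sum_divide_distrib[symmetric] sum_subtractf sum_distrib_left[symmetric])
    also have "\<dots> = (2 * (2 * r * (\<Sum>i\<in>I. Re (cnj (w i) * z i)) - r\<^sup>2 * (\<Sum>i\<in>I. (cmod (w i))\<^sup>2) - r\<^sup>2 * (\<Sum>i\<in>I. (cmod (z i))\<^sup>2))) / (2 * (1 - r\<^sup>2))"
      by (rule mult_divide_mult_cancel_left[symmetric]) simp
    also have "\<dots> = (2 * r * pairing I w z - r\<^sup>2 * pairing I w w - r\<^sup>2 * pairing I z z) / (2 * (1 - r\<^sup>2))"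
      unfolding p unfolding pairing_def by (intro arg_cong2[where f="(/)"] refl) (simp add: algebra_simps del: times_complex.sel)
    finally show ?thesis .
  qed
  ultimately show ?thesis by simp
qed (simp add: mehler_def pairing_def)

lemma mehler_rot: 
  assumes "finite I" "unitary_on I U" "cmod c = 1"
  shows "mehler I r (rot I U c w) z = mehler I r w (rot I (\<lambda>i j. U j i) c z)"
  unfolding mehler_pairing
  unfolding rot_isometry[OF assms] rot_isometry[OF assms(1) unitary_on_transpose[OF assms(2)] assms(3)]
  unfolding rot_adjoint[OF assms(1)] by simp

lemma mehler_rem_rot:
  assumes "finite I" "unitary_on I U" "cmod c = 1"
  shows "mehler_rem I r (rot I U c w) z = mehler_rem I r w (rot I (\<lambda>i j. U j i) c z)"
  unfolding mehler_rem_def mehler_rot[OF assms] rot_adjoint[OF assms(1)] by simp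

lemma mehler_rem_rot_rot:
  assumes "finite I" "unitary_on I U" "cmod c = 1"
  shows "mehler_rem I r (rot I U c w) (rot I U c z) = mehler_rem I r w z"
  unfolding mehler_rem_def mehler_pairing rot_isometry[OF assms] by simp

lemma mehler_rem_commute: "mehler_rem I r w z = mehler_rem I r z w"
  unfolding mehler_rem_def by (simp add: mehler_commute[of I r w z] pairing_commute[of I w z])

lemma integrable_mehler_rem:
  assumes "finite I" "0 \<le> r" "r < 1"
  shows "integrable (gspace I) (mehler_rem I r w)"
proof -
  have "has_bochner_integral (gspace I) (\<lambda>z. mehler I r z w - 1 - r * pairing I z w) (1 - 1 - r * 0)"
    using assms by (intro has_bochner_integral_diff has_bochner_integral_mult_right hbi_mehler hbi_pairing hbi_gspace_const)
  then have "integrable (gspace I) (\<lambda>z. mehler_rem I r z w)"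
    by (simp add: has_bochner_integral_iff mehler_rem_def)
  then show ?thesis by (simp add: mehler_rem_commute[of I r _ w])
qed

text \<open>With \<open>F r\<close> the squared norm of the image of \<open>b\<close> under the
  remainder operator, the semigroup law gives \<open>F r\<close> as the quadratic form of the
  operator for \<open>r^2\<close>, and Cauchy-Schwarz yields
  \<open>F r <= sqrt \<beta> * sqrt (F (r^2))\<close>. The trace gives a crude \<open>O(r^4)\<close>
  with a constant that depends on \<open>I\<close>, and \<open>self_improve\<close> sharpens it to
  \<open>r^4\<close>.\<close>

lemma mehler_rem_contraction_real:
  fixes b :: "('i \<Rightarrow> complex) \<Rightarrow> real"
  assumes I: "finite I" and r: "0 \<le> r" "r < 1"
    and [measurable]: "b \<in> borel_measurable (gspace I)" and bB: "\<And>x. \<bar>b x\<bar> \<le> B"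
  shows "(\<integral>y. b y * (\<integral>x. b x * mehler_rem I (r\<^sup>2) x y \<partial>gspace I) \<partial>gspace I) \<le> r ^ 4 * (\<integral>x. (b x)\<^sup>2 \<partial>gspace I)"
proof -
  let ?G = "gspace I"
  interpret prob_space ?G by (rule prob_space_gspace)
  define E where "E r w = (\<integral>x. b x * mehler_rem I r w x \<partial>?G)" for r w
  define F where "F r = (\<integral>w. (E r w)\<^sup>2 \<partial>?G)" for r
  define \<beta> where "\<beta> = (\<integral>x. (b x)\<^sup>2 \<partial>?G)"
  have \<beta>0: "\<beta> \<ge> 0" by (simp add: \<beta>_def)
  have r2: "0 \<le> r\<^sup>2" "r\<^sup>2 < 1" if "0 \<le> r" "r < 1" for r :: real
    using that by (auto simp: power_less_one_iff)
  have b2: "integrable ?G (\<lambda>x. (b x)\<^sup>2)"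
    by (rule integrable_const_bound[of _ "B\<^sup>2"]) (use bB power_mono[OF bB abs_ge_zero, of _ 2] in auto)
  have [measurable]: "E r \<in> borel_measurable ?G" for r unfolding E_def by measurable
  have sq: "has_bochner_integral ?G (\<lambda>w. (E r w)\<^sup>2) (\<integral>y. b y * E (r\<^sup>2) y \<partial>?G)"
    and bd: "F r \<le> B\<^sup>2 * (\<integral>x. mehler_rem I (r\<^sup>2) x x \<partial>?G)" if "0 \<le> r" "r < 1" for r
  proof -
    have diag: "integrable ?G (\<lambda>x. mehler_rem I (r\<^sup>2) x x)"
      using hbi_mehler_rem_diag[OF I r2[OF that]] by (simp add: has_bochner_integral_iff)
    note k = kernel_square[where A="mehler_rem I r" and G="mehler_rem I (r\<^sup>2)" and M="?G", OF prob_space_gspace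
        measurable_mehler_rem measurable_mehler_rem hbi_mehler_rem[OF I that] diag \<open>b \<in> borel_measurable ?G\<close> bB]
    show "has_bochner_integral ?G (\<lambda>w. (E r w)\<^sup>2) (\<integral>y. b y * E (r\<^sup>2) y \<partial>?G)"
      using k(1) by (simp add: E_def mehler_rem_commute[of I "r\<^sup>2"])
    show "F r \<le> B\<^sup>2 * (\<integral>x. mehler_rem I (r\<^sup>2) x x \<partial>?G)"
      using k(2) by (simp add: E_def F_def)
  qed
  have Fsq: "F r \<le> sqrt \<beta> * sqrt (F (r\<^sup>2))" if "0 \<le> r" "r < 1" for r
  proof -
    have i: "integrable ?G (\<lambda>w. (E (r\<^sup>2) w)\<^sup>2)" using sq[OF r2[OF that]] by (simp add: has_bochner_integral_iff)
    have "cmod (\<integral>y. complex_of_real (b y) * complex_of_real (E (r\<^sup>2) y) \<partial>?G) \<le> sqrt \<beta> * sqrt (F (r\<^sup>2))"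
      using integral_Cauchy_Schwarz(2)[of "\<lambda>y. complex_of_real (b y)" ?G "\<lambda>y. complex_of_real (E (r\<^sup>2) y)"] i b2
      by (simp add: \<beta>_def F_def)
    moreover have "(\<integral>y. complex_of_real (b y) * complex_of_real (E (r\<^sup>2) y) \<partial>?G) = complex_of_real (\<integral>y. b y * E (r\<^sup>2) y \<partial>?G)"
      by (simp flip: of_real_mult)
    moreover have "F r = (\<integral>y. b y * E (r\<^sup>2) y \<partial>?G)" using sq[OF that] by (simp add: F_def has_bochner_integral_iff)
    ultimately show ?thesis by simp
  qed
  obtain K where K: "\<And>s. 0 \<le> s \<Longrightarrow> s \<le> 1 / 2 \<Longrightarrow> 1 / (1 - s) ^ (2 * card I) - 1 - real (2 * card I) * s \<le> K * s\<^sup>2"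
    using inverse_power_quadratic[of "2 * card I"] by blast
  have FK: "F r \<le> B\<^sup>2 * K * r ^ 4" if "0 \<le> r" "r \<le> 1 / 2" for r
  proof -
    have "r\<^sup>2 \<le> 1 / 2" using that power_mono[of r "1/2" 2] by (simp add: power2_eq_square)
    then have "(\<integral>x. mehler_rem I (r\<^sup>2) x x \<partial>?G) \<le> K * (r\<^sup>2)\<^sup>2"
      using hbi_mehler_rem_diag[OF I r2[of r]] that K[of "r\<^sup>2"] by (simp add: has_bochner_integral_iff)
    then have "B\<^sup>2 * (\<integral>x. mehler_rem I (r\<^sup>2) x x \<partial>?G) \<le> B\<^sup>2 * (K * (r\<^sup>2)\<^sup>2)" by (intro mult_left_mono) auto
    then show ?thesis using bd[of r] that by (simp add: power_mult[symmetric] mult.assoc)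
  qed
  have F0: "F r \<ge> 0" for r by (simp add: F_def)
  have "F r \<le> r ^ 4 * \<beta>"
  proof (cases "\<beta> = 0")
    case True
    then show ?thesis using Fsq[OF r] by simp
  next
    case False
    then have \<beta>: "\<beta> > 0" using \<beta>0 by simp
    have "F r / \<beta> \<le> r ^ 4"
    proof (rule self_improve[where f="\<lambda>r. F r / \<beta>" and K="B\<^sup>2 * K / \<beta>"])
      show "0 \<le> F r / \<beta>" for r using F0 \<beta> by simp
      show "(F r / \<beta>)\<^sup>2 \<le> F (r\<^sup>2) / \<beta>" if "0 \<le> r" "r < 1" for r
      proof -
        have "(F r)\<^sup>2 \<le> (sqrt \<beta> * sqrt (F (r\<^sup>2)))\<^sup>2" using Fsq[OF that] F0 by (intro power_mono) auto
        also have "\<dots> = \<beta> * F (r\<^sup>2)" using \<beta> F0 by (simp add: power_mult_distrib)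
        finally show ?thesis using \<beta> by (simp add: field_simps power2_eq_square)
      qed
      show "F r / \<beta> \<le> B\<^sup>2 * K / \<beta> * r ^ 4" if "0 \<le> r" "r \<le> 1 / 2" for r
        using FK[OF that] \<beta> by (simp add: divide_right_mono)
    qed (use r in auto)
    then show ?thesis using \<beta> by (simp add: field_simps)
  qed
  moreover have "F r = (\<integral>y. b y * E (r\<^sup>2) y \<partial>?G)" using sq[OF r] by (simp add: F_def has_bochner_integral_iff)
  ultimately show ?thesis by (simp add: E_def \<beta>_def mehler_rem_commute[of I "r\<^sup>2"])
qed

text \<open>The rotation is moved to the other argument by its adjoint, which is again an isometry.
  Hence the rotated kernel has the same square \<open>mehler_rem I (r^2)\<close> as the original
  one.\<close>

lemma mehler_rem_rot_square:
  fixes b :: "('i \<Rightarrow> complex) \<Rightarrow> real"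
  assumes I: "finite I" and U: "unitary_on I U" and c: "cmod c = 1" and r: "0 \<le> r" "r < 1"
    and [measurable]: "b \<in> borel_measurable (gspace I)" and bB: "\<And>x. \<bar>b x\<bar> \<le> B"
  shows "integrable (gspace I) (\<lambda>w. (\<integral>x. b x * mehler_rem I r (rot I U c w) x \<partial>gspace I)\<^sup>2)"
    and "(\<integral>w. (\<integral>x. b x * mehler_rem I r (rot I U c w) x \<partial>gspace I)\<^sup>2 \<partial>gspace I) \<le> r ^ 4 * (\<integral>x. (b x)\<^sup>2 \<partial>gspace I)"
proof -
  let ?G = "gspace I"
  have r2: "0 \<le> r\<^sup>2" "r\<^sup>2 < 1" using r by (auto simp: power_less_one_iff)
  let ?A = "\<lambda>w x. mehler_rem I r (rot I U c w) x"
  have A: "case_prod ?A \<in> borel_measurable (?G \<Otimes>\<^sub>M ?G)" by measurable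
  have comp: "has_bochner_integral ?G (\<lambda>w. ?A w x * ?A w y) (mehler_rem I (r\<^sup>2) x y)" for x y
    using hbi_mehler_rem[OF I r, of "rot I (\<lambda>i j. U j i) c x" "rot I (\<lambda>i j. U j i) c y"]
    unfolding mehler_rem_rot[OF I U c] mehler_rem_rot_rot[OF I unitary_on_transpose[OF U] c] .
  have diag: "integrable ?G (\<lambda>x. mehler_rem I (r\<^sup>2) x x)"
    using hbi_mehler_rem_diag[OF I r2] by (simp add: has_bochner_integral_iff)
  note k = kernel_square(1)[where A="?A" and G="mehler_rem I (r\<^sup>2)" and M="?G", OF prob_space_gspace
        A measurable_mehler_rem comp diag \<open>b \<in> borel_measurable ?G\<close> bB]
  show "integrable ?G (\<lambda>w. (\<integral>x. b x * ?A w x \<partial>?G)\<^sup>2)"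
    using k by (simp add: has_bochner_integral_iff)
  show "(\<integral>w. (\<integral>x. b x * ?A w x \<partial>?G)\<^sup>2 \<partial>?G) \<le> r ^ 4 * (\<integral>x. (b x)\<^sup>2 \<partial>?G)"
    using k mehler_rem_contraction_real[OF I r \<open>b \<in> borel_measurable ?G\<close> bB] by (simp add: has_bochner_integral_iff)
qed

section \<open>Bounded functions and the bilinear forms of a rotated Mehler kernel\<close>

definition bdd_meas :: "'a measure \<Rightarrow> ('a \<Rightarrow> complex) \<Rightarrow> bool" where
  "bdd_meas M a \<longleftrightarrow> a \<in> borel_measurable M \<and> (\<exists>B. \<forall>x. cmod (a x) \<le> B)"

lemma bdd_meas_measurable [measurable_dest]: "bdd_meas M a \<Longrightarrow> a \<in> borel_measurable M"
  by (simp add: bdd_meas_def)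

lemma bdd_meas_mult: "bdd_meas M a \<Longrightarrow> bdd_meas M (\<lambda>x. c * a x)"
  unfolding bdd_meas_def
proof (elim conjE exE, intro conjI)
  fix B assume "\<forall>x. cmod (a x) \<le> B"
  then show "\<exists>B. \<forall>x. cmod (c * a x) \<le> B"
    by (intro exI[of _ "cmod c * B"]) (auto simp: norm_mult intro: mult_left_mono)
qed auto

lemma bdd_meas_sum:
  assumes "\<And>k. k \<in> K \<Longrightarrow> bdd_meas M (a k)"
  shows "bdd_meas M (\<lambda>x. \<Sum>k\<in>K. a k x)"
proof -
  have "\<exists>B. \<forall>k\<in>K. \<forall>x. cmod (a k x) \<le> B k"
    using assms unfolding bdd_meas_def by (auto intro: bchoice)
  then obtain B where B: "\<And>k x. k \<in> K \<Longrightarrow> cmod (a k x) \<le> B k" by blast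
  have "cmod (\<Sum>k\<in>K. a k x) \<le> (\<Sum>k\<in>K. B k)" for x
    by (rule sum_norm_le) (use B in auto)
  moreover have "(\<lambda>x. \<Sum>k\<in>K. a k x) \<in> borel_measurable M"
    by (rule borel_measurable_sum) (use assms in \<open>simp add: bdd_meas_def\<close>)
  ultimately show ?thesis unfolding bdd_meas_def by blast
qed

lemma norm_integral_le:
  fixes f :: "'a \<Rightarrow> complex" and g :: "'a \<Rightarrow> real"
  assumes "integrable M f" "integrable M g" "\<And>x. cmod (f x) \<le> g x"
  shows "cmod (\<integral>x. f x \<partial>M) \<le> (\<integral>x. g x \<partial>M)"
  by (rule order_trans[OF integral_norm_bound]) (intro integral_mono integrable_norm assms)

lemma (in finite_measure) bdd_meas_integrable:
  "bdd_meas M a \<Longrightarrow> integrable M a"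
  unfolding bdd_meas_def by (elim conjE exE) (rule integrable_const_bound, auto)

lemma (in finite_measure) bdd_meas_square_integrable:
  assumes "bdd_meas M a" shows "integrable M (\<lambda>x. (cmod (a x))\<^sup>2)"
proof -
  obtain B where "a \<in> borel_measurable M" "\<And>x. cmod (a x) \<le> B" using assms by (auto simp: bdd_meas_def)
  then show ?thesis
    by (intro integrable_const_bound[of _ "B\<^sup>2"]) (auto intro!: AE_I2 power_mono)
qed

lemma integrable_bdd_mult:
  assumes a: "bdd_meas M a" and f: "integrable M (f :: 'a \<Rightarrow> complex)"
  shows "integrable M (\<lambda>x. a x * f x)"
proof -
  obtain B where [measurable]: "a \<in> borel_measurable M" and B: "\<And>x. cmod (a x) \<le> B" using a by (auto simp: bdd_meas_def)
  have B0: "B \<ge> 0" using order_trans[OF norm_ge_zero B] .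
  have [measurable]: "f \<in> borel_measurable M" using f by simp
  show ?thesis
    by (rule Bochner_Integration.integrable_bound[OF integrable_mult_right[OF integrable_norm[OF f], of B]])
      (use B B0 in \<open>auto simp: norm_mult intro!: mult_right_mono\<close>)
qed

definition rem_form :: "'i set \<Rightarrow> ('i \<Rightarrow> 'i \<Rightarrow> complex) \<Rightarrow> real \<Rightarrow> complex \<Rightarrow>
    (('i \<Rightarrow> complex) \<Rightarrow> complex) \<Rightarrow> (('i \<Rightarrow> complex) \<Rightarrow> complex) \<Rightarrow> complex" where
  "rem_form I U r c a b = (\<integral>w. a w * (\<integral>x. b x * of_real (mehler_rem I r (rot I U c w) x) \<partial>gspace I) \<partial>gspace I)"

text \<open>Expectation of \<open>a w * b x\<close> under the coupling of two copies of Gauss space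
  whose density is the Mehler kernel at the rotated first point.\<close>

definition coupling_form :: "'i set \<Rightarrow> ('i \<Rightarrow> 'i \<Rightarrow> complex) \<Rightarrow> real \<Rightarrow> complex \<Rightarrow>
    (('i \<Rightarrow> complex) \<Rightarrow> complex) \<Rightarrow> (('i \<Rightarrow> complex) \<Rightarrow> complex) \<Rightarrow> complex" where
  "coupling_form I U r c a b = (\<integral>w. a w * (\<integral>x. b x * of_real (mehler I r (rot I U c w) x) \<partial>gspace I) \<partial>gspace I)"

text \<open>Only the coefficient against \<open>w i\<close> is recorded; the one against
  \<open>cnj (w i)\<close> belongs to the antilinear part, which the averaging over cube roots
  removes.\<close>

definition gcoef :: "'i set \<Rightarrow> (('i \<Rightarrow> complex) \<Rightarrow> complex) \<Rightarrow> 'i \<Rightarrow> complex" where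
  "gcoef I a i = (\<integral>w. a w * w i \<partial>gspace I)"

definition chaos1 :: "'i set \<Rightarrow> ('i \<Rightarrow> 'i \<Rightarrow> complex) \<Rightarrow>
    (('i \<Rightarrow> complex) \<Rightarrow> complex) \<Rightarrow> (('i \<Rightarrow> complex) \<Rightarrow> complex) \<Rightarrow> complex" where
  "chaos1 I U a b = (\<Sum>i\<in>I. \<Sum>j\<in>I. U i j * gcoef I a j * gcoef I b i)"

lemma integrable_gspace_component:
  assumes "finite I" "i \<in> I"
  shows "integrable (gspace I) (\<lambda>w. w i)" "integrable (gspace I) (\<lambda>w. cnj (w i))"
proof -
  have 1: "integrable (gspace I) (\<lambda>w. Re (w i))" "integrable (gspace I) (\<lambda>w. Im (w i))"
    using hbi_gspace_single[OF assms cgauss_moments(1)] hbi_gspace_single[OF assms cgauss_moments(2)]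
    by (simp_all add: has_bochner_integral_iff)
  have "integrable (gspace I) (\<lambda>w. complex_of_real (Re (w i)) + \<i> * complex_of_real (Im (w i)))"
    using 1 by (intro Bochner_Integration.integrable_add integrable_mult_right integrable_of_real)
  then show "integrable (gspace I) (\<lambda>w. w i)" by (simp flip: complex_eq)
  then show "integrable (gspace I) (\<lambda>w. cnj (w i))" by simp
qed

text \<open>The kernel is real, so the contraction for real functions applies to the real and the
  imaginary part of \<open>b\<close> separately, and the squares add up.\<close>

lemma rem_form_inner:
  assumes I: "finite I" and U: "unitary_on I U" and c: "cmod c = 1" and r: "0 \<le> r" "r < 1"
    and b: "bdd_meas (gspace I) b"
  shows "(\<lambda>w. \<integral>x. b x * of_real (mehler_rem I r (rot I U c w) x) \<partial>gspace I) \<in> borel_measurable (gspace I)"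
    and "integrable (gspace I) (\<lambda>w. (cmod (\<integral>x. b x * of_real (mehler_rem I r (rot I U c w) x) \<partial>gspace I))\<^sup>2)"
    and "(\<integral>w. (cmod (\<integral>x. b x * of_real (mehler_rem I r (rot I U c w) x) \<partial>gspace I))\<^sup>2 \<partial>gspace I)
           \<le> r ^ 4 * (\<integral>x. (cmod (b x))\<^sup>2 \<partial>gspace I)"
proof -
  let ?G = "gspace I"
  interpret prob_space ?G by (rule prob_space_gspace)
  obtain B where [measurable]: "b \<in> borel_measurable ?G" and B: "\<And>x. cmod (b x) \<le> B"
    using b by (auto simp: bdd_meas_def)
  let ?k = "\<lambda>w x. mehler_rem I r (rot I U c w) x"
  show "(\<lambda>w. \<integral>x. b x * of_real (?k w x) \<partial>?G) \<in> borel_measurable ?G" by measurable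
  have BR: "\<bar>Re (b x)\<bar> \<le> B" "\<bar>Im (b x)\<bar> \<le> B" for x
    using B[of x] abs_Re_le_cmod[of "b x"] abs_Im_le_cmod[of "b x"] by linarith+
  have eq: "(cmod (\<integral>x. b x * of_real (?k w x) \<partial>?G))\<^sup>2 =
     (\<integral>x. Re (b x) * ?k w x \<partial>?G)\<^sup>2 + (\<integral>x. Im (b x) * ?k w x \<partial>?G)\<^sup>2" for w
  proof -
    have i: "integrable ?G (\<lambda>x. b x * of_real (?k w x))"
      by (intro integrable_bdd_mult b integrable_of_real integrable_mehler_rem I r)
    have "Re (\<integral>x. b x * of_real (?k w x) \<partial>?G) = (\<integral>x. Re (b x) * ?k w x \<partial>?G)"
      "Im (\<integral>x. b x * of_real (?k w x) \<partial>?G) = (\<integral>x. Im (b x) * ?k w x \<partial>?G)"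
      using i by (simp_all flip: integral_Re integral_Im)
    then show ?thesis by (simp add: cmod_power2)
  qed
  note sR = mehler_rem_rot_square[OF I U c r _ BR(1), simplified] and sI = mehler_rem_rot_square[OF I U c r _ BR(2), simplified]
  show "integrable ?G (\<lambda>w. (cmod (\<integral>x. b x * of_real (?k w x) \<partial>?G))\<^sup>2)"
    unfolding eq by (intro Bochner_Integration.integrable_add sR(1) sI(1)) measurable
  have i2: "integrable ?G (\<lambda>x. (Re (b x))\<^sup>2)" "integrable ?G (\<lambda>x. (Im (b x))\<^sup>2)"
    using power_mono[OF BR(1) abs_ge_zero, of _ 2] power_mono[OF BR(2) abs_ge_zero, of _ 2]
    by (auto intro!: integrable_const_bound[of _ "B\<^sup>2"])
  have "(\<integral>w. (cmod (\<integral>x. b x * of_real (?k w x) \<partial>?G))\<^sup>2 \<partial>?G) =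
     (\<integral>w. (\<integral>x. Re (b x) * ?k w x \<partial>?G)\<^sup>2 \<partial>?G) + (\<integral>w. (\<integral>x. Im (b x) * ?k w x \<partial>?G)\<^sup>2 \<partial>?G)"
    unfolding eq by (intro Bochner_Integration.integral_add sR(1) sI(1)) measurable
  also have "\<dots> \<le> r ^ 4 * (\<integral>x. (Re (b x))\<^sup>2 \<partial>?G) + r ^ 4 * (\<integral>x. (Im (b x))\<^sup>2 \<partial>?G)"
    by (intro add_mono sR(2) sI(2)) measurable
  also have "\<dots> = r ^ 4 * (\<integral>x. (cmod (b x))\<^sup>2 \<partial>?G)"
    using i2 by (simp add: cmod_power2 algebra_simps)
  finally show "(\<integral>w. (cmod (\<integral>x. b x * of_real (?k w x) \<partial>?G))\<^sup>2 \<partial>?G) \<le> r ^ 4 * (\<integral>x. (cmod (b x))\<^sup>2 \<partial>?G)" .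
qed

lemma rem_form_bound:
  assumes I: "finite I" and U: "unitary_on I U" and c: "cmod c = 1" and r: "0 \<le> r" "r < 1"
    and a: "bdd_meas (gspace I) a" and b: "bdd_meas (gspace I) b"
  shows "integrable (gspace I) (\<lambda>w. a w * (\<integral>x. b x * of_real (mehler_rem I r (rot I U c w) x) \<partial>gspace I))"
    and "cmod (rem_form I U r c a b) \<le> r\<^sup>2 * (sqrt (\<integral>x. (cmod (a x))\<^sup>2 \<partial>gspace I) * sqrt (\<integral>x. (cmod (b x))\<^sup>2 \<partial>gspace I))"
proof -
  let ?G = "gspace I"
  interpret prob_space ?G by (rule prob_space_gspace)
  note inn = rem_form_inner[OF I U c r b]
  note CS = integral_Cauchy_Schwarz[OF bdd_meas_measurable[OF a] inn(1) bdd_meas_square_integrable[OF a] inn(2)]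
  show "integrable ?G (\<lambda>w. a w * (\<integral>x. b x * of_real (mehler_rem I r (rot I U c w) x) \<partial>?G))" by (rule CS(1))
  have "cmod (rem_form I U r c a b) \<le> sqrt (\<integral>x. (cmod (a x))\<^sup>2 \<partial>?G) * sqrt (r ^ 4 * (\<integral>x. (cmod (b x))\<^sup>2 \<partial>?G))"
    unfolding rem_form_def by (rule order_trans[OF CS(2)]) (intro mult_left_mono real_sqrt_le_mono inn(3), simp)
  also have "sqrt (r ^ 4 * (\<integral>x. (cmod (b x))\<^sup>2 \<partial>?G)) = r\<^sup>2 * sqrt (\<integral>x. (cmod (b x))\<^sup>2 \<partial>?G)"
  proof -
    have "r ^ 4 = (r\<^sup>2)\<^sup>2" by simp
    then show ?thesis by (simp only: real_sqrt_mult real_sqrt_abs) simp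
  qed
  finally show "cmod (rem_form I U r c a b) \<le> r\<^sup>2 * (sqrt (\<integral>x. (cmod (a x))\<^sup>2 \<partial>?G) * sqrt (\<integral>x. (cmod (b x))\<^sup>2 \<partial>?G))"
    by (simp add: mult_ac)
qed

lemma rem_form_linear:
  assumes I: "finite I" and U: "unitary_on I U" and c: "cmod c = 1" and r: "0 \<le> r" "r < 1"
    and a: "\<And>k. k \<in> K \<Longrightarrow> bdd_meas (gspace I) (a k)" and b: "\<And>l. l \<in> L \<Longrightarrow> bdd_meas (gspace I) (b l)"
  shows "rem_form I U r c (\<lambda>w. \<Sum>k\<in>K. \<alpha> k * a k w) (\<lambda>x. \<Sum>l\<in>L. \<gamma> l * b l x) =
    (\<Sum>k\<in>K. \<Sum>l\<in>L. \<alpha> k * \<gamma> l * rem_form I U r c (a k) (b l))"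
proof -
  let ?G = "gspace I"
  interpret prob_space ?G by (rule prob_space_gspace)
  let ?k = "\<lambda>w x. complex_of_real (mehler_rem I r (rot I U c w) x)"
  have i1: "integrable ?G (\<lambda>x. b l x * ?k w x)" if "l \<in> L" for l w
    by (intro integrable_bdd_mult b that integrable_of_real integrable_mehler_rem I r)
  have 1: "(\<integral>x. (\<Sum>l\<in>L. \<gamma> l * b l x) * ?k w x \<partial>?G) = (\<Sum>l\<in>L. \<gamma> l * (\<integral>x. b l x * ?k w x \<partial>?G))" for w
  proof -
    have "(\<integral>x. (\<Sum>l\<in>L. \<gamma> l * b l x) * ?k w x \<partial>?G) = (\<integral>x. (\<Sum>l\<in>L. \<gamma> l * (b l x * ?k w x)) \<partial>?G)"
      by (simp add: sum_distrib_right mult.assoc)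
    then show ?thesis using i1 by (simp add: Bochner_Integration.integral_sum)
  qed
  have i2: "integrable ?G (\<lambda>w. a k w * (\<integral>x. b l x * ?k w x \<partial>?G))" if "k \<in> K" "l \<in> L" for k l
    by (rule rem_form_bound(1)[OF I U c r a[OF that(1)] b[OF that(2)]])
  have "rem_form I U r c (\<lambda>w. \<Sum>k\<in>K. \<alpha> k * a k w) (\<lambda>x. \<Sum>l\<in>L. \<gamma> l * b l x) =
    (\<integral>w. (\<Sum>k\<in>K. \<Sum>l\<in>L. (\<alpha> k * \<gamma> l) * (a k w * (\<integral>x. b l x * ?k w x \<partial>?G))) \<partial>?G)"
    unfolding rem_form_def 1 by (simp add: sum_product mult_ac)
  also have "\<dots> = (\<Sum>k\<in>K. \<Sum>l\<in>L. \<alpha> k * \<gamma> l * rem_form I U r c (a k) (b l))"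
    using i2 unfolding rem_form_def by (simp add: Bochner_Integration.integral_sum)
  finally show ?thesis .
qed

text \<open>The kernel is split into degrees 0, 1 and at least 2. The point is the order of the
  quantifiers: \<open>D\<close> is the same for all phases \<open>c\<close>, so that an average over
  \<open>c\<close> can cancel it.\<close>

lemma coupling_form_expand:
  assumes I: "finite I" and U: "unitary_on I U" and c: "cmod c = 1" and r: "0 \<le> r" "r < 1"
    and a: "bdd_meas (gspace I) a" and b: "bdd_meas (gspace I) b"
  shows "\<exists>D. \<forall>c. cmod c = 1 \<longrightarrow> coupling_form I U r c a b =
    (\<integral>w. a w \<partial>gspace I) * (\<integral>x. b x \<partial>gspace I) + r * (c * chaos1 I U a b + cnj c * D) + rem_form I U r c a b"
proof -
  let ?G = "gspace I"
  interpret prob_space ?G by (rule prob_space_gspace)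
  define D where "D = (\<Sum>i\<in>I. \<Sum>j\<in>I. cnj (U i j) * (\<integral>w. a w * cnj (w j) \<partial>?G) * (\<integral>x. b x * cnj (x i) \<partial>?G))"
  show ?thesis
  proof (intro exI[of _ D] allI impI)
    fix c :: complex assume c: "cmod c = 1"
    have ia: "integrable ?G (\<lambda>w. a w * w j)" "integrable ?G (\<lambda>w. a w * cnj (w j))"
      "integrable ?G (\<lambda>w. b w * w j)" "integrable ?G (\<lambda>w. b w * cnj (w j))" if "j \<in> I" for j
      by (intro integrable_bdd_mult a b integrable_gspace_component[OF I that])+
    have p: "complex_of_real (pairing I (rot I U c w) x) = (\<Sum>i\<in>I. c * (\<Sum>j\<in>I. U i j * w j) * x i + cnj (c * (\<Sum>j\<in>I. U i j * w j)) * cnj (x i))" for w x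
    proof -
      have re: "complex_of_real (2 * Re z) = z + cnj z" for z by (simp add: complex_eq_iff)
      have "complex_of_real (pairing I (rot I U c w) x) = (\<Sum>i\<in>I. complex_of_real (2 * Re (cnj (rot I U c w i) * x i)))"
        unfolding pairing_def sum_distrib_left by (simp only: of_real_sum)
      also have "\<dots> = (\<Sum>i\<in>I. c * (\<Sum>j\<in>I. U i j * w j) * x i + cnj (c * (\<Sum>j\<in>I. U i j * w j)) * cnj (x i))"
        unfolding re by (intro sum.cong refl) (simp add: rot_def)
      finally show ?thesis .
    qed
    define Q where "Q w = (\<Sum>i\<in>I. c * (\<Sum>j\<in>I. U i j * w j) * gcoef I b i + cnj (c * (\<Sum>j\<in>I. U i j * w j)) * (\<integral>x. b x * cnj (x i) \<partial>?G))" for w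
    have inner: "(\<integral>x. b x * of_real (mehler I r (rot I U c w) x) \<partial>?G) =
       (\<integral>x. b x \<partial>?G) + r * Q w + (\<integral>x. b x * of_real (mehler_rem I r (rot I U c w) x) \<partial>?G)" for w
    proof -
      have ir: "integrable ?G (\<lambda>x. b x * of_real (mehler_rem I r (rot I U c w) x))"
        by (intro integrable_bdd_mult b integrable_of_real integrable_mehler_rem I r)
      have "b x * of_real (mehler I r (rot I U c w) x) = b x + r * (\<Sum>i\<in>I. c * (\<Sum>j\<in>I. U i j * w j) * (b x * x i) + cnj (c * (\<Sum>j\<in>I. U i j * w j)) * (b x * cnj (x i)))
         + b x * of_real (mehler_rem I r (rot I U c w) x)" for x
      proof -
        have "b x * of_real (mehler I r (rot I U c w) x) = b x + r * (b x * of_real (pairing I (rot I U c w) x)) + b x * of_real (mehler_rem I r (rot I U c w) x)"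
          by (simp add: mehler_rem_def algebra_simps)
        also have "b x * of_real (pairing I (rot I U c w) x) = (\<Sum>i\<in>I. c * (\<Sum>j\<in>I. U i j * w j) * (b x * x i) + cnj (c * (\<Sum>j\<in>I. U i j * w j)) * (b x * cnj (x i)))"
          unfolding p sum_distrib_left[of "b x"] by (intro sum.cong refl) (simp add: algebra_simps del: cnj_sum)
        finally show ?thesis .
      qed
      moreover have "has_bochner_integral ?G (\<lambda>x. b x + r * (\<Sum>i\<in>I. c * (\<Sum>j\<in>I. U i j * w j) * (b x * x i) + cnj (c * (\<Sum>j\<in>I. U i j * w j)) * (b x * cnj (x i)))
         + b x * of_real (mehler_rem I r (rot I U c w) x))
         ((\<integral>x. b x \<partial>?G) + r * Q w + (\<integral>x. b x * of_real (mehler_rem I r (rot I U c w) x) \<partial>?G))"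
        unfolding Q_def gcoef_def
        by (intro has_bochner_integral_add has_bochner_integral_mult_right has_bochner_integral_sum has_bochner_integral_integrable
           bdd_meas_integrable b ir ia)
      ultimately show ?thesis by (simp only: has_bochner_integral_iff)
    qed
    have "has_bochner_integral ?G (\<lambda>w. a w * (\<integral>x. b x \<partial>?G) + r * (c * (\<Sum>i\<in>I. \<Sum>j\<in>I. U i j * (a w * w j) * gcoef I b i) + cnj c * (\<Sum>i\<in>I. \<Sum>j\<in>I. cnj (U i j) * (a w * cnj (w j)) * (\<integral>x. b x * cnj (x i) \<partial>?G)))
        + a w * (\<integral>x. b x * of_real (mehler_rem I r (rot I U c w) x) \<partial>?G))
      ((\<integral>w. a w \<partial>?G) * (\<integral>x. b x \<partial>?G) + r * (c * chaos1 I U a b + cnj c * D) + rem_form I U r c a b)"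
      unfolding chaos1_def D_def rem_form_def gcoef_def[of I a]
      by (intro has_bochner_integral_add has_bochner_integral_mult_right has_bochner_integral_mult_left has_bochner_integral_sum has_bochner_integral_integrable
           bdd_meas_integrable a rem_form_bound(1)[OF I U c r a b] ia)
    moreover have "a w * (\<integral>x. b x * of_real (mehler I r (rot I U c w) x) \<partial>?G) =
      a w * (\<integral>x. b x \<partial>?G) + r * (c * (\<Sum>i\<in>I. \<Sum>j\<in>I. U i j * (a w * w j) * gcoef I b i) + cnj c * (\<Sum>i\<in>I. \<Sum>j\<in>I. cnj (U i j) * (a w * cnj (w j)) * (\<integral>x. b x * cnj (x i) \<partial>?G)))
        + a w * (\<integral>x. b x * of_real (mehler_rem I r (rot I U c w) x) \<partial>?G)" for w
    proof -
      have "a w * Q w = c * (\<Sum>i\<in>I. \<Sum>j\<in>I. U i j * (a w * w j) * gcoef I b i) + cnj c * (\<Sum>i\<in>I. \<Sum>j\<in>I. cnj (U i j) * (a w * cnj (w j)) * (\<integral>x. b x * cnj (x i) \<partial>?G))"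
        unfolding Q_def sum.distrib distrib_left
        by (intro arg_cong2[where f="(+)"]) (simp_all add: sum_distrib_left sum_distrib_right mult_ac)
      then show ?thesis unfolding inner distrib_left
        by (simp only: mult.left_commute[of "a w" "complex_of_real r"] distrib_left)
    qed
    ultimately show "coupling_form I U r c a b =
      (\<integral>w. a w \<partial>?G) * (\<integral>x. b x \<partial>?G) + r * (c * chaos1 I U a b + cnj c * D) + rem_form I U r c a b"
      unfolding coupling_form_def by (simp only: has_bochner_integral_iff)
  qed
qed

text \<open>Cube roots are the smallest group that works: for the signs 1 and -1 the factors
  \<open>c\<close> and \<open>cnj c\<close> agree and could not be told apart.\<close>

definition omega3 :: complex where "omega3 = Complex (- 1 / 2) (sqrt 3 / 2)"

lemma omega3: "cmod omega3 = 1" "omega3 * omega3 = cnj omega3" "1 + omega3 + cnj omega3 = 0" "omega3 * cnj omega3 = 1"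
  by (simp_all add: omega3_def cmod_def complex_eq_iff power_divide)

definition rem_avg :: "'i set \<Rightarrow> ('i \<Rightarrow> 'i \<Rightarrow> complex) \<Rightarrow> real \<Rightarrow>
    (('i \<Rightarrow> complex) \<Rightarrow> complex) \<Rightarrow> (('i \<Rightarrow> complex) \<Rightarrow> complex) \<Rightarrow> complex" where
  "rem_avg I U r a b = (rem_form I U r 1 a b + cnj omega3 * rem_form I U r omega3 a b + omega3 * rem_form I U r (cnj omega3) a b) / 3"

text \<open>Averaging over the cube roots of unity kills the constant term and the antilinear part of
  the first chaos.\<close>

lemma chaos1_eq:
  assumes I: "finite I" and U: "unitary_on I U" and r: "0 \<le> r" "r < 1"
    and a: "bdd_meas (gspace I) a" and b: "bdd_meas (gspace I) b"
  shows "r * chaos1 I U a b = (coupling_form I U r 1 a b + cnj omega3 * coupling_form I U r omega3 a b +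
     omega3 * coupling_form I U r (cnj omega3) a b) / 3 - rem_avg I U r a b"
proof -
  obtain D where D: "\<And>c. cmod c = 1 \<Longrightarrow> coupling_form I U r c a b =
    (\<integral>w. a w \<partial>gspace I) * (\<integral>x. b x \<partial>gspace I) + r * (c * chaos1 I U a b + cnj c * D) + rem_form I U r c a b"
    using coupling_form_expand[OF I U _ r a b, of 1] by auto
  define m where "m = (\<integral>w. a w \<partial>gspace I) * (\<integral>x. b x \<partial>gspace I)"
  have w: "cnj omega3 * cnj omega3 = omega3" using arg_cong[OF omega3(2), of cnj] by simp
  have c1: "cmod (cnj omega3) = 1" using omega3(1) by simp
  let ?w = "omega3" and ?v = "cnj omega3"
  have "coupling_form I U r 1 a b + ?v * coupling_form I U r ?w a b + ?w * coupling_form I U r ?v a b =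
     (1 + ?w + ?v) * m + r * (chaos1 I U a b * (1 + ?w * ?v + ?w * ?v) + D * (1 + ?v * ?v + ?w * ?w)) + 3 * rem_avg I U r a b"
    unfolding D[OF omega3(1)] D[OF c1] D[of 1, simplified] rem_avg_def m_def by (simp add: algebra_simps)
  also have "\<dots> = 3 * (r * chaos1 I U a b) + 3 * rem_avg I U r a b"
    unfolding w omega3 using omega3(3) by (simp add: algebra_simps)
  finally show ?thesis by (simp add: add_divide_distrib)
qed

text \<open>The sum over \<open>k\<close> is moved inside the integrals before anything is
  estimated. There it is at most \<open>N\<close> for each pair of points and the kernel is a
  probability density, so the number of terms does not enter.\<close>

lemma coupling_form_bound:
  assumes I: "finite I" and U: "unitary_on I U" and c: "cmod c = 1" and r: "0 \<le> r" "r < 1"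
    and K: "finite K"
    and a: "\<And>k. k \<in> K \<Longrightarrow> bdd_meas (gspace I) (a k)" and b: "\<And>k. k \<in> K \<Longrightarrow> bdd_meas (gspace I) (b k)"
    and N: "\<And>w x. cmod (\<Sum>k\<in>K. a k w * b k x) \<le> N"
  shows "cmod (\<Sum>k\<in>K. coupling_form I U r c (a k) (b k)) \<le> N"
proof -
  let ?G = "gspace I"
  interpret prob_space ?G by (rule prob_space_gspace)
  let ?k = "\<lambda>w x. mehler I r (rot I U c w) x"
  have mh: "has_bochner_integral ?G (?k w) 1" for w
    using hbi_mehler[OF I r, of "rot I U c w"] by (simp add: mehler_commute[of I r _ "rot I U c w"])
  have i1: "integrable ?G (\<lambda>x. b k x * complex_of_real (?k w x))" if "k \<in> K" for k w
    using mh[of w] by (intro integrable_bdd_mult b that integrable_of_real) (simp add: has_bochner_integral_iff)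
  have bi: "bdd_meas ?G (\<lambda>w. \<integral>x. b k x * complex_of_real (?k w x) \<partial>?G)" if k: "k \<in> K" for k
  proof -
    obtain B where [measurable]: "b k \<in> borel_measurable ?G" and B: "\<And>x. cmod (b k x) \<le> B"
      using b[OF k] by (auto simp: bdd_meas_def)
    have "cmod (\<integral>x. b k x * complex_of_real (?k w x) \<partial>?G) \<le> B" for w
    proof -
      have "cmod (\<integral>x. b k x * complex_of_real (?k w x) \<partial>?G) \<le> (\<integral>x. B * ?k w x \<partial>?G)"
        using i1[OF k, of w] mh[of w] B mehler_nonneg[OF r, of I "rot I U c w"]
        by (intro norm_integral_le) (auto simp: norm_mult has_bochner_integral_iff abs_of_nonneg intro!: mult_right_mono)
      then show ?thesis using mh[of w] by (simp add: has_bochner_integral_iff)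
    qed
    moreover have "(\<lambda>w. \<integral>x. b k x * complex_of_real (?k w x) \<partial>?G) \<in> borel_measurable ?G" by measurable
    ultimately show ?thesis unfolding bdd_meas_def by blast
  qed
  have i2: "integrable ?G (\<lambda>w. a k w * (\<integral>x. b k x * complex_of_real (?k w x) \<partial>?G))" if "k \<in> K" for k
    by (intro integrable_bdd_mult a that bdd_meas_integrable bi)
  have "(\<Sum>k\<in>K. coupling_form I U r c (a k) (b k)) = (\<integral>w. (\<Sum>k\<in>K. a k w * (\<integral>x. b k x * complex_of_real (?k w x) \<partial>?G)) \<partial>?G)"
    unfolding coupling_form_def using i2 by (simp add: Bochner_Integration.integral_sum)
  also have "\<dots> = (\<integral>w. (\<integral>x. (\<Sum>k\<in>K. a k w * b k x) * complex_of_real (?k w x) \<partial>?G) \<partial>?G)"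
  proof (rule Bochner_Integration.integral_cong[OF refl])
    fix w
    have "(\<integral>x. (\<Sum>k\<in>K. a k w * b k x) * complex_of_real (?k w x) \<partial>?G) = (\<integral>x. (\<Sum>k\<in>K. a k w * (b k x * complex_of_real (?k w x))) \<partial>?G)"
      by (simp add: sum_distrib_right mult.assoc)
    then show "(\<Sum>k\<in>K. a k w * (\<integral>x. b k x * complex_of_real (?k w x) \<partial>?G)) = (\<integral>x. (\<Sum>k\<in>K. a k w * b k x) * complex_of_real (?k w x) \<partial>?G)"
      using i1 by (simp add: Bochner_Integration.integral_sum)
  qed
  finally have eq: "(\<Sum>k\<in>K. coupling_form I U r c (a k) (b k)) = (\<integral>w. (\<integral>x. (\<Sum>k\<in>K. a k w * b k x) * complex_of_real (?k w x) \<partial>?G) \<partial>?G)" .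
  have inner: "cmod (\<integral>x. (\<Sum>k\<in>K. a k w * b k x) * complex_of_real (?k w x) \<partial>?G) \<le> N" for w
  proof -
    have "integrable ?G (\<lambda>x. (\<Sum>k\<in>K. a k w * b k x) * complex_of_real (?k w x))"
      using mh[of w] by (intro integrable_bdd_mult bdd_meas_sum bdd_meas_mult b integrable_of_real) (auto simp add: has_bochner_integral_iff)
    then have "cmod (\<integral>x. (\<Sum>k\<in>K. a k w * b k x) * complex_of_real (?k w x) \<partial>?G) \<le> (\<integral>x. N * ?k w x \<partial>?G)"
      using mh[of w] N[of w] mehler_nonneg[OF r, of I "rot I U c w"]
      by (intro norm_integral_le) (auto simp: norm_mult has_bochner_integral_iff abs_of_nonneg intro!: mult_right_mono)
    then show ?thesis using mh[of w] by (simp add: has_bochner_integral_iff)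
  qed
  have N0: "N \<ge> 0" using order_trans[OF norm_ge_zero N] .
  \<comment> \<open>The integral of a function that is not integrable is 0 by convention, so that
    case only asks for \<open>0 <= N\<close>.\<close>
  show ?thesis unfolding eq
  proof (cases "integrable ?G (\<lambda>w. (\<integral>x. (\<Sum>k\<in>K. a k w * b k x) * complex_of_real (?k w x) \<partial>?G))")
    case True
    then have "cmod (\<integral>w. (\<integral>x. (\<Sum>k\<in>K. a k w * b k x) * complex_of_real (?k w x) \<partial>?G) \<partial>?G) \<le> (\<integral>w. N \<partial>?G)"
      using inner by (intro norm_integral_le) auto
    then show "cmod (\<integral>w. (\<integral>x. (\<Sum>k\<in>K. a k w * b k x) * complex_of_real (?k w x) \<partial>?G) \<partial>?G) \<le> N"
      using prob_space by simp
  qed (use N0 in \<open>simp add: not_integrable_integral_eq\<close>)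
qed

lemma rem_avg_bound:
  assumes I: "finite I" and U: "unitary_on I U" and r: "0 \<le> r" "r < 1"
    and a: "bdd_meas (gspace I) a" and b: "bdd_meas (gspace I) b"
  shows "cmod (rem_avg I U r a b) \<le> r\<^sup>2 * (sqrt (\<integral>x. (cmod (a x))\<^sup>2 \<partial>gspace I) * sqrt (\<integral>x. (cmod (b x))\<^sup>2 \<partial>gspace I))"
    (is "_ \<le> ?R")
proof -
  have c1: "cmod (cnj omega3) = 1" "cmod 1 = 1" using omega3(1) by simp_all
  have "cmod (rem_form I U r 1 a b + cnj omega3 * rem_form I U r omega3 a b + omega3 * rem_form I U r (cnj omega3) a b)
    \<le> cmod (rem_form I U r 1 a b) + cmod (cnj omega3 * rem_form I U r omega3 a b) + cmod (omega3 * rem_form I U r (cnj omega3) a b)"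
    by (intro norm_triangle_le add_mono norm_triangle_ineq order_refl)
  also have "\<dots> = cmod (rem_form I U r 1 a b) + cmod (rem_form I U r omega3 a b) + cmod (rem_form I U r (cnj omega3) a b)"
    by (simp add: norm_mult omega3(1))
  also have "\<dots> \<le> ?R + ?R + ?R"
    by (intro add_mono rem_form_bound(2)[OF I U _ r a b] c1 omega3(1))
  finally show ?thesis unfolding rem_avg_def by (simp add: norm_divide)
qed

lemma rem_avg_linear:
  assumes I: "finite I" and U: "unitary_on I U" and r: "0 \<le> r" "r < 1"
    and a: "\<And>k. k \<in> K \<Longrightarrow> bdd_meas (gspace I) (a k)" and b: "\<And>l. l \<in> L \<Longrightarrow> bdd_meas (gspace I) (b l)"
  shows "rem_avg I U r (\<lambda>w. \<Sum>k\<in>K. \<alpha> k * a k w) (\<lambda>x. \<Sum>l\<in>L. \<gamma> l * b l x) =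
    (\<Sum>k\<in>K. \<Sum>l\<in>L. \<alpha> k * \<gamma> l * rem_avg I U r (a k) (b l))"
proof -
  have c1: "cmod (cnj omega3) = 1" "cmod 1 = 1" using omega3(1) by simp_all
  have alg: "s * ((x + u * y + v * z) / 3) = (s * x + u * (s * y) + v * (s * z)) / 3" for s u v x y z :: complex
    by (simp add: algebra_simps)
  have lin: "rem_form I U r c (\<lambda>w. \<Sum>k\<in>K. \<alpha> k * a k w) (\<lambda>x. \<Sum>l\<in>L. \<gamma> l * b l x) =
    (\<Sum>k\<in>K. \<Sum>l\<in>L. \<alpha> k * \<gamma> l * rem_form I U r c (a k) (b l))" if "cmod c = 1" for c
    by (rule rem_form_linear[OF I U that r a b])
  show ?thesis
    unfolding rem_avg_def lin[OF c1(1)] lin[OF c1(2)] lin[OF omega3(1)]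
    unfolding alg by (simp only: sum_divide_distrib[symmetric] sum.distrib sum_distrib_left[symmetric])
qed

text \<open>Each of the three coupling forms is at most \<open>N\<close> and their weights have
  modulus one, so their mean is at most \<open>N\<close> as well.\<close>

lemma chaos1_bound:
  assumes I: "finite I" and U: "unitary_on I U" and r: "0 < r" "r < 1" and K: "finite K"
    and a: "\<And>k. k \<in> K \<Longrightarrow> bdd_meas (gspace I) (a k)" and b: "\<And>k. k \<in> K \<Longrightarrow> bdd_meas (gspace I) (b k)"
    and N: "\<And>w x. cmod (\<Sum>k\<in>K. a k w * b k x) \<le> N"
  shows "r * cmod (\<Sum>k\<in>K. chaos1 I U (a k) (b k)) \<le> N + cmod (\<Sum>k\<in>K. rem_avg I U r (a k) (b k))"
proof -
  have r': "0 \<le> r" using r by simp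
  have c1: "cmod (cnj omega3) = 1" "cmod 1 = 1" using omega3(1) by simp_all
  let ?S = "\<lambda>c. \<Sum>k\<in>K. coupling_form I U r c (a k) (b k)"
  have "r * (\<Sum>k\<in>K. chaos1 I U (a k) (b k)) = (\<Sum>k\<in>K. r * chaos1 I U (a k) (b k))" by (simp add: sum_distrib_left)
  also have "\<dots> = (?S 1 + cnj omega3 * ?S omega3 + omega3 * ?S (cnj omega3)) / 3 - (\<Sum>k\<in>K. rem_avg I U r (a k) (b k))"
    using chaos1_eq[OF I U r' r(2) a b]
    by (simp add: sum_subtractf sum_divide_distrib[symmetric] sum.distrib sum_distrib_left)
  finally have eq: "r * (\<Sum>k\<in>K. chaos1 I U (a k) (b k)) = (?S 1 + cnj omega3 * ?S omega3 + omega3 * ?S (cnj omega3)) / 3 - (\<Sum>k\<in>K. rem_avg I U r (a k) (b k))" .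
  have S: "cmod (?S c) \<le> N" if "cmod c = 1" for c
    by (rule coupling_form_bound[OF I U that r' r(2) K a b N])
  have "cmod (?S 1 + cnj omega3 * ?S omega3 + omega3 * ?S (cnj omega3)) \<le> cmod (?S 1) + cmod (cnj omega3 * ?S omega3) + cmod (omega3 * ?S (cnj omega3))"
    by (intro norm_triangle_le add_mono norm_triangle_ineq order_refl)
  also have "\<dots> = cmod (?S 1) + cmod (?S omega3) + cmod (?S (cnj omega3))"
    by (simp add: norm_mult omega3(1))
  also have "\<dots> \<le> N + N + N" by (intro add_mono S c1 omega3(1))
  finally have "cmod ((?S 1 + cnj omega3 * ?S omega3 + omega3 * ?S (cnj omega3)) / 3) \<le> N" by (simp add: norm_divide)
  then have "cmod (r * (\<Sum>k\<in>K. chaos1 I U (a k) (b k))) \<le> N + cmod (\<Sum>k\<in>K. rem_avg I U r (a k) (b k))"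
    unfolding eq by (intro order_trans[OF norm_triangle_ineq4] add_mono) auto
  then show ?thesis using r by (simp add: norm_mult)
qed

section \<open>Matrices and their norms\<close>

abbreviation orth :: "nat \<Rightarrow> (nat \<Rightarrow> nat \<Rightarrow> complex) \<Rightarrow> bool" where
  "orth n \<equiv> unitary_on {..<n}"

definition vnorm :: "nat \<Rightarrow> (nat \<Rightarrow> complex) \<Rightarrow> real" where
  "vnorm n v = sqrt (\<Sum>i<n. (cmod (v i))\<^sup>2)"

definition herm :: "nat \<Rightarrow> (nat \<Rightarrow> nat \<Rightarrow> complex) \<Rightarrow> bool" where
  "herm n A \<longleftrightarrow> (\<forall>i<n. \<forall>j<n. A j i = cnj (A i j))"

lemma vnorm_nonneg [simp]: "0 \<le> vnorm n v"
  by (simp add: vnorm_def sum_nonneg)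

lemma vnorm_sq: "(vnorm n v)\<^sup>2 = (\<Sum>i<n. (cmod (v i))\<^sup>2)"
  by (simp add: vnorm_def sum_nonneg)

lemma sum_cnj_self: "(\<Sum>i<n. v i * cnj (v i)) = complex_of_real ((vnorm n v)\<^sup>2)"
  by (simp only: vnorm_sq of_real_sum complex_norm_square)

lemma orthD1: "orth n U \<Longrightarrow> i < n \<Longrightarrow> j < n \<Longrightarrow> (\<Sum>k<n. U i k * cnj (U j k)) = (if i = j then 1 else 0)"
  by (simp add: unitary_on_def)

lemma orthD2: "orth n U \<Longrightarrow> i < n \<Longrightarrow> j < n \<Longrightarrow> (\<Sum>k<n. U k i * cnj (U k j)) = (if i = j then 1 else 0)"
  by (simp add: unitary_on_def)

lemma hermitian_eigenvector:
  assumes "0 < n"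
  shows "\<exists>v c. vnorm n v = 1 \<and> (\<forall>i<n. (\<Sum>j<n. A i j * v j) = c * v i)"
proof -
  define M where "M = mat n n (\<lambda>(i, j). A i j)"
  have M: "M \<in> carrier_mat n n" by (simp add: M_def)
  obtain c where "c \<in> spectrum M" using spectrum_non_empty[OF M] assms by auto
  then have "eigenvalue M c" by (simp add: spectrum_def)
  then obtain u where u: "u \<in> carrier_vec n" "u \<noteq> 0\<^sub>v n" "M *\<^sub>v u = c \<cdot>\<^sub>v u"
    using M unfolding eigenvalue_def eigenvector_def by auto
  define w where "w i = u $ i" for i
  have w: "(\<Sum>j<n. A i j * w j) = c * w i" if "i < n" for i
  proof -
    have "(M *\<^sub>v u) $ i = (\<Sum>j<n. A i j * w j)"
      using that u(1) by (simp add: M_def scalar_prod_def w_def lessThan_atLeast0)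
    then show ?thesis using u(1,3) that by (simp add: w_def)
  qed
  have "\<exists>i<n. u $ i \<noteq> 0"
  proof (rule ccontr)
    assume "\<not> ?thesis"
    then have "u = 0\<^sub>v n" using u(1) by (intro eq_vecI) auto
    then show False using u(2) by simp
  qed
  then obtain i0 where i0: "i0 < n" "w i0 \<noteq> 0" by (auto simp: w_def)
  have s0: "0 < (\<Sum>i<n. (cmod (w i))\<^sup>2)"
    by (rule sum_pos2[of _ i0]) (use i0 in auto)
  then have N: "vnorm n w > 0" by (simp add: vnorm_def)
  define v where "v i = w i / vnorm n w" for i
  have "(vnorm n v)\<^sup>2 = 1"
    using N s0 by (simp add: vnorm_sq v_def norm_divide power_divide flip: sum_divide_distrib)
  then have "vnorm n v = 1" by (simp add: power2_eq_1_iff) (metis vnorm_nonneg neg_0_le_iff_le not_one_le_zero)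
  moreover have "(\<Sum>j<n. A i j * v j) = c * v i" if "i < n" for i
    using w[OF that] by (simp add: v_def flip: sum_divide_distrib)
  ultimately show ?thesis by blast
qed

text \<open>A Householder reflection. The phase \<open>p\<close> makes the leading entry of
  \<open>u\<close> nonnegative, so \<open>w = e_0 + u\<close> is not zero and has squared norm
  \<open>2 * t\<close>. The reflection \<open>R\<close> along \<open>w\<close> sends
  \<open>e_0\<close> to \<open>u\<close>, and multiplying by \<open>p\<close> turns \<open>u\<close>
  back into \<open>v\<close>.\<close>

lemma orth_first_column:
  assumes n: "0 < n" and v: "vnorm n v = 1"
  shows "\<exists>H. orth n H \<and> (\<forall>i<n. H i 0 = v i)"
proof -
  define p where "p = (if v 0 = 0 then 1 else v 0 / complex_of_real (cmod (v 0)))"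
  have "cmod p = 1" by (simp add: p_def norm_divide)
  then have pp: "p * cnj p = 1" "cnj p * p = 1"
    using complex_norm_square[of p] by (simp_all add: mult.commute)
  define u where "u i = cnj p * v i" for i
  have u0: "u 0 = complex_of_real (cmod (v 0))"
  proof (cases "v 0 = 0")
    case False
    have "u 0 = (v 0 * cnj (v 0)) / complex_of_real (cmod (v 0))" by (simp add: u_def p_def False)
    also have "\<dots> = complex_of_real ((cmod (v 0))\<^sup>2) / complex_of_real (cmod (v 0))" by (simp only: complex_norm_square)
    finally show ?thesis using False by (simp add: power2_eq_square)
  qed (simp add: u_def)
  define t where "t = 1 + cmod (v 0)"
  have t: "t > 0" unfolding t_def by (smt (verit) norm_ge_zero)
  define w where "w i = (if i = 0 then 1 else 0) + u i" for i
  have ww: "(\<Sum>i<n. w i * cnj (w i)) = 2 * complex_of_real t"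
  proof -
    have "(\<Sum>i<n. w i * cnj (w i)) = (\<Sum>i<n. (if i = 0 then 1 + u i + cnj (u i) else 0) + u i * cnj (u i))"
      by (intro sum.cong refl) (auto simp: w_def algebra_simps)
    also have "\<dots> = 1 + u 0 + cnj (u 0) + (\<Sum>i<n. u i * cnj (u i))"
      using n by (simp add: sum.distrib sum.delta)
    also have "(\<Sum>i<n. u i * cnj (u i)) = (\<Sum>i<n. v i * cnj (v i))"
      by (intro sum.cong refl) (simp add: u_def, metis (no_types, lifting) mult.assoc mult.commute mult.left_neutral pp(2))
    also have "\<dots> = 1" using v by (simp add: sum_cnj_self)
    finally show ?thesis by (simp add: u0 t_def)
  qed
  define R where "R i j = w i * cnj (w j) / complex_of_real t - (if i = j then 1 else 0)" for i j
  have Rh: "cnj (R i j) = R j i" for i j by (simp add: R_def)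
  have RR: "(\<Sum>k<n. R i k * R k j) = (if i = j then 1 else 0)" if "i < n" "j < n" for i j
  proof -
    define z where "z = w i * cnj (w j) / (complex_of_real t)\<^sup>2"
    have "(\<Sum>k<n. R i k * R k j) = (\<Sum>k<n. z * (w k * cnj (w k))
        - (if k = j then w i * cnj (w k) / complex_of_real t else 0) - (if k = i then w k * cnj (w j) / complex_of_real t else 0)
        + (if k = i then (if i = j then 1 else 0) else 0))"
      by (intro sum.cong refl) (auto simp: R_def z_def power2_eq_square algebra_simps)
    also have "\<dots> = z * (\<Sum>k<n. w k * cnj (w k))
        - w i * cnj (w j) / complex_of_real t - w i * cnj (w j) / complex_of_real t + (if i = j then 1 else 0)"
      using that by (simp add: sum.distrib sum_subtractf sum.delta flip: sum_distrib_left)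
    also have "\<dots> = w i * cnj (w j) / (complex_of_real t)\<^sup>2 * (2 * complex_of_real t)
        - w i * cnj (w j) / complex_of_real t - w i * cnj (w j) / complex_of_real t + (if i = j then 1 else 0)"
      by (simp only: ww z_def)
    also have "\<dots> = (if i = j then 1 else 0)" using t by (simp add: power2_eq_square)
    finally show ?thesis .
  qed
  define H where "H i j = p * R i j" for i j
  have "orth n H" unfolding unitary_on_def
  proof (intro conjI ballI)
    fix i j assume ij: "i \<in> {..<n}" "j \<in> {..<n}"
    have "(\<Sum>k<n. H i k * cnj (H j k)) = (\<Sum>k<n. (p * cnj p) * (R i k * R k j))"
      by (intro sum.cong refl) (simp add: H_def Rh)
    then show "(\<Sum>k<n. H i k * cnj (H j k)) = (if i = j then 1 else 0)" using RR[of i j] ij by (simp add: pp)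
    have "(\<Sum>k<n. H k i * cnj (H k j)) = (\<Sum>k<n. (p * cnj p) * (R j k * R k i))"
      by (intro sum.cong refl) (simp add: H_def Rh)
    then show "(\<Sum>k<n. H k i * cnj (H k j)) = (if i = j then 1 else 0)" using RR[of j i] ij by (simp add: pp)
  qed
  moreover have "H i 0 = v i" if "i < n" for i
  proof -
    have "cnj (w 0) = complex_of_real t" by (simp add: w_def u0 t_def)
    then have "R i 0 = u i" using t by (simp add: R_def w_def)
    then have "H i 0 = (p * cnj p) * v i" by (simp add: H_def u_def)
    then show ?thesis by (simp add: pp)
  qed
  ultimately show ?thesis by blast
qed

text \<open>Deflation. A unitary whose first column is an eigenvector clears the first column below
  the diagonal, Hermitian symmetry clears the first row and makes the eigenvalue real, and the
  induction hypothesis treats the remaining block.\<close>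

lemma spectral_theorem:
  assumes "herm n A"
  shows "\<exists>U l. orth n U \<and> (\<forall>i<n. \<forall>j<n. A i j = (\<Sum>k<n. U i k * complex_of_real (l k) * cnj (U j k)))"
  using assms
proof (induction n arbitrary: A)
  case 0
  show ?case by (auto simp: unitary_on_def)
next
  case (Suc n)
  let ?N = "Suc n"
  obtain v c where v: "vnorm ?N v = 1" and Av: "\<And>i. i < ?N \<Longrightarrow> (\<Sum>j<?N. A i j * v j) = c * v i"
    using hermitian_eigenvector[of ?N A] by blast
  obtain H where H: "orth ?N H" and Hv: "\<And>i. i < ?N \<Longrightarrow> H i 0 = v i"
    using orth_first_column[OF _ v] by auto
  define B where "B i j = (\<Sum>a<?N. \<Sum>b<?N. cnj (H a i) * A a b * H b j)" for i j
  have Bh: "B j i = cnj (B i j)" for i j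
  proof -
    have "cnj (B i j) = (\<Sum>a<?N. \<Sum>b<?N. H a i * A b a * cnj (H b j))"
    proof -
      have h: "cnj (A a b) = A b a" if "a < ?N" "b < ?N" for a b
        by (rule sym) (use Suc.prems that in \<open>unfold herm_def, blast\<close>)
      show ?thesis unfolding B_def cnj_sum by (intro sum.cong refl) (simp add: h)
    qed
    also have "\<dots> = (\<Sum>b<?N. \<Sum>a<?N. H a i * A b a * cnj (H b j))" by (rule sum.swap)
    finally show ?thesis unfolding B_def by (simp add: mult_ac del: sum.lessThan_Suc)
  qed
  have B0: "B i 0 = (if i = 0 then c else 0)" if "i < ?N" for i
  proof -
    have "B i 0 = (\<Sum>a<?N. cnj (H a i) * (\<Sum>b<?N. A a b * v b))"
      unfolding B_def sum_distrib_left using Hv by (intro sum.cong refl) simp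
    also have "\<dots> = (\<Sum>a<?N. c * (H a 0 * cnj (H a i)))"
      using Av Hv by (intro sum.cong refl) simp
    also have "\<dots> = c * (if 0 = i then 1 else 0)"
      unfolding sum_distrib_left[symmetric] using orthD2[OF H, of 0 i] that by simp
    finally show ?thesis by simp
  qed
  have c: "c = complex_of_real (Re c)"
    using Bh[of 0 0] B0[of 0] by (simp add: complex_eq_iff)
  have "herm n (\<lambda>i j. B (Suc i) (Suc j))" unfolding herm_def using Bh by blast
  from Suc.IH[OF this] obtain V l where V: "orth n V"
    and Bl: "\<And>i j. i < n \<Longrightarrow> j < n \<Longrightarrow> B (Suc i) (Suc j) = (\<Sum>k<n. V i k * complex_of_real (l k) * cnj (V j k))"
    by blast
  \<comment> \<open>\<open>W\<close> is the block sum of 1 and \<open>V\<close>; the diagonalising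
    unitary is the product of \<open>H\<close> and \<open>W\<close>.\<close>
  define W where "W i j = (case i of 0 \<Rightarrow> (case j of 0 \<Rightarrow> 1 | Suc j' \<Rightarrow> 0) | Suc i' \<Rightarrow> (case j of 0 \<Rightarrow> 0 | Suc j' \<Rightarrow> V i' j'))" for i j
  define m where "m k = (case k of 0 \<Rightarrow> Re c | Suc k' \<Rightarrow> l k')" for k
  have W: "orth ?N W" unfolding unitary_on_def
  proof (intro conjI ballI)
    fix i j assume ij: "i \<in> {..<?N}" "j \<in> {..<?N}"
    show "(\<Sum>k<?N. W i k * cnj (W j k)) = (if i = j then 1 else 0)"
      unfolding sum.lessThan_Suc_shift using ij orthD1[OF V] by (cases i; cases j) (simp_all add: W_def)
    show "(\<Sum>k<?N. W k i * cnj (W k j)) = (if i = j then 1 else 0)"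
      unfolding sum.lessThan_Suc_shift using ij orthD2[OF V] by (cases i; cases j) (simp_all add: W_def)
  qed
  have BW: "B i j = (\<Sum>k<?N. W i k * complex_of_real (m k) * cnj (W j k))" if ij: "i < ?N" "j < ?N" for i j
  proof (cases i)
    case 0
    have "B 0 j = (if j = 0 then c else 0)"
    proof -
      have "B 0 j = cnj (B j 0)" by (rule Bh)
      moreover have "cnj c = c" using Bh[of 0 0] B0[of 0] by simp
      ultimately show ?thesis unfolding B0[OF ij(2)] by simp
    qed
    then show ?thesis unfolding sum.lessThan_Suc_shift 0 using c by (cases j) (simp_all add: W_def m_def)
  next
    case (Suc i')
    show ?thesis
    proof (cases j)
      case 0
      then show ?thesis unfolding sum.lessThan_Suc_shift using B0[OF ij(1)] Suc by (simp add: W_def)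
    next
      case (Suc j')
      then show ?thesis unfolding sum.lessThan_Suc_shift using Bl[of i' j'] ij \<open>i = Suc i'\<close> by (simp add: W_def m_def)
    qed
  qed
  define U where "U i k = (\<Sum>a<?N. H i a * W a k)" for i k
  have mulorth: "orth ?N U" unfolding unitary_on_def
  proof (intro conjI ballI)
    fix i j assume ij: "i \<in> {..<?N}" "j \<in> {..<?N}"
    have "(\<Sum>k<?N. U i k * cnj (U j k)) = (\<Sum>k<?N. \<Sum>a<?N. \<Sum>b<?N. (W a k * cnj (W b k)) * (H i a * cnj (H j b)))"
      unfolding U_def by (simp add: sum_product mult_ac del: sum.lessThan_Suc)
    also have "\<dots> = (\<Sum>a<?N. \<Sum>b<?N. \<Sum>k<?N. (W a k * cnj (W b k)) * (H i a * cnj (H j b)))"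
      by (rule trans[OF sum.swap]) (intro sum.cong refl sum.swap)
    also have "\<dots> = (\<Sum>a<?N. \<Sum>b<?N. if a = b then H i a * cnj (H j b) else 0)"
      unfolding sum_distrib_right[symmetric] by (intro sum.cong refl) (use orthD1[OF W] in \<open>simp del: sum.lessThan_Suc\<close>)
    also have "\<dots> = (\<Sum>a<?N. H i a * cnj (H j a))" by (simp add: sum.delta del: sum.lessThan_Suc)
    finally show "(\<Sum>k<?N. U i k * cnj (U j k)) = (if i = j then 1 else 0)" using orthD1[OF H] ij by simp
    have "(\<Sum>k<?N. U k i * cnj (U k j)) = (\<Sum>k<?N. \<Sum>a<?N. \<Sum>b<?N. (H k a * cnj (H k b)) * (W a i * cnj (W b j)))"
      unfolding U_def by (simp add: sum_product mult_ac del: sum.lessThan_Suc)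
    also have "\<dots> = (\<Sum>a<?N. \<Sum>b<?N. \<Sum>k<?N. (H k a * cnj (H k b)) * (W a i * cnj (W b j)))"
      by (rule trans[OF sum.swap]) (intro sum.cong refl sum.swap)
    also have "\<dots> = (\<Sum>a<?N. \<Sum>b<?N. if a = b then W a i * cnj (W b j) else 0)"
      unfolding sum_distrib_right[symmetric] by (intro sum.cong refl) (use orthD2[OF H] in \<open>simp del: sum.lessThan_Suc\<close>)
    also have "\<dots> = (\<Sum>a<?N. W a i * cnj (W a j))" by (simp add: sum.delta del: sum.lessThan_Suc)
    finally show "(\<Sum>k<?N. U k i * cnj (U k j)) = (if i = j then 1 else 0)" using orthD2[OF W] ij by simp
  qed
  have "A i j = (\<Sum>k<?N. U i k * complex_of_real (m k) * cnj (U j k))" if ij: "i < ?N" "j < ?N" for i j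
  proof -
    have "(\<Sum>k<?N. U i k * complex_of_real (m k) * cnj (U j k)) =
      (\<Sum>k<?N. \<Sum>a<?N. \<Sum>b<?N. (W a k * complex_of_real (m k) * cnj (W b k)) * (H i a * cnj (H j b)))"
      unfolding U_def by (simp add: sum_product sum_distrib_left sum_distrib_right mult_ac del: sum.lessThan_Suc)
    also have "\<dots> = (\<Sum>a<?N. \<Sum>b<?N. \<Sum>k<?N. (W a k * complex_of_real (m k) * cnj (W b k)) * (H i a * cnj (H j b)))"
      by (rule trans[OF sum.swap]) (intro sum.cong refl sum.swap)
    also have "\<dots> = (\<Sum>a<?N. \<Sum>b<?N. B a b * (H i a * cnj (H j b)))"
      unfolding sum_distrib_right[symmetric] by (intro sum.cong refl) (simp add: BW del: sum.lessThan_Suc)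
    also have "\<dots> = (\<Sum>a<?N. \<Sum>b<?N. \<Sum>x<?N. \<Sum>y<?N. A x y * ((H i a * cnj (H x a)) * (H y b * cnj (H j b))))"
      unfolding B_def sum_distrib_right by (intro sum.cong refl) simp
    also have "\<dots> = (\<Sum>x<?N. \<Sum>y<?N. \<Sum>a<?N. \<Sum>b<?N. A x y * ((H i a * cnj (H x a)) * (H y b * cnj (H j b))))"
    proof -
      have sw: "(\<Sum>a\<in>P. \<Sum>b\<in>P. \<Sum>x\<in>P. \<Sum>y\<in>P. f a b x y) = (\<Sum>x\<in>P. \<Sum>y\<in>P. \<Sum>a\<in>P. \<Sum>b\<in>P. f a b x y)" for P and f :: "nat \<Rightarrow> nat \<Rightarrow> nat \<Rightarrow> nat \<Rightarrow> complex"
      proof -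
        have "(\<Sum>a\<in>P. \<Sum>b\<in>P. \<Sum>x\<in>P. \<Sum>y\<in>P. f a b x y) = (\<Sum>a\<in>P. \<Sum>x\<in>P. \<Sum>b\<in>P. \<Sum>y\<in>P. f a b x y)"
          by (intro sum.cong refl sum.swap)
        also have "\<dots> = (\<Sum>x\<in>P. \<Sum>a\<in>P. \<Sum>b\<in>P. \<Sum>y\<in>P. f a b x y)" by (rule sum.swap)
        also have "\<dots> = (\<Sum>x\<in>P. \<Sum>a\<in>P. \<Sum>y\<in>P. \<Sum>b\<in>P. f a b x y)" by (intro sum.cong refl sum.swap)
        also have "\<dots> = (\<Sum>x\<in>P. \<Sum>y\<in>P. \<Sum>a\<in>P. \<Sum>b\<in>P. f a b x y)" by (intro sum.cong refl sum.swap)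
        finally show ?thesis .
      qed
      show ?thesis by (rule sw)
    qed
    also have "\<dots> = (\<Sum>x<?N. \<Sum>y<?N. A x y * ((\<Sum>a<?N. H i a * cnj (H x a)) * (\<Sum>b<?N. H y b * cnj (H j b))))"
      unfolding sum_product by (simp only: sum_distrib_left)
    finally have e1: "(\<Sum>k<?N. U i k * complex_of_real (m k) * cnj (U j k)) =
       (\<Sum>x<?N. \<Sum>y<?N. A x y * ((\<Sum>a<?N. H i a * cnj (H x a)) * (\<Sum>b<?N. H y b * cnj (H j b))))" .
    have e2: "(\<Sum>x<?N. \<Sum>y<?N. A x y * ((\<Sum>a<?N. H i a * cnj (H x a)) * (\<Sum>b<?N. H y b * cnj (H j b)))) =
      (\<Sum>x<?N. if x = i then (\<Sum>y<?N. if y = j then A x y else 0) else 0)"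
    proof (rule sum.cong[OF refl])
      fix x assume x: "x \<in> {..<?N}"
      have "(\<Sum>y<?N. A x y * ((\<Sum>a<?N. H i a * cnj (H x a)) * (\<Sum>b<?N. H y b * cnj (H j b)))) =
        (\<Sum>y<?N. A x y * ((if i = x then 1 else 0) * (if y = j then 1 else 0)))"
        using orthD1[OF H, of i x] orthD1[OF H, of _ j] ij x by (intro sum.cong refl) (simp only: lessThan_iff)
      also have "\<dots> = (if x = i then (\<Sum>y<?N. if y = j then A x y else 0) else 0)"
      proof (cases "x = i")
        case True
        have "(\<Sum>y<?N. A x y * (1 * (if y = j then 1 else 0))) = (\<Sum>y<?N. if y = j then A x y else 0)"
          by (intro sum.cong refl) simp
        then show ?thesis using True by (simp only: if_True refl)
      next
        case False
        then show ?thesis by simp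
      qed
      finally show "(\<Sum>y<?N. A x y * ((\<Sum>a<?N. H i a * cnj (H x a)) * (\<Sum>b<?N. H y b * cnj (H j b)))) =
        (if x = i then (\<Sum>y<?N. if y = j then A x y else 0) else 0)" .
    qed
    have e3: "(\<Sum>x<?N. if x = i then (\<Sum>y<?N. if y = j then A x y else 0) else 0) = A i j"
      by (simp only: sum.delta[OF finite_lessThan] lessThan_iff ij if_True)
    show ?thesis unfolding e1 e2 e3 ..
  qed
  then show ?case using mulorth by blast
qed

section \<open>Operator bounds and the decomposition of contractions into unitaries\<close>

lemma sum_rotate: "(\<Sum>i\<in>A. \<Sum>j\<in>B. \<Sum>k\<in>C. f i j k) = (\<Sum>k\<in>C. \<Sum>i\<in>A. \<Sum>j\<in>B. f i j k)"
proof -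
  have "(\<Sum>i\<in>A. \<Sum>j\<in>B. \<Sum>k\<in>C. f i j k) = (\<Sum>i\<in>A. \<Sum>k\<in>C. \<Sum>j\<in>B. f i j k)"
    by (intro sum.cong refl sum.swap)
  also have "\<dots> = (\<Sum>k\<in>C. \<Sum>i\<in>A. \<Sum>j\<in>B. f i j k)" by (rule sum.swap)
  finally show ?thesis .
qed

text \<open>The form is bilinear rather than sesquilinear. Since \<open>v\<close> is arbitrary the
  bound is the same, and transposition becomes an exchange of \<open>v\<close> and
  \<open>u\<close>.\<close>

definition op_bounded :: "nat \<Rightarrow> real \<Rightarrow> (nat \<Rightarrow> nat \<Rightarrow> complex) \<Rightarrow> bool" where
  "op_bounded n K A \<longleftrightarrow> (\<forall>v u. cmod (\<Sum>i<n. \<Sum>j<n. v i * A i j * u j) \<le> K * (vnorm n v * vnorm n u))"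

lemma op_boundedD: "op_bounded n K A \<Longrightarrow> cmod (\<Sum>i<n. \<Sum>j<n. v i * A i j * u j) \<le> K * (vnorm n v * vnorm n u)"
  by (simp add: op_bounded_def)

lemma vnorm_cnj [simp]: "vnorm n (\<lambda>i. cnj (v i)) = vnorm n v"
  by (simp add: vnorm_def)

lemma vnorm_scale: "vnorm n (\<lambda>i. c * v i) = cmod c * vnorm n v"
  by (simp add: vnorm_def norm_mult power_mult_distrib real_sqrt_mult flip: sum_distrib_left)

lemma sum_mult_le_vnorm: "cmod (\<Sum>i<n. v i * u i) \<le> vnorm n v * vnorm n u"
proof -
  have "cmod (\<Sum>i<n. v i * u i) \<le> (\<Sum>i<n. \<bar>cmod (v i)\<bar> * \<bar>cmod (u i)\<bar>)"
    by (rule order_trans[OF norm_sum]) (simp add: norm_mult)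
  also have "\<dots> \<le> vnorm n v * vnorm n u"
    using L2_set_mult_ineq[of "\<lambda>i. cmod (v i)" "\<lambda>i. cmod (u i)" "{..<n}"] by (simp add: L2_set_def vnorm_def)
  finally show ?thesis .
qed

text \<open>Testing with the conjugate of the image vector produces the square of its norm, and one
  factor cancels.\<close>

lemma op_bounded_vnorm:
  assumes "op_bounded n K A" "0 \<le> K"
  shows "vnorm n (\<lambda>i. \<Sum>j<n. A i j * u j) \<le> K * vnorm n u"
proof -
  define w where "w i = (\<Sum>j<n. A i j * u j)" for i
  have "(\<Sum>i<n. \<Sum>j<n. cnj (w i) * A i j * u j) = (\<Sum>i<n. w i * cnj (w i))"
    unfolding mult.assoc sum_distrib_left[symmetric] w_def[symmetric] by (simp add: mult.commute)
  also have "\<dots> = complex_of_real ((vnorm n w)\<^sup>2)" by (rule sum_cnj_self)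
  finally have "(vnorm n w)\<^sup>2 \<le> K * (vnorm n w * vnorm n u)"
    using op_boundedD[OF assms(1), of "\<lambda>i. cnj (w i)" u] by (simp del: of_real_power)
  then have "vnorm n w * vnorm n w \<le> vnorm n w * (K * vnorm n u)" by (simp add: power2_eq_square mult_ac)
  then have "vnorm n w \<le> K * vnorm n u"
  proof (cases "vnorm n w = 0")
    case True
    then show ?thesis using assms(2) by simp
  next
    case False
    then have "vnorm n w > 0" using vnorm_nonneg[of n w] by linarith
    with \<open>vnorm n w * vnorm n w \<le> vnorm n w * (K * vnorm n u)\<close> show ?thesis by (rule mult_left_le_imp_le)
  qed
  then show ?thesis by (simp add: w_def[abs_def])
qed

lemma op_bounded_transpose: "op_bounded n K A \<Longrightarrow> op_bounded n K (\<lambda>i j. A j i)"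
  unfolding op_bounded_def
proof (intro allI)
  fix v u assume A: "\<forall>v u. cmod (\<Sum>i<n. \<Sum>j<n. v i * A i j * u j) \<le> K * (vnorm n v * vnorm n u)"
  have "(\<Sum>i<n. \<Sum>j<n. v i * A j i * u j) = (\<Sum>i<n. \<Sum>j<n. u i * A i j * v j)"
    by (subst sum.swap) (simp add: mult_ac)
  then show "cmod (\<Sum>i<n. \<Sum>j<n. v i * A j i * u j) \<le> K * (vnorm n v * vnorm n u)"
    using A by (simp add: mult_ac)
qed

lemma op_bounded_cnj: "op_bounded n K A \<Longrightarrow> op_bounded n K (\<lambda>i j. cnj (A i j))"
  unfolding op_bounded_def
proof (intro allI)
  fix v u assume A: "\<forall>v u. cmod (\<Sum>i<n. \<Sum>j<n. v i * A i j * u j) \<le> K * (vnorm n v * vnorm n u)"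
  have "(\<Sum>i<n. \<Sum>j<n. v i * cnj (A i j) * u j) = cnj (\<Sum>i<n. \<Sum>j<n. cnj (v i) * A i j * cnj (u j))"
    by simp
  then have "cmod (\<Sum>i<n. \<Sum>j<n. v i * cnj (A i j) * u j) = cmod (\<Sum>i<n. \<Sum>j<n. cnj (v i) * A i j * cnj (u j))"
    by (simp only: complex_mod_cnj)
  also have "\<dots> \<le> K * (vnorm n (\<lambda>i. cnj (v i)) * vnorm n (\<lambda>i. cnj (u i)))" by (rule A[rule_format])
  finally show "cmod (\<Sum>i<n. \<Sum>j<n. v i * cnj (A i j) * u j) \<le> K * (vnorm n v * vnorm n u)" by simp
qed

lemma op_bounded_scale: "op_bounded n K A \<Longrightarrow> op_bounded n (cmod c * K) (\<lambda>i j. c * A i j)"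
  unfolding op_bounded_def
proof (intro allI)
  fix v u assume A: "\<forall>v u. cmod (\<Sum>i<n. \<Sum>j<n. v i * A i j * u j) \<le> K * (vnorm n v * vnorm n u)"
  have "(\<Sum>i<n. \<Sum>j<n. v i * (c * A i j) * u j) = c * (\<Sum>i<n. \<Sum>j<n. v i * A i j * u j)"
    by (simp add: sum_distrib_left mult_ac)
  then show "cmod (\<Sum>i<n. \<Sum>j<n. v i * (c * A i j) * u j) \<le> cmod c * K * (vnorm n v * vnorm n u)"
    using A by (simp add: norm_mult mult.assoc mult_left_mono)
qed

lemma op_bounded_add: 
  assumes "op_bounded n K A" "op_bounded n L B"
  shows "op_bounded n (K + L) (\<lambda>i j. A i j + B i j)"
  unfolding op_bounded_def
proof (intro allI)
  fix v u
  have "(\<Sum>i<n. \<Sum>j<n. v i * (A i j + B i j) * u j) = (\<Sum>i<n. \<Sum>j<n. v i * A i j * u j) + (\<Sum>i<n. \<Sum>j<n. v i * B i j * u j)"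
    by (simp add: sum.distrib algebra_simps)
  then show "cmod (\<Sum>i<n. \<Sum>j<n. v i * (A i j + B i j) * u j) \<le> (K + L) * (vnorm n v * vnorm n u)"
    using norm_triangle_ineq op_boundedD[OF assms(1), of v u] op_boundedD[OF assms(2), of v u]
    by (smt (verit) distrib_right)
qed

lemma op_bounded_mult:
  assumes "op_bounded n K A" "op_bounded n L B" "0 \<le> K" "0 \<le> L"
  shows "op_bounded n (K * L) (\<lambda>i j. \<Sum>k<n. A i k * B k j)"
  unfolding op_bounded_def
proof (intro allI)
  fix v u
  have "(\<Sum>i<n. \<Sum>j<n. v i * (\<Sum>k<n. A i k * B k j) * u j) = (\<Sum>i<n. \<Sum>j<n. \<Sum>k<n. v i * A i k * (B k j * u j))"
    by (simp add: sum_distrib_left sum_distrib_right mult_ac)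
  also have "\<dots> = (\<Sum>i<n. \<Sum>k<n. v i * A i k * (\<Sum>j<n. B k j * u j))"
    unfolding sum_distrib_left by (intro sum.cong refl sum.swap)
  finally have "cmod (\<Sum>i<n. \<Sum>j<n. v i * (\<Sum>k<n. A i k * B k j) * u j) \<le> K * (vnorm n v * vnorm n (\<lambda>k. \<Sum>j<n. B k j * u j))"
    using op_boundedD[OF assms(1)] by simp
  also have "\<dots> \<le> K * (vnorm n v * (L * vnorm n u))"
    using assms op_bounded_vnorm[OF assms(2,4), of u] by (intro mult_left_mono) auto
  finally show "cmod (\<Sum>i<n. \<Sum>j<n. v i * (\<Sum>k<n. A i k * B k j) * u j) \<le> K * L * (vnorm n v * vnorm n u)"
    by (simp add: mult_ac)
qed

lemma vnorm_column: "orth n U \<Longrightarrow> k < n \<Longrightarrow> vnorm n (\<lambda>i. U i k) = 1"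
proof -
  assume "orth n U" "k < n"
  then have "complex_of_real ((vnorm n (\<lambda>i. U i k))\<^sup>2) = 1"
    using orthD2[of n U k k] sum_cnj_self[of "\<lambda>i. U i k" n] by simp
  then have "(vnorm n (\<lambda>i. U i k))\<^sup>2 = 1\<^sup>2" by (simp only: of_real_eq_1_iff) simp
  then show ?thesis by (rule power2_eq_imp_eq) auto
qed

text \<open>A Hermitian contraction \<open>H\<close> is the mean of \<open>H \<plusminus> i (1 - H\<^sup>2)\<^sup>1\<^sup>/\<^sup>2\<close>.\<close>

lemma hermitian_contraction_unitary:
  assumes H: "herm n H" and o: "op_bounded n 1 H"
  shows "\<exists>V. orth n V \<and> (\<forall>i<n. \<forall>j<n. H i j = (V i j + cnj (V j i)) / 2)"
proof -
  obtain U l where U: "orth n U" and Hl: "\<And>i j. i < n \<Longrightarrow> j < n \<Longrightarrow> H i j = (\<Sum>k<n. U i k * complex_of_real (l k) * cnj (U j k))"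
    using spectral_theorem[OF H] by blast
  have l: "\<bar>l k\<bar> \<le> 1" if k: "k < n" for k
  proof -
    have "(\<Sum>i<n. \<Sum>j<n. cnj (U i k) * H i j * U j k) = (\<Sum>i<n. \<Sum>j<n. \<Sum>m<n. complex_of_real (l m) * ((U i m * cnj (U i k)) * (U j k * cnj (U j m))))"
      by (intro sum.cong refl) (simp add: Hl sum_distrib_left sum_distrib_right mult_ac)
    also have "\<dots> = (\<Sum>m<n. \<Sum>i<n. \<Sum>j<n. complex_of_real (l m) * ((U i m * cnj (U i k)) * (U j k * cnj (U j m))))"
      by (rule sum_rotate)
    also have "\<dots> = (\<Sum>m<n. complex_of_real (l m) * ((\<Sum>i<n. U i m * cnj (U i k)) * (\<Sum>j<n. U j k * cnj (U j m))))"
      unfolding sum_product by (simp only: sum_distrib_left)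
    also have "\<dots> = (\<Sum>m<n. if m = k then complex_of_real (l m) else 0)"
      using orthD2[OF U] k by (intro sum.cong refl) auto
    also have "\<dots> = complex_of_real (l k)" using k by simp
    finally have "complex_of_real (l k) = (\<Sum>i<n. \<Sum>j<n. cnj (U i k) * H i j * U j k)" by simp
    then have "\<bar>l k\<bar> = cmod (\<Sum>i<n. \<Sum>j<n. cnj (U i k) * H i j * U j k)" by (metis norm_of_real)
    also have "\<dots> \<le> 1 * (vnorm n (\<lambda>i. cnj (U i k)) * vnorm n (\<lambda>j. U j k))" by (rule op_boundedD[OF o])
    also have "\<dots> = 1" using vnorm_column[OF U k] by simp
    finally show ?thesis .
  qed
  \<comment> \<open>The point of the upper unit circle above \<open>l k\<close>: it has modulus one,
    and its mean with its conjugate is \<open>l k\<close>.\<close>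
  define e where "e k = Complex (l k) (sqrt (1 - (l k)\<^sup>2))" for k
  have e: "e k * cnj (e k) = 1" "e k + cnj (e k) = 2 * complex_of_real (l k)" if "k < n" for k
  proof -
    have "(l k)\<^sup>2 \<le> 1" using l[OF that] by (simp add: abs_square_le_1)
    then show "e k * cnj (e k) = 1" "e k + cnj (e k) = 2 * complex_of_real (l k)"
      by (auto simp: e_def complex_eq_iff power2_eq_square)
  qed
  define V where "V i j = (\<Sum>k<n. U i k * e k * cnj (U j k))" for i j
  have prod: "(\<Sum>k<n. (\<Sum>a<n. U i a * x a * cnj (U k a)) * cnj (\<Sum>b<n. U j b * x b * cnj (U k b))) = (if i = j then 1 else 0)"
    if ij: "i < n" "j < n" and x: "\<And>k. k < n \<Longrightarrow> x k * cnj (x k) = 1" for i j x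
  proof -
    have "(\<Sum>k<n. (\<Sum>a<n. U i a * x a * cnj (U k a)) * cnj (\<Sum>b<n. U j b * x b * cnj (U k b))) =
      (\<Sum>k<n. \<Sum>a<n. \<Sum>b<n. (U k b * cnj (U k a)) * (U i a * x a * cnj (x b) * cnj (U j b)))"
      by (simp add: sum_product mult_ac)
    also have "\<dots> = (\<Sum>a<n. \<Sum>b<n. \<Sum>k<n. (U k b * cnj (U k a)) * (U i a * x a * cnj (x b) * cnj (U j b)))"
      by (rule trans[OF sum.swap]) (intro sum.cong refl sum.swap)
    also have "\<dots> = (\<Sum>a<n. \<Sum>b<n. if b = a then U i a * x a * cnj (x b) * cnj (U j b) else 0)"
      unfolding sum_distrib_right[symmetric] using orthD2[OF U] by (intro sum.cong refl) simp
    also have "\<dots> = (\<Sum>a<n. (x a * cnj (x a)) * (U i a * cnj (U j a)))"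
      by (simp add: sum.delta mult_ac)
    also have "\<dots> = (\<Sum>a<n. U i a * cnj (U j a))" using x by (intro sum.cong refl) simp
    also have "\<dots> = (if i = j then 1 else 0)" by (rule orthD1[OF U ij])
    finally show ?thesis .
  qed
  have V2: "cnj (V j i) = (\<Sum>k<n. U i k * cnj (e k) * cnj (U j k))" for i j
    by (simp add: V_def mult_ac)
  have "orth n V" unfolding unitary_on_def
  proof (intro conjI ballI)
    fix i j assume ij: "i \<in> {..<n}" "j \<in> {..<n}"
    show "(\<Sum>k<n. V i k * cnj (V j k)) = (if i = j then 1 else 0)"
      unfolding V_def using ij e by (intro prod) auto
    have "(\<Sum>k<n. V k i * cnj (V k j)) = (\<Sum>k<n. cnj (V k j) * cnj (cnj (V k i)))" by (simp add: mult_ac)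
    also have "\<dots> = (if j = i then 1 else 0)"
    proof -
      have e': "cnj (e k) * cnj (cnj (e k)) = 1" if "k < n" for k
        using e(1)[OF that] by (simp only: complex_cnj_cnj mult.commute)
      show ?thesis unfolding V2 by (rule prod[OF _ _ e']) (use ij in auto)
    qed
    finally show "(\<Sum>k<n. V k i * cnj (V k j)) = (if i = j then 1 else 0)" by auto
  qed
  moreover have "H i j = (V i j + cnj (V j i)) / 2" if ij: "i < n" "j < n" for i j
  proof -
    have "V i j + cnj (V j i) = (\<Sum>k<n. U i k * (e k + cnj (e k)) * cnj (U j k))"
      unfolding V2 unfolding V_def by (simp only: sum.distrib[symmetric] distrib_left distrib_right)
    also have "\<dots> = (\<Sum>k<n. 2 * (U i k * complex_of_real (l k) * cnj (U j k)))"
      using e by (intro sum.cong refl) simp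
    also have "\<dots> = 2 * H i j" unfolding Hl[OF ij] sum_distrib_left ..
    finally show ?thesis by simp
  qed
  ultimately show ?thesis by blast
qed

lemma orth_adjoint: "orth n V \<Longrightarrow> orth n (\<lambda>i j. cnj (V j i))"
  unfolding unitary_on_def
proof (intro conjI ballI; elim conjE)
  fix i j assume ij: "i \<in> {..<n}" "j \<in> {..<n}"
    and 1: "\<forall>i\<in>{..<n}. \<forall>j\<in>{..<n}. (\<Sum>k<n. V i k * cnj (V j k)) = (if i = j then 1 else 0)"
    and 2: "\<forall>i\<in>{..<n}. \<forall>j\<in>{..<n}. (\<Sum>k<n. V k i * cnj (V k j)) = (if i = j then 1 else 0)"
  have "(\<Sum>k<n. cnj (V k i) * cnj (cnj (V k j))) = (\<Sum>k<n. V k j * cnj (V k i))" by (simp add: mult_ac)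
  then show "(\<Sum>k<n. cnj (V k i) * cnj (cnj (V k j))) = (if i = j then 1 else 0)" using 2 ij by auto
  have "(\<Sum>k<n. cnj (V i k) * cnj (cnj (V j k))) = (\<Sum>k<n. V j k * cnj (V i k))" by (simp add: mult_ac)
  then show "(\<Sum>k<n. cnj (V i k) * cnj (cnj (V j k))) = (if i = j then 1 else 0)" using 1 ij by auto
qed

lemma orth_scale: "orth n V \<Longrightarrow> cmod c = 1 \<Longrightarrow> orth n (\<lambda>i j. c * V i j)"
proof -
  assume V: "orth n V" and c: "cmod c = 1"
  have cc: "c * cnj c = 1" using c by (simp add: complex_norm_square[symmetric])
  have "c * x * (cnj c * y) = x * y" for x y
  proof -
    have "c * x * (cnj c * y) = (c * cnj c) * (x * y)" by (simp only: mult_ac)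
    then show ?thesis by (simp only: cc mult_1)
  qed
  then show ?thesis using V unfolding unitary_on_def complex_cnj_mult by (simp only:)
qed

text \<open>Write \<open>A = H + \<i> * K\<close> with Hermitian contractions and each of them as
  the mean of a unitary and its adjoint. This gives four unitaries, each with weight 1/2.\<close>

lemma contraction_unitaries:
  assumes o: "op_bounded n 1 A"
  shows "\<exists>V. (\<forall>m<4. orth n (V m)) \<and> (\<forall>i<n. \<forall>j<n. A i j = (\<Sum>m<(4::nat). V m i j) / 2)"
proof -
  let ?A = "\<lambda>i j. cnj (A j i)"
  have o': "op_bounded n 1 ?A" using op_bounded_cnj[OF op_bounded_transpose[OF o]] .
  define H where "H i j = (1 / 2) * (A i j + ?A i j)" for i j
  define K where "K i j = (- \<i> / 2) * (A i j + (-1) * ?A i j)" for i j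
  have "op_bounded n (cmod (1 / 2) * (1 + 1)) H" unfolding H_def[abs_def]
    by (intro op_bounded_scale op_bounded_add o o')
  then have H1: "op_bounded n 1 H" by (simp add: norm_divide)
  have "op_bounded n (cmod (- \<i> / 2) * (1 + cmod (-1) * 1)) K" unfolding K_def[abs_def]
    by (intro op_bounded_scale op_bounded_add o o')
  then have K1: "op_bounded n 1 K" by (simp add: norm_divide)
  have h: "herm n H" "herm n K" by (auto simp: herm_def H_def K_def algebra_simps)
  obtain V where V: "orth n V" "\<And>i j. i < n \<Longrightarrow> j < n \<Longrightarrow> H i j = (V i j + cnj (V j i)) / 2"
    using hermitian_contraction_unitary[OF h(1) H1] by blast
  obtain W where W: "orth n W" "\<And>i j. i < n \<Longrightarrow> j < n \<Longrightarrow> K i j = (W i j + cnj (W j i)) / 2"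
    using hermitian_contraction_unitary[OF h(2) K1] by blast
  define X where "X m = (if m = 0 then V else if m = 1 then (\<lambda>i j. cnj (V j i)) else if m = 2 then (\<lambda>i j. \<i> * W i j) else (\<lambda>i j. \<i> * cnj (W j i)))" for m :: nat
  have "orth n (X m)" for m
    unfolding X_def using V(1) W(1) by (simp add: orth_adjoint orth_scale)
  moreover have "A i j = (\<Sum>m<4. X m i j) / 2" if "i < n" "j < n" for i j
  proof -
    have "A i j = H i j + \<i> * K i j" by (simp add: H_def K_def algebra_simps)
    also have "\<dots> = (\<Sum>m<4. X m i j) / 2"
    proof -
      have "(\<Sum>m<4. X m i j) = V i j + cnj (V j i) + \<i> * W i j + \<i> * cnj (W j i)"
        by (simp add: X_def eval_nat_numeral)
      moreover have "(x + y) / 2 + \<i> * ((z + w) / 2) = (x + y + \<i> * z + \<i> * w) / 2" for x y z w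
        by (simp add: add_divide_distrib distrib_left)
      ultimately show ?thesis by (simp only: V(2)[OF that] W(2)[OF that])
    qed
    finally show ?thesis .
  qed
  ultimately show ?thesis by blast
qed

section \<open>Operator norm, positive square roots and trace norm\<close>

definition mv :: "nat \<Rightarrow> (nat \<Rightarrow> nat \<Rightarrow> complex) \<Rightarrow> (nat \<Rightarrow> complex) \<Rightarrow> nat \<Rightarrow> complex" where
  "mv n A v i = (\<Sum>j<n. A i j * v j)"

definition qform :: "nat \<Rightarrow> (nat \<Rightarrow> nat \<Rightarrow> complex) \<Rightarrow> (nat \<Rightarrow> complex) \<Rightarrow> complex" where
  "qform n A v = (\<Sum>i<n. mv n A v i * cnj (v i))"

lemma l2_norm_vec_vnorm: "v \<in> carrier_vec n \<Longrightarrow> l2_norm_vec v = vnorm n (\<lambda>i. v $ i)"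
  by (simp add: l2_norm_vec_def vnorm_def)

lemma mult_mat_vec_mv: "M \<in> carrier_mat n n \<Longrightarrow> v \<in> carrier_vec n \<Longrightarrow> i < n \<Longrightarrow> (M *\<^sub>v v) $ i = mv n (\<lambda>i j. M $$ (i, j)) (\<lambda>i. v $ i) i"
  by (simp add: mv_def scalar_prod_def lessThan_atLeast0)

lemma vnorm_cong: "(\<And>i. i < n \<Longrightarrow> v i = w i) \<Longrightarrow> vnorm n v = vnorm n w"
  unfolding vnorm_def by (intro arg_cong[where f=sqrt] sum.cong) auto

text \<open>Its main use is to show that the supremum in \<open>mat_op_norm\<close> is taken over a
  bounded set, without which a supremum of reals says nothing.\<close>

lemma mv_le_frobenius: "vnorm n (mv n A v) \<le> sqrt (\<Sum>i<n. (vnorm n (A i))\<^sup>2) * vnorm n v"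
proof -
  have "(\<Sum>i<n. (cmod (mv n A v i))\<^sup>2) \<le> (\<Sum>i<n. (vnorm n (A i) * vnorm n v)\<^sup>2)"
    unfolding mv_def by (intro sum_mono power_mono sum_mult_le_vnorm) auto
  also have "\<dots> = (\<Sum>i<n. (vnorm n (A i))\<^sup>2) * (vnorm n v)\<^sup>2"
    by (simp add: power_mult_distrib sum_distrib_right)
  finally have "vnorm n (mv n A v) \<le> sqrt ((\<Sum>i<n. (vnorm n (A i))\<^sup>2) * (vnorm n v)\<^sup>2)"
    unfolding vnorm_def[of n "mv n A v"] by (rule real_sqrt_le_mono)
  then show ?thesis by (simp add: real_sqrt_mult)
qed

lemma mv_scale: "mv n A (\<lambda>i. c * v i) = (\<lambda>i. c * mv n A v i)"
  by (simp add: mv_def[abs_def] sum_distrib_left mult_ac)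

lemma mv_le_op_norm:
  assumes M: "M \<in> carrier_mat n n"
  shows "vnorm n (mv n (\<lambda>i j. M $$ (i, j)) u) \<le> mat_op_norm M * vnorm n u"
proof -
  let ?A = "\<lambda>i j. M $$ (i, j)"
  let ?S = "{v \<in> carrier_vec (dim_col M). l2_norm_vec v \<le> 1}"
  define F where "F = sqrt (\<Sum>i<n. (vnorm n (?A i))\<^sup>2)"
  have F0: "F \<ge> 0" by (simp add: F_def sum_nonneg)
  have l2: "l2_norm_vec (M *\<^sub>v v) = vnorm n (mv n ?A (\<lambda>i. v $ i))" if "v \<in> carrier_vec n" for v
  proof -
    have "M *\<^sub>v v \<in> carrier_vec n" using M that by simp
    then show ?thesis
      using mult_mat_vec_mv[OF M that] by (simp only: l2_norm_vec_vnorm) (intro vnorm_cong)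
  qed
  have bdd: "bdd_above ((\<lambda>v. l2_norm_vec (M *\<^sub>v v)) ` ?S)"
  proof (rule bdd_aboveI2)
    fix v assume v: "v \<in> ?S"
    then have v': "v \<in> carrier_vec n" using M by auto
    have "l2_norm_vec (M *\<^sub>v v) \<le> F * vnorm n (\<lambda>i. v $ i)"
      unfolding l2[OF v'] F_def by (rule mv_le_frobenius)
    also have "\<dots> \<le> F * 1" using v l2_norm_vec_vnorm[OF v'] F0 by (intro mult_left_mono) auto
    finally show "l2_norm_vec (M *\<^sub>v v) \<le> F" by simp
  qed
  show ?thesis
  proof (cases "vnorm n u = 0")
    case True
    then show ?thesis using mv_le_frobenius[of n ?A u] by simp
  next
    case False
    define a where "a = vnorm n u"
    have a: "a > 0" using False vnorm_nonneg[of n u] unfolding a_def by linarith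
    define v where "v = vec n (\<lambda>i. complex_of_real (1 / a) * u i)"
    have v: "v \<in> carrier_vec n" by (simp add: v_def)
    have vi: "vnorm n (\<lambda>i. v $ i) = 1"
    proof -
      have "vnorm n (\<lambda>i. v $ i) = vnorm n (\<lambda>i. complex_of_real (1 / a) * u i)"
        by (intro vnorm_cong) (simp add: v_def)
      also have "\<dots> = 1" unfolding vnorm_scale using a by (simp add: a_def[symmetric] norm_divide)
      finally show ?thesis .
    qed
    then have "v \<in> ?S" using v M l2_norm_vec_vnorm[OF v] by simp
    then have "l2_norm_vec (M *\<^sub>v v) \<le> mat_op_norm M"
      unfolding mat_op_norm_def using bdd by (rule cSUP_upper)
    moreover have "l2_norm_vec (M *\<^sub>v v) = 1 / a * vnorm n (mv n ?A u)"
    proof -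
      have "mv n ?A (\<lambda>i. v $ i) = mv n ?A (\<lambda>i. complex_of_real (1 / a) * u i)"
        by (rule ext) (auto simp: mv_def v_def intro!: sum.cong)
      then show ?thesis unfolding l2[OF v] by (simp only: mv_scale vnorm_scale norm_of_real) (use a in simp)
    qed
    ultimately show ?thesis using a by (simp add: a_def[symmetric] field_simps)
  qed
qed

lemma op_bounded_mat_op_norm:
  assumes M: "M \<in> carrier_mat n n" and K: "mat_op_norm M \<le> K"
  shows "op_bounded n K (\<lambda>i j. M $$ (i, j))"
  unfolding op_bounded_def
proof (intro allI)
  fix v u
  have "(\<Sum>i<n. \<Sum>j<n. v i * M $$ (i, j) * u j) = (\<Sum>i<n. v i * mv n (\<lambda>i j. M $$ (i, j)) u i)"
    by (simp add: mv_def sum_distrib_left mult.assoc)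
  then have "cmod (\<Sum>i<n. \<Sum>j<n. v i * M $$ (i, j) * u j) \<le> vnorm n v * vnorm n (mv n (\<lambda>i j. M $$ (i, j)) u)"
    using sum_mult_le_vnorm by simp
  also have "\<dots> \<le> vnorm n v * (K * vnorm n u)"
    using mv_le_op_norm[OF M, of u] mult_right_mono[OF K vnorm_nonneg[of n u]] by (intro mult_left_mono) auto
  finally show "cmod (\<Sum>i<n. \<Sum>j<n. v i * M $$ (i, j) * u j) \<le> K * (vnorm n v * vnorm n u)" by (simp add: mult_ac)
qed

definition psd :: "nat \<Rightarrow> (nat \<Rightarrow> nat \<Rightarrow> complex) \<Rightarrow> bool" where
  "psd n A \<longleftrightarrow> (\<forall>v. Im (qform n A v) = 0 \<and> 0 \<le> Re (qform n A v))"

lemma pos_semidef_psd: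
  assumes M: "M \<in> carrier_mat n n"
  shows "pos_semidef n M \<longleftrightarrow> psd n (\<lambda>i j. M $$ (i, j))"
proof -
  let ?A = "\<lambda>i j. M $$ (i, j)"
  have q: "(M *\<^sub>v v) \<bullet>c v = qform n ?A (\<lambda>i. v $ i)" if "v \<in> carrier_vec n" for v
    using that M mult_mat_vec_mv[OF M that]
    by (simp add: scalar_prod_def qform_def lessThan_atLeast0)
  show ?thesis
  proof
    assume p: "pos_semidef n M"
    show "psd n ?A" unfolding psd_def
    proof
      fix v
      have "0 \<le> (M *\<^sub>v vec n v) \<bullet>c vec n v" using p by (simp add: pos_semidef_def)
      also have "(M *\<^sub>v vec n v) \<bullet>c vec n v = qform n ?A v"
        unfolding q[OF vec_carrier] by (simp add: qform_def mv_def)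
      finally show "Im (qform n ?A v) = 0 \<and> 0 \<le> Re (qform n ?A v)" by (simp add: less_eq_complex_def)
    qed
  next
    assume "psd n ?A"
    then show "pos_semidef n M" using M by (simp add: pos_semidef_def q psd_def less_eq_complex_def)
  qed
qed

text \<open>Polarisation: the form is real on \<open>e_i\<close>, \<open>e_i + e_j\<close> and
  \<open>e_i + \<i> * e_j\<close>, and these values compare the real and imaginary parts of
  \<open>A i j\<close> and \<open>A j i\<close>.\<close>

lemma psd_herm:
  assumes p: "psd n A"
  shows "herm n A"
  unfolding herm_def
proof (intro allI impI)
  fix i j assume ij: "i < n" "j < n"
  have q: "qform n A (\<lambda>k. if k = i then x else if k = j then y else 0) =
     A i i * (x * cnj x) + A j j * (y * cnj y) + A i j * (y * cnj x) + A j i * (x * cnj y)" if "i \<noteq> j" for x y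
  proof -
    let ?v = "\<lambda>k. if k = i then x else if k = j then y else 0"
    have s: "(\<Sum>k<n. f k * ?v k) = f i * x + f j * y" for f
    proof -
      have "(\<Sum>k<n. f k * ?v k) = (\<Sum>k<n. (if k = i then f i * x else 0) + (if k = j then f j * y else 0))"
        using that by (intro sum.cong refl) auto
      then show ?thesis using ij by (simp add: sum.distrib)
    qed
    have s': "(\<Sum>k<n. f k * cnj (?v k)) = f i * cnj x + f j * cnj y" for f
    proof -
      have "(\<Sum>k<n. f k * cnj (?v k)) = (\<Sum>k<n. (if k = i then f i * cnj x else 0) + (if k = j then f j * cnj y else 0))"
        using that by (intro sum.cong refl) auto
      then show ?thesis using ij by (simp add: sum.distrib)
    qed
    show ?thesis unfolding qform_def s' mv_def s by (simp add: algebra_simps)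
  qed
  have d: "Im (A k k) = 0" if "k < n" for k
  proof -
    have "(\<Sum>j<n. A i j * (if j = k then 1 else 0)) = A i k" for i
    proof -
      have "(\<Sum>j<n. A i j * (if j = k then 1 else 0)) = (\<Sum>j<n. if j = k then A i j else 0)"
        by (intro sum.cong) auto
      then show ?thesis using that by simp
    qed
    then have "qform n A (\<lambda>i. if i = k then 1 else 0) = (\<Sum>i<n. A i k * cnj (if i = k then 1 else 0))"
      by (simp add: qform_def mv_def)
    also have "\<dots> = (\<Sum>i<n. if i = k then A i k else 0)" by (intro sum.cong) auto
    also have "\<dots> = A k k" using that by simp
    finally show ?thesis using p unfolding psd_def by metis
  qed
  show "A j i = cnj (A i j)"
  proof (cases "i = j")
    case True
    then show ?thesis using d[OF ij(1)] by (simp add: complex_eq_iff)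
  next
    case False
    have "Im (A i i * (x * cnj x) + A j j * (y * cnj y) + A i j * (y * cnj x) + A j i * (x * cnj y)) = 0" for x y
    proof -
      have "Im (qform n A (\<lambda>k. if k = i then x else if k = j then y else 0)) = 0"
        using p unfolding psd_def by blast
      then show ?thesis unfolding q[OF False] .
    qed
    note im = this
    have "Im (A i i) + Im (A j j) + Im (A i j) + Im (A j i) = 0" using im[of 1 1] by simp
    moreover have "Im (A i i) + Im (A j j) + Re (A i j) - Re (A j i) = 0" using im[of 1 \<i>] by simp
    ultimately have "Im (A j i) = - Im (A i j)" "Re (A j i) = Re (A i j)"
      using d[OF ij(1)] d[OF ij(2)] by linarith+
    then show ?thesis by (intro complex_eqI) simp_all
  qed
qed

lemma eigen_column:
  assumes U: "orth n U" and A: "\<And>i j. i < n \<Longrightarrow> j < n \<Longrightarrow> A i j = (\<Sum>k<n. U i k * complex_of_real (l k) * cnj (U j k))"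
    and i: "i < n" and k: "k < n"
  shows "mv n A (\<lambda>j. U j k) i = complex_of_real (l k) * U i k"
proof -
  have "mv n A (\<lambda>j. U j k) i = (\<Sum>j<n. \<Sum>m<n. (U j k * cnj (U j m)) * (U i m * complex_of_real (l m)))"
    unfolding mv_def using A i by (intro sum.cong refl) (simp add: sum_distrib_left sum_distrib_right mult_ac)
  also have "\<dots> = (\<Sum>m<n. (\<Sum>j<n. U j k * cnj (U j m)) * (U i m * complex_of_real (l m)))"
    unfolding sum_distrib_right by (rule sum.swap)
  also have "\<dots> = (\<Sum>m<n. if m = k then U i m * complex_of_real (l m) else 0)"
    using orthD2[OF U k] by (intro sum.cong refl) auto
  also have "\<dots> = complex_of_real (l k) * U i k" using k by simp
  finally show ?thesis .
qed

lemma orth_expand: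
  assumes U: "orth n U" and j: "j < n"
  shows "f j = (\<Sum>k<n. (\<Sum>i<n. f i * U i k) * cnj (U j k))"
proof -
  have "(\<Sum>k<n. (\<Sum>i<n. f i * U i k) * cnj (U j k)) = (\<Sum>k<n. \<Sum>i<n. f i * (U i k * cnj (U j k)))"
    by (simp add: sum_distrib_right mult.assoc)
  also have "\<dots> = (\<Sum>i<n. f i * (\<Sum>k<n. U i k * cnj (U j k)))"
    unfolding sum_distrib_left by (rule sum.swap)
  also have "\<dots> = (\<Sum>i<n. if i = j then f i else 0)"
    using orthD1[OF U _ j] by (intro sum.cong refl) auto
  also have "\<dots> = f j" using j by simp
  finally show ?thesis by simp
qed

lemma qform_column:
  assumes U: "orth n U" and k: "k < n" and A: "\<And>i. i < n \<Longrightarrow> mv n A (\<lambda>j. U j k) i = c * U i k"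
  shows "qform n A (\<lambda>j. U j k) = c"
proof -
  have "qform n A (\<lambda>j. U j k) = c * (\<Sum>i<n. U i k * cnj (U i k))"
    unfolding qform_def sum_distrib_left using A by (intro sum.cong refl) simp
  then show ?thesis using orthD2[OF U k k] by simp
qed

lemma psd_sqrt_exists:
  assumes p: "psd n A"
  shows "\<exists>B. psd n B \<and> (\<forall>i<n. \<forall>j<n. (\<Sum>k<n. B i k * B k j) = A i j)"
proof -
  obtain U l where U: "orth n U" and A: "\<And>i j. i < n \<Longrightarrow> j < n \<Longrightarrow> A i j = (\<Sum>k<n. U i k * complex_of_real (l k) * cnj (U j k))"
    using spectral_theorem[OF psd_herm[OF p]] by blast
  have l: "l k \<ge> 0" if "k < n" for k
    using qform_column[OF U that eigen_column[OF U A _ that]] p unfolding psd_def by (metis Re_complex_of_real)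
  define B where "B i j = (\<Sum>k<n. U i k * complex_of_real (sqrt (l k)) * cnj (U j k))" for i j
  have "(\<Sum>k<n. B i k * B k j) = A i j" if ij: "i < n" "j < n" for i j
  proof -
    have "(\<Sum>k<n. B i k * B k j) = (\<Sum>k<n. \<Sum>m<n. B i k * U k m * (complex_of_real (sqrt (l m)) * cnj (U j m)))"
      by (simp add: B_def[of _ j] sum_distrib_left mult.assoc)
    also have "\<dots> = (\<Sum>m<n. mv n B (\<lambda>k. U k m) i * (complex_of_real (sqrt (l m)) * cnj (U j m)))"
      unfolding mv_def sum_distrib_right by (rule sum.swap)
    also have "\<dots> = (\<Sum>m<n. U i m * complex_of_real (l m) * cnj (U j m))"
    proof (intro sum.cong refl)
      fix m assume m: "m \<in> {..<n}"
      have e: "mv n B (\<lambda>k. U k m) i = complex_of_real (sqrt (l m)) * U i m"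
        by (rule eigen_column[OF U _ ij(1)]) (use m in \<open>auto simp: B_def\<close>)
      have "complex_of_real (sqrt (l m)) * complex_of_real (sqrt (l m)) = complex_of_real (l m)"
        using l[of m] m by (simp flip: of_real_mult)
      then show "mv n B (\<lambda>k. U k m) i * (complex_of_real (sqrt (l m)) * cnj (U j m)) = U i m * complex_of_real (l m) * cnj (U j m)"
        unfolding e by (metis mult.assoc mult.commute)
    qed
    finally show ?thesis using A[OF ij] by simp
  qed
  moreover have "psd n B" unfolding psd_def
  proof (rule allI)
    fix v
    have "qform n B v = (\<Sum>k<n. complex_of_real (sqrt (l k)) * ((\<Sum>i<n. cnj (v i) * U i k) * cnj (\<Sum>i<n. cnj (v i) * U i k)))"
    proof -
      have "qform n B v = (\<Sum>i<n. \<Sum>j<n. \<Sum>k<n. complex_of_real (sqrt (l k)) * ((cnj (v i) * U i k) * cnj (cnj (v j) * U j k)))"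
        unfolding qform_def mv_def B_def sum_distrib_right by (intro sum.cong refl) (simp add: mult_ac)
      also have "\<dots> = (\<Sum>k<n. \<Sum>i<n. \<Sum>j<n. complex_of_real (sqrt (l k)) * ((cnj (v i) * U i k) * cnj (cnj (v j) * U j k)))"
        by (rule sum_rotate)
      finally show ?thesis unfolding cnj_sum sum_product by (simp only: sum_distrib_left)
    qed
    also have "\<dots> = complex_of_real (\<Sum>k<n. sqrt (l k) * (cmod (\<Sum>i<n. cnj (v i) * U i k))\<^sup>2)"
      by (simp only: complex_norm_square[symmetric] of_real_mult[symmetric] of_real_sum[symmetric])
    finally have q: "qform n B v = complex_of_real (\<Sum>k<n. sqrt (l k) * (cmod (\<Sum>i<n. cnj (v i) * U i k))\<^sup>2)" .
    show "Im (qform n B v) = 0 \<and> 0 \<le> Re (qform n B v)"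
      unfolding q Im_complex_of_real Re_complex_of_real using l by (auto intro!: sum_nonneg)
  qed
  ultimately show ?thesis by blast
qed

lemma mv_cong: "(\<And>j. j < n \<Longrightarrow> v j = w j) \<Longrightarrow> mv n A v i = mv n A w i"
  unfolding mv_def by (intro sum.cong) auto

lemma mv_mv: "mv n A (mv n B v) i = (\<Sum>j<n. (\<Sum>k<n. A i k * B k j) * v j)"
  unfolding mv_def sum_distrib_left sum_distrib_right mult.assoc by (rule sum.swap)

text \<open>It suffices that every eigenvector \<open>u\<close> of \<open>B\<close>, with eigenvalue
  \<open>l k\<close>, is one of \<open>C\<close>. The defect \<open>y = C u - l k * u\<close>
  satisfies \<open>C y = - l k * y\<close>. If \<open>l k > 0\<close>, positivity of
  \<open>C\<close> forces \<open>y = 0\<close>; if \<open>l k = 0\<close>, then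
  \<open>y = C u\<close> and the squared norm of \<open>y\<close> is the product of \<open>u\<close>
  with \<open>C y = 0\<close>.\<close>

lemma psd_sqrt_unique:
  assumes B: "psd n B" and C: "psd n C"
    and eq: "\<And>i j. i < n \<Longrightarrow> j < n \<Longrightarrow> (\<Sum>k<n. B i k * B k j) = (\<Sum>k<n. C i k * C k j)"
    and ij: "i < n" "j < n"
  shows "B i j = C i j"
proof -
  obtain U l where U: "orth n U" and Bl: "\<And>i j. i < n \<Longrightarrow> j < n \<Longrightarrow> B i j = (\<Sum>k<n. U i k * complex_of_real (l k) * cnj (U j k))"
    using spectral_theorem[OF psd_herm[OF B]] by blast
  have e: "mv n C (\<lambda>j. U j k) i = complex_of_real (l k) * U i k" if i: "i < n" and k: "k < n" for i k
  proof -
    define u where "u = (\<lambda>j. U j k)"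
    have Bu: "mv n B u i = complex_of_real (l k) * u i" if "i < n" for i
      unfolding u_def by (rule eigen_column[OF U Bl that k])
    have l: "l k \<ge> 0"
      using qform_column[OF U k eigen_column[OF U Bl _ k]] B unfolding psd_def by (metis Re_complex_of_real)
    have CC: "mv n C (mv n C u) i = complex_of_real (l k) * (complex_of_real (l k) * u i)" if i: "i < n" for i
    proof -
      have "mv n C (mv n C u) i = mv n B (mv n B u) i"
        unfolding mv_mv using eq[OF i] by (intro sum.cong refl) simp
      also have "\<dots> = mv n B (\<lambda>j. complex_of_real (l k) * u j) i" using Bu by (intro mv_cong)
      also have "\<dots> = complex_of_real (l k) * (complex_of_real (l k) * u i)" using Bu[OF i] by (simp add: mv_scale)
      finally show ?thesis .
    qed
    define y where "y j = mv n C u j - complex_of_real (l k) * u j" for j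
    have Cy: "mv n C y i = - complex_of_real (l k) * y i" if i: "i < n" for i
    proof -
      have "mv n C y i = mv n C (mv n C u) i - complex_of_real (l k) * mv n C u i"
        unfolding y_def mv_def by (simp add: right_diff_distrib sum_subtractf sum_distrib_left mult_ac)
      then show ?thesis unfolding CC[OF i] by (simp add: y_def algebra_simps)
    qed
    have "vnorm n y = 0"
    proof (cases "l k = 0")
      case True
      have y: "y j = mv n C u j" for j using True by (simp add: y_def)
      have "complex_of_real ((vnorm n y)\<^sup>2) = (\<Sum>i<n. mv n C u i * cnj (y i))"
        using sum_cnj_self[of y n] y by simp
      also have "\<dots> = (\<Sum>i<n. \<Sum>j<n. u j * (C i j * cnj (y i)))"
        unfolding mv_def by (simp add: sum_distrib_right sum_distrib_left mult_ac)
      also have "\<dots> = (\<Sum>j<n. \<Sum>i<n. u j * (C i j * cnj (y i)))" by (rule sum.swap)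
      also have "\<dots> = (\<Sum>j<n. u j * cnj (mv n C y j))"
      proof (intro sum.cong refl)
        fix j assume j: "j \<in> {..<n}"
        have "C i j = cnj (C j i)" if "i < n" for i
          using psd_herm[OF C] that j unfolding herm_def by blast
        then show "(\<Sum>i<n. u j * (C i j * cnj (y i))) = u j * cnj (mv n C y j)"
          unfolding mv_def cnj_sum sum_distrib_left by (intro sum.cong refl) simp
      qed
      also have "\<dots> = 0" using Cy True by (intro sum.neutral) simp
      finally have "(vnorm n y)\<^sup>2 = 0" by (simp only: of_real_eq_0_iff)
      then show ?thesis by simp
    next
      case False
      have "qform n C y = - complex_of_real (l k) * (\<Sum>i<n. y i * cnj (y i))"
        unfolding qform_def sum_distrib_left using Cy by (intro sum.cong refl) simp
      also have "\<dots> = complex_of_real (- l k * (vnorm n y)\<^sup>2)" unfolding sum_cnj_self by simp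
      finally have "Re (qform n C y) = - l k * (vnorm n y)\<^sup>2" by (simp only: Re_complex_of_real)
      then have "l k * (vnorm n y)\<^sup>2 \<le> 0" using C unfolding psd_def by (metis minus_mult_left neg_0_le_iff_le)
      then have "(vnorm n y)\<^sup>2 \<le> 0" using False l by (simp add: mult_le_0_iff)
      then show ?thesis by simp
    qed
    then have "(\<Sum>i<n. (cmod (y i))\<^sup>2) = 0" using vnorm_sq[of n y] by simp
    then have "y i = 0" using i by (simp add: sum_nonneg_eq_0_iff)
    then show ?thesis by (simp add: y_def u_def)
  qed
  have "C i j = (\<Sum>k<n. mv n C (\<lambda>m. U m k) i * cnj (U j k))"
    unfolding mv_def by (rule orth_expand[OF U ij(2)])
  also have "\<dots> = B i j" unfolding Bl[OF ij] using e[OF ij(1)] by (intro sum.cong refl) (simp add: mult_ac)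
  finally show ?thesis by simp
qed

lemma mult_mat_index: "A \<in> carrier_mat n n \<Longrightarrow> B \<in> carrier_mat n n \<Longrightarrow> i < n \<Longrightarrow> j < n \<Longrightarrow>
  (A * B) $$ (i, j) = (\<Sum>k<n. A $$ (i, k) * B $$ (k, j))"
  by (simp add: scalar_prod_def lessThan_atLeast0)

text \<open>Existence and uniqueness of the positive root give the definite description in
  \<open>mat_sqrt\<close> its value. Later arguments use \<open>mat_abs\<close> only through these
  two properties.\<close>

lemma mat_abs_props:
  assumes x: "x \<in> carrier_mat n n"
  shows "pos_semidef n (mat_abs x)" "mat_abs x * mat_abs x = mat_adjoint x * x"
proof -
  define A where "A = mat_adjoint x * x"
  have adj: "mat_adjoint x \<in> carrier_mat n n" "\<And>i j. i < n \<Longrightarrow> j < n \<Longrightarrow> mat_adjoint x $$ (i, j) = cnj (x $$ (j, i))"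
    using x by (auto simp: mat_adjoint_def mat_of_rows_def)
  have A: "A \<in> carrier_mat n n" using adj x by (simp add: A_def)
  have Aij: "A $$ (i, j) = (\<Sum>k<n. cnj (x $$ (k, i)) * x $$ (k, j))" if "i < n" "j < n" for i j
    unfolding A_def using mult_mat_index[OF adj(1) x that] adj(2) that by simp
  have "psd n (\<lambda>i j. A $$ (i, j))" unfolding psd_def
  proof
    fix v
    let ?w = "mv n (\<lambda>i j. x $$ (i, j)) v"
    have "qform n (\<lambda>i j. A $$ (i, j)) v = (\<Sum>i<n. \<Sum>j<n. \<Sum>k<n. (x $$ (k, j) * v j) * cnj (x $$ (k, i) * v i))"
      unfolding qform_def mv_def sum_distrib_right using Aij by (intro sum.cong refl) (simp add: sum_distrib_left sum_distrib_right mult_ac)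
    also have "\<dots> = (\<Sum>k<n. \<Sum>i<n. \<Sum>j<n. (x $$ (k, j) * v j) * cnj (x $$ (k, i) * v i))" by (rule sum_rotate)
    also have "\<dots> = (\<Sum>k<n. ?w k * cnj (?w k))"
      unfolding mv_def cnj_sum sum_product by (intro sum.cong refl sum.swap)
    also have "\<dots> = complex_of_real ((vnorm n ?w)\<^sup>2)" by (rule sum_cnj_self)
    finally show "Im (qform n (\<lambda>i j. A $$ (i, j)) v) = 0 \<and> 0 \<le> Re (qform n (\<lambda>i j. A $$ (i, j)) v)"
      by (simp del: of_real_power)
  qed
  then obtain B where B: "psd n B" "\<And>i j. i < n \<Longrightarrow> j < n \<Longrightarrow> (\<Sum>k<n. B i k * B k j) = A $$ (i, j)"
    using psd_sqrt_exists by blast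
  define S where "S = mat n n (\<lambda>(i, j). B i j)"
  have S: "S \<in> carrier_mat n n" "\<And>i j. i < n \<Longrightarrow> j < n \<Longrightarrow> S $$ (i, j) = B i j" by (simp_all add: S_def)
  have qc: "qform n (\<lambda>i j. S $$ (i, j)) v = qform n B v" for v
    unfolding qform_def mv_def using S(2) by (intro sum.cong refl arg_cong2[where f=times]) auto
  have Sp: "pos_semidef n S" unfolding pos_semidef_psd[OF S(1)] using B(1) by (simp add: psd_def qc)
  have SS: "S * S = A"
  proof (rule eq_matI)
    fix i j assume "i < dim_row A" "j < dim_col A"
    then have ij: "i < n" "j < n" using A by auto
    show "(S * S) $$ (i, j) = A $$ (i, j)"
      unfolding mult_mat_index[OF S(1) S(1) ij] B(2)[OF ij, symmetric] using S(2) ij by (intro sum.cong refl) auto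
  qed (use S A in auto)
  have "\<exists>!B. pos_semidef (dim_row A) B \<and> B * B = A"
  proof (rule ex1I[of _ S])
    show "pos_semidef (dim_row A) S \<and> S * S = A" using Sp SS A by simp
    fix T assume T: "pos_semidef (dim_row A) T \<and> T * T = A"
    then have Tc: "T \<in> carrier_mat n n" and Tp: "pos_semidef n T" using A by (auto simp: pos_semidef_def)
    show "T = S"
    proof (rule eq_matI)
      fix i j assume "i < dim_row S" "j < dim_col S"
      then have ij: "i < n" "j < n" using S by auto
      show "T $$ (i, j) = S $$ (i, j)"
      proof (rule psd_sqrt_unique[where B="\<lambda>i j. T $$ (i, j)" and C="\<lambda>i j. S $$ (i, j)", OF _ _ _ ij])
        show "psd n (\<lambda>i j. T $$ (i, j))" "psd n (\<lambda>i j. S $$ (i, j))"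
          using Tp Sp pos_semidef_psd[OF Tc] pos_semidef_psd[OF S(1)] by auto
        fix a b assume ab: "a < n" "b < n"
        show "(\<Sum>k<n. T $$ (a, k) * T $$ (k, b)) = (\<Sum>k<n. S $$ (a, k) * S $$ (k, b))"
          unfolding mult_mat_index[OF Tc Tc ab, symmetric] mult_mat_index[OF S(1) S(1) ab, symmetric] using T SS by simp
      qed
    qed (use S Tc in auto)
  qed
  from theI'[OF this] have "pos_semidef (dim_row A) (mat_sqrt A) \<and> mat_sqrt A * mat_sqrt A = A"
    unfolding mat_sqrt_def .
  then show "pos_semidef n (mat_abs x)" "mat_abs x * mat_abs x = mat_adjoint x * x"
    using A by (auto simp: mat_abs_def A_def[symmetric])
qed

text \<open>If \<open>u_k\<close> is an orthonormal eigenbasis of \<open>mat_abs x\<close> with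
  eigenvalues \<open>l k\<close>, then \<open>x u_k\<close> has norm \<open>l k\<close>. Expanding
  the trace in this basis gives one value of the form of \<open>Y\<close> for each \<open>k\<close>,
  of size at most \<open>K * l k\<close>.\<close>

lemma trace_duality:
  assumes x: "x \<in> carrier_mat n n" and Y: "op_bounded n K Y" and K: "0 \<le> K"
  shows "cmod (\<Sum>e<n. \<Sum>p<n. x $$ (e, p) * Y p e) \<le> K * trace_norm x"
proof -
  let ?X = "\<lambda>i j. x $$ (i, j)"
  define S where "S = mat_abs x"
  have Sp: "pos_semidef n S" and SS: "S * S = mat_adjoint x * x" using mat_abs_props[OF x] by (auto simp: S_def)
  have Sc: "S \<in> carrier_mat n n" using Sp by (simp add: pos_semidef_def)
  have adj: "mat_adjoint x \<in> carrier_mat n n" "\<And>i j. i < n \<Longrightarrow> j < n \<Longrightarrow> mat_adjoint x $$ (i, j) = cnj (x $$ (j, i))"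
    using x by (auto simp: mat_adjoint_def mat_of_rows_def)
  have psd: "psd n (\<lambda>i j. S $$ (i, j))" using Sp pos_semidef_psd[OF Sc] by simp
  obtain U l where U: "orth n U" and Sl: "\<And>i j. i < n \<Longrightarrow> j < n \<Longrightarrow> S $$ (i, j) = (\<Sum>k<n. U i k * complex_of_real (l k) * cnj (U j k))"
    using spectral_theorem[OF psd_herm[OF psd]] by blast
  have e: "mv n (\<lambda>i j. S $$ (i, j)) (\<lambda>j. U j k) i = complex_of_real (l k) * U i k" if "i < n" "k < n" for i k
    by (rule eigen_column[OF U Sl that])
  have l: "l k \<ge> 0" if "k < n" for k
    using qform_column[OF U that e[OF _ that]] psd unfolding psd_def by (metis Re_complex_of_real)
  have tr: "trace_norm x = (\<Sum>k<n. l k)"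
  proof -
    have "mat_tr S = (\<Sum>i<n. \<Sum>k<n. U i k * complex_of_real (l k) * cnj (U i k))"
      using Sc Sl by (simp add: mat_tr_def)
    also have "\<dots> = (\<Sum>k<n. complex_of_real (l k) * (\<Sum>i<n. U i k * cnj (U i k)))"
      unfolding sum_distrib_left by (subst sum.swap) (simp add: mult_ac)
    also have "\<dots> = (\<Sum>k<n. complex_of_real (l k))"
      using orthD2[OF U] by (intro sum.cong refl) simp
    finally show ?thesis by (simp add: trace_norm_def S_def[symmetric])
  qed
  have xv: "vnorm n (mv n ?X (\<lambda>j. U j k)) = l k" if k: "k < n" for k
  proof -
    let ?u = "\<lambda>j. U j k"
    have "complex_of_real ((vnorm n (mv n ?X ?u))\<^sup>2) = (\<Sum>a<n. (\<Sum>j<n. x $$ (a, j) * U j k) * (\<Sum>i<n. cnj (x $$ (a, i) * U i k)))"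
      unfolding sum_cnj_self[symmetric] mv_def cnj_sum ..
    also have "\<dots> = (\<Sum>a<n. \<Sum>j<n. \<Sum>i<n. (cnj (x $$ (a, i)) * x $$ (a, j)) * (U j k * cnj (U i k)))"
      unfolding sum_product by (simp add: mult_ac)
    also have "\<dots> = (\<Sum>j<n. \<Sum>i<n. \<Sum>a<n. (cnj (x $$ (a, i)) * x $$ (a, j)) * (U j k * cnj (U i k)))"
      by (rule trans[OF sum.swap]) (intro sum.cong refl sum.swap)
    also have "\<dots> = (\<Sum>i<n. \<Sum>j<n. \<Sum>a<n. (cnj (x $$ (a, i)) * x $$ (a, j)) * (U j k * cnj (U i k)))"
      by (rule sum.swap)
    also have "\<dots> = (\<Sum>i<n. \<Sum>j<n. (\<Sum>m<n. S $$ (i, m) * S $$ (m, j)) * (U j k * cnj (U i k)))"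
    proof (intro sum.cong refl)
      fix i j assume "i \<in> {..<n}" "j \<in> {..<n}"
      then have ij: "i < n" "j < n" by auto
      have "(\<Sum>m<n. S $$ (i, m) * S $$ (m, j)) = (\<Sum>a<n. cnj (x $$ (a, i)) * x $$ (a, j))"
        unfolding mult_mat_index[OF Sc Sc ij, symmetric] SS mult_mat_index[OF adj(1) x ij] using adj(2) ij by (intro sum.cong refl) simp
      then show "(\<Sum>a<n. (cnj (x $$ (a, i)) * x $$ (a, j)) * (U j k * cnj (U i k))) = (\<Sum>m<n. S $$ (i, m) * S $$ (m, j)) * (U j k * cnj (U i k))"
        unfolding sum_distrib_right[symmetric] by (rule arg_cong2[where f=times, OF sym refl])
    qed
    also have "\<dots> = (\<Sum>i<n. mv n (\<lambda>i j. S $$ (i, j)) (mv n (\<lambda>i j. S $$ (i, j)) ?u) i * cnj (U i k))"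
      unfolding mv_mv sum_distrib_right by (simp only: mult.assoc)
    also have "\<dots> = (\<Sum>i<n. complex_of_real (l k * l k) * (U i k * cnj (U i k)))"
    proof (intro sum.cong refl)
      fix i assume "i \<in> {..<n}"
      then have i: "i < n" by simp
      have "mv n (\<lambda>i j. S $$ (i, j)) (mv n (\<lambda>i j. S $$ (i, j)) ?u) i = mv n (\<lambda>i j. S $$ (i, j)) (\<lambda>j. complex_of_real (l k) * U j k) i"
        using e k by (intro mv_cong)
      also have "\<dots> = complex_of_real (l k) * (complex_of_real (l k) * U i k)"
        unfolding mv_scale using e[OF i k] by simp
      finally show "mv n (\<lambda>i j. S $$ (i, j)) (mv n (\<lambda>i j. S $$ (i, j)) ?u) i * cnj (U i k) = complex_of_real (l k * l k) * (U i k * cnj (U i k))"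
        by simp
    qed
    also have "\<dots> = complex_of_real (l k * l k)" using orthD2[OF U k k] by (simp add: sum_distrib_left[symmetric] del: of_real_mult)
    finally have "(vnorm n (mv n ?X ?u))\<^sup>2 = (l k)\<^sup>2" by (simp only: of_real_eq_iff power2_eq_square)
    then show ?thesis by (rule power2_eq_imp_eq) (use l[OF k] in auto)
  qed
  have "(\<Sum>e<n. \<Sum>p<n. x $$ (e, p) * Y p e) = (\<Sum>e<n. \<Sum>p<n. \<Sum>k<n. (cnj (U p k) * Y p e) * mv n ?X (\<lambda>j. U j k) e)"
  proof (intro sum.cong refl)
    fix e p assume "p \<in> {..<n}"
    then have "x $$ (e, p) = (\<Sum>k<n. mv n ?X (\<lambda>j. U j k) e * cnj (U p k))"
      unfolding mv_def by (intro orth_expand[OF U]) simp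
    then show "x $$ (e, p) * Y p e = (\<Sum>k<n. (cnj (U p k) * Y p e) * mv n ?X (\<lambda>j. U j k) e)"
      by (simp add: sum_distrib_left sum_distrib_right mult_ac)
  qed
  also have "\<dots> = (\<Sum>k<n. \<Sum>e<n. \<Sum>p<n. (cnj (U p k) * Y p e) * mv n ?X (\<lambda>j. U j k) e)" by (rule sum_rotate)
  also have "\<dots> = (\<Sum>k<n. \<Sum>p<n. \<Sum>e<n. (cnj (U p k) * Y p e) * mv n ?X (\<lambda>j. U j k) e)"
    by (intro sum.cong refl sum.swap)
  finally have "cmod (\<Sum>e<n. \<Sum>p<n. x $$ (e, p) * Y p e) \<le> (\<Sum>k<n. K * l k)"
  proof (simp only:, intro sum_norm_le)
    fix k assume "k \<in> {..<n}"
    then have k: "k < n" by simp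
    have "cmod (\<Sum>p<n. \<Sum>e<n. (cnj (U p k) * Y p e) * mv n ?X (\<lambda>j. U j k) e) \<le> K * (vnorm n (\<lambda>p. cnj (U p k)) * vnorm n (mv n ?X (\<lambda>j. U j k)))"
      by (rule op_boundedD[OF Y])
    then show "cmod (\<Sum>p<n. \<Sum>e<n. (cnj (U p k) * Y p e) * mv n ?X (\<lambda>j. U j k) e) \<le> K * l k"
      using vnorm_column[OF U k] xv[OF k] by simp
  qed
  then show ?thesis by (simp add: tr sum_distrib_left)
qed

lemma trace_norm_nonneg: "x \<in> carrier_mat n n \<Longrightarrow> 0 \<le> trace_norm x"
  using trace_duality[of x n 1 "\<lambda>_ _. 0"] by (simp add: op_bounded_def)

section \<open>Norming kernels for randomly Sidon systems\<close>

lemma std_complex_gaussian_distr: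
  assumes "prob_space P" and Z: "std_complex_gaussian P Z"
  shows "Z \<in> borel_measurable P" and "distr P borel Z = cgauss"
proof -
  interpret prob_space P by fact
  let ?n = "density lborel (normal_density 0 (1 / sqrt 2))"
  have R: "(\<lambda>w. Re (Z w)) \<in> borel_measurable P" "distr P lborel (\<lambda>w. Re (Z w)) = ?n"
    and I: "(\<lambda>w. Im (Z w)) \<in> borel_measurable P" "distr P lborel (\<lambda>w. Im (Z w)) = ?n"
    using Z unfolding std_complex_gaussian_def distributed_def by auto
  have "(\<lambda>w. complex_of_real (Re (Z w)) + \<i> * complex_of_real (Im (Z w))) \<in> borel_measurable P"
    using R(1) I(1) by measurable
  then show Zm: "Z \<in> borel_measurable P" by (simp flip: complex_eq)
  have R': "distr P borel (\<lambda>w. Re (Z w)) = ?n" and I': "distr P borel (\<lambda>w. Im (Z w)) = ?n"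
    using R(2) I(2) by (metis distr_cong sets_lborel)+
  have "distr P borel (\<lambda>w. Re (Z w)) \<Otimes>\<^sub>M distr P borel (\<lambda>w. Im (Z w)) = distr P (borel \<Otimes>\<^sub>M borel) (\<lambda>w. (Re (Z w), Im (Z w)))"
    using Z unfolding std_complex_gaussian_def indep_var_distribution_eq by blast
  then have eq: "?n \<Otimes>\<^sub>M ?n = distr P (borel \<Otimes>\<^sub>M borel) (\<lambda>w. (Re (Z w), Im (Z w)))"
    unfolding R' I' .
  have c: "(\<lambda>(x, y). Complex x y) \<in> borel_measurable (borel \<Otimes>\<^sub>M borel)"
    using measurable_case_Complex by (simp cong: measurable_cong_sets)
  have "cgauss = distr P borel ((\<lambda>(x, y). Complex x y) \<circ> (\<lambda>w. (Re (Z w), Im (Z w))))"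
    unfolding cgauss_distr eq by (rule distr_distr[OF c]) (use R(1) I(1) in measurable)
  then show "distr P borel Z = cgauss" by (simp add: comp_def)
qed

text \<open>The factor \<open>sqrt (d n)\<close> undoes the normalisation of \<open>g\<close>, so
  that all coordinates are standard; it returns as a division in \<open>zmat\<close>.\<close>

definition gvec :: "(nat \<Rightarrow> nat) \<Rightarrow> (nat \<Rightarrow> 'w \<Rightarrow> complex mat) \<Rightarrow> (nat \<times> nat \<times> nat) set \<Rightarrow> 'w \<Rightarrow> nat \<times> nat \<times> nat \<Rightarrow> complex" where
  "gvec d g I w = (\<lambda>(n, i, j)\<in>I. complex_of_real (sqrt (real (d n))) * g n w $$ (i, j))"

lemma gvec_distr:
  assumes P: "prob_space P" and g: "gaussian_matrices P d g"
    and I: "I \<noteq> {}" "I \<subseteq> {(n, i, j). i < d n \<and> j < d n}"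
  shows "gvec d g I \<in> measurable P (gspace I)" and "distr P (gspace I) (gvec d g I) = gspace I"
proof -
  interpret prob_space P by fact
  let ?X = "\<lambda>(n, i, j) w. complex_of_real (sqrt (real (d n))) * g n w $$ (i, j)"
  have X: "?X p \<in> borel_measurable P" "distr P borel (?X p) = cgauss" if "p \<in> I" for p
    using std_complex_gaussian_distr[OF P] g I that unfolding gaussian_matrices_def by force+
  have eq: "gvec d g I = (\<lambda>w. \<lambda>p\<in>I. ?X p w)" by (auto simp: gvec_def fun_eq_iff restrict_def)
  show "gvec d g I \<in> measurable P (gspace I)"
    unfolding eq using X by (intro measurable_restrict) (simp cong: measurable_cong_sets)
  have ind: "indep_vars (\<lambda>_. borel) ?X I"
    using g I(2) unfolding gaussian_matrices_def by (blast intro: indep_vars_subset)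
  have "distr P (\<Pi>\<^sub>M p\<in>I. borel) (\<lambda>w. \<lambda>p\<in>I. ?X p w) = (\<Pi>\<^sub>M p\<in>I. distr P borel (?X p))"
    using indep_vars_iff_distr_eq_PiM'[OF I(1), where M'="\<lambda>_. borel" and X="?X"] X(1) ind by simp
  also have "\<dots> = gspace I" using X(2) by (intro PiM_cong) auto
  also have "distr P (\<Pi>\<^sub>M p\<in>I. borel) (\<lambda>w. \<lambda>p\<in>I. ?X p w) = distr P (gspace I) (gvec d g I)"
    unfolding eq by (intro distr_cong refl sets_PiM_cong) auto
  finally show "distr P (gspace I) (gvec d g I) = gspace I" .
qed

text \<open>The essential supremum exceeds \<open>y\<close> exactly if the set where
  \<open>f w\<close> exceeds \<open>y\<close> has positive measure, and the measure of a section
  depends measurably on \<open>w\<close>.\<close>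

lemma measurable_esssup:
  fixes f :: "'a \<Rightarrow> 't \<Rightarrow> ennreal"
  assumes m: "sigma_finite_measure M" and f [measurable]: "case_prod f \<in> borel_measurable (N \<Otimes>\<^sub>M M)"
  shows "(\<lambda>w. esssup M (f w)) \<in> borel_measurable N"
proof (rule borel_measurableI_greater)
  fix y :: ennreal
  interpret sigma_finite_measure M by fact
  let ?Q = "{p \<in> space (N \<Otimes>\<^sub>M M). y < case_prod f p}"
  have Q: "?Q \<in> sets (N \<Otimes>\<^sub>M M)" by measurable
  have m: "(\<lambda>w. emeasure M (Pair w -` ?Q)) \<in> borel_measurable N" by (rule measurable_emeasure_Pair[OF Q])
  have "y < esssup M (f w) \<longleftrightarrow> 0 < emeasure M (Pair w -` ?Q)" if w: "w \<in> space N" for w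
  proof -
    have fw: "f w \<in> borel_measurable M" using measurable_Pair2[OF f w] by simp
    have eq: "Pair w -` ?Q = {t \<in> space M. y < f w t}" using w by (auto simp: space_pair_measure)
    show ?thesis unfolding eq
    proof
      assume "y < esssup M (f w)"
      then show "0 < emeasure M {t \<in> space M. y < f w t}" by (rule esssup_pos_measure[OF fw])
    next
      assume p: "0 < emeasure M {t \<in> space M. y < f w t}"
      show "y < esssup M (f w)"
      proof (rule ccontr)
        assume "\<not> y < esssup M (f w)"
        then have "AE t in M. f w t \<le> y" using esssup_AE[of "f w" M] by (auto elim!: eventually_mono)
        then have "AE t in M. \<not> y < f w t" by (auto elim!: eventually_mono)
        then have "emeasure M {t \<in> space M. y < f w t} = 0"
          using fw by (subst (asm) AE_iff_measurable[OF _ refl]) auto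
        then show False using p by simp
      qed
    qed
  qed
  then have "{w \<in> space N. y < esssup M (f w)} = {w \<in> space N. 0 < emeasure M (Pair w -` ?Q)}" by blast
  also have "\<dots> \<in> sets N" using m by measurable
  finally show "{w \<in> space N. y < esssup M (f w)} \<in> sets N" .
qed

text \<open>A measurable family in the unit ball of \<open>L_1\<close>. The conditions hold for
  every \<open>w\<close>, also outside \<open>space N\<close>, so that averages against the kernel
  are bounded at every point, as \<open>bdd_meas\<close> demands.\<close>

definition unit_kernel :: "'a measure \<Rightarrow> 't measure \<Rightarrow> ('a \<Rightarrow> 't \<Rightarrow> complex) \<Rightarrow> bool" where
  "unit_kernel N M \<beta> \<longleftrightarrow> case_prod \<beta> \<in> borel_measurable (N \<Otimes>\<^sub>M M) \<and>
     (\<forall>w. integrable M (\<beta> w) \<and> (\<integral>t. cmod (\<beta> w t) \<partial>M) \<le> 1)"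

text \<open>Normalised indicators of the sets where \<open>\<bar>h w t\<bar>\<close> exceeds half of its essential supremum
  almost attain the norm of \<open>h\<close> in \<open>L\<^sub>1(L\<^sub>\<infinity>)\<close>.\<close>

lemma unit_kernel_norming:
  assumes N: "prob_space N" and M: "prob_space M"
    and h [measurable]: "case_prod h \<in> borel_measurable (N \<Otimes>\<^sub>M M)"
    and B: "integrable N B" and hB: "\<And>w. w \<in> space N \<Longrightarrow> AE t in M. cmod (h w t) \<le> B w"
  shows "(\<lambda>w. Linf_norm M (h w)) \<in> borel_measurable N"
    and "\<exists>\<beta>. unit_kernel N M \<beta> \<and>
      (\<integral>\<^sup>+w. Linf_norm M (h w) \<partial>N) \<le> 2 * ennreal (Re (\<integral>w. (\<integral>t. \<beta> w t * h w t \<partial>M) \<partial>N))"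
proof -
  interpret N: prob_space N by fact
  interpret M: prob_space M by fact
  have [measurable]: "B \<in> borel_measurable N" using B by simp
  show Lm [measurable]: "(\<lambda>w. Linf_norm M (h w)) \<in> borel_measurable N"
    unfolding Linf_norm_def by (rule measurable_esssup) (auto intro: M.sigma_finite_measure_axioms)
  define s where "s w = enn2real (Linf_norm M (h w))" for w
  have [measurable]: "s \<in> borel_measurable N" unfolding s_def by measurable
  have s0: "s w \<ge> 0" for w by (simp add: s_def)
  have hw: "h w \<in> borel_measurable M" if "w \<in> space N" for w using measurable_Pair2[OF h that] by simp
  have B0: "B w \<ge> 0" if w: "w \<in> space N" for w
  proof (rule ccontr)
    assume "\<not> 0 \<le> B w"
    have "AE t in M. False" using hB[OF w]
    proof eventually_elim
      case (elim t)
      then show ?case using \<open>\<not> 0 \<le> B w\<close> norm_ge_zero[of "h w t"] by linarith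
    qed
    then show False by simp
  qed
  have Lle: "Linf_norm M (h w) \<le> ennreal (B w)" if w: "w \<in> space N" for w
    unfolding Linf_norm_def using hw[OF w] hB[OF w] B0[OF w] by (intro esssup_I) (auto elim!: eventually_mono intro!: ennreal_leI)
  have Ls: "Linf_norm M (h w) = ennreal (s w)" if w: "w \<in> space N" for w
    using le_less_trans[OF Lle[OF w] ennreal_less_top] unfolding s_def by simp
  have sB: "s w \<le> B w" if "w \<in> space N" for w
    using Lle[OF that] Ls[OF that] B0[OF that] by simp
  have hs: "AE t in M. cmod (h w t) \<le> s w" if w: "w \<in> space N" for w
    using esssup_AE[of "\<lambda>t. ennreal (cmod (h w t))" M] Ls[OF w] s0[of w] unfolding Linf_norm_def[symmetric]
    by (auto elim!: eventually_mono)
  let ?E = "\<lambda>w. {t \<in> space M. s w / 2 < cmod (h w t)}"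
  have Em: "?E w \<in> sets M" if "w \<in> space N" for w using hw[OF that] by measurable
  define p where "p w = measure M (?E w)" for w
  have pm [measurable]: "p \<in> borel_measurable N"
  proof -
    let ?Q = "{q \<in> space (N \<Otimes>\<^sub>M M). s (fst q) / 2 < cmod (h (fst q) (snd q))}"
    have "?Q \<in> sets (N \<Otimes>\<^sub>M M)" by measurable
    then have "(\<lambda>w. enn2real (emeasure M (Pair w -` ?Q))) \<in> borel_measurable N"
      by (intro borel_measurable_enn2real M.measurable_emeasure_Pair)
    moreover have "enn2real (emeasure M (Pair w -` ?Q)) = p w" if "w \<in> space N" for w
      unfolding p_def measure_def using that by (intro arg_cong[where f="\<lambda>A. enn2real (emeasure M A)"]) (auto simp: space_pair_measure)
    ultimately show ?thesis by (subst (asm) measurable_cong) auto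
  qed
  have p0: "p w \<ge> 0" for w by (simp add: p_def)
  have ppos: "p w > 0" if w: "w \<in> space N" and "s w > 0" for w
  proof -
    have "ennreal (s w / 2) < Linf_norm M (h w)" using Ls[OF w] that by (simp add: ennreal_less_iff)
    then have "0 < emeasure M {t \<in> space M. ennreal (s w / 2) < ennreal (cmod (h w t))}"
      unfolding Linf_norm_def using hw[OF w] by (intro esssup_pos_measure) auto
    then show ?thesis using that s0[of w] unfolding p_def
      by (simp add: ennreal_less_iff M.emeasure_eq_measure)
  qed
  \<comment> \<open>Conjugate phase of \<open>h\<close> times the normalised indicator of the set
    \<open>?E w\<close>. If \<open>p w = 0\<close>, division by zero gives the kernel 0; by
    \<open>ppos\<close> this happens only for \<open>s w = 0\<close>, where nothing has to be
    attained.\<close>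
  define \<beta> where "\<beta> w t = (if w \<in> space N then cnj (sgn (h w t)) * complex_of_real (indicator (?E w) t / p w) else 0)" for w t
  have sgm: "(\<lambda>x. sgn (f x)) \<in> borel_measurable L" if "f \<in> borel_measurable L" for f :: "'x \<Rightarrow> complex" and L
    using that unfolding sgn_div_norm by measurable
  have \<beta>m: "case_prod \<beta> \<in> borel_measurable (N \<Otimes>\<^sub>M M)"
  proof -
    have [measurable]: "(\<lambda>q. sgn (h (fst q) (snd q))) \<in> borel_measurable (N \<Otimes>\<^sub>M M)"
      by (intro sgm) measurable
    have "(\<lambda>q. cnj (sgn (h (fst q) (snd q))) * complex_of_real ((if s (fst q) / 2 < cmod (h (fst q) (snd q)) then 1 else 0) / p (fst q))) \<in> borel_measurable (N \<Otimes>\<^sub>M M)"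
      by measurable
    then show ?thesis
      by (rule measurable_cong[THEN iffD1, rotated]) (auto simp: \<beta>_def space_pair_measure indicator_def)
  qed
  have \<beta>w: "\<beta> w \<in> borel_measurable M" for w
  proof (cases "w \<in> space N")
    case True then show ?thesis using measurable_Pair2[OF \<beta>m True] by simp
  qed (simp add: \<beta>_def[abs_def])
  have \<beta>le: "cmod (\<beta> w t) \<le> indicator (?E w) t / p w" for w t
  proof -
    have "cmod (sgn (h w t)) \<le> 1" by (simp add: norm_sgn)
    then show ?thesis using p0[of w] by (auto simp: \<beta>_def norm_mult norm_divide indicator_def intro!: divide_right_mono)
  qed
  have iE: "integrable M (\<lambda>t. indicator (?E w) t / p w)" "(\<integral>t. indicator (?E w) t / p w \<partial>M) \<le> 1" if w: "w \<in> space N" for w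
  proof -
    show "integrable M (\<lambda>t. indicator (?E w) t / p w)" unfolding divide_inverse using Em[OF w]
      by (intro integrable_mult_left integrable_real_indicator) (auto simp: M.emeasure_eq_measure)
    have "(\<integral>t. indicator (?E w) t / p w \<partial>M) = p w / p w" using Em[OF w] by (simp add: p_def)
    then show "(\<integral>t. indicator (?E w) t / p w \<partial>M) \<le> 1" by simp
  qed
  have u1: "integrable M (\<beta> w) \<and> (\<integral>t. cmod (\<beta> w t) \<partial>M) \<le> 1" for w
  proof (cases "w \<in> space N")
    case True
    have i: "integrable M (\<beta> w)"
      by (rule Bochner_Integration.integrable_bound[OF iE(1)[OF True] \<beta>w]) (use \<beta>le p0 in \<open>auto intro!: AE_I2\<close>)
    have "(\<integral>t. cmod (\<beta> w t) \<partial>M) \<le> (\<integral>t. indicator (?E w) t / p w \<partial>M)"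
      using i iE(1)[OF True] \<beta>le by (intro integral_mono integrable_norm)
    then show ?thesis using i iE(2)[OF True] by linarith
  qed (simp add: \<beta>_def[abs_def])
  have \<beta>h: "\<beta> w t * h w t = complex_of_real (cmod (h w t) * (indicator (?E w) t / p w))" if "w \<in> space N" for w t
  proof -
    have "cnj (sgn z) * z = complex_of_real (cmod z)" for z :: complex
    proof (cases "z = 0")
      case False
      have "cnj (sgn z) * z = (z * cnj z) / complex_of_real (cmod z)"
        by (simp add: sgn_eq)
      also have "\<dots> = complex_of_real ((cmod z)\<^sup>2) / complex_of_real (cmod z)" by (simp only: complex_norm_square)
      finally show ?thesis using False by (simp add: power2_eq_square)
    qed simp
    then show ?thesis using that by (simp add: \<beta>_def mult_ac)
  qed
  define f where "f w = (\<integral>t. cmod (h w t) * (indicator (?E w) t / p w) \<partial>M)" for w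
  have f: "(\<integral>t. \<beta> w t * h w t \<partial>M) = complex_of_real (f w)" if "w \<in> space N" for w
    unfolding \<beta>h[OF that] f_def by (rule integral_complex_of_real)
  have fi: "integrable M (\<lambda>t. cmod (h w t) * (indicator (?E w) t / p w))" if w: "w \<in> space N" for w
  proof (rule Bochner_Integration.integrable_bound[OF integrable_mult_right[OF iE(1)[OF w], of "B w"]])
    show "(\<lambda>t. cmod (h w t) * (indicator (?E w) t / p w)) \<in> borel_measurable M"
      using hw[OF w] Em[OF w] by measurable
    show "AE t in M. norm (cmod (h w t) * (indicator (?E w) t / p w)) \<le> norm (B w * (indicator (?E w) t / p w))"
      using hB[OF w] by eventually_elim (use B0[OF w] p0[of w] in \<open>auto simp: indicator_def divide_right_mono\<close>)
  qed
  have fB: "f w \<le> B w" and f0: "f w \<ge> 0" if w: "w \<in> space N" for w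
  proof -
    have "f w \<le> (\<integral>t. B w * (indicator (?E w) t / p w) \<partial>M)"
      unfolding f_def
    proof (rule integral_mono_AE[OF fi[OF w] integrable_mult_right[OF iE(1)[OF w]]])
      show "AE t in M. cmod (h w t) * (indicator (?E w) t / p w) \<le> B w * (indicator (?E w) t / p w)"
        using hB[OF w] by eventually_elim (use p0[of w] in \<open>auto simp: indicator_def divide_right_mono\<close>)
    qed
    also have "\<dots> = B w * (\<integral>t. indicator (?E w) t / p w \<partial>M)" by (rule integral_mult_right_zero)
    also have "\<dots> \<le> B w * 1" using B0[OF w] iE(2)[OF w] by (intro mult_left_mono)
    finally show "f w \<le> B w" by simp
    show "f w \<ge> 0" unfolding f_def using p0 by (intro integral_nonneg_AE) (auto simp: indicator_def)
  qed
  \<comment> \<open>On \<open>?E w\<close> the modulus of \<open>h\<close> is at least half of its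
    essential supremum; this is the loss of the factor 2.\<close>
  have sf: "s w / 2 \<le> f w" if w: "w \<in> space N" for w
  proof (cases "s w > 0")
    case True
    have "s w / 2 = (\<integral>t. s w / 2 * (indicator (?E w) t / p w) \<partial>M)"
      using Em[OF w] ppos[OF w True] by (simp add: p_def)
    also have "\<dots> \<le> f w" unfolding f_def
    proof (intro integral_mono fi[OF w] integrable_mult_right iE(1)[OF w])
      fix t
      show "s w / 2 * (indicator (?E w) t / p w) \<le> cmod (h w t) * (indicator (?E w) t / p w)"
      proof (cases "t \<in> ?E w")
        case True
        then have "s w / 2 \<le> cmod (h w t)" by simp
        then show ?thesis by (rule mult_right_mono) (simp add: p0)
      qed simp
    qed
    finally show ?thesis .
  next
    case False
    then show ?thesis using s0[of w] f0[OF w] by linarith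
  qed
  have fm [measurable]: "f \<in> borel_measurable N"
  proof -
    have "(\<lambda>w. \<integral>t. \<beta> w t * h w t \<partial>M) \<in> borel_measurable N"
      using \<beta>m by measurable
    then have "(\<lambda>w. Re (\<integral>t. \<beta> w t * h w t \<partial>M)) \<in> borel_measurable N" by measurable
    then show ?thesis by (rule measurable_cong[THEN iffD1, rotated]) (simp add: f)
  qed
  have fint: "integrable N f"
    by (rule Bochner_Integration.integrable_bound[OF B fm]) (use fB f0 in \<open>auto intro!: AE_I2 intro: order_trans[OF _ abs_ge_self]\<close>)
  have sint: "integrable N s"
    by (rule Bochner_Integration.integrable_bound[OF B]) (use sB s0 in \<open>auto intro!: AE_I2 intro: order_trans[OF _ abs_ge_self]\<close>)
  have "(\<integral>\<^sup>+w. Linf_norm M (h w) \<partial>N) = (\<integral>\<^sup>+w. ennreal (s w) \<partial>N)"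
    using Ls by (intro nn_integral_cong) auto
  also have "\<dots> = ennreal (\<integral>w. s w \<partial>N)" using sint s0 by (intro nn_integral_eq_integral) auto
  also have "(\<integral>w. s w \<partial>N) \<le> (\<integral>w. 2 * f w \<partial>N)"
    using sint fint by (intro integral_mono_AE AE_I2) (use sf in \<open>auto simp: field_simps\<close>)
  also have "ennreal (\<integral>w. 2 * f w \<partial>N) = 2 * ennreal (\<integral>w. f w \<partial>N)"
    by (simp add: ennreal_mult')
  also have "(\<integral>w. f w \<partial>N) = Re (\<integral>w. (\<integral>t. \<beta> w t * h w t \<partial>M) \<partial>N)"
  proof -
    have "(\<integral>w. (\<integral>t. \<beta> w t * h w t \<partial>M) \<partial>N) = (\<integral>w. complex_of_real (f w) \<partial>N)"
      by (intro Bochner_Integration.integral_cong refl f)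
    then show ?thesis by simp
  qed
  finally have "(\<integral>\<^sup>+w. Linf_norm M (h w) \<partial>N) \<le> 2 * ennreal (Re (\<integral>w. (\<integral>t. \<beta> w t * h w t \<partial>M) \<partial>N))"
    by (simp add: ennreal_leI)
  then show "\<exists>\<beta>. unit_kernel N M \<beta> \<and>
      (\<integral>\<^sup>+w. Linf_norm M (h w) \<partial>N) \<le> 2 * ennreal (Re (\<integral>w. (\<integral>t. \<beta> w t * h w t \<partial>M) \<partial>N))"
    using \<beta>m u1 unfolding unit_kernel_def by blast
qed

section \<open>Averages of matrix systems against kernels, and the Sidon property in dual
  form\<close>

definition bounded_system :: "'s measure \<Rightarrow> (nat \<Rightarrow> nat) \<Rightarrow> real \<Rightarrow> (nat \<Rightarrow> 's \<Rightarrow> nat \<Rightarrow> nat \<Rightarrow> complex) \<Rightarrow> bool" where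
  "bounded_system M d K F \<longleftrightarrow> (\<forall>n i j. i < d n \<longrightarrow> j < d n \<longrightarrow> (\<lambda>s. F n s i j) \<in> borel_measurable M) \<and>
     (AE s in M. \<forall>n. op_bounded (d n) K (F n s))"

lemma bounded_system_measurable: "bounded_system M d K F \<Longrightarrow> i < d n \<Longrightarrow> j < d n \<Longrightarrow> (\<lambda>s. F n s i j) \<in> borel_measurable M"
  by (simp add: bounded_system_def)

lemma op_bounded_entry:
  assumes A: "op_bounded n K A" and ij: "i < n" "j < n"
  shows "cmod (A i j) \<le> K"
proof -
  have n1: "vnorm n (\<lambda>k. if k = a then 1 else 0) = 1" if "a < n" for a
  proof -
    have "(\<Sum>k<n. (cmod (if k = a then 1 else 0))\<^sup>2) = (\<Sum>k<n. if k = a then 1 else 0)"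
      by (intro sum.cong) auto
    then show ?thesis using that by (simp add: vnorm_def)
  qed
  have "(\<Sum>a<n. \<Sum>b<n. (if a = i then 1 else 0) * A a b * (if b = j then 1 else 0)) = (\<Sum>a<n. if a = i then (\<Sum>b<n. if b = j then A a b else 0) else 0)"
  proof (rule sum.cong[OF refl])
    fix a
    have "(\<Sum>b<n. (if a = i then 1 else 0) * A a b * (if b = j then 1 else 0)) = (\<Sum>b<n. if a = i then (if b = j then A a b else 0) else 0)"
      by (intro sum.cong) auto
    then show "(\<Sum>b<n. (if a = i then 1 else 0) * A a b * (if b = j then 1 else 0)) = (if a = i then (\<Sum>b<n. if b = j then A a b else 0) else 0)"
      by (cases "a = i") (simp_all only: simp_thms if_True if_False sum.neutral_const)
  qed
  also have "\<dots> = A i j" by (simp only: sum.delta[OF finite_lessThan] lessThan_iff ij if_True)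
  finally show ?thesis
    using op_boundedD[OF A, of "\<lambda>k. if k = i then 1 else 0" "\<lambda>k. if k = j then 1 else 0"] n1[OF ij(1)] n1[OF ij(2)] by simp
qed

lemma bounded_system_entry: "bounded_system M d K F \<Longrightarrow> i < d n \<Longrightarrow> j < d n \<Longrightarrow> AE s in M. cmod (F n s i j) \<le> K"
  unfolding bounded_system_def by (elim conjE) (auto elim!: eventually_mono intro: op_bounded_entry)

definition kcoef :: "'t measure \<Rightarrow> ('a \<Rightarrow> 't \<Rightarrow> complex) \<Rightarrow> (nat \<Rightarrow> 't \<Rightarrow> nat \<Rightarrow> nat \<Rightarrow> complex) \<Rightarrow> nat \<Rightarrow> nat \<Rightarrow> nat \<Rightarrow> 'a \<Rightarrow> complex" where
  "kcoef M \<beta> F n i j w = (\<integral>t. \<beta> w t * F n t i j \<partial>M)"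

lemma unit_kernel_measurable: "unit_kernel N M \<beta> \<Longrightarrow> case_prod \<beta> \<in> borel_measurable (N \<Otimes>\<^sub>M M)"
  by (simp add: unit_kernel_def)

lemma unit_kernel_integrable: "unit_kernel N M \<beta> \<Longrightarrow> integrable M (\<beta> w)"
  by (simp add: unit_kernel_def)

lemma unit_kernel_mult_integrable:
  assumes \<beta>: "unit_kernel N M \<beta>" and f [measurable]: "f \<in> borel_measurable M" and c: "AE t in M. cmod (f t) \<le> c"
  shows "integrable M (\<lambda>t. \<beta> w t * f t)"
proof (rule Bochner_Integration.integrable_bound[OF integrable_mult_left[OF integrable_norm[OF unit_kernel_integrable[OF \<beta>, of w]], of c]])
  have [measurable]: "\<beta> w \<in> borel_measurable M" using unit_kernel_integrable[OF \<beta>, of w] by simp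
  show "(\<lambda>t. \<beta> w t * f t) \<in> borel_measurable M" by measurable
  show "AE t in M. norm (\<beta> w t * f t) \<le> norm (norm (\<beta> w t) * c)"
    using c by eventually_elim (auto simp: norm_mult abs_mult intro!: mult_left_mono)
qed

lemma unit_kernel_bound:
  assumes \<beta>: "unit_kernel N M \<beta>" and c: "AE t in M. cmod (f t) \<le> c" and c0: "0 \<le> c"
  shows "cmod (\<integral>t. \<beta> w t * f t \<partial>M) \<le> c"
proof (cases "integrable M (\<lambda>t. \<beta> w t * f t)")
  case True
  have "cmod (\<integral>t. \<beta> w t * f t \<partial>M) \<le> (\<integral>t. cmod (\<beta> w t * f t) \<partial>M)" by (rule integral_norm_bound)
  also have "\<dots> \<le> (\<integral>t. cmod (\<beta> w t) * c \<partial>M)"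
  proof (rule integral_mono_AE[OF integrable_norm[OF True] integrable_mult_left[OF integrable_norm[OF unit_kernel_integrable[OF \<beta>]]]])
    show "AE t in M. cmod (\<beta> w t * f t) \<le> cmod (\<beta> w t) * c"
      using c by eventually_elim (auto simp: norm_mult intro!: mult_left_mono)
  qed
  also have "\<dots> = (\<integral>t. cmod (\<beta> w t) \<partial>M) * c" by simp
  also have "\<dots> \<le> 1 * c" using \<beta> c0 unfolding unit_kernel_def by (intro mult_right_mono) auto
  finally show ?thesis by simp
qed (use c0 in \<open>simp add: not_integrable_integral_eq\<close>)

lemma kcoef_integrable:
  assumes "unit_kernel N M \<beta>" "bounded_system M d K F" "i < d n" "j < d n"
  shows "integrable M (\<lambda>t. \<beta> w t * F n t i j)"
  by (rule unit_kernel_mult_integrable[OF assms(1) bounded_system_measurable[OF assms(2-4)] bounded_system_entry[OF assms(2-4)]])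

lemma kcoef_bdd_meas:
  assumes M: "prob_space M" and \<beta>: "unit_kernel N M \<beta>" and F: "bounded_system M d K F" and K: "0 \<le> K" and ij: "i < d n" "j < d n"
  shows "bdd_meas N (kcoef M \<beta> F n i j)"
proof -
  interpret prob_space M by fact
  have [measurable]: "case_prod \<beta> \<in> borel_measurable (N \<Otimes>\<^sub>M M)" "(\<lambda>t. F n t i j) \<in> borel_measurable M"
    using unit_kernel_measurable[OF \<beta>] bounded_system_measurable[OF F ij] by auto
  have "kcoef M \<beta> F n i j \<in> borel_measurable N" unfolding kcoef_def[abs_def] by measurable
  moreover have "cmod (kcoef M \<beta> F n i j w) \<le> K" for w
    unfolding kcoef_def by (rule unit_kernel_bound[OF \<beta> bounded_system_entry[OF F ij] K])
  ultimately show ?thesis unfolding bdd_meas_def by blast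
qed

text \<open>Testing with fixed vectors turns this into the scalar estimate for a kernel of mass at
  most one.\<close>

lemma kcoef_op_bounded:
  assumes \<beta>: "unit_kernel N M \<beta>" and F: "bounded_system M d K F" and K: "0 \<le> K"
  shows "op_bounded (d n) K (\<lambda>i j. kcoef M \<beta> F n i j w)"
  unfolding op_bounded_def
proof (intro allI)
  fix v u
  have i: "integrable M (\<lambda>t. \<beta> w t * F n t i j)" if "i < d n" "j < d n" for i j
    by (rule kcoef_integrable[OF \<beta> F that])
  have "has_bochner_integral M (\<lambda>t. \<Sum>i<d n. \<Sum>j<d n. v i * (\<beta> w t * F n t i j) * u j) (\<Sum>i<d n. \<Sum>j<d n. v i * kcoef M \<beta> F n i j w * u j)"
    unfolding kcoef_def by (intro has_bochner_integral_sum has_bochner_integral_mult_left has_bochner_integral_mult_right has_bochner_integral_integrable i) auto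
  then have "(\<Sum>i<d n. \<Sum>j<d n. v i * kcoef M \<beta> F n i j w * u j) = (\<integral>t. (\<Sum>i<d n. \<Sum>j<d n. v i * (\<beta> w t * F n t i j) * u j) \<partial>M)"
    by (simp only: has_bochner_integral_iff)
  also have "\<dots> = (\<integral>t. \<beta> w t * (\<Sum>i<d n. \<Sum>j<d n. v i * F n t i j * u j) \<partial>M)"
    by (simp add: sum_distrib_left mult_ac)
  finally have eq: "(\<Sum>i<d n. \<Sum>j<d n. v i * kcoef M \<beta> F n i j w * u j) = (\<integral>t. \<beta> w t * (\<Sum>i<d n. \<Sum>j<d n. v i * F n t i j * u j) \<partial>M)" .
  show "cmod (\<Sum>i<d n. \<Sum>j<d n. v i * kcoef M \<beta> F n i j w * u j) \<le> K * (vnorm (d n) v * vnorm (d n) u)"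
    unfolding eq
  proof (rule unit_kernel_bound[OF \<beta>])
    have "AE t in M. \<forall>n. op_bounded (d n) K (F n t)" using F by (simp add: bounded_system_def)
    then show "AE t in M. cmod (\<Sum>i<d n. \<Sum>j<d n. v i * F n t i j * u j) \<le> K * (vnorm (d n) v * vnorm (d n) u)"
      by eventually_elim (auto intro: op_boundedD)
  qed (use K in simp)
qed

definition entry_index :: "(nat \<Rightarrow> nat) \<Rightarrow> nat set \<Rightarrow> (nat \<times> nat \<times> nat) set" where
  "entry_index d S = (SIGMA n:S. {..<d n} \<times> {..<d n})"

lemma finite_entry_index: "finite S \<Longrightarrow> finite (entry_index d S)"
  by (simp add: entry_index_def)

lemma sum_entry_index: "finite S \<Longrightarrow> (\<Sum>p\<in>entry_index d S. f p) = (\<Sum>n\<in>S. \<Sum>i<d n. \<Sum>j<d n. f (n, i, j))"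
proof -
  assume S: "finite S"
  have "(\<Sum>p\<in>entry_index d S. f p) = (\<Sum>n\<in>S. \<Sum>q\<in>{..<d n} \<times> {..<d n}. f (n, q))"
    unfolding entry_index_def using S by (subst sum.Sigma) (auto simp: case_prod_eta)
  also have "\<dots> = (\<Sum>n\<in>S. \<Sum>i<d n. \<Sum>j<d n. f (n, i, j))"
    by (intro sum.cong refl) (simp add: sum.cartesian_product)
  finally show ?thesis .
qed

text \<open>When \<open>F\<close> holds the entries of \<open>\<psi>\<close>, this is the matrix
  obtained by integrating \<open>\<beta>\<close> times the product of \<open>g_n\<close> and
  \<open>\<psi>_n\<close> over both variables. The trace of \<open>y n\<close> times it is what the
  kernel yields for the test family \<open>y\<close>.\<close>

definition zmat :: "(nat \<Rightarrow> nat) \<Rightarrow> nat set \<Rightarrow> 't measure \<Rightarrow> ((nat \<times> nat \<times> nat \<Rightarrow> complex) \<Rightarrow> 't \<Rightarrow> complex) \<Rightarrow>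
    (nat \<Rightarrow> 't \<Rightarrow> nat \<Rightarrow> nat \<Rightarrow> complex) \<Rightarrow> nat \<Rightarrow> nat \<Rightarrow> nat \<Rightarrow> complex" where
  "zmat d S M \<beta> F n i l = (\<Sum>j<d n. gcoef (entry_index d S) (kcoef M \<beta> F n j l) (n, i, j)) / complex_of_real (sqrt (real (d n)))"

text \<open>Only the Gaussian entries over \<open>S\<close> occur, so the expectation moves from
  \<open>P\<close> to their joint law, the finite-dimensional Gauss space; there
  \<open>unit_kernel_norming\<close> supplies the kernel and the factor 2. The kernel depends on
  \<open>y\<close>.\<close>

lemma sidon_kernel:
  fixes m :: "'t measure" and \<psi> :: "nat \<Rightarrow> 't \<Rightarrow> complex mat"
  defines "F \<equiv> \<lambda>n t i j. \<psi> n t $$ (i, j)"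
  assumes d: "\<And>n. 0 < d n" and m: "prob_space m" and P: "prob_space P" and g: "gaussian_matrices P d g"
    and rm: "\<And>n. random_matrix m (d n) (\<psi> n)"
    and F: "bounded_system m d K F" and K: "0 \<le> K" and C: "0 \<le> C"
    and sidon: "\<And>x. fin_supp_family d x \<Longrightarrow>
        ennreal (\<Sum>n \<in> mat_support d x. real (d n) * trace_norm (x n))
        \<le> ennreal C * (\<integral>\<^sup>+ w. Linf_norm m
             (\<lambda>t. \<Sum>n \<in> mat_support d x. of_nat (d n) * mat_tr (x n * g n w * \<psi> n t)) \<partial>P)"
    and S: "finite S" "S \<noteq> {}" and y: "fin_supp_family d y" "mat_support d y \<subseteq> S"
  shows "\<exists>\<beta>. unit_kernel (gspace (entry_index d S)) m \<beta> \<and>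
     (\<Sum>n \<in> mat_support d y. real (d n) * trace_norm (y n)) \<le>
     2 * C * Re (\<Sum>n\<in>S. of_nat (d n) * (\<Sum>l<d n. \<Sum>i<d n. y n $$ (l, i) * zmat d S m \<beta> F n i l))"
proof -
  interpret m: prob_space m by fact
  interpret P: prob_space P by fact
  define I where "I = entry_index d S"
  let ?G = "gspace I"
  have GP: "prob_space ?G" by (rule prob_space_gspace)
  interpret G: prob_space ?G by (rule GP)
  have I: "finite I" "I \<noteq> {}" "I \<subseteq> {(n, i, j). i < d n \<and> j < d n}"
    using S d by (auto simp: I_def entry_index_def)
  have yc: "y n \<in> carrier_mat (d n) (d n)" for n using y(1) by (simp add: fin_supp_family_def)
  have y0: "y n = 0\<^sub>m (d n) (d n)" if "n \<notin> mat_support d y" for n using that by (simp add: mat_support_def)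
  let ?c = "\<lambda>n. complex_of_real (sqrt (real (d n)))"
  have c0: "?c n \<noteq> 0" for n using d[of n] by simp
  \<comment> \<open>The random function of the Sidon inequality in standard coordinates; dividing by
    \<open>?c n\<close> compensates the factor in \<open>gvec\<close>.\<close>
  define h where "h w t = (\<Sum>n\<in>S. of_nat (d n) * (\<Sum>l<d n. \<Sum>i<d n. \<Sum>j<d n. (y n $$ (l, i) / ?c n) * (w (n, i, j) * F n t j l)))"
    for w :: "nat \<times> nat \<times> nat \<Rightarrow> complex" and t
  have Im: "(n, i, j) \<in> I" if "n \<in> S" "i < d n" "j < d n" for n i j using that by (simp add: I_def entry_index_def)
  have Fm: "(\<lambda>t. F n t i j) \<in> borel_measurable m" if "i < d n" "j < d n" for n i j
    by (rule bounded_system_measurable[where F=F, OF F that])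
  have hm: "case_prod h \<in> borel_measurable (?G \<Otimes>\<^sub>M m)"
  proof -
    have 1: "(\<lambda>p. fst p (n, i, j)) \<in> borel_measurable (?G \<Otimes>\<^sub>M m)" if "n \<in> S" "i < d n" "j < d n" for n i j
      using Im[OF that] by measurable
    have 2: "(\<lambda>p. F n (snd p) i j) \<in> borel_measurable (?G \<Otimes>\<^sub>M m)" if "i < d n" "j < d n" for n i j
      using Fm[OF that] by measurable
    show ?thesis unfolding h_def case_prod_beta'
      by (intro borel_measurable_sum borel_measurable_times borel_measurable_const 1 2) auto
  qed
  define B where "B w = (\<Sum>n\<in>S. real (d n) * (\<Sum>l<d n. \<Sum>i<d n. \<Sum>j<d n. cmod (y n $$ (l, i) / ?c n) * (cmod (w (n, i, j)) * K)))"
    for w :: "nat \<times> nat \<times> nat \<Rightarrow> complex"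
  have wi: "integrable ?G (\<lambda>w. w (n, i, j))" if "n \<in> S" "i < d n" "j < d n" for n i j
    by (rule integrable_gspace_component[OF I(1) Im[OF that]])
  have Bi: "integrable ?G B"
    unfolding B_def using wi by (intro Bochner_Integration.integrable_sum integrable_mult_right integrable_mult_left integrable_norm) auto
  have hB: "AE t in m. cmod (h w t) \<le> B w" for w
  proof -
    have "AE t in m. \<forall>n. op_bounded (d n) K (F n t)" using F by (simp add: bounded_system_def)
    then show ?thesis
    proof eventually_elim
      case (elim t)
      have e: "cmod (F n t j l) \<le> K" if "j < d n" "l < d n" for n j l using op_bounded_entry[OF _ that] elim by blast
      show ?case unfolding h_def B_def
        by (intro sum_norm_le order_trans[OF norm_mult_ineq] mult_mono e)
           (auto intro!: sum_nonneg mult_nonneg_nonneg K sum_norm_le order_trans[OF norm_mult_ineq] mult_mono e)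
    qed
  qed
  note norming = unit_kernel_norming[OF GP m hm Bi hB]
  obtain \<beta> where \<beta>: "unit_kernel ?G m \<beta>"
    and le: "(\<integral>\<^sup>+w. Linf_norm m (h w) \<partial>?G) \<le> 2 * ennreal (Re (\<integral>w. (\<integral>t. \<beta> w t * h w t \<partial>m) \<partial>?G))"
    using norming(2) by blast
  have "(\<integral>\<^sup>+ w. Linf_norm m (\<lambda>t. \<Sum>n \<in> mat_support d y. of_nat (d n) * mat_tr (y n * g n w * \<psi> n t)) \<partial>P)
     = (\<integral>\<^sup>+w. Linf_norm m (h (gvec d g I w)) \<partial>P)"
  proof (rule nn_integral_cong)
    fix w assume w: "w \<in> space P"
    have gc: "g n w \<in> carrier_mat (d n) (d n)" for n
      using g w unfolding gaussian_matrices_def random_matrix_def by blast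
    have eq: "(\<Sum>n \<in> mat_support d y. of_nat (d n) * mat_tr (y n * g n w * \<psi> n t)) = h (gvec d g I w) t" if t: "t \<in> space m" for t
    proof -
      have pc: "\<psi> n t \<in> carrier_mat (d n) (d n)" for n using rm t unfolding random_matrix_def by blast
      have tr: "mat_tr (y n * g n w * \<psi> n t) = (\<Sum>l<d n. \<Sum>i<d n. \<Sum>j<d n. y n $$ (l, i) * (g n w $$ (i, j) * F n t j l))" for n
      proof -
        have e: "(y n * g n w * \<psi> n t) $$ (l, l) = (\<Sum>j<d n. (\<Sum>i<d n. y n $$ (l, i) * g n w $$ (i, j)) * F n t j l)" if l: "l < d n" for l
          unfolding mult_mat_index[OF mult_carrier_mat[OF yc gc] pc l l] F_def
          using mult_mat_index[OF yc gc l] by (intro sum.cong refl) (simp only: lessThan_iff)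
        have "dim_row (y n * g n w * \<psi> n t) = d n" using yc[of n] by simp
        then have "mat_tr (y n * g n w * \<psi> n t) = (\<Sum>l<d n. \<Sum>j<d n. (\<Sum>i<d n. y n $$ (l, i) * g n w $$ (i, j)) * F n t j l)"
          unfolding mat_tr_def using e by (intro sum.cong) auto
        also have "\<dots> = (\<Sum>l<d n. \<Sum>i<d n. \<Sum>j<d n. y n $$ (l, i) * (g n w $$ (i, j) * F n t j l))"
          unfolding sum_distrib_right mult.assoc by (intro sum.cong refl sum.swap)
        finally show ?thesis .
      qed
      have "(\<Sum>n \<in> mat_support d y. of_nat (d n) * mat_tr (y n * g n w * \<psi> n t)) = (\<Sum>n \<in> S. of_nat (d n) * mat_tr (y n * g n w * \<psi> n t))"
      proof (rule sum.mono_neutral_left[OF S(1) y(2)], rule ballI)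
        fix n assume "n \<in> S - mat_support d y"
        then have "y n = 0\<^sub>m (d n) (d n)" using y0 by blast
        then have "mat_tr (y n * g n w * \<psi> n t) = 0" unfolding tr by (intro sum.neutral) auto
        then show "of_nat (d n) * mat_tr (y n * g n w * \<psi> n t) = 0" by simp
      qed
      also have "\<dots> = h (gvec d g I w) t"
      proof -
        have "(\<Sum>l<d n. \<Sum>i<d n. \<Sum>j<d n. y n $$ (l, i) * (g n w $$ (i, j) * F n t j l)) =
          (\<Sum>l<d n. \<Sum>i<d n. \<Sum>j<d n. (y n $$ (l, i) / ?c n) * (gvec d g I w (n, i, j) * F n t j l))" if n: "n \<in> S" for n
        proof (intro sum.cong refl)
          fix l i j assume "i \<in> {..<d n}" "j \<in> {..<d n}"
          then have "gvec d g I w (n, i, j) = ?c n * g n w $$ (i, j)" using Im n by (simp add: gvec_def)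
          then show "y n $$ (l, i) * (g n w $$ (i, j) * F n t j l) = (y n $$ (l, i) / ?c n) * (gvec d g I w (n, i, j) * F n t j l)"
            using c0[of n] by simp
        qed
        then show ?thesis unfolding h_def tr by simp
      qed
      finally show ?thesis .
    qed
    have hw: "h (gvec d g I w) \<in> borel_measurable m"
      using measurable_Pair2[OF hm, of "gvec d g I w"] measurable_space[OF gvec_distr(1)[OF P g I(2,3)] w] by simp
    have "(\<lambda>t. \<Sum>n \<in> mat_support d y. of_nat (d n) * mat_tr (y n * g n w * \<psi> n t)) \<in> borel_measurable m"
      using hw by (rule measurable_cong[THEN iffD1, rotated]) (simp add: eq)
    then show "Linf_norm m (\<lambda>t. \<Sum>n \<in> mat_support d y. of_nat (d n) * mat_tr (y n * g n w * \<psi> n t)) = Linf_norm m (h (gvec d g I w))"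
      unfolding Linf_norm_def using hw by (intro esssup_AE_cong) (auto simp: eq)
  qed
  also have "\<dots> = (\<integral>\<^sup>+w. Linf_norm m (h w) \<partial>?G)"
  proof -
    have "(\<integral>\<^sup>+w. Linf_norm m (h w) \<partial>distr P ?G (gvec d g I)) = (\<integral>\<^sup>+w. Linf_norm m (h (gvec d g I w)) \<partial>P)"
      by (rule nn_integral_distr[OF gvec_distr(1)[OF P g I(2,3)]]) (use norming(1) in simp)
    then show ?thesis unfolding gvec_distr(2)[OF P g I(2,3)] by (rule sym)
  qed
  finally have "ennreal (\<Sum>n \<in> mat_support d y. real (d n) * trace_norm (y n)) \<le> ennreal C * (\<integral>\<^sup>+w. Linf_norm m (h w) \<partial>?G)"
    using sidon[OF y(1)] by simp
  also have "\<dots> \<le> ennreal C * (2 * ennreal (Re (\<integral>w. (\<integral>t. \<beta> w t * h w t \<partial>m) \<partial>?G)))"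
    by (intro mult_left_mono le) simp
  finally have fin: "ennreal (\<Sum>n \<in> mat_support d y. real (d n) * trace_norm (y n)) \<le> ennreal C * (2 * ennreal (Re (\<integral>w. (\<integral>t. \<beta> w t * h w t \<partial>m) \<partial>?G)))" .
  have val: "(\<integral>w. (\<integral>t. \<beta> w t * h w t \<partial>m) \<partial>?G) = (\<Sum>n\<in>S. of_nat (d n) * (\<Sum>l<d n. \<Sum>i<d n. y n $$ (l, i) * zmat d S m \<beta> F n i l))"
  proof -
    have k: "(\<integral>t. \<beta> w t * h w t \<partial>m) = (\<Sum>n\<in>S. of_nat (d n) * (\<Sum>l<d n. \<Sum>i<d n. \<Sum>j<d n. (y n $$ (l, i) / ?c n) * (kcoef m \<beta> F n j l w * w (n, i, j))))" for w
    proof -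
      have "\<beta> w t * h w t = (\<Sum>n\<in>S. of_nat (d n) * (\<Sum>l<d n. \<Sum>i<d n. \<Sum>j<d n. (y n $$ (l, i) / ?c n) * ((\<beta> w t * F n t j l) * w (n, i, j))))" for t
        unfolding h_def sum_distrib_left by (intro sum.cong refl) (simp add: mult_ac)
      moreover have "has_bochner_integral m (\<lambda>t. (\<Sum>n\<in>S. of_nat (d n) * (\<Sum>l<d n. \<Sum>i<d n. \<Sum>j<d n. (y n $$ (l, i) / ?c n) * ((\<beta> w t * F n t j l) * w (n, i, j)))))
        (\<Sum>n\<in>S. of_nat (d n) * (\<Sum>l<d n. \<Sum>i<d n. \<Sum>j<d n. (y n $$ (l, i) / ?c n) * (kcoef m \<beta> F n j l w * w (n, i, j))))"
        unfolding kcoef_def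
        by (intro has_bochner_integral_sum has_bochner_integral_mult_right has_bochner_integral_mult_left has_bochner_integral_integrable
           kcoef_integrable[OF \<beta> F]) auto
      ultimately show ?thesis by (simp only: has_bochner_integral_iff)
    qed
    have gi: "integrable ?G (\<lambda>w. kcoef m \<beta> F n j l w * w (n, i, j))" if "n \<in> S" "i < d n" "j < d n" "l < d n" for n i j l
      by (intro integrable_bdd_mult kcoef_bdd_meas[OF m \<beta> F K] wi that)
    have "has_bochner_integral ?G (\<lambda>w. \<integral>t. \<beta> w t * h w t \<partial>m)
      (\<Sum>n\<in>S. of_nat (d n) * (\<Sum>l<d n. \<Sum>i<d n. \<Sum>j<d n. (y n $$ (l, i) / ?c n) * gcoef I (kcoef m \<beta> F n j l) (n, i, j)))"
      unfolding k gcoef_def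
      by (intro has_bochner_integral_sum has_bochner_integral_mult_right has_bochner_integral_integrable gi) auto
    then have "(\<integral>w. (\<integral>t. \<beta> w t * h w t \<partial>m) \<partial>?G) = (\<Sum>n\<in>S. of_nat (d n) * (\<Sum>l<d n. \<Sum>i<d n. \<Sum>j<d n. (y n $$ (l, i) / ?c n) * gcoef I (kcoef m \<beta> F n j l) (n, i, j)))"
      by (simp only: has_bochner_integral_iff)
    also have "\<dots> = (\<Sum>n\<in>S. of_nat (d n) * (\<Sum>l<d n. \<Sum>i<d n. y n $$ (l, i) * zmat d S m \<beta> F n i l))"
      unfolding zmat_def I_def[symmetric] sum_divide_distrib sum_distrib_left by (intro sum.cong refl) simp
    finally show ?thesis .
  qed
  define R where "R = Re (\<integral>w. (\<integral>t. \<beta> w t * h w t \<partial>m) \<partial>?G)"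
  \<comment> \<open>For negative \<open>R\<close> the coercion to \<open>ennreal\<close> yields 0,
    so the norm of \<open>h\<close> vanishes. Then \<open>h\<close> is 0 almost everywhere and
    \<open>R = 0\<close>, a contradiction.\<close>
  have R0: "(\<Sum>n \<in> mat_support d y. real (d n) * trace_norm (y n)) \<le> 2 * C * R"
  proof (cases "R \<ge> 0")
    case True
    have "ennreal C * (2 * ennreal R) = ennreal (C * (2 * R))"
      using C True by (simp add: ennreal_mult)
    then show ?thesis using fin C True unfolding R_def[symmetric] by (simp add: mult_ac)
  next
    case False
    then have "(\<integral>\<^sup>+w. Linf_norm m (h w) \<partial>?G) = 0" using le by (simp add: R_def[symmetric] ennreal_neg)
    then have "AE w in ?G. Linf_norm m (h w) = 0" using norming(1) by (simp add: nn_integral_0_iff_AE)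
    have hz: "AE w in ?G. (\<integral>t. \<beta> w t * h w t \<partial>m) = 0"
      using \<open>AE w in ?G. Linf_norm m (h w) = 0\<close>
    proof eventually_elim
      case (elim w)
      have "AE t in m. ennreal (cmod (h w t)) \<le> 0"
        using esssup_AE[of "\<lambda>t. ennreal (cmod (h w t))" m] elim by (simp add: Linf_norm_def)
      then have "AE t in m. cmod (h w t) \<le> 0" by (auto elim!: eventually_mono simp: ennreal_eq_0_iff)
      then have "cmod (\<integral>t. \<beta> w t * h w t \<partial>m) \<le> 0" by (intro unit_kernel_bound[OF \<beta>]) auto
      then show ?case by simp
    qed
    have "(\<integral>w. (\<integral>t. \<beta> w t * h w t \<partial>m) \<partial>?G) = 0"
      using hz by (rule integral_eq_zero_AE)
    then show ?thesis using False by (simp add: R_def)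
  qed
  then have "(\<Sum>n \<in> mat_support d y. real (d n) * trace_norm (y n)) \<le>
     2 * C * Re (\<Sum>n\<in>S. of_nat (d n) * (\<Sum>l<d n. \<Sum>i<d n. y n $$ (l, i) * zmat d S m \<beta> F n i l))"
    unfolding R_def val .
  with \<beta>[unfolded I_def] show ?thesis by (intro exI[of _ \<beta>] conjI)
qed

section \<open>The coupled bilinear form\<close>

text \<open>On each block this maps a matrix \<open>w\<close> to the product of \<open>c1\<close>,
  the transpose of \<open>w\<close>, and \<open>c2\<close>. The transposition makes each Gaussian
  entry meet the transposed entry of the system, which is what the traces of \<open>zmat\<close>
  require.\<close>

definition tensor_op :: "(nat \<Rightarrow> nat \<Rightarrow> nat \<Rightarrow> complex) \<Rightarrow> (nat \<Rightarrow> nat \<Rightarrow> nat \<Rightarrow> complex) \<Rightarrow>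
    nat \<times> nat \<times> nat \<Rightarrow> nat \<times> nat \<times> nat \<Rightarrow> complex" where
  "tensor_op c1 c2 = (\<lambda>(n, i, q) (n', j, l). if n = n' then c1 n i l * c2 n j q else 0)"

text \<open>The sum over a block factors into a sum over a column of one matrix and a sum over a row
  of the other, each given by unitarity.\<close>

lemma unitary_on_tensor_op:
  assumes S: "finite S" and c1: "\<And>n. n \<in> S \<Longrightarrow> orth (d n) (c1 n)" and c2: "\<And>n. n \<in> S \<Longrightarrow> orth (d n) (c2 n)"
  shows "unitary_on (entry_index d S) (tensor_op c1 c2)"
  unfolding unitary_on_def
proof (intro conjI ballI)
  fix \<alpha> \<gamma> assume "\<alpha> \<in> entry_index d S" "\<gamma> \<in> entry_index d S"
  then obtain n i q n' i' q' where ag: "\<alpha> = (n, i, q)" "\<gamma> = (n', i', q')"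
    and n: "n \<in> S" "i < d n" "q < d n" and n': "n' \<in> S" "i' < d n'" "q' < d n'"
    by (auto simp: entry_index_def)
  have red: "(\<Sum>k\<in>S. \<Sum>j<d k. \<Sum>l<d k. f k j l) = (\<Sum>j<d n. \<Sum>l<d n. f n j l)" if "\<And>k. k \<noteq> n \<Longrightarrow> (\<Sum>j<d k. \<Sum>l<d k. f k j l) = 0" for f :: "nat \<Rightarrow> nat \<Rightarrow> nat \<Rightarrow> complex"
    using S n(1) that by (subst sum.remove[of _ n]) (auto intro!: sum.neutral)
  show "(\<Sum>k\<in>entry_index d S. tensor_op c1 c2 \<alpha> k * cnj (tensor_op c1 c2 \<gamma> k)) = (if \<alpha> = \<gamma> then 1 else 0)"
  proof -
    have "(\<Sum>k\<in>entry_index d S. tensor_op c1 c2 \<alpha> k * cnj (tensor_op c1 c2 \<gamma> k)) =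
      (\<Sum>k\<in>S. \<Sum>j<d k. \<Sum>l<d k. tensor_op c1 c2 (n, i, q) (k, j, l) * cnj (tensor_op c1 c2 (n', i', q') (k, j, l)))"
      unfolding ag by (rule sum_entry_index[OF S])
    also have "\<dots> = (\<Sum>j<d n. \<Sum>l<d n. tensor_op c1 c2 (n, i, q) (n, j, l) * cnj (tensor_op c1 c2 (n', i', q') (n, j, l)))"
      by (rule red) (simp add: tensor_op_def)
    also have "\<dots> = (if n = n' then (\<Sum>j<d n. c2 n j q * cnj (c2 n j q')) * (\<Sum>l<d n. c1 n i l * cnj (c1 n i' l)) else 0)"
      unfolding sum_product by (auto simp: tensor_op_def mult_ac intro!: sum.cong)
    also have "\<dots> = (if \<alpha> = \<gamma> then 1 else 0)"
      using orthD2[OF c2[OF n(1)] n(3), of q'] orthD1[OF c1[OF n(1)] n(2), of i'] n' by (auto simp: ag)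
    finally show ?thesis .
  qed
  show "(\<Sum>k\<in>entry_index d S. tensor_op c1 c2 k \<alpha> * cnj (tensor_op c1 c2 k \<gamma>)) = (if \<alpha> = \<gamma> then 1 else 0)"
  proof -
    have "(\<Sum>k\<in>entry_index d S. tensor_op c1 c2 k \<alpha> * cnj (tensor_op c1 c2 k \<gamma>)) =
      (\<Sum>k\<in>S. \<Sum>j<d k. \<Sum>l<d k. tensor_op c1 c2 (k, j, l) (n, i, q) * cnj (tensor_op c1 c2 (k, j, l) (n', i', q')))"
      unfolding ag by (rule sum_entry_index[OF S])
    also have "\<dots> = (\<Sum>j<d n. \<Sum>l<d n. tensor_op c1 c2 (n, j, l) (n, i, q) * cnj (tensor_op c1 c2 (n, j, l) (n', i', q')))"
      by (rule red) (simp add: tensor_op_def)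
    also have "\<dots> = (if n = n' then (\<Sum>j<d n. c1 n j q * cnj (c1 n j q')) * (\<Sum>l<d n. c2 n i l * cnj (c2 n i' l)) else 0)"
      by (auto simp: tensor_op_def sum_product mult_ac)
    also have "\<dots> = (if \<alpha> = \<gamma> then 1 else 0)"
      using orthD2[OF c1[OF n(1)] n(3), of q'] orthD1[OF c2[OF n(1)] n(2), of i'] n' by (auto simp: ag)
    finally show ?thesis .
  qed
qed

text \<open>For fixed values of the other variables, \<open>M1\<close> is the product of the first \<open>k - 3\<close> factors and \<open>M2\<close>
  the factor in \<open>t\<^bsub>k-1\<^esub>\<close>; the kernels \<open>\<beta>\<close> and \<open>\<beta>'\<close> belong to \<open>t\<^bsub>k-2\<^esub>\<close> and \<open>t\<^sub>k\<close>.\<close>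

locale coupling = prob_space m for m :: "'t measure" +
  fixes d :: "nat \<Rightarrow> nat" and S :: "nat set" and K K1 K2 :: real
    and F :: "nat \<Rightarrow> 't \<Rightarrow> nat \<Rightarrow> nat \<Rightarrow> complex"
    and \<beta> \<beta>' :: "(nat \<times> nat \<times> nat \<Rightarrow> complex) \<Rightarrow> 't \<Rightarrow> complex"
    and x :: "nat \<Rightarrow> complex mat" and M1 M2 :: "nat \<Rightarrow> nat \<Rightarrow> nat \<Rightarrow> complex"
  assumes S: "finite S" and K: "0 \<le> K" "0 \<le> K1" "0 \<le> K2" and F: "bounded_system m d K F"
    and \<beta>: "unit_kernel (gspace (entry_index d S)) m \<beta>" "unit_kernel (gspace (entry_index d S)) m \<beta>'"
    and x: "\<And>n. x n \<in> carrier_mat (d n) (d n)"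
    and M1: "\<And>n. n \<in> S \<Longrightarrow> op_bounded (d n) K1 (M1 n)" and M2: "\<And>n. n \<in> S \<Longrightarrow> op_bounded (d n) K2 (M2 n)"
begin

abbreviation "I \<equiv> entry_index d S"
abbreviation "G \<equiv> gspace I"

lemma m_prob: "prob_space m" by (rule prob_space_axioms)

definition mid :: "nat \<Rightarrow> nat \<Rightarrow> nat \<Rightarrow> (nat \<times> nat \<times> nat \<Rightarrow> complex) \<Rightarrow> complex" where
  "mid n p c w = (\<Sum>b<d n. (\<Sum>a<d n. M1 n p a * kcoef m \<beta> F n a b w) * M2 n b c)"

text \<open>\<open>lhs\<close> and \<open>rhs\<close> cut the trace at the last factor: the sum of
  their products is the sum of \<open>d_n tr(x_n M1 F M2 F')\<close>, with the averages by
  \<open>\<beta>\<close> and \<open>\<beta>'\<close> in place of the two systems \<open>F\<close>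
  and \<open>F'\<close>.\<close>

definition lhs :: "nat \<times> nat \<times> nat \<Rightarrow> (nat \<times> nat \<times> nat \<Rightarrow> complex) \<Rightarrow> complex" where
  "lhs = (\<lambda>(n, e, c) w. \<Sum>p<d n. (of_nat (d n) * x n $$ (e, p)) * mid n p c w)"

definition rhs :: "nat \<times> nat \<times> nat \<Rightarrow> (nat \<times> nat \<times> nat \<Rightarrow> complex) \<Rightarrow> complex" where
  "rhs = (\<lambda>(n, e, c). kcoef m \<beta>' F n c e)"

definition trf :: "'t \<Rightarrow> 't \<Rightarrow> complex" where
  "trf t t' = (\<Sum>n\<in>S. \<Sum>e<d n. \<Sum>c<d n. (\<Sum>p<d n. (of_nat (d n) * x n $$ (e, p)) *
     (\<Sum>b<d n. (\<Sum>a<d n. M1 n p a * F n t a b) * M2 n b c)) * F n t' c e)"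

lemma kb: "i < d n \<Longrightarrow> j < d n \<Longrightarrow> bdd_meas G (kcoef m \<beta> F n i j)"
  "i < d n \<Longrightarrow> j < d n \<Longrightarrow> bdd_meas G (kcoef m \<beta>' F n i j)"
  by (rule kcoef_bdd_meas[OF m_prob \<beta>(1) F K(1)] kcoef_bdd_meas[OF m_prob \<beta>(2) F K(1)], assumption+)+

lemma mid_bdd: "p < d n \<Longrightarrow> c < d n \<Longrightarrow> bdd_meas G (mid n p c)"
proof -
  assume pc: "p < d n" "c < d n"
  have "bdd_meas G (\<lambda>w. \<Sum>b<d n. M2 n b c * (\<Sum>a<d n. M1 n p a * kcoef m \<beta> F n a b w))"
    by (intro bdd_meas_sum bdd_meas_mult kb) auto
  then show ?thesis unfolding mid_def[abs_def] by (simp add: mult.commute)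
qed

lemma lhs_bdd: "k \<in> I \<Longrightarrow> bdd_meas G (lhs k)"
proof -
  assume "k \<in> I"
  then obtain n e c where k: "k = (n, e, c)" "e < d n" "c < d n" by (auto simp: entry_index_def)
  show "bdd_meas G (lhs k)" unfolding k lhs_def prod.case
    using k by (intro bdd_meas_sum bdd_meas_mult mid_bdd) auto
qed

lemma rhs_bdd: "k \<in> I \<Longrightarrow> bdd_meas G (rhs k)"
proof -
  assume "k \<in> I"
  then obtain n e c where k: "k = (n, e, c)" "e < d n" "c < d n" by (auto simp: entry_index_def)
  show "bdd_meas G (rhs k)" unfolding k rhs_def prod.case by (rule kb(2)[OF k(3,2)])
qed

lemma mid_op_bounded: "n \<in> S \<Longrightarrow> op_bounded (d n) (K1 * K * K2) (\<lambda>p c. mid n p c w)"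
  unfolding mid_def
  by (intro op_bounded_mult M1 M2 kcoef_op_bounded[OF \<beta>(1) F] K mult_nonneg_nonneg)

text \<open>The bound on \<open>trf\<close> is averaged in \<open>t'\<close> against the kernel at
  \<open>w'\<close> and then in \<open>t\<close> against the kernel at \<open>w\<close>, both of
  mass at most one. The outcome holds for all \<open>w\<close> and \<open>w'\<close>, as
  \<open>coupling_form_bound\<close> needs.\<close>

lemma form_bound:
  assumes N: "AE t in m. AE t' in m. cmod (trf t t') \<le> N" and N0: "0 \<le> N"
  shows "cmod (\<Sum>k\<in>I. lhs k w * rhs k w') \<le> N"
proof -
  let ?g = "\<lambda>t. (\<Sum>n\<in>S. \<Sum>e<d n. \<Sum>c<d n. (\<Sum>p<d n. (of_nat (d n) * x n $$ (e, p)) *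
     (\<Sum>b<d n. (\<Sum>a<d n. M1 n p a * F n t a b) * M2 n b c)) * kcoef m \<beta>' F n c e w')"
  have 1: "(\<integral>t'. \<beta>' w' t' * trf t t' \<partial>m) = ?g t" for t
  proof -
    have "\<beta>' w' t' * trf t t' = (\<Sum>n\<in>S. \<Sum>e<d n. \<Sum>c<d n. (\<Sum>p<d n. (of_nat (d n) * x n $$ (e, p)) *
     (\<Sum>b<d n. (\<Sum>a<d n. M1 n p a * F n t a b) * M2 n b c)) * (\<beta>' w' t' * F n t' c e))" for t'
      unfolding trf_def sum_distrib_left[of "\<beta>' w' t'"] by (intro sum.cong refl mult.left_commute)
    moreover have "has_bochner_integral m (\<lambda>t'. (\<Sum>n\<in>S. \<Sum>e<d n. \<Sum>c<d n. (\<Sum>p<d n. (of_nat (d n) * x n $$ (e, p)) *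
     (\<Sum>b<d n. (\<Sum>a<d n. M1 n p a * F n t a b) * M2 n b c)) * (\<beta>' w' t' * F n t' c e))) (?g t)"
      unfolding kcoef_def
      by (intro has_bochner_integral_sum has_bochner_integral_mult_right has_bochner_integral_integrable kcoef_integrable[OF \<beta>(2) F]) auto
    ultimately show ?thesis by (simp only: has_bochner_integral_iff)
  qed
  have 2: "AE t in m. cmod (?g t) \<le> N"
    using N
  proof eventually_elim
    case (elim t)
    show ?case unfolding 1[symmetric] by (rule unit_kernel_bound[OF \<beta>(2) elim N0])
  qed
  have 3: "(\<integral>t. \<beta> w t * ?g t \<partial>m) = (\<Sum>n\<in>S. \<Sum>e<d n. \<Sum>c<d n. lhs (n, e, c) w * rhs (n, e, c) w')"
  proof -
    let ?h = "\<lambda>t. (\<Sum>n\<in>S. \<Sum>e<d n. \<Sum>c<d n. (\<Sum>p<d n. (of_nat (d n) * x n $$ (e, p)) *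
     (\<Sum>b<d n. (\<Sum>a<d n. M1 n p a * (\<beta> w t * F n t a b)) * M2 n b c)) * kcoef m \<beta>' F n c e w')"
    have "\<beta> w t * ?g t = ?h t" for t
      unfolding sum_distrib_left sum_distrib_right by (intro sum.cong refl) (simp only: mult_ac)
    moreover have "has_bochner_integral m ?h (\<Sum>n\<in>S. \<Sum>e<d n. \<Sum>c<d n. (\<Sum>p<d n. (of_nat (d n) * x n $$ (e, p)) *
     (\<Sum>b<d n. (\<Sum>a<d n. M1 n p a * kcoef m \<beta> F n a b w) * M2 n b c)) * kcoef m \<beta>' F n c e w')"
      unfolding kcoef_def[of m \<beta>]
      by (intro has_bochner_integral_sum has_bochner_integral_mult_right has_bochner_integral_mult_left has_bochner_integral_integrable kcoef_integrable[OF \<beta>(1) F]) auto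
    ultimately show ?thesis by (simp only: has_bochner_integral_iff lhs_def rhs_def mid_def prod.case)
  qed
  show ?thesis unfolding sum_entry_index[OF S] 3[symmetric] by (rule unit_kernel_bound[OF \<beta>(1) 2 N0])
qed

text \<open>Estimating each \<open>k\<close> separately would cost a power of \<open>d n\<close>.
  Instead the sum over the inner index \<open>c\<close> is collected in the matrix
  \<open>Y n\<close>. Tested with vectors, it is controlled by \<open>rem_avg_bound\<close> and
  Cauchy-Schwarz over \<open>c\<close>, where only the pointwise operator bounds of
  \<open>mid\<close> and \<open>kcoef\<close> enter. So \<open>Y n\<close> has operator bound
  \<open>L\<close>, and duality with \<open>x n\<close> produces the trace norm.\<close>

lemma remainder_bound:
  assumes U: "unitary_on I U" and r: "0 \<le> r" "r < 1"
  shows "cmod (\<Sum>k\<in>I. rem_avg I U r (lhs k) (rhs k)) \<le> r\<^sup>2 * (K1 * K * K2 * K) * (\<Sum>n\<in>S. real (d n) * trace_norm (x n))"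
proof -
  interpret G: prob_space G by (rule prob_space_gspace)
  have I: "finite I" using S by (rule finite_entry_index)
  define Y where "Y n p e = (\<Sum>c<d n. rem_avg I U r (mid n p c) (kcoef m \<beta>' F n c e))" for n p e
  define L where "L = r\<^sup>2 * (K1 * K * K2 * K)"
  have L0: "0 \<le> L" using K by (simp add: L_def)
  have Y: "op_bounded (d n) L (Y n)" if n: "n \<in> S" for n
    unfolding op_bounded_def
  proof (intro allI)
    fix v u
    let ?a = "\<lambda>c w. \<Sum>p<d n. v p * mid n p c w" and ?b = "\<lambda>c w. \<Sum>e<d n. u e * kcoef m \<beta>' F n c e w"
    have lin: "rem_avg I U r (?a c) (?b c) = (\<Sum>p<d n. \<Sum>e<d n. v p * u e * rem_avg I U r (mid n p c) (kcoef m \<beta>' F n c e))" if "c < d n" for c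
      by (rule rem_avg_linear[OF I U r]) (use that in \<open>auto intro: mid_bdd kb\<close>)
    have "(\<Sum>p<d n. \<Sum>e<d n. v p * Y n p e * u e) = (\<Sum>p<d n. \<Sum>e<d n. \<Sum>c<d n. v p * u e * rem_avg I U r (mid n p c) (kcoef m \<beta>' F n c e))"
      unfolding Y_def sum_distrib_left sum_distrib_right by (intro sum.cong refl) (simp only: mult_ac)
    also have "\<dots> = (\<Sum>c<d n. \<Sum>p<d n. \<Sum>e<d n. v p * u e * rem_avg I U r (mid n p c) (kcoef m \<beta>' F n c e))" by (rule sum_rotate)
    also have "\<dots> = (\<Sum>c<d n. rem_avg I U r (?a c) (?b c))" using lin by simp
    finally have eq: "(\<Sum>p<d n. \<Sum>e<d n. v p * Y n p e * u e) = (\<Sum>c<d n. rem_avg I U r (?a c) (?b c))" .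
    have ab: "bdd_meas G (?a c)" "bdd_meas G (?b c)" if "c < d n" for c
      by (intro bdd_meas_sum bdd_meas_mult mid_bdd kb that; simp)+
    let ?A = "\<lambda>c. sqrt (\<integral>w. (cmod (?a c w))\<^sup>2 \<partial>G)" and ?B = "\<lambda>c. sqrt (\<integral>w. (cmod (?b c w))\<^sup>2 \<partial>G)"
    have "cmod (\<Sum>c<d n. rem_avg I U r (?a c) (?b c)) \<le> (\<Sum>c<d n. r\<^sup>2 * (?A c * ?B c))"
      using ab by (intro sum_norm_le rem_avg_bound[OF I U r]) auto
    also have "\<dots> = r\<^sup>2 * (\<Sum>c<d n. \<bar>?A c\<bar> * \<bar>?B c\<bar>)" by (simp add: sum_distrib_left)
    also have "(\<Sum>c<d n. \<bar>?A c\<bar> * \<bar>?B c\<bar>) \<le> L2_set ?A {..<d n} * L2_set ?B {..<d n}" by (rule L2_set_mult_ineq)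
    also have "L2_set ?A {..<d n} \<le> K1 * K * K2 * vnorm (d n) v"
    proof -
      have "(\<Sum>c<d n. (?A c)\<^sup>2) = (\<integral>w. (\<Sum>c<d n. (cmod (?a c w))\<^sup>2) \<partial>G)"
        using G.bdd_meas_square_integrable[OF ab(1)] by (simp add: Bochner_Integration.integral_sum)
      also have "\<dots> \<le> (\<integral>w. (K1 * K * K2 * vnorm (d n) v)\<^sup>2 \<partial>G)"
      proof (rule integral_mono)
        show "integrable G (\<lambda>w. \<Sum>c<d n. (cmod (?a c w))\<^sup>2)"
          using G.bdd_meas_square_integrable[OF ab(1)] by (intro Bochner_Integration.integrable_sum) auto
        fix w
        have "vnorm (d n) (\<lambda>c. \<Sum>p<d n. mid n p c w * v p) \<le> K1 * K * K2 * vnorm (d n) v"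
          by (rule op_bounded_vnorm[OF op_bounded_transpose[OF mid_op_bounded[OF n]]]) (use K in simp)
        then have "(vnorm (d n) (\<lambda>c. ?a c w))\<^sup>2 \<le> (K1 * K * K2 * vnorm (d n) v)\<^sup>2"
          by (intro power_mono) (simp_all add: mult.commute)
        then show "(\<Sum>c<d n. (cmod (?a c w))\<^sup>2) \<le> (K1 * K * K2 * vnorm (d n) v)\<^sup>2" by (simp add: vnorm_sq)
      qed simp
      also have "\<dots> = (K1 * K * K2 * vnorm (d n) v)\<^sup>2" using G.prob_space by simp
      finally have "L2_set ?A {..<d n} \<le> sqrt ((K1 * K * K2 * vnorm (d n) v)\<^sup>2)"
        unfolding L2_set_def by (rule real_sqrt_le_mono)
      then show ?thesis using K by simp
    qed
    also have "L2_set ?B {..<d n} \<le> K * vnorm (d n) u"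
    proof -
      have "(\<Sum>c<d n. (?B c)\<^sup>2) = (\<integral>w. (\<Sum>c<d n. (cmod (?b c w))\<^sup>2) \<partial>G)"
        using G.bdd_meas_square_integrable[OF ab(2)] by (simp add: Bochner_Integration.integral_sum)
      also have "\<dots> \<le> (\<integral>w. (K * vnorm (d n) u)\<^sup>2 \<partial>G)"
      proof (rule integral_mono)
        show "integrable G (\<lambda>w. \<Sum>c<d n. (cmod (?b c w))\<^sup>2)"
          using G.bdd_meas_square_integrable[OF ab(2)] by (intro Bochner_Integration.integrable_sum) auto
        fix w
        have "vnorm (d n) (\<lambda>c. \<Sum>e<d n. kcoef m \<beta>' F n c e w * u e) \<le> K * vnorm (d n) u"
          by (rule op_bounded_vnorm[OF kcoef_op_bounded[OF \<beta>(2) F K(1)] K(1)])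
        then have "(vnorm (d n) (\<lambda>c. ?b c w))\<^sup>2 \<le> (K * vnorm (d n) u)\<^sup>2"
          by (intro power_mono) (simp_all add: mult.commute)
        then show "(\<Sum>c<d n. (cmod (?b c w))\<^sup>2) \<le> (K * vnorm (d n) u)\<^sup>2" by (simp add: vnorm_sq)
      qed simp
      also have "\<dots> = (K * vnorm (d n) u)\<^sup>2" using G.prob_space by simp
      finally have "L2_set ?B {..<d n} \<le> sqrt ((K * vnorm (d n) u)\<^sup>2)"
        unfolding L2_set_def by (rule real_sqrt_le_mono)
      then show ?thesis using K by simp
    qed
    finally have "cmod (\<Sum>c<d n. rem_avg I U r (?a c) (?b c)) \<le> r\<^sup>2 * (K1 * K * K2 * vnorm (d n) v * (K * vnorm (d n) u))"
      using K by (simp add: mult_left_mono mult_right_mono L2_set_nonneg)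
    then show "cmod (\<Sum>p<d n. \<Sum>e<d n. v p * Y n p e * u e) \<le> L * (vnorm (d n) v * vnorm (d n) u)"
      unfolding eq L_def by (simp add: mult_ac)
  qed
  have rl: "rem_avg I U r (lhs (n, e, c)) (rhs (n, e, c)) = (\<Sum>p<d n. of_nat (d n) * x n $$ (e, p) * rem_avg I U r (mid n p c) (kcoef m \<beta>' F n c e))"
    if "e < d n" "c < d n" for n e c
  proof -
    have "rem_avg I U r (\<lambda>w. \<Sum>p<d n. (of_nat (d n) * x n $$ (e, p)) * mid n p c w) (\<lambda>w. \<Sum>l\<in>{()}. 1 * kcoef m \<beta>' F n c e w) =
      (\<Sum>p<d n. \<Sum>l\<in>{()}. (of_nat (d n) * x n $$ (e, p)) * 1 * rem_avg I U r (mid n p c) (kcoef m \<beta>' F n c e))"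
      by (rule rem_avg_linear[OF I U r]) (use that in \<open>auto intro: mid_bdd kb\<close>)
    then show ?thesis by (simp add: lhs_def rhs_def)
  qed
  have "(\<Sum>k\<in>I. rem_avg I U r (lhs k) (rhs k)) = (\<Sum>n\<in>S. \<Sum>e<d n. \<Sum>c<d n. \<Sum>p<d n. of_nat (d n) * x n $$ (e, p) * rem_avg I U r (mid n p c) (kcoef m \<beta>' F n c e))"
    unfolding sum_entry_index[OF S] using rl by (intro sum.cong refl) simp
  also have "\<dots> = (\<Sum>n\<in>S. of_nat (d n) * (\<Sum>e<d n. \<Sum>p<d n. x n $$ (e, p) * Y n p e))"
  proof (rule sum.cong[OF refl])
    fix n
    have "(\<Sum>e<d n. \<Sum>c<d n. \<Sum>p<d n. of_nat (d n) * x n $$ (e, p) * rem_avg I U r (mid n p c) (kcoef m \<beta>' F n c e)) =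
      (\<Sum>e<d n. \<Sum>p<d n. \<Sum>c<d n. of_nat (d n) * x n $$ (e, p) * rem_avg I U r (mid n p c) (kcoef m \<beta>' F n c e))"
      by (intro sum.cong refl sum.swap)
    then show "(\<Sum>e<d n. \<Sum>c<d n. \<Sum>p<d n. of_nat (d n) * x n $$ (e, p) * rem_avg I U r (mid n p c) (kcoef m \<beta>' F n c e)) =
      of_nat (d n) * (\<Sum>e<d n. \<Sum>p<d n. x n $$ (e, p) * Y n p e)"
      unfolding Y_def sum_distrib_left by (simp only: mult.assoc)
  qed
  finally have "cmod (\<Sum>k\<in>I. rem_avg I U r (lhs k) (rhs k)) \<le> (\<Sum>n\<in>S. real (d n) * (L * trace_norm (x n)))"
    using trace_duality[OF x Y L0] by (simp only:) (intro sum_norm_le, simp add: norm_mult mult_left_mono)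
  also have "\<dots> = L * (\<Sum>n\<in>S. real (d n) * trace_norm (x n))" by (simp add: sum_distrib_left mult_ac)
  finally show ?thesis by (simp add: L_def)
qed

definition wcoef :: "nat \<Rightarrow> nat \<Rightarrow> nat \<Rightarrow> nat \<Rightarrow> nat \<Rightarrow> complex" where
  "wcoef n i l j q = (\<Sum>k\<in>I. gcoef I (lhs k) (n, j, l) * gcoef I (rhs k) (n, i, q))"

text \<open>The first chaos term as a bilinear form in \<open>c1\<close> and \<open>c2\<close>. It
  makes sense for arbitrary matrices, which is what allows the passage from unitaries to
  contractions.\<close>

definition lform :: "(nat \<Rightarrow> nat \<Rightarrow> nat \<Rightarrow> complex) \<Rightarrow> (nat \<Rightarrow> nat \<Rightarrow> nat \<Rightarrow> complex) \<Rightarrow> complex" where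
  "lform c1 c2 = (\<Sum>n\<in>S. \<Sum>i<d n. \<Sum>q<d n. \<Sum>j<d n. \<Sum>l<d n. c1 n i l * c2 n j q * wcoef n i l j q)"

lemma lform_chaos1: "(\<Sum>k\<in>I. chaos1 I (tensor_op c1 c2) (lhs k) (rhs k)) = lform c1 c2"
proof -
  have red: "(\<Sum>n'\<in>S. \<Sum>j<d n'. \<Sum>l<d n'. tensor_op c1 c2 (n, i, q) (n', j, l) * f (n', j, l) * h) =
      (\<Sum>j<d n. \<Sum>l<d n. c1 n i l * c2 n j q * (f (n, j, l) * h))" if n: "n \<in> S" for n i q f h
  proof -
    have "(\<Sum>n'\<in>S. \<Sum>j<d n'. \<Sum>l<d n'. tensor_op c1 c2 (n, i, q) (n', j, l) * f (n', j, l) * h) =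
      (\<Sum>j<d n. \<Sum>l<d n. tensor_op c1 c2 (n, i, q) (n, j, l) * f (n, j, l) * h)"
      using S n by (subst sum.remove[of _ n]) (auto intro!: sum.neutral simp: tensor_op_def)
    then show ?thesis by (simp only: tensor_op_def prod.case if_True simp_thms mult.assoc)
  qed
  have "chaos1 I (tensor_op c1 c2) (lhs k) (rhs k) = (\<Sum>n\<in>S. \<Sum>i<d n. \<Sum>q<d n. \<Sum>j<d n. \<Sum>l<d n.
     c1 n i l * c2 n j q * (gcoef I (lhs k) (n, j, l) * gcoef I (rhs k) (n, i, q)))" for k
    unfolding chaos1_def sum_entry_index[OF S] using red by simp
  then have "(\<Sum>k\<in>I. chaos1 I (tensor_op c1 c2) (lhs k) (rhs k)) = (\<Sum>k\<in>I. \<Sum>n\<in>S. \<Sum>i<d n. \<Sum>q<d n. \<Sum>j<d n. \<Sum>l<d n.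
     c1 n i l * c2 n j q * (gcoef I (lhs k) (n, j, l) * gcoef I (rhs k) (n, i, q)))" by simp
  also have "\<dots> = (\<Sum>n\<in>S. \<Sum>i<d n. \<Sum>q<d n. \<Sum>j<d n. \<Sum>l<d n. \<Sum>k\<in>I.
     c1 n i l * c2 n j q * (gcoef I (lhs k) (n, j, l) * gcoef I (rhs k) (n, i, q)))"
    by (subst sum.swap, intro sum.cong refl, subst sum.swap, intro sum.cong refl, subst sum.swap, intro sum.cong refl,
        subst sum.swap, intro sum.cong refl, rule sum.swap)
  finally show ?thesis unfolding lform_def wcoef_def sum_distrib_left .
qed

lemma lform_unitary:
  assumes N: "AE t in m. AE t' in m. cmod (trf t t') \<le> N" and N0: "0 \<le> N" and r: "0 < r" "r < 1"
    and c1: "\<And>n. n \<in> S \<Longrightarrow> orth (d n) (c1 n)" and c2: "\<And>n. n \<in> S \<Longrightarrow> orth (d n) (c2 n)"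
  shows "r * cmod (lform c1 c2) \<le> N + r\<^sup>2 * (K1 * K * K2 * K) * (\<Sum>n\<in>S. real (d n) * trace_norm (x n))"
proof -
  have U: "unitary_on I (tensor_op c1 c2)" by (rule unitary_on_tensor_op[OF S c1 c2])
  have I: "finite I" using S by (rule finite_entry_index)
  have "r * cmod (\<Sum>k\<in>I. chaos1 I (tensor_op c1 c2) (lhs k) (rhs k)) \<le> N + cmod (\<Sum>k\<in>I. rem_avg I (tensor_op c1 c2) r (lhs k) (rhs k))"
    by (rule chaos1_bound[OF I U r I lhs_bdd rhs_bdd form_bound[OF N N0]])
  also have "\<dots> \<le> N + r\<^sup>2 * (K1 * K * K2 * K) * (\<Sum>n\<in>S. real (d n) * trace_norm (x n))"
    using remainder_bound[OF U, of r] r by (intro add_left_mono) auto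
  finally show ?thesis unfolding lform_chaos1 .
qed

text \<open>Each argument is a positive multiple of half a sum of four unitaries, chosen for every
  \<open>n\<close> with the same labels. Hence 16 terms with weight \<open>L1 * L2 / 4\<close>, and
  the factor \<open>4 * L1 * L2\<close>.\<close>

lemma lform_contraction:
  assumes N: "AE t in m. AE t' in m. cmod (trf t t') \<le> N" and N0: "0 \<le> N" and r: "0 < r" "r < 1"
    and c1: "\<And>n. n \<in> S \<Longrightarrow> op_bounded (d n) L1 (c1 n)" and c2: "\<And>n. n \<in> S \<Longrightarrow> op_bounded (d n) L2 (c2 n)"
    and L: "0 < L1" "0 < L2"
  shows "r * cmod (lform c1 c2) \<le> 4 * L1 * L2 * (N + r\<^sup>2 * (K1 * K * K2 * K) * (\<Sum>n\<in>S. real (d n) * trace_norm (x n)))"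
proof -
  define T where "T = N + r\<^sup>2 * (K1 * K * K2 * K) * (\<Sum>n\<in>S. real (d n) * trace_norm (x n))"
  have dec: "\<exists>V. (\<forall>n\<in>S. \<forall>m<4. orth (d n) (V m n)) \<and> (\<forall>n\<in>S. \<forall>i<d n. \<forall>j<d n. c n i j = complex_of_real L * ((\<Sum>m<(4::nat). V m n i j) / 2))"
    if c: "\<And>n. n \<in> S \<Longrightarrow> op_bounded (d n) L (c n)" and L: "0 < L" for c L
  proof -
    have "\<exists>V. (\<forall>m<4. orth (d n) (V m)) \<and> (\<forall>i<d n. \<forall>j<d n. complex_of_real (1 / L) * c n i j = (\<Sum>m<(4::nat). V m i j) / 2)" if n: "n \<in> S" for n
    proof (rule contraction_unitaries)
      have "op_bounded (d n) (cmod (complex_of_real (1 / L)) * L) (\<lambda>i j. complex_of_real (1 / L) * c n i j)" by (rule op_bounded_scale[OF c[OF n]])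
      then show "op_bounded (d n) 1 (\<lambda>i j. complex_of_real (1 / L) * c n i j)" using L by (simp add: norm_divide)
    qed
    then obtain V where V: "\<And>n. n \<in> S \<Longrightarrow> (\<forall>m<4. orth (d n) (V n m)) \<and> (\<forall>i<d n. \<forall>j<d n. complex_of_real (1 / L) * c n i j = (\<Sum>m<(4::nat). V n m i j) / 2)"
      by metis
    show ?thesis
    proof (intro exI[of _ "\<lambda>m n. V n m"] conjI ballI allI impI)
      fix n i j assume "n \<in> S" "i < d n" "j < d n"
      then have "complex_of_real (1 / L) * c n i j = (\<Sum>m<(4::nat). V n m i j) / 2" using V by blast
      then have "complex_of_real L * (complex_of_real (1 / L) * c n i j) = complex_of_real L * ((\<Sum>m<(4::nat). V n m i j) / 2)" by (simp only:)
      moreover have "complex_of_real L * (complex_of_real (1 / L) * c n i j) = c n i j"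
      proof -
        have "complex_of_real L * complex_of_real (1 / L) = 1" using L by simp
        then show ?thesis by (simp only: mult.assoc[symmetric] mult_1_left)
      qed
      ultimately show "c n i j = complex_of_real L * ((\<Sum>m<(4::nat). V n m i j) / 2)" by (simp only:)
    qed (use V in blast)
  qed
  obtain V where V: "\<And>m n. n \<in> S \<Longrightarrow> m < 4 \<Longrightarrow> orth (d n) (V m n)"
    and Vc: "\<And>n i j. n \<in> S \<Longrightarrow> i < d n \<Longrightarrow> j < d n \<Longrightarrow> c1 n i j = complex_of_real L1 * ((\<Sum>m<(4::nat). V m n i j) / 2)"
    using dec[OF c1 L(1)] by blast
  obtain W where W: "\<And>m n. n \<in> S \<Longrightarrow> m < 4 \<Longrightarrow> orth (d n) (W m n)"
    and Wc: "\<And>n i j. n \<in> S \<Longrightarrow> i < d n \<Longrightarrow> j < d n \<Longrightarrow> c2 n i j = complex_of_real L2 * ((\<Sum>m<(4::nat). W m n i j) / 2)"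
    using dec[OF c2 L(2)] by blast
  have "lform c1 c2 = (\<Sum>n\<in>S. \<Sum>i<d n. \<Sum>q<d n. \<Sum>j<d n. \<Sum>l<d n. \<Sum>a<4. \<Sum>b<4. complex_of_real (L1 * L2 / 4) * (V a n i l * W b n j q * wcoef n i l j q))"
    unfolding lform_def
  proof (intro sum.cong refl)
    fix n i q j l assume n: "n \<in> S" "i \<in> {..<d n}" "q \<in> {..<d n}" "j \<in> {..<d n}" "l \<in> {..<d n}"
    have "c1 n i l * c2 n j q * wcoef n i l j q = complex_of_real (L1 * L2 / 4) * ((\<Sum>a<4. V a n i l) * (\<Sum>b<4. W b n j q) * wcoef n i l j q)"
    proof -
      have alg: "(complex_of_real L1 * (A / 2)) * (complex_of_real L2 * (B / 2)) * w = complex_of_real (L1 * L2 / 4) * (A * B * w)" for A B w :: complex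
        by simp
      show ?thesis using n by (simp only: Vc Wc lessThan_iff alg)
    qed
    also have "\<dots> = (\<Sum>a<4. \<Sum>b<4. complex_of_real (L1 * L2 / 4) * (V a n i l * W b n j q * wcoef n i l j q))"
      by (subst sum_product, simp only: sum_distrib_right, simp only: sum_distrib_left)
    finally show "c1 n i l * c2 n j q * wcoef n i l j q = (\<Sum>a<4. \<Sum>b<4. complex_of_real (L1 * L2 / 4) * (V a n i l * W b n j q * wcoef n i l j q))" .
  qed
  also have "\<dots> = (\<Sum>a<4. \<Sum>b<4. \<Sum>n\<in>S. \<Sum>i<d n. \<Sum>q<d n. \<Sum>j<d n. \<Sum>l<d n. complex_of_real (L1 * L2 / 4) * (V a n i l * W b n j q * wcoef n i l j q))"
  proof -
    have sw: "(\<Sum>z\<in>A. \<Sum>a<4. \<Sum>b<4. f z a b) = (\<Sum>a<4. \<Sum>b<4. \<Sum>z\<in>A. f z a b)" for A :: "nat set" and f :: "nat \<Rightarrow> nat \<Rightarrow> nat \<Rightarrow> complex"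
      by (subst sum.swap) (intro sum.cong refl sum.swap)
    show ?thesis unfolding sw ..
  qed
  also have "\<dots> = (\<Sum>a<4. \<Sum>b<4. complex_of_real (L1 * L2 / 4) * lform (V a) (W b))"
    unfolding lform_def sum_distrib_left ..
  finally have eq: "lform c1 c2 = (\<Sum>a<4. \<Sum>b<4. complex_of_real (L1 * L2 / 4) * lform (V a) (W b))" .
  have "r * cmod (lform c1 c2) \<le> r * (\<Sum>a<(4::nat). \<Sum>b<(4::nat). L1 * L2 / 4 * (T / r))"
    unfolding eq
  proof (intro mult_left_mono sum_norm_le)
    fix a b :: nat assume "a \<in> {..<4}" "b \<in> {..<4}"
    then have "r * cmod (lform (V a) (W b)) \<le> T" unfolding T_def by (intro lform_unitary[OF N N0 r]) (auto intro: V W)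
    then have "cmod (lform (V a) (W b)) \<le> T / r" using r by (simp add: field_simps)
    then show "cmod (complex_of_real (L1 * L2 / 4) * lform (V a) (W b)) \<le> L1 * L2 / 4 * (T / r)"
      using L unfolding norm_mult by (intro mult_mono) (auto simp: norm_divide norm_mult)
  qed (use r in simp)
  also have "\<dots> = 4 * L1 * L2 * T" using r by simp
  finally show ?thesis by (simp add: T_def)
qed

end

section \<open>Matrix products over independent variables\<close>

lemma sum_eq_single:
  fixes f :: "'a \<Rightarrow> 'b::comm_monoid_add"
  assumes "finite A" "i \<in> A" "\<And>j. j \<in> A \<Longrightarrow> j \<noteq> i \<Longrightarrow> f j = 0"
  shows "(\<Sum>j\<in>A. f j) = f i"
  using assms by (subst sum.remove[of A i]) (auto intro: sum.neutral)

text \<open>Entrywise counterpart of \<open>mat_prod_upto\<close>, extended on the right, so that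
  one more independent variable is one more step of the recursion. The factors are numbered from
  1.\<close>

primrec entry_prod :: "nat \<Rightarrow> (nat \<Rightarrow> nat \<Rightarrow> nat \<Rightarrow> complex) \<Rightarrow> nat \<Rightarrow> nat \<Rightarrow> nat \<Rightarrow> complex" where
  "entry_prod n A 0 = (\<lambda>i j. if i = j then 1 else 0)"
| "entry_prod n A (Suc p) = (\<lambda>i j. \<Sum>k<n. entry_prod n A p i k * A (Suc p) k j)"

lemma foldr_mat_mult:
  fixes A :: "nat \<Rightarrow> complex mat"
  assumes "\<And>j. j \<in> set xs \<Longrightarrow> A j \<in> carrier_mat n n" "B \<in> carrier_mat n n"
  shows "foldr (\<lambda>j B. A j * B) xs (1\<^sub>m n) \<in> carrier_mat n n"
    "foldr (\<lambda>j B. A j * B) xs B = foldr (\<lambda>j B. A j * B) xs (1\<^sub>m n) * B"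
proof -
  have "foldr (\<lambda>j B. A j * B) xs (1\<^sub>m n) \<in> carrier_mat n n \<and> foldr (\<lambda>j B. A j * B) xs B = foldr (\<lambda>j B. A j * B) xs (1\<^sub>m n) * B"
    using assms
  proof (induction xs)
    case (Cons a xs)
    have a: "A a \<in> carrier_mat n n" and IH: "foldr (\<lambda>j B. A j * B) xs (1\<^sub>m n) \<in> carrier_mat n n"
      "foldr (\<lambda>j B. A j * B) xs B = foldr (\<lambda>j B. A j * B) xs (1\<^sub>m n) * B"
      using Cons by auto
    show ?case using mult_carrier_mat[OF a IH(1)] assoc_mult_mat[OF a IH(1) assms(2)] IH(2) by simp
  next
    case Nil
    then show ?case using left_mult_one_mat[OF assms(2)] by simp
  qed
  then show "foldr (\<lambda>j B. A j * B) xs (1\<^sub>m n) \<in> carrier_mat n n"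
    "foldr (\<lambda>j B. A j * B) xs B = foldr (\<lambda>j B. A j * B) xs (1\<^sub>m n) * B" by blast+
qed

lemma mat_prod_upto_carrier:
  "(\<And>j. j \<in> {1..p} \<Longrightarrow> A j \<in> carrier_mat n n) \<Longrightarrow> mat_prod_upto n A p \<in> carrier_mat n n"
  unfolding mat_prod_upto_def by (rule foldr_mat_mult(1)[of _ _ _ "1\<^sub>m n"]) auto

lemma mat_prod_upto_Suc:
  assumes A: "\<And>j. j \<in> {1..Suc p} \<Longrightarrow> A j \<in> carrier_mat n n"
  shows "mat_prod_upto n A (Suc p) = mat_prod_upto n A p * A (Suc p)"
proof -
  have 1: "A (Suc p) \<in> carrier_mat n n" using A by simp
  have "mat_prod_upto n A (Suc p) = foldr (\<lambda>j B. A j * B) [1..<Suc p] (A (Suc p) * 1\<^sub>m n)"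
    unfolding mat_prod_upto_def upt_Suc_append[of 1 "Suc p", simplified] foldr_append by simp
  also have "A (Suc p) * 1\<^sub>m n = A (Suc p)" using 1 by simp
  also have "foldr (\<lambda>j B. A j * B) [1..<Suc p] (A (Suc p)) = mat_prod_upto n A p * A (Suc p)"
    unfolding mat_prod_upto_def by (rule foldr_mat_mult(2)) (use A in auto)
  finally show ?thesis .
qed

lemma mat_prod_upto_entry_prod:
  assumes "\<And>j. j \<in> {1..p} \<Longrightarrow> A j \<in> carrier_mat n n" "i < n" "k < n"
  shows "mat_prod_upto n A p $$ (i, k) = entry_prod n (\<lambda>j a b. A j $$ (a, b)) p i k"
  using assms
proof (induction p arbitrary: k)
  case 0
  then show ?case by (simp add: mat_prod_upto_def)
next
  case (Suc p)
  have c: "mat_prod_upto n A p \<in> carrier_mat n n" by (rule mat_prod_upto_carrier) (use Suc.prems in auto)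
  have "mat_prod_upto n A (Suc p) $$ (i, k) = (\<Sum>l<n. mat_prod_upto n A p $$ (i, l) * A (Suc p) $$ (l, k))"
    using mult_mat_index[OF c Suc.prems(1)[of "Suc p"] Suc.prems(2,3)] mat_prod_upto_Suc[OF Suc.prems(1)] by simp
  also have "\<dots> = (\<Sum>l<n. entry_prod n (\<lambda>j a b. A j $$ (a, b)) p i l * A (Suc p) $$ (l, k))"
    using Suc by (intro sum.cong refl) simp
  finally show ?case by simp
qed

lemma entry_prod_cong: "(\<And>j. j \<in> {1..p} \<Longrightarrow> A j = B j) \<Longrightarrow> entry_prod n A p = entry_prod n B p"
  by (induction p) auto

lemma op_bounded_one: "op_bounded n 1 (\<lambda>i j. if i = j then 1 else 0)"
  unfolding op_bounded_def
proof (intro allI)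
  fix v u :: "nat \<Rightarrow> complex"
  have "(\<Sum>i<n. \<Sum>j<n. v i * (if i = j then 1 else 0) * u j) = (\<Sum>i<n. v i * u i)"
  proof (rule sum.cong[OF refl])
    fix i assume "i \<in> {..<n}"
    then show "(\<Sum>j<n. v i * (if i = j then 1 else 0) * u j) = v i * u i"
      using sum_eq_single[of "{..<n}" i "\<lambda>j. v i * (if i = j then 1 else 0) * u j"] by auto
  qed
  then show "cmod (\<Sum>i<n. \<Sum>j<n. v i * (if i = j then 1 else 0) * u j) \<le> 1 * (vnorm n v * vnorm n u)"
    using sum_mult_le_vnorm[of v u n] by simp
qed

lemma op_bounded_entry_prod:
  assumes "\<And>j. j \<in> {1..p} \<Longrightarrow> op_bounded n K (A j)" "0 \<le> K"
  shows "op_bounded n (K ^ p) (entry_prod n A p)"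
  using assms(1)
proof (induction p)
  case (Suc p)
  then have "op_bounded n (K ^ p * K) (entry_prod n A (Suc p))"
    unfolding entry_prod.simps by (intro op_bounded_mult) (use assms(2) in auto)
  then show ?case by (simp add: mult.commute)
qed (simp add: op_bounded_one)

lemma entry_prod_measurable:
  assumes F: "\<And>i j. i < d n \<Longrightarrow> j < d n \<Longrightarrow> (\<lambda>t. F n t i j) \<in> borel_measurable m"
    and p: "{1..p} \<subseteq> J" and ij: "i < d n" "j < d n"
  shows "(\<lambda>s. entry_prod (d n) (\<lambda>q. F n (s q)) p i j) \<in> borel_measurable (\<Pi>\<^sub>M q\<in>J. m)"
  using p ij
proof (induction p arbitrary: j)
  case (Suc p)
  have 1: "(\<lambda>s. F n (s (Suc p)) k j) \<in> borel_measurable (\<Pi>\<^sub>M q\<in>J. m)" if "k < d n" for k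
  proof -
    have "Suc p \<in> J" using Suc.prems by auto
    then show ?thesis by (rule measurable_compose[OF measurable_component_singleton[where M="\<lambda>_. m"] F[OF that Suc.prems(3)]])
  qed
  have "{1..p} \<subseteq> J" using Suc.prems by auto
  then show ?case unfolding entry_prod.simps
    by (intro borel_measurable_sum borel_measurable_times Suc.IH 1) (use Suc.prems in auto)
qed simp

context prob_space
begin

lemma AE_PiM_component_const: "i \<in> J \<Longrightarrow> AE t in M. Q t \<Longrightarrow> AE s in \<Pi>\<^sub>M q\<in>J. M. Q (s i)"
  by (rule AE_PiM_component) (auto intro: prob_space_axioms)

lemma prob_space_PiM_const: "prob_space (\<Pi>\<^sub>M q\<in>J. M)"
  by (rule prob_space_PiM) (rule prob_space_axioms)

text \<open>The product over \<open>insert i J\<close> is the image of a pair product under the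
  update map, which turns the claim into the iterated form of an almost everywhere statement on a
  pair.\<close>

lemma AE_PiM_insert:
  assumes J: "finite J" "i \<notin> J" and Q: "AE s in \<Pi>\<^sub>M q\<in>insert i J. M. Q s"
  shows "AE s in \<Pi>\<^sub>M q\<in>J. M. AE t in M. Q (s(i := t))"
proof -
  interpret J: prob_space "\<Pi>\<^sub>M q\<in>J. M" by (rule prob_space_PiM_const)
  interpret P1: pair_sigma_finite M "\<Pi>\<^sub>M q\<in>J. M" ..
  interpret P2: pair_sigma_finite "\<Pi>\<^sub>M q\<in>J. M" M ..
  have "distr (M \<Otimes>\<^sub>M (\<Pi>\<^sub>M q\<in>J. M)) (\<Pi>\<^sub>M q\<in>insert i J. M) (\<lambda>(x, X). X(i := x)) = (\<Pi>\<^sub>M q\<in>insert i J. M)"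
    by (rule distr_pair_PiM_eq_PiM) (rule prob_space_axioms)+
  then have "AE s in distr (M \<Otimes>\<^sub>M (\<Pi>\<^sub>M q\<in>J. M)) (\<Pi>\<^sub>M q\<in>insert i J. M) (\<lambda>(x, X). X(i := x)). Q s" using Q by (simp only:)
  then have "AE x in M \<Otimes>\<^sub>M (\<Pi>\<^sub>M q\<in>J. M). Q ((\<lambda>(x, X). X(i := x)) x)"
    by (rule AE_distrD[rotated]) measurable
  then have "AE x in distr ((\<Pi>\<^sub>M q\<in>J. M) \<Otimes>\<^sub>M M) (M \<Otimes>\<^sub>M (\<Pi>\<^sub>M q\<in>J. M)) (\<lambda>(x, y). (y, x)). Q ((\<lambda>(x, X). X(i := x)) x)"
    unfolding P1.distr_pair_swap[symmetric] .
  then have "AE x in (\<Pi>\<^sub>M q\<in>J. M) \<Otimes>\<^sub>M M. Q ((\<lambda>(x, X). X(i := x)) ((\<lambda>(x, y). (y, x)) x))"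
    by (rule AE_distrD[rotated]) measurable
  then have "AE x in \<Pi>\<^sub>M q\<in>J. M. AE y in M. Q ((\<lambda>(x, X). X(i := x)) ((\<lambda>(x, y). (y, x)) (x, y)))"
    by (rule P2.AE_pair)
  then show ?thesis by simp
qed

text \<open>The assumption \<open>upd\<close> expresses that \<open>f\<close> ignores the coordinate
  \<open>i\<close>, so integrating that coordinate first separates the factors.\<close>

lemma has_bochner_integral_PiM_insert:
  fixes f :: "('i \<Rightarrow> 'a) \<Rightarrow> complex"
  assumes J: "finite J" "i \<notin> J"
    and f [measurable]: "f \<in> borel_measurable (\<Pi>\<^sub>M q\<in>insert i J. M)" and fc: "AE s in \<Pi>\<^sub>M q\<in>insert i J. M. cmod (f s) \<le> c"
    and g [measurable]: "g \<in> borel_measurable M" and gc: "AE t in M. cmod (g t) \<le> c'"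
    and upd: "\<And>s t. f (s(i := t)) = f s"
  shows "has_bochner_integral (\<Pi>\<^sub>M q\<in>insert i J. M) (\<lambda>s. f s * g (s i)) ((\<integral>s. f s \<partial>(\<Pi>\<^sub>M q\<in>J. M)) * (\<integral>t. g t \<partial>M))"
proof -
  interpret JJ: prob_space "\<Pi>\<^sub>M q\<in>insert i J. M" by (rule prob_space_PiM_const)
  interpret PS: product_sigma_finite "\<lambda>_. M" ..
  have gi: "AE s in \<Pi>\<^sub>M q\<in>insert i J. M. cmod (g (s i)) \<le> c'" by (rule AE_PiM_component_const[OF _ gc]) simp
  have gm: "(\<lambda>s. g (s i)) \<in> borel_measurable (\<Pi>\<^sub>M q\<in>insert i J. M)" by measurable
  have int: "integrable (\<Pi>\<^sub>M q\<in>insert i J. M) (\<lambda>s. f s * g (s i))"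
  proof (rule JJ.integrable_const_bound[of _ "c * c'"])
    show "AE s in \<Pi>\<^sub>M q\<in>insert i J. M. norm (f s * g (s i)) \<le> c * c'"
      using fc gi
    proof eventually_elim
      case (elim s)
      then show ?case unfolding norm_mult by (intro mult_mono) (auto intro: order_trans[OF norm_ge_zero])
    qed
  qed (use gm in measurable)
  have "(\<integral>s. f s * g (s i) \<partial>(\<Pi>\<^sub>M q\<in>insert i J. M)) = (\<integral>s. (\<integral>t. f (s(i := t)) * g ((s(i := t)) i) \<partial>M) \<partial>(\<Pi>\<^sub>M q\<in>J. M))"
    by (rule PS.product_integral_insert[OF J int])
  also have "\<dots> = (\<integral>s. f s \<partial>(\<Pi>\<^sub>M q\<in>J. M)) * (\<integral>t. g t \<partial>M)" by (simp add: upd)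
  finally show ?thesis using int by (simp add: has_bochner_integral_iff)
qed

lemma bounded_system_AE_PiM:
  assumes F: "bounded_system M d K F" and J: "finite J"
  shows "AE s in \<Pi>\<^sub>M q\<in>J. M. \<forall>q\<in>J. \<forall>n. op_bounded (d n) K (F n (s q))"
proof -
  have "AE t in M. \<forall>n. op_bounded (d n) K (F n t)" using F by (simp add: bounded_system_def)
  then show ?thesis by (intro AE_finite_allI[OF J] AE_PiM_component_const)
qed

lemma entry_prod_entry_bound:
  assumes F: "bounded_system M d K F" and K: "0 \<le> K" and J: "finite J" "{1..p} \<subseteq> J" and ij: "i < d n" "j < d n"
  shows "AE s in \<Pi>\<^sub>M q\<in>J. M. cmod (entry_prod (d n) (\<lambda>q. F n (s q)) p i j) \<le> K ^ p"
  using bounded_system_AE_PiM[OF F J(1)]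
proof eventually_elim
  case (elim s)
  show ?case by (rule op_bounded_entry[OF op_bounded_entry_prod[OF _ K] ij]) (use elim J(2) in auto)
qed

end

section \<open>Biorthogonality of products and evaluation of the first chaos term\<close>

locale biorthogonal = prob_space m for m :: "'t measure" +
  fixes d :: "nat \<Rightarrow> nat" and K :: real and A B :: "nat \<Rightarrow> 't \<Rightarrow> nat \<Rightarrow> nat \<Rightarrow> complex"
  assumes d: "\<And>n. 0 < d n" and K: "0 < K" and A: "bounded_system m d K A" and B: "bounded_system m d K B"
    and biorth: "\<And>n n' i j k l. i < d n \<Longrightarrow> j < d n \<Longrightarrow> k < d n' \<Longrightarrow> l < d n' \<Longrightarrow>
      (\<integral>t. A n t i j * B n' t k l \<partial>m) = (if n = n' \<and> i = k \<and> j = l then 1 / of_nat (d n) else 0)"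
begin

text \<open>The coordinate \<open>q\<close> is independent of those in the products, so the integral
  factors and \<open>biorth\<close> evaluates the second part. No conjugates appear because
  \<open>A\<close> stands for the entrywise conjugates of \<open>\<phi>\<close>.\<close>

lemma pair_split:
  assumes J: "finite J" "{1..p} \<subseteq> J" "q \<notin> J"
    and ix: "i < d n" "k < d n" "j < d n" "l < d n" "i' < d n'" "k' < d n'" "j' < d n'" "l' < d n'"
  shows "has_bochner_integral (\<Pi>\<^sub>M q\<in>insert q J. m)
    (\<lambda>s. (entry_prod (d n) (\<lambda>q. A n (s q)) p i k * entry_prod (d n') (\<lambda>q. B n' (s q)) p i' k') * (A n (s q) j l * B n' (s q) j' l'))
    ((\<integral>s. entry_prod (d n) (\<lambda>q. A n (s q)) p i k * entry_prod (d n') (\<lambda>q. B n' (s q)) p i' k' \<partial>(\<Pi>\<^sub>M q\<in>J. m)) *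
      (if n = n' \<and> j = j' \<and> l = l' then 1 / of_nat (d n) else 0))"
proof -
  have J': "finite (insert q J)" "{1..p} \<subseteq> insert q J" "q \<notin> {1..p}" using J by auto
  have K0: "0 \<le> K" using K by simp
  have upd: "entry_prod N (\<lambda>r. F ((s(q := t)) r)) p = entry_prod N (\<lambda>r. F (s r)) p" for N s t and F :: "'t \<Rightarrow> nat \<Rightarrow> nat \<Rightarrow> complex"
    by (rule entry_prod_cong) (use J'(3) in auto)
  show ?thesis
    unfolding biorth[OF ix(3,4,7,8), symmetric]
  proof (rule has_bochner_integral_PiM_insert[OF J(1,3), where c="K ^ p * K ^ p" and c'="K * K"])
    show "(\<lambda>s. entry_prod (d n) (\<lambda>q. A n (s q)) p i k * entry_prod (d n') (\<lambda>q. B n' (s q)) p i' k') \<in> borel_measurable (\<Pi>\<^sub>M q\<in>insert q J. m)"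
      by (intro borel_measurable_times entry_prod_measurable bounded_system_measurable[OF A] bounded_system_measurable[OF B] J' ix)
    show "AE s in \<Pi>\<^sub>M q\<in>insert q J. m. cmod (entry_prod (d n) (\<lambda>q. A n (s q)) p i k * entry_prod (d n') (\<lambda>q. B n' (s q)) p i' k') \<le> K ^ p * K ^ p"
      using entry_prod_entry_bound[where F=A, OF A K0 J'(1,2) ix(1,2)] entry_prod_entry_bound[where F=B, OF B K0 J'(1,2) ix(5,6)]
      by eventually_elim (auto simp: norm_mult intro!: mult_mono K0 zero_le_power)
    show "(\<lambda>t. A n t j l * B n' t j' l') \<in> borel_measurable m"
      by (intro borel_measurable_times bounded_system_measurable[OF A] bounded_system_measurable[OF B] ix)
    show "AE t in m. cmod (A n t j l * B n' t j' l') \<le> K * K"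
      using bounded_system_entry[where F=A, OF A ix(3,4)] bounded_system_entry[where F=B, OF B ix(7,8)]
      by eventually_elim (auto simp: norm_mult intro!: mult_mono K0)
  qed (simp only: upd)
qed

lemma pair_Suc:
  assumes ix: "i < d n" "l < d n" "i' < d n'" "l' < d n'"
  shows "(\<integral>s. entry_prod (d n) (\<lambda>q. A n (s q)) (Suc p) i l * entry_prod (d n') (\<lambda>q. B n' (s q)) (Suc p) i' l' \<partial>(\<Pi>\<^sub>M q\<in>{1..Suc p}. m)) =
    (\<Sum>k<d n. \<Sum>k'<d n'. (\<integral>s. entry_prod (d n) (\<lambda>q. A n (s q)) p i k * entry_prod (d n') (\<lambda>q. B n' (s q)) p i' k' \<partial>(\<Pi>\<^sub>M q\<in>{1..p}. m)) *
      (if n = n' \<and> k = k' \<and> l = l' then 1 / of_nat (d n) else 0))"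
proof -
  have J: "{1..Suc p} = insert (Suc p) {1..p}" by auto
  have eq: "entry_prod (d n) (\<lambda>q. A n (s q)) (Suc p) i l * entry_prod (d n') (\<lambda>q. B n' (s q)) (Suc p) i' l' =
    (\<Sum>k<d n. \<Sum>k'<d n'. (entry_prod (d n) (\<lambda>q. A n (s q)) p i k * entry_prod (d n') (\<lambda>q. B n' (s q)) p i' k') * (A n (s (Suc p)) k l * B n' (s (Suc p)) k' l'))" for s
    unfolding entry_prod.simps sum_product by (simp only: mult_ac)
  have "has_bochner_integral (\<Pi>\<^sub>M q\<in>insert (Suc p) {1..p}. m) (\<lambda>s. \<Sum>k<d n. \<Sum>k'<d n'. (entry_prod (d n) (\<lambda>q. A n (s q)) p i k * entry_prod (d n') (\<lambda>q. B n' (s q)) p i' k') * (A n (s (Suc p)) k l * B n' (s (Suc p)) k' l'))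
    (\<Sum>k<d n. \<Sum>k'<d n'. (\<integral>s. entry_prod (d n) (\<lambda>q. A n (s q)) p i k * entry_prod (d n') (\<lambda>q. B n' (s q)) p i' k' \<partial>(\<Pi>\<^sub>M q\<in>{1..p}. m)) *
      (if n = n' \<and> k = k' \<and> l = l' then 1 / of_nat (d n) else 0))"
    by (intro has_bochner_integral_sum pair_split) (use ix in auto)
  then show ?thesis unfolding J eq by (simp only: has_bochner_integral_iff)
qed

lemma diag_sum:
  fixes X :: "nat \<Rightarrow> nat \<Rightarrow> complex"
  shows "(\<Sum>k<d n. \<Sum>k'<d n'. X k k' * (if n = n' \<and> k = k' \<and> l = l' then c else 0)) =
    (if n = n' \<and> l = l' then (\<Sum>k<d n. X k k * c) else 0)"
proof (cases "n = n' \<and> l = l'")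
  case True
  have "(\<Sum>k'<d n'. X k k' * (if n = n' \<and> k = k' \<and> l = l' then c else 0)) = X k k * c" if "k < d n" for k
    using that True sum_eq_single[of "{..<d n'}" k "\<lambda>k'. X k k' * (if n = n' \<and> k = k' \<and> l = l' then c else 0)"] by auto
  then show ?thesis using True by simp
qed auto

text \<open>Products of independent copies keep the constant \<open>1 / d n\<close>: a new factor
  gives a sum of \<open>d n\<close> terms, each equal to \<open>1 / d n\<close> times
  \<open>1 / d n\<close>. The induction starts with one factor, since an empty product is the
  identity and would not give 0 for different \<open>n\<close> and \<open>n'\<close>.\<close>

lemma biorth_entry_prod:
  assumes ix: "i < d n" "l < d n" "i' < d n'" "l' < d n'"
  shows "(\<integral>s. entry_prod (d n) (\<lambda>q. A n (s q)) (Suc p) i l * entry_prod (d n') (\<lambda>q. B n' (s q)) (Suc p) i' l' \<partial>(\<Pi>\<^sub>M q\<in>{1..Suc p}. m)) =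
    (if n = n' \<and> i = i' \<and> l = l' then 1 / of_nat (d n) else 0)"
  using ix
proof (induction p arbitrary: l l')
  case (0 l l')
  interpret E: prob_space "\<Pi>\<^sub>M q\<in>{1..0::nat}. m" by (rule prob_space_PiM_const)
  have "(\<Sum>k<d n. (\<integral>s. entry_prod (d n) (\<lambda>q. A n (s q)) 0 i k * entry_prod (d n') (\<lambda>q. B n' (s q)) 0 i' k \<partial>(\<Pi>\<^sub>M q\<in>{1..0}. m)) * (1 / of_nat (d n)))
    = (\<Sum>k<d n. if k = i then (if i = i' then 1 / of_nat (d n) else 0) else 0)"
    using E.prob_space by (intro sum.cong) auto
  also have "\<dots> = (if i = i' then 1 / of_nat (d n) else 0)" using 0 by simp
  finally have e: "(\<Sum>k<d n. (\<integral>s. entry_prod (d n) (\<lambda>q. A n (s q)) 0 i k * entry_prod (d n') (\<lambda>q. B n' (s q)) 0 i' k \<partial>(\<Pi>\<^sub>M q\<in>{1..0}. m)) * (1 / of_nat (d n)))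
    = (if i = i' then 1 / of_nat (d n) else 0)" .
  show ?case unfolding pair_Suc[OF 0] diag_sum e by auto
next
  case (Suc p l l')
  show ?case
  proof (cases "n = n'")
    case True
    have "(\<Sum>k<d n. (\<integral>s. entry_prod (d n) (\<lambda>q. A n (s q)) (Suc p) i k * entry_prod (d n') (\<lambda>q. B n' (s q)) (Suc p) i' k \<partial>(\<Pi>\<^sub>M q\<in>{1..Suc p}. m)) * (1 / of_nat (d n)))
      = (\<Sum>k<d n. (if i = i' then 1 / of_nat (d n) else 0) * (1 / of_nat (d n)))"
      by (intro sum.cong refl, subst Suc.IH) (use Suc.prems True in auto)
    also have "\<dots> = (if i = i' then 1 / of_nat (d n) else 0)" using d[of n] by simp
    finally have e: "(\<Sum>k<d n. (\<integral>s. entry_prod (d n) (\<lambda>q. A n (s q)) (Suc p) i k * entry_prod (d n') (\<lambda>q. B n' (s q)) (Suc p) i' k \<partial>(\<Pi>\<^sub>M q\<in>{1..Suc p}. m)) * (1 / of_nat (d n)))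
      = (if i = i' then 1 / of_nat (d n) else 0)" .
    show ?thesis unfolding pair_Suc[OF Suc.prems] diag_sum e by auto
  next
    case False
    then show ?thesis unfolding pair_Suc[OF Suc.prems] diag_sum by simp
  qed
qed

end

definition gterm where
  "gterm d S m F \<beta> \<beta>' x n i q j l n' e c p b a = complex_of_nat (d n') * x n' $$ (e, p) *
     gcoef (entry_index d S) (kcoef m \<beta> F n' a b) (n, j, l) * gcoef (entry_index d S) (kcoef m \<beta>' F n' c e) (n, i, q)"

text \<open>All sums are expanded, so that the outer variables enter only through products of
  entries of \<open>c1\<close> with \<open>M1\<close> and of \<open>c2\<close> with
  \<open>M2\<close>, which are integrated term by term. The definition stands outside
  \<open>coupling\<close> because there \<open>M1\<close> and \<open>M2\<close> are fixed, while
  here they vary with the outer variables.\<close>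

definition xform where
  "xform d S m F \<beta> \<beta>' x c1 c2 M1 M2 = (\<Sum>n\<in>S. \<Sum>i<d n. \<Sum>q<d n. \<Sum>j<d n. \<Sum>l<d n.
     \<Sum>n'\<in>S. \<Sum>e<d n'. \<Sum>c<d n'. \<Sum>p<d n'. \<Sum>b<d n'. \<Sum>a<d n'.
       (c1 n i l * M1 n' p a) * (c2 n j q * M2 n' b c) * gterm d S m F \<beta> \<beta>' x n i q j l n' e c p b a)"

context coupling
begin

lemma gcoef_lhs:
  assumes ec: "c < d n" and k: "k \<in> I"
  shows "gcoef I (lhs (n, e, c)) k = (\<Sum>p<d n. (of_nat (d n) * x n $$ (e, p)) *
    (\<Sum>b<d n. (\<Sum>a<d n. M1 n p a * gcoef I (kcoef m \<beta> F n a b) k) * M2 n b c))"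
proof -
  have eq: "lhs (n, e, c) w * w k = (\<Sum>p<d n. (of_nat (d n) * x n $$ (e, p)) *
    (\<Sum>b<d n. (\<Sum>a<d n. M1 n p a * (kcoef m \<beta> F n a b w * w k)) * M2 n b c))" for w
    unfolding lhs_def mid_def prod.case sum_distrib_left sum_distrib_right by (simp only: mult_ac)
  have "has_bochner_integral G (\<lambda>w. (\<Sum>p<d n. (of_nat (d n) * x n $$ (e, p)) *
    (\<Sum>b<d n. (\<Sum>a<d n. M1 n p a * (kcoef m \<beta> F n a b w * w k)) * M2 n b c)))
    (\<Sum>p<d n. (of_nat (d n) * x n $$ (e, p)) *
    (\<Sum>b<d n. (\<Sum>a<d n. M1 n p a * (\<integral>w. kcoef m \<beta> F n a b w * w k \<partial>G)) * M2 n b c))"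
    by (intro has_bochner_integral_sum has_bochner_integral_mult_right has_bochner_integral_mult_left has_bochner_integral_integrable
        integrable_bdd_mult kb integrable_gspace_component finite_entry_index S k) auto
  then show ?thesis unfolding gcoef_def eq by (simp only: has_bochner_integral_iff)
qed

lemma lform_xform: "lform c1 c2 = xform d S m F \<beta> \<beta>' x c1 c2 M1 M2"
  unfolding lform_def xform_def
proof (intro sum.cong refl)
  fix n i q j l assume n: "n \<in> S" "i \<in> {..<d n}" "q \<in> {..<d n}" "j \<in> {..<d n}" "l \<in> {..<d n}"
  then have k: "(n, j, l) \<in> I" by (simp add: entry_index_def)
  have w: "wcoef n i l j q = (\<Sum>n'\<in>S. \<Sum>e<d n'. \<Sum>c<d n'. (\<Sum>p<d n'. (of_nat (d n') * x n' $$ (e, p)) *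
    (\<Sum>b<d n'. (\<Sum>a<d n'. M1 n' p a * gcoef I (kcoef m \<beta> F n' a b) (n, j, l)) * M2 n' b c)) * gcoef I (kcoef m \<beta>' F n' c e) (n, i, q))"
    unfolding wcoef_def sum_entry_index[OF S] rhs_def prod.case using gcoef_lhs[OF _ k] by simp
  show "c1 n i l * c2 n j q * wcoef n i l j q = (\<Sum>n'\<in>S. \<Sum>e<d n'. \<Sum>c<d n'. \<Sum>p<d n'. \<Sum>b<d n'. \<Sum>a<d n'.
       (c1 n i l * M1 n' p a) * (c2 n j q * M2 n' b c) * gterm d S m F \<beta> \<beta>' x n i q j l n' e c p b a)"
    unfolding w gterm_def sum_distrib_left sum_distrib_right by (simp only: mult_ac)
qed

end

context biorthogonal
begin

text \<open>Biorthogonality forces \<open>n' = n\<close>, \<open>p = i\<close>,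
  \<open>a = l\<close>, \<open>b = j\<close> and \<open>c = q\<close>. The surviving sum over
  \<open>j\<close>, \<open>l\<close> separates from that over \<open>i\<close>, \<open>q\<close>,
  \<open>e\<close>, and the two become traces.\<close>

lemma integral_xform:
  fixes \<beta> \<beta>' :: "(nat \<times> nat \<times> nat \<Rightarrow> complex) \<Rightarrow> 't \<Rightarrow> complex"
  assumes S: "finite S" and J: "J = {1..Suc p}" "r \<notin> J"
  shows "has_bochner_integral (\<Pi>\<^sub>M q\<in>insert r J. m)
    (\<lambda>s. xform d S m B \<beta> \<beta>' x (\<lambda>n. entry_prod (d n) (\<lambda>q. A n (s q)) (Suc p)) (\<lambda>n. A n (s r)) (\<lambda>n. entry_prod (d n) (\<lambda>q. B n (s q)) (Suc p)) (\<lambda>n. B n (s r)))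
    (\<Sum>n\<in>S. (\<Sum>j<d n. zmat d S m \<beta> B n j j) * (\<Sum>e<d n. \<Sum>i<d n. x n $$ (e, i) * zmat d S m \<beta>' B n i e))"
proof -
  let ?g = "gterm d S m B \<beta> \<beta>' x"
  let ?\<delta> = "\<lambda>n n' i i' l l'. if n = n' \<and> i = i' \<and> l = l' then 1 / complex_of_nat (d n) else 0"
  let ?V = "\<Sum>n\<in>S. \<Sum>i<d n. \<Sum>q<d n. \<Sum>j<d n. \<Sum>l<d n.
     \<Sum>n'\<in>S. \<Sum>e<d n'. \<Sum>c<d n'. \<Sum>p<d n'. \<Sum>b<d n'. \<Sum>a<d n'. (?\<delta> n n' i p l a * ?\<delta> n n' j b q c) * ?g n i q j l n' e c p b a"
  have 1: "has_bochner_integral (\<Pi>\<^sub>M q\<in>insert r J. m)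
    (\<lambda>s. xform d S m B \<beta> \<beta>' x (\<lambda>n. entry_prod (d n) (\<lambda>q. A n (s q)) (Suc p)) (\<lambda>n. A n (s r)) (\<lambda>n. entry_prod (d n) (\<lambda>q. B n (s q)) (Suc p)) (\<lambda>n. B n (s r))) ?V"
    unfolding xform_def
  proof (intro has_bochner_integral_sum has_bochner_integral_mult_left)
    fix n i q j l n' e c p' b a
    assume "i \<in> {..<d n}" "q \<in> {..<d n}" "j \<in> {..<d n}" "l \<in> {..<d n}" "c \<in> {..<d n'}" "p' \<in> {..<d n'}" "b \<in> {..<d n'}" "a \<in> {..<d n'}"
    then have ix: "i < d n" "l < d n" "p' < d n'" "a < d n'" "j < d n" "q < d n" "b < d n'" "c < d n'" by auto
    have "has_bochner_integral (\<Pi>\<^sub>M q\<in>insert r J. m)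
      (\<lambda>s. (entry_prod (d n) (\<lambda>q. A n (s q)) (Suc p) i l * entry_prod (d n') (\<lambda>q. B n' (s q)) (Suc p) p' a) * (A n (s r) j q * B n' (s r) b c))
      ((\<integral>s. entry_prod (d n) (\<lambda>q. A n (s q)) (Suc p) i l * entry_prod (d n') (\<lambda>q. B n' (s q)) (Suc p) p' a \<partial>(\<Pi>\<^sub>M q\<in>J. m)) * ?\<delta> n n' j b q c)"
      by (rule pair_split) (use J ix in auto)
    then show "has_bochner_integral (\<Pi>\<^sub>M q\<in>insert r J. m)
      (\<lambda>s. (entry_prod (d n) (\<lambda>q. A n (s q)) (Suc p) i l * entry_prod (d n') (\<lambda>q. B n' (s q)) (Suc p) p' a) * (A n (s r) j q * B n' (s r) b c))
      (?\<delta> n n' i p' l a * ?\<delta> n n' j b q c)"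
      unfolding J(1) biorth_entry_prod[OF ix(1-4)] .
  qed
  have coll: "(\<Sum>n'\<in>S. \<Sum>e<d n'. \<Sum>c<d n'. \<Sum>p<d n'. \<Sum>b<d n'. \<Sum>a<d n'. (?\<delta> n n' i p l a * ?\<delta> n n' j b q c) * ?g n i q j l n' e c p b a) =
      (\<Sum>e<d n. (1 / of_nat (d n)) * (1 / of_nat (d n)) * ?g n i q j l n e q i j l)"
    if n: "n \<in> S" and ix: "i \<in> {..<d n}" "q \<in> {..<d n}" "j \<in> {..<d n}" "l \<in> {..<d n}" for n i q j l
  proof -
    let ?t = "\<lambda>n' e c p b a. (?\<delta> n n' i p l a * ?\<delta> n n' j b q c) * ?g n i q j l n' e c p b a"
    have "(\<Sum>n'\<in>S. \<Sum>e<d n'. \<Sum>c<d n'. \<Sum>p<d n'. \<Sum>b<d n'. \<Sum>a<d n'. ?t n' e c p b a) =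
      (\<Sum>e<d n. \<Sum>c<d n. \<Sum>p<d n. \<Sum>b<d n. \<Sum>a<d n. ?t n e c p b a)"
      by (rule sum_eq_single[OF S n]) (auto intro!: sum.neutral)
    also have "\<dots> = (\<Sum>e<d n. (1 / of_nat (d n)) * (1 / of_nat (d n)) * ?g n i q j l n e q i j l)"
    proof (rule sum.cong[OF refl])
      fix e
      have "(\<Sum>c<d n. \<Sum>p<d n. \<Sum>b<d n. \<Sum>a<d n. ?t n e c p b a) = (\<Sum>p<d n. \<Sum>b<d n. \<Sum>a<d n. ?t n e q p b a)"
        by (rule sum_eq_single[OF finite_lessThan ix(2)]) (auto intro!: sum.neutral)
      also have "\<dots> = (\<Sum>b<d n. \<Sum>a<d n. ?t n e q i b a)"
        by (rule sum_eq_single[OF finite_lessThan ix(1)]) (auto intro!: sum.neutral)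
      also have "\<dots> = (\<Sum>a<d n. ?t n e q i j a)"
        by (rule sum_eq_single[OF finite_lessThan ix(3)]) (auto intro!: sum.neutral)
      also have "\<dots> = ?t n e q i j l"
        by (rule sum_eq_single[OF finite_lessThan ix(4)]) auto
      finally show "(\<Sum>c<d n. \<Sum>p<d n. \<Sum>b<d n. \<Sum>a<d n. ?t n e c p b a) = (1 / of_nat (d n)) * (1 / of_nat (d n)) * ?g n i q j l n e q i j l"
        by (simp only: simp_thms if_True)
    qed
    finally show ?thesis .
  qed
  have "?V = (\<Sum>n\<in>S. \<Sum>i<d n. \<Sum>q<d n. \<Sum>j<d n. \<Sum>l<d n. \<Sum>e<d n. (1 / of_nat (d n)) * (1 / of_nat (d n)) * ?g n i q j l n e q i j l)"
  by (rule sum.cong[OF refl], rule sum.cong[OF refl], rule sum.cong[OF refl], rule sum.cong[OF refl], rule sum.cong[OF refl], rule coll)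
  also have "\<dots> = (\<Sum>n\<in>S. (\<Sum>j<d n. zmat d S m \<beta> B n j j) * (\<Sum>e<d n. \<Sum>i<d n. x n $$ (e, i) * zmat d S m \<beta>' B n i e))"
  proof (rule sum.cong[OF refl])
    fix n
    let ?s = "complex_of_real (sqrt (real (d n)))" and ?D = "complex_of_nat (d n)"
    let ?f = "\<lambda>j l. gcoef (entry_index d S) (kcoef m \<beta> B n l j) (n, j, l)"
    let ?h = "\<lambda>i e q. gcoef (entry_index d S) (kcoef m \<beta>' B n q e) (n, i, q)"
    have D: "?D \<noteq> 0" using d[of n] by simp
    have ss: "?s * ?s = ?D" by (simp flip: of_real_mult)
    \<comment> \<open>One factor \<open>d n\<close> from the trace and two factors
      \<open>1 / d n\<close> from biorthogonality leave \<open>1 / d n\<close>, shared as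
      \<open>1 / sqrt (d n)\<close> by the two matrices \<open>zmat\<close>.\<close>
    have c: "(1 / ?D) * (1 / ?D) * (?D * X * Y * Z) = Y / ?s * (X * (Z / ?s))" for X Y Z
    proof -
      have "Y / ?s * (X * (Z / ?s)) = X * Y * Z / (?s * ?s)" by simp
      moreover have "(1 / ?D) * (1 / ?D) * (?D * X * Y * Z) = X * Y * Z / ?D" using D by simp
      ultimately show ?thesis by (simp only: ss)
    qed
    have "(\<Sum>i<d n. \<Sum>q<d n. \<Sum>j<d n. \<Sum>l<d n. \<Sum>e<d n. (1 / ?D) * (1 / ?D) * ?g n i q j l n e q i j l)
      = (\<Sum>i<d n. \<Sum>q<d n. \<Sum>j<d n. \<Sum>l<d n. \<Sum>e<d n. ?f j l / ?s * (x n $$ (e, i) * (?h i e q / ?s)))"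
      unfolding gterm_def c ..
    also have "\<dots> = (\<Sum>j<d n. \<Sum>l<d n. ?f j l / ?s) * (\<Sum>i<d n. \<Sum>q<d n. \<Sum>e<d n. x n $$ (e, i) * (?h i e q / ?s))"
      by (simp only: sum_distrib_left[symmetric] sum_distrib_right[symmetric])
    also have "(\<Sum>i<d n. \<Sum>q<d n. \<Sum>e<d n. x n $$ (e, i) * (?h i e q / ?s)) = (\<Sum>e<d n. \<Sum>i<d n. \<Sum>q<d n. x n $$ (e, i) * (?h i e q / ?s))"
      by (rule sum_rotate)
    also have "(\<Sum>j<d n. \<Sum>l<d n. ?f j l / ?s) * \<dots> = (\<Sum>j<d n. zmat d S m \<beta> B n j j) * (\<Sum>e<d n. \<Sum>i<d n. x n $$ (e, i) * zmat d S m \<beta>' B n i e)"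
      unfolding zmat_def sum_divide_distrib sum_distrib_left[of "x n $$ _"] ..
    finally show "(\<Sum>i<d n. \<Sum>q<d n. \<Sum>j<d n. \<Sum>l<d n. \<Sum>e<d n. (1 / ?D) * (1 / ?D) * ?g n i q j l n e q i j l)
      = (\<Sum>j<d n. zmat d S m \<beta> B n j j) * (\<Sum>e<d n. \<Sum>i<d n. x n $$ (e, i) * zmat d S m \<beta>' B n i e)" .
  qed
  finally show ?thesis using 1 by (simp only:)
qed

text \<open>Here \<open>k = p + 3\<close>: the kernels act on the variables \<open>p + 1\<close> and
  \<open>p + 3\<close>, and the others form \<open>J\<close>. For almost every choice of the latter
  \<open>lform_contraction\<close> bounds \<open>E s\<close> by the same constant, while the
  integral of \<open>E\<close> over them is the coupled sum of traces.\<close>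

lemma coupling_estimate:
  fixes \<beta> \<beta>' :: "(nat \<times> nat \<times> nat \<Rightarrow> complex) \<Rightarrow> 't \<Rightarrow> complex"
  assumes S: "finite S" and \<beta>: "unit_kernel (gspace (entry_index d S)) m \<beta>" "unit_kernel (gspace (entry_index d S)) m \<beta>'"
    and x: "\<And>n. x n \<in> carrier_mat (d n) (d n)" and N0: "0 \<le> N" and r: "0 < r" "r < 1" and p: "1 \<le> p"
    and N: "AE t in \<Pi>\<^sub>M q\<in>{1..p + 3}. m. cmod (\<Sum>n\<in>S. of_nat (d n) *
      (\<Sum>e<d n. \<Sum>i<d n. x n $$ (e, i) * entry_prod (d n) (\<lambda>q. B n (t q)) (p + 3) i e)) \<le> N"
  shows "r * cmod (\<Sum>n\<in>S. (\<Sum>j<d n. zmat d S m \<beta> B n j j) * (\<Sum>e<d n. \<Sum>i<d n. x n $$ (e, i) * zmat d S m \<beta>' B n i e))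
    \<le> 4 * K ^ p * K * (N + r\<^sup>2 * (K ^ p * K * K * K) * (\<Sum>n\<in>S. real (d n) * trace_norm (x n)))" (is "r * cmod ?\<Lambda> \<le> ?R")
proof -
  define J where "J = insert (p + 2) {1..p}"
  have J: "finite J" "p + 1 \<notin> J" "p + 3 \<notin> insert (p + 1) J" "{1..p + 3} = insert (p + 3) (insert (p + 1) J)"
    "p + 2 \<notin> {1..p}" by (auto simp: J_def)
  let ?Q = "\<lambda>t. cmod (\<Sum>n\<in>S. of_nat (d n) * (\<Sum>e<d n. \<Sum>i<d n. x n $$ (e, i) * entry_prod (d n) (\<lambda>q. B n (t q)) (p + 3) i e)) \<le> N"
  have "AE s in \<Pi>\<^sub>M q\<in>insert (p + 1) J. m. AE t' in m. ?Q (s(p + 3 := t'))"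
    using N unfolding J(4) by (rule AE_PiM_insert[rotated 2]) (use J in simp_all)
  then have Q: "AE s in \<Pi>\<^sub>M q\<in>J. m. AE t in m. AE t' in m. ?Q ((s(p + 1 := t))(p + 3 := t'))"
    by (rule AE_PiM_insert[OF J(1,2)])
  interpret PJ: prob_space "\<Pi>\<^sub>M q\<in>J. m" by (rule prob_space_PiM_const)
  define E where "E s = xform d S m B \<beta> \<beta>' x (\<lambda>n. entry_prod (d n) (\<lambda>q. A n (s q)) p) (\<lambda>n. A n (s (p + 2)))
    (\<lambda>n. entry_prod (d n) (\<lambda>q. B n (s q)) p) (\<lambda>n. B n (s (p + 2)))" for s
  obtain p0 where p0: "p = Suc p0" using p by (cases p) auto
  have E: "has_bochner_integral (\<Pi>\<^sub>M q\<in>J. m) E ?\<Lambda>"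
    unfolding E_def J_def p0 by (rule integral_xform[OF S refl]) simp
  have K0: "0 \<le> K" "0 \<le> K ^ p" "0 < K ^ p" "0 < K" using K by auto
  define R where "R = ?R"
  have "AE s in \<Pi>\<^sub>M q\<in>J. m. cmod (E s) \<le> R / r"
    using Q bounded_system_AE_PiM[OF A J(1)] bounded_system_AE_PiM[OF B J(1)]
  proof eventually_elim
    case (elim s)
    have J': "q \<in> {1..p} \<Longrightarrow> q \<in> J" "p + 2 \<in> J" for q by (auto simp: J_def)
    have AB: "q \<in> J \<Longrightarrow> op_bounded (d n) K (A n (s q))" "q \<in> J \<Longrightarrow> op_bounded (d n) K (B n (s q))" for q n
      using elim(2,3) by blast+
    have M: "op_bounded (d n) (K ^ p) (entry_prod (d n) (\<lambda>q. A n (s q)) p)" "op_bounded (d n) (K ^ p) (entry_prod (d n) (\<lambda>q. B n (s q)) p)"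
      "op_bounded (d n) K (A n (s (p + 2)))" "op_bounded (d n) K (B n (s (p + 2)))" for n
      by (rule op_bounded_entry_prod[OF AB(1) K0(1)], erule J'(1), rule op_bounded_entry_prod[OF AB(2) K0(1)], erule J'(1), rule AB(1)[OF J'(2)], rule AB(2)[OF J'(2)])
    interpret coupling m d S K "K ^ p" K B \<beta> \<beta>' x "\<lambda>n. entry_prod (d n) (\<lambda>q. B n (s q)) p" "\<lambda>n. B n (s (p + 2))"
      by unfold_locales (use S K0 B \<beta> x M in auto)
    have tr: "(\<Sum>n\<in>S. of_nat (d n) * (\<Sum>e<d n. \<Sum>i<d n. x n $$ (e, i) *
        entry_prod (d n) (\<lambda>q. B n (((s(p + 1 := t))(p + 3 := t')) q)) (p + 3) i e)) = trf t t'" for t t'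
    proof -
      let ?u = "(s(p + 1 := t))(p + 3 := t')"
      have "entry_prod (d n) (\<lambda>q. B n (?u q)) p = entry_prod (d n) (\<lambda>q. B n (s q)) p" for n by (rule entry_prod_cong) auto
      then have mp: "entry_prod (d n) (\<lambda>q. B n (?u q)) (p + 3) i e = (\<Sum>c<d n. (\<Sum>b<d n. (\<Sum>a<d n. entry_prod (d n) (\<lambda>q. B n (s q)) p i a *
          B n t a b) * B n (s (p + 2)) b c) * B n t' c e)" for n i e
        by (simp add: numeral_3_eq_3)
      show ?thesis
        unfolding trf_def mp
      proof (rule sum.cong[OF refl])
        fix n
        let ?Y = "\<lambda>i c. \<Sum>b<d n. (\<Sum>a<d n. entry_prod (d n) (\<lambda>q. B n (s q)) p i a * B n t a b) * B n (s (p + 2)) b c"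
        have "of_nat (d n) * (\<Sum>e<d n. \<Sum>i<d n. x n $$ (e, i) * (\<Sum>c<d n. Y i c * B n t' c e)) =
          (\<Sum>e<d n. \<Sum>c<d n. (\<Sum>i<d n. (of_nat (d n) * x n $$ (e, i)) * Y i c) * B n t' c e)" for Y
        proof -
          have "of_nat (d n) * (\<Sum>e<d n. \<Sum>i<d n. x n $$ (e, i) * (\<Sum>c<d n. Y i c * B n t' c e)) =
            (\<Sum>e<d n. \<Sum>i<d n. \<Sum>c<d n. (of_nat (d n) * x n $$ (e, i)) * Y i c * B n t' c e)"
            unfolding sum_distrib_left by (simp only: mult_ac)
          also have "\<dots> = (\<Sum>e<d n. \<Sum>c<d n. \<Sum>i<d n. (of_nat (d n) * x n $$ (e, i)) * Y i c * B n t' c e)"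
            by (intro sum.cong refl sum.swap)
          finally show ?thesis unfolding sum_distrib_right .
        qed
        from this[of ?Y] show "of_nat (d n) * (\<Sum>e<d n. \<Sum>i<d n. x n $$ (e, i) * (\<Sum>c<d n. ?Y i c * B n t' c e)) =
          (\<Sum>e<d n. \<Sum>c<d n. (\<Sum>i<d n. (of_nat (d n) * x n $$ (e, i)) * ?Y i c) * B n t' c e)" .
      qed
    qed
    have "AE t in m. AE t' in m. cmod (trf t t') \<le> N" using elim(1) unfolding tr .
    note lform_contraction[OF this N0 r M(1,3) K0(3,4)]
    then have "r * cmod (E s) \<le> R" unfolding E_def lform_xform R_def .
    then show ?case using r by (simp add: field_simps)
  qed
  then have "(\<integral>s. cmod (E s) \<partial>(\<Pi>\<^sub>M q\<in>J. m)) \<le> (\<integral>s. R / r \<partial>(\<Pi>\<^sub>M q\<in>J. m))"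
    using E by (intro integral_mono_AE integrable_norm) (auto simp: has_bochner_integral_iff)
  moreover have "cmod ?\<Lambda> \<le> (\<integral>s. cmod (E s) \<partial>(\<Pi>\<^sub>M q\<in>J. m))"
    using integral_norm_bound[of "\<Pi>\<^sub>M q\<in>J. m" E] E by (simp only: has_bochner_integral_iff)
  moreover have "(\<integral>s. R / r \<partial>(\<Pi>\<^sub>M q\<in>J. m)) = R / r"
    by (simp only: lebesgue_integral_const PJ.prob_space scaleR_one)
  ultimately have "cmod ?\<Lambda> \<le> R / r" by linarith
  then have "r * cmod ?\<Lambda> \<le> R" using r by (simp add: field_simps)
  then show ?thesis unfolding R_def .
qed

end

section \<open>From the coupled estimate to the Sidon property\<close>

lemma trace_le_trace_norm: "x \<in> carrier_mat n n \<Longrightarrow> cmod (\<Sum>e<n. x $$ (e, e)) \<le> trace_norm x"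
proof -
  assume x: "x \<in> carrier_mat n n"
  have "(\<Sum>p<n. x $$ (e, p) * (if p = e then 1 else 0)) = x $$ (e, e)" if "e < n" for e
    using sum_eq_single[of "{..<n}" e "\<lambda>p. x $$ (e, p) * (if p = e then 1 else 0)"] that by auto
  then have "(\<Sum>e<n. \<Sum>p<n. x $$ (e, p) * (if p = e then 1 else 0)) = (\<Sum>e<n. x $$ (e, e))" by simp
  then show ?thesis using trace_duality[OF x op_bounded_one] by simp
qed

lemma bounded_system_of_Linf:
  assumes rm: "\<And>n. random_matrix m (d n) (\<psi> n)" and C: "\<And>n. Linf_norm_mat m (\<psi> n) \<le> ennreal C'" and K: "C' \<le> K" "0 \<le> K"
  shows "bounded_system m d K (\<lambda>n t i j. \<psi> n t $$ (i, j))"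
  unfolding bounded_system_def
proof (intro conjI allI impI)
  fix n i j assume "i < d n" "j < d n"
  then show "(\<lambda>t. \<psi> n t $$ (i, j)) \<in> borel_measurable m" using rm by (simp add: random_matrix_def)
next
  have "AE t in m. op_bounded (d n) K (\<lambda>i j. \<psi> n t $$ (i, j))" for n
    using esssup_AE[of "\<lambda>t. ennreal (mat_op_norm (\<psi> n t))" m] AE_space
  proof eventually_elim
    case (elim t)
    have "ennreal (mat_op_norm (\<psi> n t)) \<le> ennreal K"
      using elim(1) C[of n] K ennreal_leI[OF K(1)] unfolding Linf_norm_mat_def by (meson order_trans)
    then have "mat_op_norm (\<psi> n t) \<le> K" using K(2) by (cases "0 \<le> mat_op_norm (\<psi> n t)") (simp_all add: ennreal_le_iff)
    moreover have "\<psi> n t \<in> carrier_mat (d n) (d n)" using rm elim(2) by (simp add: random_matrix_def)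
    ultimately show ?case by (intro op_bounded_mat_op_norm)
  qed
  then show "AE t in m. \<forall>n. op_bounded (d n) K (\<lambda>i j. \<psi> n t $$ (i, j))" by (simp add: AE_all_countable)
qed

lemma mat_tr_mult:
  assumes "x \<in> carrier_mat n n" "Q \<in> carrier_mat n n"
  shows "mat_tr (x * Q) = (\<Sum>e<n. \<Sum>i<n. x $$ (e, i) * Q $$ (i, e))"
proof -
  have "dim_row (x * Q) = n" using assms by simp
  then show ?thesis unfolding mat_tr_def by (simp add: mult_mat_index[OF assms])
qed

text \<open>The condition on \<open>r\<close> makes the remainder at most half of the left-hand side
  \<open>r * T\<close>.\<close>

lemma absorb_remainder:
  fixes T :: real
  assumes T: "r * T \<le> c * (N + r\<^sup>2 * q * T)" and r: "0 < r" "2 * c * q * r \<le> 1" and T0: "0 \<le> T"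
  shows "T \<le> 2 * c / r * N"
proof -
  have "c * (r\<^sup>2 * q * T) = (2 * c * q * r) * (r * T / 2)" by (simp add: power2_eq_square)
  also have "\<dots> \<le> 1 * (r * T / 2)" using r T0 by (intro mult_right_mono) auto
  finally have "r * T \<le> 2 * (c * N)" using T by (simp add: distrib_left)
  then show ?thesis using r by (simp add: field_simps)
qed

abbreviation (input) mat_entries :: "(nat \<Rightarrow> 't \<Rightarrow> complex mat) \<Rightarrow> nat \<Rightarrow> 't \<Rightarrow> nat \<Rightarrow> nat \<Rightarrow> complex" where
  "mat_entries \<psi> \<equiv> \<lambda>n t i j. \<psi> n t $$ (i, j)"

context
  fixes d :: "nat \<Rightarrow> nat" and m :: "'t measure" and P :: "'w measure" and g :: "nat \<Rightarrow> 'w \<Rightarrow> complex mat"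
    and \<psi> :: "nat \<Rightarrow> 't \<Rightarrow> complex mat" and A :: "nat \<Rightarrow> 't \<Rightarrow> nat \<Rightarrow> nat \<Rightarrow> complex" and K C :: real
  assumes bi: "biorthogonal m d K A (\<lambda>n t i j. \<psi> n t $$ (i, j))"
    and P: "prob_space P" and g: "gaussian_matrices P d g" and rm: "\<And>n. random_matrix m (d n) (\<psi> n)"
    and C: "0 \<le> C"
    and sidon: "\<And>x. fin_supp_family d x \<Longrightarrow>
        ennreal (\<Sum>n \<in> mat_support d x. real (d n) * trace_norm (x n))
        \<le> ennreal C * (\<integral>\<^sup>+ w. Linf_norm m
             (\<lambda>t. \<Sum>n \<in> mat_support d x. of_nat (d n) * mat_tr (x n * g n w * \<psi> n t)) \<partial>P)"
begin

interpretation biorthogonal m d K A "\<lambda>n t i j. \<psi> n t $$ (i, j)" by (rule bi)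

text \<open>A first kernel bounds the trace norms of \<open>x\<close> by the numbers
  \<open>\<mu> n = tr(x_n z'_n)\<close>. These have no reason to add up without cancellation, so a
  second kernel is chosen for scalar matrices with traces \<open>\<mu> n\<close>. Each use costs a
  factor \<open>2 * C\<close>.\<close>

lemma trace_norm_le_coupled:
  assumes x: "fin_supp_family d x" and S: "S = mat_support d x" "S \<noteq> {}"
  shows "\<exists>\<beta> \<beta>'. unit_kernel (gspace (entry_index d S)) m \<beta> \<and> unit_kernel (gspace (entry_index d S)) m \<beta>' \<and>
    (\<Sum>n\<in>S. real (d n) * trace_norm (x n)) \<le> (2 * C)\<^sup>2 *
      cmod (\<Sum>n\<in>S. (\<Sum>j<d n. zmat d S m \<beta> (mat_entries \<psi>) n j j) * (\<Sum>e<d n. \<Sum>i<d n. x n $$ (e, i) * zmat d S m \<beta>' (mat_entries \<psi>) n i e))"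
proof -
  have fS: "finite S" using x by (simp add: fin_supp_family_def S(1))
  note kernel = sidon_kernel[OF d prob_space_axioms P g rm B less_imp_le[OF K] C sidon fS S(2)]
  obtain \<beta>' where \<beta>': "unit_kernel (gspace (entry_index d S)) m \<beta>'"
    and le1: "(\<Sum>n\<in>S. real (d n) * trace_norm (x n)) \<le>
      2 * C * Re (\<Sum>n\<in>S. of_nat (d n) * (\<Sum>e<d n. \<Sum>i<d n. x n $$ (e, i) * zmat d S m \<beta>' (mat_entries \<psi>) n i e))"
    using kernel[OF _ x] by (auto simp: S(1))
  define \<mu> where "\<mu> n = (\<Sum>e<d n. \<Sum>i<d n. x n $$ (e, i) * zmat d S m \<beta>' (mat_entries \<psi>) n i e)" for n
  \<comment> \<open>The trace norm of \<open>y n\<close> dominates the modulus of its trace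
    \<open>\<mu> n\<close>, while pairing the scalar matrix \<open>y n\<close> with
    \<open>zmat\<close> gives \<open>\<mu> n / d n\<close> times the trace of
    \<open>zmat\<close>.\<close>
  define y where "y n = (if n \<in> S then (\<mu> n / of_nat (d n)) \<cdot>\<^sub>m 1\<^sub>m (d n) else 0\<^sub>m (d n) (d n))" for n
  have yc: "y n \<in> carrier_mat (d n) (d n)" for n by (simp add: y_def)
  have ysub: "mat_support d y \<subseteq> S" by (auto simp: mat_support_def y_def)
  have fy: "fin_supp_family d y" using yc finite_subset[OF ysub fS] by (simp add: fin_supp_family_def)
  have yi: "y n $$ (l, i) = (if l = i then \<mu> n / of_nat (d n) else 0)" if "n \<in> S" "l < d n" "i < d n" for n l i
    using that by (simp add: y_def)
  have ytr: "(\<Sum>e<d n. y n $$ (e, e)) = \<mu> n" if "n \<in> S" for n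
    using that yi[OF that] d[of n] by simp
  obtain \<beta> where \<beta>: "unit_kernel (gspace (entry_index d S)) m \<beta>"
    and le2: "(\<Sum>n\<in>mat_support d y. real (d n) * trace_norm (y n)) \<le>
      2 * C * Re (\<Sum>n\<in>S. of_nat (d n) * (\<Sum>l<d n. \<Sum>i<d n. y n $$ (l, i) * zmat d S m \<beta> (mat_entries \<psi>) n i l))"
    using kernel[OF _ fy ysub] by auto
  let ?\<Lambda> = "\<Sum>n\<in>S. (\<Sum>j<d n. zmat d S m \<beta> (mat_entries \<psi>) n j j) * \<mu> n"
  have "(\<Sum>n\<in>S. of_nat (d n) * (\<Sum>l<d n. \<Sum>i<d n. y n $$ (l, i) * zmat d S m \<beta> (mat_entries \<psi>) n i l)) = ?\<Lambda>"
  proof (rule sum.cong[OF refl])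
    fix n assume n: "n \<in> S"
    have "(\<Sum>i<d n. y n $$ (l, i) * zmat d S m \<beta> (mat_entries \<psi>) n i l) = \<mu> n / of_nat (d n) * zmat d S m \<beta> (mat_entries \<psi>) n l l" if l: "l < d n" for l
      using sum_eq_single[of "{..<d n}" l "\<lambda>i. y n $$ (l, i) * zmat d S m \<beta> (mat_entries \<psi>) n i l"] l yi[OF n l] by simp
    then have "(\<Sum>l<d n. \<Sum>i<d n. y n $$ (l, i) * zmat d S m \<beta> (mat_entries \<psi>) n i l) = \<mu> n / of_nat (d n) * (\<Sum>l<d n. zmat d S m \<beta> (mat_entries \<psi>) n l l)"
      by (simp add: sum_distrib_left)
    then show "of_nat (d n) * (\<Sum>l<d n. \<Sum>i<d n. y n $$ (l, i) * zmat d S m \<beta> (mat_entries \<psi>) n i l) = (\<Sum>j<d n. zmat d S m \<beta> (mat_entries \<psi>) n j j) * \<mu> n"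
      using d[of n] by simp
  qed
  with le2 have le2': "(\<Sum>n\<in>mat_support d y. real (d n) * trace_norm (y n)) \<le> 2 * C * Re ?\<Lambda>" by simp
  have "Re (\<Sum>n\<in>S. of_nat (d n) * \<mu> n) \<le> cmod (\<Sum>n\<in>S. of_nat (d n) * \<mu> n)" by (rule complex_Re_le_cmod)
  also have "\<dots> \<le> (\<Sum>n\<in>S. real (d n) * cmod (\<mu> n))" by (rule order_trans[OF norm_sum]) (simp add: norm_mult)
  also have "\<dots> = (\<Sum>n\<in>mat_support d y. real (d n) * cmod (\<mu> n))"
  proof (rule sum.mono_neutral_right[OF fS ysub], rule ballI)
    fix n assume n: "n \<in> S - mat_support d y"
    then have "(\<Sum>e<d n. y n $$ (e, e)) = 0" by (simp add: mat_support_def)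
    then show "real (d n) * cmod (\<mu> n) = 0" using ytr n by simp
  qed
  also have "\<dots> \<le> (\<Sum>n\<in>mat_support d y. real (d n) * trace_norm (y n))"
  proof (intro sum_mono mult_left_mono)
    fix n assume "n \<in> mat_support d y"
    then show "cmod (\<mu> n) \<le> trace_norm (y n)" using trace_le_trace_norm[OF yc[of n]] ytr[of n] ysub by auto
  qed simp
  also have "\<dots> \<le> 2 * C * Re ?\<Lambda>" by (rule le2')
  also have "\<dots> \<le> 2 * C * cmod ?\<Lambda>" using C by (intro mult_left_mono complex_Re_le_cmod) auto
  finally have "2 * C * Re (\<Sum>n\<in>S. of_nat (d n) * \<mu> n) \<le> 2 * C * (2 * C * cmod ?\<Lambda>)" using C by (intro mult_left_mono) auto
  with le1 have "(\<Sum>n\<in>S. real (d n) * trace_norm (x n)) \<le> (2 * C)\<^sup>2 * cmod ?\<Lambda>"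
    by (simp add: \<mu>_def power2_eq_square)
  with \<beta> \<beta>' show ?thesis unfolding \<mu>_def by blast
qed

lemma dot_tensor_sidon_of_randomly_sidon:
  assumes p: "1 \<le> p"
  shows "dot_tensor_sidon (p + 3) m d \<psi>"
proof -
  define c where "c = (2 * C)\<^sup>2 * (4 * K ^ p * K)"
  define q where "q = K ^ p * K * K * K"
  \<comment> \<open>The bound 1/2 keeps \<open>r\<close> below 1 and the other one ensures
    \<open>2 * c * q * r <= 1\<close>; the added 1 keeps the denominator positive when
    \<open>c * q = 0\<close>.\<close>
  define r where "r = min (1 / 2) (1 / (2 * c * q + 1))"
  have K0: "0 < K" by (rule K)
  have c0: "0 \<le> c" and q0: "0 \<le> q" using K0 by (auto simp: c_def q_def)
  have r: "0 < r" "r < 1" using c0 q0 by (auto simp: r_def min_def add_nonneg_pos)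
  have ratio_le: "X * (1 / (X + 1)) \<le> 1" if "0 \<le> X" for X :: real using that by (simp add: field_simps)
  have "2 * c * q * r \<le> 2 * c * q * (1 / (2 * c * q + 1))" using c0 q0 by (intro mult_left_mono) (auto simp: r_def)
  also have "\<dots> \<le> 1" by (rule ratio_le) (use c0 q0 in simp)
  finally have r2: "2 * c * q * r \<le> 1" .
  \<comment> \<open>The added 1 makes \<open>D\<close> positive, so that an infinite norm gives an
    infinite right-hand side; in \<open>ennreal\<close> the product of 0 and infinity is 0.\<close>
  define D where "D = 2 * c / r + 1"
  have D: "0 < D" using c0 r by (simp add: D_def add_nonneg_pos)
  show ?thesis unfolding dot_tensor_sidon_def
  proof (intro exI[of _ D] allI impI)
    fix x assume x: "fin_supp_family d x"
    define S where "S = mat_support d x"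
    define f where "f t = (\<Sum>n\<in>S. of_nat (d n) * mat_tr (x n * mat_prod_upto (d n) (\<lambda>j. \<psi> n (t j)) (p + 3)))" for t :: "nat \<Rightarrow> 't"
    define T where "T = (\<Sum>n\<in>S. real (d n) * trace_norm (x n))"
    have xc: "x n \<in> carrier_mat (d n) (d n)" for n using x by (simp add: fin_supp_family_def)
    have fS: "finite S" using x by (simp add: fin_supp_family_def S_def)
    have T0: "0 \<le> T" unfolding T_def by (intro sum_nonneg mult_nonneg_nonneg trace_norm_nonneg[OF xc]) simp
    have "ennreal T \<le> ennreal D * Linf_norm (\<Pi>\<^sub>M j\<in>{1..p + 3}. m) f"
    proof (cases "S = {} \<or> Linf_norm (\<Pi>\<^sub>M j\<in>{1..p + 3}. m) f = \<infinity>")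
      case True
      then show ?thesis using D by (auto simp: T_def ennreal_mult_top infinity_ennreal_def)
    next
      case False
      define N where "N = enn2real (Linf_norm (\<Pi>\<^sub>M j\<in>{1..p + 3}. m) f)"
      have N: "Linf_norm (\<Pi>\<^sub>M j\<in>{1..p + 3}. m) f = ennreal N" and N0: "0 \<le> N"
        using False by (simp_all add: N_def ennreal_enn2real_if infinity_ennreal_def)
      have ae: "AE t in \<Pi>\<^sub>M j\<in>{1..p + 3}. m. cmod (\<Sum>n\<in>S. of_nat (d n) *
          (\<Sum>e<d n. \<Sum>i<d n. x n $$ (e, i) * entry_prod (d n) (\<lambda>q. mat_entries \<psi> n (t q)) (p + 3) i e)) \<le> N"
        using esssup_AE[of "\<lambda>t. ennreal (cmod (f t))" "\<Pi>\<^sub>M j\<in>{1..p + 3}. m"] AE_space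
      proof eventually_elim
        case (elim t)
        have tm: "t j \<in> space m" if "j \<in> {1..p + 3}" for j
          using PiE_mem[of t "{1..p + 3}" "\<lambda>_. space m" j] elim(2) that unfolding space_PiM by blast
        have pc: "\<psi> n (t j) \<in> carrier_mat (d n) (d n)" if "j \<in> {1..p + 3}" for n j
          using rm tm[OF that] by (simp add: random_matrix_def)
        have "f t = (\<Sum>n\<in>S. of_nat (d n) * (\<Sum>e<d n. \<Sum>i<d n. x n $$ (e, i) * entry_prod (d n) (\<lambda>q. mat_entries \<psi> n (t q)) (p + 3) i e))"
          unfolding f_def
        proof (intro sum.cong refl arg_cong2[where f=times])
          fix n
          have Q: "mat_prod_upto (d n) (\<lambda>j. \<psi> n (t j)) (p + 3) \<in> carrier_mat (d n) (d n)"
            by (rule mat_prod_upto_carrier) (rule pc)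
          have "mat_prod_upto (d n) (\<lambda>j. \<psi> n (t j)) (p + 3) $$ (i, e) = entry_prod (d n) (\<lambda>q. mat_entries \<psi> n (t q)) (p + 3) i e"
            if "i < d n" "e < d n" for i e
            by (rule mat_prod_upto_entry_prod[OF pc that])
          then show "mat_tr (x n * mat_prod_upto (d n) (\<lambda>j. \<psi> n (t j)) (p + 3)) =
            (\<Sum>e<d n. \<Sum>i<d n. x n $$ (e, i) * entry_prod (d n) (\<lambda>q. mat_entries \<psi> n (t q)) (p + 3) i e)"
            unfolding mat_tr_mult[OF xc Q] by simp
        qed
        moreover have "cmod (f t) \<le> N" using elim(1) N N0 by (simp add: Linf_norm_def ennreal_le_iff)
        ultimately show ?case by (simp only:)
      qed
      obtain \<beta> \<beta>' where \<beta>: "unit_kernel (gspace (entry_index d S)) m \<beta>" "unit_kernel (gspace (entry_index d S)) m \<beta>'"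
        and le: "T \<le> (2 * C)\<^sup>2 * cmod (\<Sum>n\<in>S. (\<Sum>j<d n. zmat d S m \<beta> (mat_entries \<psi>) n j j) *
          (\<Sum>e<d n. \<Sum>i<d n. x n $$ (e, i) * zmat d S m \<beta>' (mat_entries \<psi>) n i e))" (is "_ \<le> _ * cmod ?\<Lambda>")
        using trace_norm_le_coupled[OF x S_def] False unfolding T_def by blast
      have "r * cmod ?\<Lambda> \<le> 4 * K ^ p * K * (N + r\<^sup>2 * q * T)"
        unfolding q_def T_def by (rule coupling_estimate[OF fS \<beta> xc N0 r p ae])
      then have "(2 * C)\<^sup>2 * (r * cmod ?\<Lambda>) \<le> (2 * C)\<^sup>2 * (4 * K ^ p * K * (N + r\<^sup>2 * q * T))"
        by (intro mult_left_mono) auto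
      moreover have "r * T \<le> r * ((2 * C)\<^sup>2 * cmod ?\<Lambda>)" using le r by (intro mult_left_mono) auto
      ultimately have "r * T \<le> c * (N + r\<^sup>2 * q * T)" unfolding c_def by (simp only: mult.assoc mult.left_commute[of r])
      then have "T \<le> 2 * c / r * N" by (rule absorb_remainder[OF _ r(1) r2 T0])
      also have "\<dots> \<le> D * N" using N0 by (simp add: D_def distrib_right)
      finally show ?thesis unfolding N using D N0 by (simp add: ennreal_mult[symmetric] ennreal_leI)
    qed
    then show "ennreal (\<Sum>n\<in>mat_support d x. real (d n) * trace_norm (x n)) \<le> ennreal D * Linf_norm (\<Pi>\<^sub>M j\<in>{1..p + 3}. m)
      (\<lambda>t. \<Sum>n\<in>mat_support d x. of_nat (d n) * mat_tr (x n * mat_prod_upto (d n) (\<lambda>j. \<psi> n (t j)) (p + 3)))"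
      unfolding T_def f_def[abs_def] S_def .
  qed
qed

end

theorem theorem5p7:
  fixes d :: "nat \<Rightarrow> nat"
    and m :: "'t measure"
    and P :: "'w measure"
    and g :: "nat \<Rightarrow> 'w \<Rightarrow> complex mat"
    and \<phi> \<psi> :: "nat \<Rightarrow> 't \<Rightarrow> complex mat"
    and C' :: real
  assumes "\<And>n. 0 < d n"
    and "prob_space m"
    and "prob_space P"
    and "gaussian_matrices P d g"
    and "\<And>n. random_matrix m (d n) (\<phi> n)"
    and "\<And>n. random_matrix m (d n) (\<psi> n)"
    and "\<And>n. Linf_norm_mat m (\<phi> n) \<le> ennreal C'"
    and "\<And>n. Linf_norm_mat m (\<psi> n) \<le> ennreal C'"
    and "\<And>n n' i j k l. i < d n \<Longrightarrow> j < d n \<Longrightarrow> k < d n' \<Longrightarrow> l < d n' \<Longrightarrow>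
           (\<integral>t. \<phi> n t $$ (i, j) * cnj (\<psi> n' t $$ (k, l)) \<partial>m) =
             (if n = n' \<and> i = k \<and> j = l then 1 / of_nat (d n) else 0)"
    and "randomly_sidon P g m d \<psi>"
  shows "\<forall>k\<ge>4. dot_tensor_sidon k m d \<psi>"
proof (intro allI impI)
  fix k :: nat assume k: "4 \<le> k"
  \<comment> \<open>The maximum with 1 makes \<open>K\<close> positive whatever the sign of
    \<open>C'\<close>.\<close>
  define K where "K = max 1 C'"
  have K: "C' \<le> K" "0 \<le> K" "0 < K" by (auto simp: K_def)
  interpret prob_space m by fact
  have \<phi>: "bounded_system m d K (\<lambda>n t i j. \<phi> n t $$ (i, j))" by (rule bounded_system_of_Linf[OF assms(5,7) K(1,2)])
  have A: "bounded_system m d K (\<lambda>n t i j. cnj (\<phi> n t $$ (i, j)))"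
    unfolding bounded_system_def
  proof (intro conjI allI impI)
    fix n i j assume "i < d n" "j < d n"
    then show "(\<lambda>t. cnj (\<phi> n t $$ (i, j))) \<in> borel_measurable m"
      by (intro borel_measurable_cnj bounded_system_measurable[OF \<phi>])
  next
    have "AE t in m. \<forall>n. op_bounded (d n) K (\<lambda>i j. \<phi> n t $$ (i, j))" using \<phi> by (simp add: bounded_system_def)
    then show "AE t in m. \<forall>n. op_bounded (d n) K (\<lambda>i j. cnj (\<phi> n t $$ (i, j)))" by eventually_elim (auto intro: op_bounded_cnj)
  qed
  have bi: "biorthogonal m d K (\<lambda>n t i j. cnj (\<phi> n t $$ (i, j))) (\<lambda>n t i j. \<psi> n t $$ (i, j))"
  proof unfold_locales
    fix n n' i j k l assume "i < d n" "j < d n" "k < d n'" "l < d n'"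
    note arg_cong[OF assms(9)[OF this], of cnj]
    moreover have "cnj (\<integral>t. \<phi> n t $$ (i, j) * cnj (\<psi> n' t $$ (k, l)) \<partial>m) = (\<integral>t. cnj (\<phi> n t $$ (i, j)) * \<psi> n' t $$ (k, l) \<partial>m)"
      by (subst Bochner_Integration.integral_cnj[symmetric]) simp
    ultimately show "(\<integral>t. cnj (\<phi> n t $$ (i, j)) * \<psi> n' t $$ (k, l) \<partial>m) = (if n = n' \<and> i = k \<and> j = l then 1 / of_nat (d n) else 0)"
      by (simp split: if_splits)
  qed (use assms(1) K(3) A bounded_system_of_Linf[OF assms(6,8) K(1,2)] in auto)
  obtain C where C: "\<And>x. fin_supp_family d x \<Longrightarrow>
        ennreal (\<Sum>n \<in> mat_support d x. real (d n) * trace_norm (x n))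
        \<le> ennreal C * (\<integral>\<^sup>+ w. Linf_norm m
             (\<lambda>t. \<Sum>n \<in> mat_support d x. of_nat (d n) * mat_tr (x n * g n w * \<psi> n t)) \<partial>P)"
    using assms(10) unfolding randomly_sidon_def by blast
  have "dot_tensor_sidon (k - 3 + 3) m d \<psi>"
  \<comment> \<open>A negative constant is read as 0 by \<open>ennreal\<close>, so
    \<open>max 0 C\<close> serves as well. The number \<open>k - 3\<close> of leading factors is at
    least 1 because \<open>k >= 4\<close>.\<close>
  proof (rule dot_tensor_sidon_of_randomly_sidon[OF bi assms(3,4,6), of "max 0 C"])
    fix x assume "fin_supp_family d x"
    moreover have "ennreal (max 0 C) = ennreal C" by (cases "0 \<le> C") (simp_all add: max_def ennreal_neg)
    ultimately show "ennreal (\<Sum>n \<in> mat_support d x. real (d n) * trace_norm (x n))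
        \<le> ennreal (max 0 C) * (\<integral>\<^sup>+ w. Linf_norm m
             (\<lambda>t. \<Sum>n \<in> mat_support d x. of_nat (d n) * mat_tr (x n * g n w * \<psi> n t)) \<partial>P)"
      using C by (simp only:)
  qed (use k in auto)
  then show "dot_tensor_sidon k m d \<psi>" using k by simp
qed

end
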